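(* Let $w\in A_2(\mathbb R^n)$ with $[w]_{A_2}\le M$. Let $I\Subset I'$ be bounded intervals, let $D_x\Subset D_x'$ be bounded balls in $\mathbb R^n$, and let $D_y\Subset D_y'$ be bounded Lipschitz sets in $\mathbb R^m$. Suppose $$f,\ \nabla_xf,\ F,\ g\in L^2(D_x'\times D_y'\times I',d\mu_w)$$ and $Yf=\operatorname{div}_{w,x}F+g$ in the weighted distributional sense. Then there are $s_*=s_*(m,k,M)>0$ and $C<\infty$ such that, for every $0<s\le s_*$, $$\|f\|_{L^2(D_x;H^s(D_y\times I);w\,dx)}\le C\bigl(\|f\|_{L^2(d\mu_w)}+\|\nabla_xf\|_{L^2(d\mu_w)}+\|F\|_{L^2(d\mu_w)}+\|g\|_{L^2(d\mu_w)}\bigr),$$ where the norms on the right are over $D_x'\times D_y'\times I'$. The constant $C$ also depends on the fixed nested domains (on their full geometry, in particular on cutoff bounds and on an upper bound for $|v|$ in $D_x'$).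
   Context: Let $m\ge1$, $k\ge0$, $n=m+k$, $x=(v,z)\in\mathbb R^m\times\mathbb R^k$ ($z$ omitted when $k=0$), $y\in\mathbb R^m$, $t\in\mathbb R$, $Y=v\cdot\nabla_y+\partial_t$. $w=w(x)$ is positive a.e., $w,w^{-1}\in L^1_{\rm loc}(\mathbb R^n)$, and $[w]_{A_2}:=\sup_{\mathcal B}\bigl(\frac1{|\mathcal B|}\int_{\mathcal B}w\,dx\bigr)\bigl(\frac1{|\mathcal B|}\int_{\mathcal B}w^{-1}dx\bigr)\le M$ (supremum over Euclidean balls in $\mathbb R^n$). $d\mu_w=w(x)\,dx\,dy\,dt$. $F$ is an $\mathbb R^n$-valued field. The equation $Yf=\operatorname{div}_{w,x}F+g$ in the weighted distributional sense means $-\int fY\varphi\,d\mu_w=-\int F\cdot\nabla_x\varphi\,d\mu_w+\int g\varphi\,d\mu_w$ for every test function $\varphi\in C_0^\infty(D_x'\times D_y'\times I')$; equivalently $Y(wf)=\operatorname{div}_x(wF)+wg$ in ordinary distributions. For $0<s<1$ and $G\subset\mathbb R^{m+1}$ open, $H^s(G)$ is the restriction space of the Bessel-potential space $H^s(\mathbb R^{m+1})$ (norm $\|V\|^2=\int(1+|\eta|^2+|\tau|^2)^s|\widehat V(\eta,\tau)|^2d\eta\,d\tau$) with the quotient norm, and $\|f\|_{L^2(D_x;H^s(G);w\,dx)}^2=\int_{D_x}\|f(x,\cdot,\cdot)\|_{H^s(G)}^2w(x)\,dx$. *)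

theory Defs
  imports "HOL-Analysis.Analysis"
begin

section \<open>Domains\<close>

definition balls :: "'a::euclidean_space set set" where
  "balls = {ball c r | c r. 0 < r}"

definition bounded_open_intervals :: "real set set" where
  "bounded_open_intervals = {{a<..<b} | a b. a < b}"

definition compactly_inside :: "'a::topological_space set \<Rightarrow> 'a set \<Rightarrow> bool" (infix \<open>\<Subset>\<close> 50) where
  "A \<Subset> B \<longleftrightarrow> compact (closure A) \<and> closure A \<subseteq> B"

text \<open>
  Near each boundary point the set is the strict epigraph of a Lipschitz function in the
  direction of some unit vector \<open>e\<close>.  The hyperplane orthogonal to \<open>e\<close> plays the role of
  \<open>\<real>\<^sup>m\<^sup>-\<^sup>1\<close>; for \<open>m = 1\<close> it is \<open>{0}\<close> and the condition says that the set lies locally on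
  exactly one side of each boundary point.  Connectedness is not required.
\<close>
definition bounded_Lipschitz_set :: "'a::euclidean_space set \<Rightarrow> bool" where
  "bounded_Lipschitz_set D \<longleftrightarrow> open D \<and> bounded D \<and>
     (\<forall>p\<in>frontier D. \<exists>U e L \<gamma>. open U \<and> p \<in> U \<and> norm e = 1 \<and>
        L-lipschitz_on {q. q \<bullet> e = 0} \<gamma> \<and>
        D \<inter> U = {q \<in> U. \<gamma> (q - (q \<bullet> e) *\<^sub>R e) < q \<bullet> e})"


section \<open>Square-integrable functions\<close>

definition esqrt :: "ennreal \<Rightarrow> ennreal" where
  "esqrt a = (if a = top then top else ennreal (sqrt (enn2real a)))"

definition L2_norm :: "'a measure \<Rightarrow> ('a \<Rightarrow> 'b::real_normed_vector) \<Rightarrow> ennreal" where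
  "L2_norm M u = esqrt (\<integral>\<^sup>+p. ennreal ((norm (u p))\<^sup>2) \<partial>M)"

definition L2 :: "'a measure \<Rightarrow> ('a \<Rightarrow> 'b::real_normed_vector) set" where
  "L2 M = {u \<in> borel_measurable M. L2_norm M u < top}"


section \<open>Muckenhoupt weights\<close>

definition locally_integrable :: "('a::euclidean_space \<Rightarrow> real) \<Rightarrow> bool" where
  "locally_integrable u \<longleftrightarrow> (\<forall>K. compact K \<longrightarrow> integrable (lebesgue_on K) u)"

definition weight :: "('a::euclidean_space \<Rightarrow> real) \<Rightarrow> bool" where
  "weight w \<longleftrightarrow> w \<in> borel_measurable lebesgue \<and> (AE x in lebesgue. 0 < w x) \<and>
     locally_integrable w \<and> locally_integrable (\<lambda>x. inverse (w x))"

definition A2_const :: "('a::euclidean_space \<Rightarrow> real) \<Rightarrow> ennreal" where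
  "A2_const w = (SUP B\<in>balls.
     ((\<integral>\<^sup>+x\<in>B. ennreal (w x) \<partial>lebesgue) / emeasure lebesgue B) *
     ((\<integral>\<^sup>+x\<in>B. ennreal (inverse (w x)) \<partial>lebesgue) / emeasure lebesgue B))"


section \<open>Test functions and the kinetic equation\<close>

primrec C_k :: "nat \<Rightarrow> ('a::euclidean_space \<Rightarrow> real) \<Rightarrow> bool" where
  "C_k 0 \<phi> \<longleftrightarrow> continuous_on UNIV \<phi>"
| "C_k (Suc k) \<phi> \<longleftrightarrow> \<phi> differentiable_on UNIV \<and>
     (\<forall>b\<in>Basis. C_k k (\<lambda>p. frechet_derivative \<phi> (at p) b))"

definition test_functions :: "'a::euclidean_space set \<Rightarrow> ('a \<Rightarrow> real) set" where
  "test_functions \<Omega> = {\<phi>. (\<forall>k. C_k k \<phi>) \<and> {p. \<phi> p \<noteq> 0} \<Subset> \<Omega>}"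

text \<open>
  Points of the phase space are triples \<open>(x, y, t)\<close> with \<open>x \<in> \<real>\<^sup>n\<close>, \<open>y \<in> \<real>\<^sup>m\<close>, \<open>t \<in> \<real>\<close>,
  where \<open>n\<close> and \<open>m\<close> are the cardinalities of the index types.  The splitting \<open>x = (v, z)\<close> is
  given by an injection \<open>\<iota>\<close> of the index type of \<open>y\<close> into that of \<open>x\<close>: it selects the \<open>m\<close>
  coordinates of \<open>x\<close> that form \<open>v\<close>, and the other \<open>k = n - m\<close> coordinates form \<open>z\<close>.
  A product of index types would not do, since \<open>k = 0\<close> has to be allowed.
\<close>
type_synonym ('n, 'm) phase = "(real ^ 'n) \<times> (real ^ 'm) \<times> real"

definition vel :: "('m::finite \<Rightarrow> 'n::finite) \<Rightarrow> real ^ 'n \<Rightarrow> real ^ 'm" where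
  "vel \<iota> x = (\<chi> i. x $ \<iota> i)"

definition grad_x :: "(('n::finite, 'm::finite) phase \<Rightarrow> real) \<Rightarrow> ('n, 'm) phase \<Rightarrow> real ^ 'n" where
  "grad_x \<phi> p = (\<chi> i. frechet_derivative \<phi> (at p) (axis i 1, 0, 0))"

definition grad_y :: "(('n::finite, 'm::finite) phase \<Rightarrow> real) \<Rightarrow> ('n, 'm) phase \<Rightarrow> real ^ 'm" where
  "grad_y \<phi> p = (\<chi> i. frechet_derivative \<phi> (at p) (0, axis i 1, 0))"

definition d_t :: "(('n::finite, 'm::finite) phase \<Rightarrow> real) \<Rightarrow> ('n, 'm) phase \<Rightarrow> real" where
  "d_t \<phi> p = frechet_derivative \<phi> (at p) (0, 0, 1)"

definition Y_op ::
    "('m::finite \<Rightarrow> 'n::finite) \<Rightarrow> (('n, 'm) phase \<Rightarrow> real) \<Rightarrow> ('n, 'm) phase \<Rightarrow> real" where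
  "Y_op \<iota> \<phi> p = vel \<iota> (fst p) \<bullet> grad_y \<phi> p + d_t \<phi> p"

definition weighted_measure ::
    "(real ^ 'n \<Rightarrow> real) \<Rightarrow> ('n::finite, 'm::finite) phase set \<Rightarrow> ('n, 'm) phase measure" where
  "weighted_measure w \<Omega> = density (lebesgue_on \<Omega>) (\<lambda>p. ennreal (w (fst p)))"

text \<open>The weak gradient is the ordinary (unweighted) distributional one.\<close>
definition is_weak_grad_x ::
    "('n::finite, 'm::finite) phase set \<Rightarrow> (('n, 'm) phase \<Rightarrow> real) \<Rightarrow>
      (('n, 'm) phase \<Rightarrow> real ^ 'n) \<Rightarrow> bool" where
  "is_weak_grad_x \<Omega> f Df \<longleftrightarrow> (\<forall>\<phi>\<in>test_functions \<Omega>. \<forall>i.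
     (\<integral>p. f p * grad_x \<phi> p $ i \<partial>lebesgue_on \<Omega>) = - (\<integral>p. Df p $ i * \<phi> p \<partial>lebesgue_on \<Omega>))"

definition weighted_kinetic_eq ::
    "('m::finite \<Rightarrow> 'n::finite) \<Rightarrow> (real ^ 'n \<Rightarrow> real) \<Rightarrow> ('n, 'm) phase set \<Rightarrow>
      (('n, 'm) phase \<Rightarrow> real) \<Rightarrow> (('n, 'm) phase \<Rightarrow> real ^ 'n) \<Rightarrow> (('n, 'm) phase \<Rightarrow> real) \<Rightarrow> bool"
  where
  "weighted_kinetic_eq \<iota> w \<Omega> f F g \<longleftrightarrow> (\<forall>\<phi>\<in>test_functions \<Omega>.
     - (\<integral>p. f p * Y_op \<iota> \<phi> p \<partial>weighted_measure w \<Omega>) =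
     - (\<integral>p. F p \<bullet> grad_x \<phi> p \<partial>weighted_measure w \<Omega>) + (\<integral>p. g p * \<phi> p \<partial>weighted_measure w \<Omega>))"


section \<open>Bessel-potential spaces\<close>

text \<open>
  The Fourier--Plancherel transform of an \<open>L\<^sup>2\<close> function, as the \<open>L\<^sup>2\<close> limit of the Fourier
  integrals over growing balls; it is determined up to a null set.  No normalising factor is used.
\<close>
definition is_L2_fourier ::
    "('a::euclidean_space \<Rightarrow> complex) \<Rightarrow> ('a \<Rightarrow> complex) \<Rightarrow> bool" where
  "is_L2_fourier V W \<longleftrightarrow> W \<in> L2 lebesgue \<and>
     ((\<lambda>R. L2_norm lebesgue
        (\<lambda>\<xi>. (\<integral>p. exp (- \<i> * of_real (p \<bullet> \<xi>)) * V p \<partial>lebesgue_on (ball 0 R)) - W \<xi>))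
      \<longlongrightarrow> 0) at_top"

definition L2_fourier :: "('a::euclidean_space \<Rightarrow> complex) \<Rightarrow> 'a \<Rightarrow> complex" where
  "L2_fourier V = (SOME W. is_L2_fourier V W)"

definition Hs_norm :: "real \<Rightarrow> ('a::euclidean_space \<Rightarrow> complex) \<Rightarrow> ennreal" where
  "Hs_norm s V =
     esqrt (\<integral>\<^sup>+\<xi>. ennreal ((1 + (norm \<xi>)\<^sup>2) powr s * (cmod (L2_fourier V \<xi>))\<^sup>2) \<partial>lebesgue)"

text \<open>Intended for \<open>s \<ge> 0\<close>, where Bessel-potential spaces consist of \<open>L\<^sup>2\<close> functions.\<close>
definition Hs :: "real \<Rightarrow> ('a::euclidean_space \<Rightarrow> complex) set" where
  "Hs s = {V \<in> L2 lebesgue. Hs_norm s V < top}"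

text \<open>The quotient norm on restrictions to \<open>G\<close>; it is infinite if there is no extension in \<open>H\<^sup>s\<close>.\<close>
definition Hs_norm_on ::
    "real \<Rightarrow> 'a::euclidean_space set \<Rightarrow> ('a \<Rightarrow> complex) \<Rightarrow> ennreal" where
  "Hs_norm_on s G u =
     (INF V\<in>{V \<in> Hs s. AE p in lebesgue. p \<in> G \<longrightarrow> V p = u p}. Hs_norm s V)"

definition L2_Hs_norm ::
    "(real ^ 'n \<Rightarrow> real) \<Rightarrow> (real ^ 'n) set \<Rightarrow> real \<Rightarrow> ((real ^ 'm) \<times> real) set \<Rightarrow>
      (('n::finite, 'm::finite) phase \<Rightarrow> real) \<Rightarrow> ennreal" where
  "L2_Hs_norm w Dx s G f =
     esqrt (\<integral>\<^sup>+x\<in>Dx. (Hs_norm_on s G (\<lambda>q. complex_of_real (f (x, q))))\<^sup>2 * ennreal (w x) \<partial>lebesgue)"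

end

theory Submission
  imports Defs "HOL-Probability.Probability"
begin

text \<open>
  The regularity in \<open>q = (y, t)\<close> is read off from the Fourier transform in \<open>q\<close>.  Let \<open>f\<close> be cut off
  by \<open>\<kappa>(x) \<theta>(q)\<close>, and let \<open>p(x)\<close> be the cosine or sine transform of the result at the frequency
  \<open>\<xi> = (\<eta>, \<tau>)\<close>.  Testing the equation with functions \<open>h(x) \<kappa>(x) \<theta>(q) e(q \<bullet> \<xi>)\<close>, where \<open>e\<close> is a sine or
  a cosine, gives an equation in \<open>x\<close> alone: \<open>a w p = - div (w \<Phi>) + w G\<close> with the affine symbol
  \<open>a = v \<bullet> \<eta> + \<tau>\<close> (\<open>transport_cut\<close>), and \<open>p\<close> inherits a weak gradient \<open>P\<close> (\<open>weak_grad_cut\<close>).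
  The heart of the proof is \<open>frequency_decay\<close>: the weighted norm of \<open>p\<close> is smaller by a power of
  \<open>N = 1 + |\<eta>| + |\<tau>|\<close> than the sum of the norms of \<open>p\<close>, \<open>P\<close>, \<open>\<Phi>\<close>, \<open>G\<close>, uniformly in the weight.  After
  multiplication by \<open>(1 + |\<xi>|\<^sup>2)\<^sup>s\<close>, integration in \<open>\<xi>\<close> and Plancherel in \<open>q\<close> this power
  becomes the fractional derivative in \<open>q\<close> (\<open>kinetic_fourier_estimate\<close>, \<open>fractional_norm_le\<close>).

  Two mechanisms give the power.  The energy estimate, in which the equation is tested with \<open>a\<close>
  times a mollification of \<open>p\<close> at the scale \<open>1/N\<close>, bounds the integral of \<open>a\<^sup>2 p\<^sup>2 w\<close> by a
  multiple of \<open>N\<close> (\<open>energy_estimate\<close>); it settles the region where \<open>|a|\<close> exceeds \<open>N\<^sup>3\<^sup>/\<^sup>4\<close>.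
  What remains is a neighbourhood of the hyperplane \<open>a = 0\<close> that is thin at the scale
  \<open>N\<^sup>-\<^sup>1\<^sup>/\<^sup>4\<close>.  A function with a gradient in \<open>L\<^sup>2(w)\<close> cannot live on a thin slab: its
  values there are, up to a Poincare error, averages of its values just outside.  Iterating this
  hole-filling argument over slabs of geometrically decreasing width gives a power of the width
  (\<open>slab_hole_filling\<close>, \<open>slab_decay\<close>).

  The weight enters through two facts whose constants depend on the dimension and the \<open>A\<^sub>2\<close>
  bound only: averages over balls of a fixed radius are bounded on \<open>L\<^sup>2(w)\<close> (\<open>A2_averaging\<close>), and
  mollification at scale \<open>s\<close> changes a function by \<open>s\<close> times the norm of its gradient
  (\<open>wsq_mollify_diff\<close>).  Hence so does the exponent.  The domains enter through the cutoffs and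
  through a bound of \<open>v\<close> on the support, and affect only the constant.
\<close>

section \<open>Smooth functions\<close>

definition smooth :: "('a::euclidean_space \<Rightarrow> real) \<Rightarrow> bool" where
  "smooth \<phi> \<longleftrightarrow> (\<forall>k. C_k k \<phi>)"

definition grad :: "('a::euclidean_space \<Rightarrow> real) \<Rightarrow> 'a \<Rightarrow> 'a" where
  "grad \<phi> x = (\<Sum>b\<in>Basis. frechet_derivative \<phi> (at x) b *\<^sub>R b)"

lemma C_k_SucI:
  assumes "\<And>p. (\<phi> has_derivative \<phi>' p) (at p)"
    and "\<And>b. b \<in> Basis \<Longrightarrow> C_k k (\<lambda>p. \<phi>' p b)"
  shows "C_k (Suc k) \<phi>"
proof -
  have eq: "frechet_derivative \<phi> (at p) = \<phi>' p" for p
    using frechet_derivative_at[OF assms(1)] by simp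
  have "\<phi> differentiable_on UNIV"
    using assms(1) unfolding differentiable_on_def differentiable_def by blast
  then show ?thesis
    using assms(2) by (simp add: eq)
qed

lemma C_k_Suc_has_derivative:
  assumes "C_k (Suc k) \<phi>"
  shows "(\<phi> has_derivative frechet_derivative \<phi> (at p)) (at p)"
  using assms by (auto simp: differentiable_on_def frechet_derivative_works)

lemma C_k_SucD: "C_k (Suc k) \<phi> \<Longrightarrow> C_k k \<phi>"
proof (induction k arbitrary: \<phi>)
  case 0
  then show ?case by (auto intro: differentiable_imp_continuous_on)
next
  case (Suc k)
  then show ?case by (metis C_k.simps(2))
qed

lemma C_k_cmult: "C_k k \<phi> \<Longrightarrow> C_k k (\<lambda>x. c * \<phi> x)"
proof (induction k arbitrary: \<phi>)
  case 0
  then show ?case by (auto intro: continuous_intros)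
next
  case (Suc k)
  show ?case
  proof (rule C_k_SucI)
    show "((\<lambda>x. c * \<phi> x) has_derivative (\<lambda>v. c * frechet_derivative \<phi> (at p) v)) (at p)" for p
      by (intro has_derivative_mult_right C_k_Suc_has_derivative[OF Suc.prems])
    show "C_k k (\<lambda>p. c * frechet_derivative \<phi> (at p) b)" if "b \<in> Basis" for b
      using Suc.prems that by (intro Suc.IH) auto
  qed
qed

lemma C_k_const: "C_k k (\<lambda>x. c)"
proof (induction k arbitrary: c)
  case (Suc k)
  show ?case
    by (rule C_k_SucI[where \<phi>'="\<lambda>p v. 0"]) (auto intro: Suc)
qed auto

lemma C_k_add: "C_k k \<phi> \<Longrightarrow> C_k k \<psi> \<Longrightarrow> C_k k (\<lambda>x. \<phi> x + \<psi> x)"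
proof (induction k arbitrary: \<phi> \<psi>)
  case 0
  then show ?case by (auto intro: continuous_intros)
next
  case (Suc k)
  show ?case
  proof (rule C_k_SucI)
    show "((\<lambda>x. \<phi> x + \<psi> x) has_derivative
        (\<lambda>v. frechet_derivative \<phi> (at p) v + frechet_derivative \<psi> (at p) v)) (at p)" for p
      by (intro has_derivative_add C_k_Suc_has_derivative[OF Suc.prems(1)]
          C_k_Suc_has_derivative[OF Suc.prems(2)])
    show "C_k k (\<lambda>p. frechet_derivative \<phi> (at p) b + frechet_derivative \<psi> (at p) b)"
      if "b \<in> Basis" for b
      using Suc.prems that by (intro Suc.IH) auto
  qed
qed

lemma C_k_sum: "(\<And>i. i \<in> A \<Longrightarrow> C_k k (\<phi> i)) \<Longrightarrow> C_k k (\<lambda>x. \<Sum>i\<in>A. \<phi> i x)"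
  by (induction A rule: infinite_finite_induct) (auto intro: C_k_const C_k_add)

lemma C_k_mult: "C_k k \<phi> \<Longrightarrow> C_k k \<psi> \<Longrightarrow> C_k k (\<lambda>x. \<phi> x * \<psi> x)"
proof (induction k arbitrary: \<phi> \<psi>)
  case 0
  then show ?case by (auto intro: continuous_intros)
next
  case (Suc k)
  show ?case
  proof (rule C_k_SucI)
    show "((\<lambda>x. \<phi> x * \<psi> x) has_derivative
        (\<lambda>v. \<phi> p * frechet_derivative \<psi> (at p) v + frechet_derivative \<phi> (at p) v * \<psi> p)) (at p)" for p
      by (intro has_derivative_mult C_k_Suc_has_derivative[OF Suc.prems(1)]
          C_k_Suc_has_derivative[OF Suc.prems(2)])
    show "C_k k (\<lambda>p. \<phi> p * frechet_derivative \<psi> (at p) b + frechet_derivative \<phi> (at p) b * \<psi> p)"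
      if "b \<in> Basis" for b
      using Suc.prems that C_k_SucD[OF Suc.prems(1)] C_k_SucD[OF Suc.prems(2)]
      by (intro C_k_add Suc.IH) auto
  qed
qed

lemma C_k_frechet:
  assumes "C_k (Suc k) \<phi>"
  shows "C_k k (\<lambda>p. frechet_derivative \<phi> (at p) v)"
proof -
  have "linear (frechet_derivative \<phi> (at p))" for p
    using C_k_Suc_has_derivative[OF assms] by (meson has_derivative_linear)
  then have "frechet_derivative \<phi> (at p) v = (\<Sum>b\<in>Basis. (v \<bullet> b) * frechet_derivative \<phi> (at p) b)" for p
    by (subst euclidean_representation[of v, symmetric]) (simp add: linear_sum linear_cmul)
  moreover have "C_k k (\<lambda>p. (\<Sum>b\<in>Basis. (v \<bullet> b) * frechet_derivative \<phi> (at p) b))"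
    using assms by (intro C_k_sum C_k_cmult) auto
  ultimately show ?thesis by simp
qed

lemma C_k_affine:
  assumes "bounded_linear L"
  shows "C_k k \<phi> \<Longrightarrow> C_k k (\<lambda>x. \<phi> (c + L x))"
proof (induction k arbitrary: \<phi>)
  case 0
  then show ?case
    using linear_continuous_on[OF assms]
    by (auto intro!: continuous_intros continuous_on_compose2[of UNIV \<phi>])
next
  case (Suc k)
  show ?case
  proof (rule C_k_SucI)
    have "((\<lambda>x. c + L x) has_derivative L) (at p)" for p
      using bounded_linear_imp_has_derivative[OF assms] by (auto intro!: derivative_eq_intros)
    then show "((\<lambda>x. \<phi> (c + L x)) has_derivative (\<lambda>v. frechet_derivative \<phi> (at (c + L p)) (L v))) (at p)" for p
      using has_derivative_compose[OF _ C_k_Suc_has_derivative[OF Suc.prems]] by blast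
    show "C_k k (\<lambda>p. frechet_derivative \<phi> (at (c + L p)) (L b))" for b
      using Suc.IH[OF C_k_frechet[OF Suc.prems, of "L b"]] .
  qed
qed

lemma C_k_compose:
  fixes g :: "real \<Rightarrow> real"
  shows "C_k k g \<Longrightarrow> C_k k \<phi> \<Longrightarrow> C_k k (\<lambda>x. g (\<phi> x))"
proof (induction k arbitrary: g)
  case 0
  then show ?case by (auto intro!: continuous_on_compose2[of UNIV g])
next
  case (Suc k)
  have lin: "frechet_derivative g (at t) v = frechet_derivative g (at t) 1 * v" for t v
  proof -
    have "linear (frechet_derivative g (at t))"
      using C_k_Suc_has_derivative[OF Suc.prems(1)] by (meson has_derivative_linear)
    then show ?thesis
      using linear_cmul[of "frechet_derivative g (at t)" v 1] by (simp add: mult.commute)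
  qed
  show ?case
  proof (rule C_k_SucI)
    have "((\<lambda>x. g (\<phi> x)) has_derivative
       (\<lambda>v. frechet_derivative g (at (\<phi> p)) (frechet_derivative \<phi> (at p) v))) (at p)" for p
      using has_derivative_compose[OF C_k_Suc_has_derivative[OF Suc.prems(2)]
          C_k_Suc_has_derivative[OF Suc.prems(1)]] .
    then show "((\<lambda>x. g (\<phi> x)) has_derivative
       (\<lambda>v. frechet_derivative g (at (\<phi> p)) 1 * frechet_derivative \<phi> (at p) v)) (at p)" for p
      by (rule has_derivative_eq_rhs) (rule ext, rule lin)
    show "C_k k (\<lambda>p. frechet_derivative g (at (\<phi> p)) 1 * frechet_derivative \<phi> (at p) b)" for b
      proof -
      have "C_k k (\<lambda>t. frechet_derivative g (at t) 1)"
        by (rule C_k_frechet[OF Suc.prems(1)])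
      then have "C_k k (\<lambda>p. frechet_derivative g (at (\<phi> p)) 1)"
        by (rule Suc.IH[OF _ C_k_SucD[OF Suc.prems(2)]])
      then show ?thesis
        by (rule C_k_mult) (rule C_k_frechet[OF Suc.prems(2)])
    qed
  qed
qed

lemma C_k_inverse:
  assumes pos: "\<And>x. \<phi> x \<noteq> 0"
  shows "C_k k \<phi> \<Longrightarrow> C_k k (\<lambda>x. inverse (\<phi> x))"
proof (induction k)
  case 0
  then show ?case using pos by (auto intro!: continuous_intros)
next
  case (Suc k)
  show ?case
  proof (rule C_k_SucI)
    show "((\<lambda>x. inverse (\<phi> x)) has_derivative
       (\<lambda>v. (-1) * (inverse (\<phi> p) * frechet_derivative \<phi> (at p) v * inverse (\<phi> p)))) (at p)" for p
      using Deriv.has_derivative_inverse[OF pos C_k_Suc_has_derivative[OF Suc.prems]] by simp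
    show "C_k k (\<lambda>p. (-1) * (inverse (\<phi> p) * frechet_derivative \<phi> (at p) b * inverse (\<phi> p)))" for b
      by (intro C_k_cmult C_k_mult C_k_frechet Suc.prems Suc.IH C_k_SucD[OF Suc.prems])
  qed
qed

lemma C_k_inner: "C_k k (\<lambda>x. x \<bullet> v)"
proof (cases k)
  case (Suc j)
  show ?thesis unfolding Suc
    by (rule C_k_SucI[where \<phi>'="\<lambda>p u. u \<bullet> v"]) (auto intro!: derivative_eq_intros C_k_const)
qed (auto intro!: continuous_intros)

text \<open>
  For functions on the line that are given piecewise it is easier to exhibit all derivatives at
  once than to differentiate repeatedly.
\<close>
lemma C_k_derivative_sequence:
  fixes D :: "nat \<Rightarrow> real \<Rightarrow> real"
  assumes "\<And>j t. (D j has_field_derivative D (Suc j) t) (at t)"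
  shows "C_k k (D j)"
proof (induction k arbitrary: j)
  case 0
  show ?case using assms by (auto intro!: DERIV_continuous_on)
next
  case (Suc k)
  show ?case
    by (rule C_k_SucI[where \<phi>'="\<lambda>p v. D (Suc j) p * v"])
      (use assms Suc in \<open>auto simp: has_field_derivative_def\<close>)
qed

lemma smooth_const [intro]: "smooth (\<lambda>x. c)"
  and smooth_add [intro]: "smooth \<phi> \<Longrightarrow> smooth \<psi> \<Longrightarrow> smooth (\<lambda>x. \<phi> x + \<psi> x)"
  and smooth_mult [intro]: "smooth \<phi> \<Longrightarrow> smooth \<psi> \<Longrightarrow> smooth (\<lambda>x. \<phi> x * \<psi> x)"
  and smooth_sum [intro]: "(\<And>i. i \<in> A \<Longrightarrow> smooth (\<Phi> i)) \<Longrightarrow> smooth (\<lambda>x. \<Sum>i\<in>A. \<Phi> i x)"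
  and smooth_inner [intro]: "smooth (\<lambda>x. x \<bullet> v)"
  and smooth_inverse: "(\<And>x. \<phi> x \<noteq> 0) \<Longrightarrow> smooth \<phi> \<Longrightarrow> smooth (\<lambda>x. inverse (\<phi> x))"
  and smooth_compose: "smooth g \<Longrightarrow> smooth \<phi> \<Longrightarrow> smooth (\<lambda>x. g (\<phi> x))"
  and smooth_affine: "bounded_linear L \<Longrightarrow> smooth \<zeta> \<Longrightarrow> smooth (\<lambda>x. \<zeta> (c\<^sub>0 + L x))"
  by (auto simp: smooth_def C_k_const C_k_add C_k_mult C_k_sum C_k_inner C_k_inverse C_k_compose
      C_k_affine)

lemma smooth_diff [intro]: "smooth \<phi> \<Longrightarrow> smooth \<psi> \<Longrightarrow> smooth (\<lambda>x. \<phi> x - \<psi> x)"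
  using smooth_add[of \<phi> "\<lambda>x. (-1) * \<psi> x"] smooth_mult[OF smooth_const[of "-1"]] by auto

lemma smooth_prod: "(\<And>i. i \<in> A \<Longrightarrow> smooth (\<Phi> i)) \<Longrightarrow> smooth (\<lambda>x. \<Prod>i\<in>A. \<Phi> i x)"
  by (induction A rule: infinite_finite_induct) auto

lemmas smooth_intros = smooth_const smooth_add smooth_mult smooth_sum smooth_inner smooth_diff smooth_prod

lemma smooth_linear: "bounded_linear L \<Longrightarrow> smooth \<zeta> \<Longrightarrow> smooth (\<lambda>x. \<zeta> (L x))"
  using smooth_affine[of L \<zeta> 0] by simp

lemma smooth_frechet [intro]: "smooth \<phi> \<Longrightarrow> smooth (\<lambda>x. frechet_derivative \<phi> (at x) v)"
  unfolding smooth_def by (blast intro: C_k_frechet)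

lemma smooth_has_derivative_frechet:
  "smooth \<phi> \<Longrightarrow> (\<phi> has_derivative frechet_derivative \<phi> (at x)) (at x)"
  unfolding smooth_def by (blast intro: C_k_Suc_has_derivative)

lemma smooth_continuous: "smooth \<phi> \<Longrightarrow> continuous_on S \<phi>"
  unfolding smooth_def by (metis C_k.simps(1) continuous_on_subset subset_UNIV)

lemma frechet_derivative_grad:
  assumes "smooth \<phi>"
  shows "frechet_derivative \<phi> (at x) v = grad \<phi> x \<bullet> v"
proof -
  have "linear (frechet_derivative \<phi> (at x))"
    using smooth_has_derivative_frechet[OF assms] by (meson has_derivative_linear)
  then have "frechet_derivative \<phi> (at x) v = (\<Sum>b\<in>Basis. (v \<bullet> b) * frechet_derivative \<phi> (at x) b)"
    by (subst euclidean_representation[of v, symmetric]) (simp add: linear_sum linear_cmul)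
  also have "\<dots> = grad \<phi> x \<bullet> v"
    unfolding grad_def inner_sum_left inner_scaleR_left
    by (intro sum.cong refl) (metis inner_commute mult.commute)
  finally show ?thesis .
qed

lemma smooth_has_derivative:
  assumes "smooth \<phi>"
  shows "(\<phi> has_derivative (\<lambda>v. grad \<phi> x \<bullet> v)) (at x)"
  by (rule has_derivative_eq_rhs[OF smooth_has_derivative_frechet[OF assms]])
    (rule ext, rule frechet_derivative_grad[OF assms])

lemma smooth_continuous_grad:
  assumes "smooth \<phi>" shows "continuous_on S (grad \<phi>)"
  unfolding grad_def by (intro continuous_intros smooth_continuous smooth_frechet assms)

lemma grad_unique:
  assumes "(\<phi> has_derivative (\<lambda>v. G \<bullet> v)) (at x)"
  shows "grad \<phi> x = G"
  using frechet_derivative_at[OF assms] unfolding grad_def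
  by (simp add: euclidean_representation flip: frechet_derivative_at[OF assms])

lemma grad_mult:
  assumes "smooth \<phi>" "smooth \<psi>"
  shows "grad (\<lambda>x. \<phi> x * \<psi> x) x = \<phi> x *\<^sub>R grad \<psi> x + \<psi> x *\<^sub>R grad \<phi> x"
  by (rule grad_unique, rule has_derivative_eq_rhs,
      rule has_derivative_mult[OF smooth_has_derivative[OF assms(1)] smooth_has_derivative[OF assms(2)]])
    (auto simp: inner_add_left algebra_simps)

lemma grad_zero_outside:
  assumes "open U" "x \<in> U" "\<And>y. y \<in> U \<Longrightarrow> \<phi> y = 0"
  shows "grad \<phi> x = 0"
proof (rule grad_unique)
  have "((\<lambda>y. 0) has_derivative (\<lambda>v. 0)) (at x)" by simp
  then have "(\<phi> has_derivative (\<lambda>v. 0)) (at x)"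
    using has_derivative_transform_within_open[OF _ assms(1,2)] assms(3) by (metis (mono_tags, lifting))
  then show "(\<phi> has_derivative (\<lambda>v. 0 \<bullet> v)) (at x)" by simp
qed

lemma smooth_cos: "smooth (cos :: real \<Rightarrow> real)"
proof -
  define D where "D j t = cos (t + of_nat j * (pi/2))" for j and t :: real
  have "(D j has_field_derivative D (Suc j) t) (at t)" for j t
  proof -
    have "D (Suc j) t = - sin (t + of_nat j * (pi/2))"
      unfolding D_def using cos_add[of "t + of_nat j * (pi/2)" "pi/2"]
      by (simp add: algebra_simps add_divide_distrib)
    moreover have "(D j has_field_derivative - sin (t + of_nat j * (pi/2))) (at t)"
      unfolding D_def by (auto intro!: derivative_eq_intros)
    ultimately show ?thesis by simp
  qed
  then have "C_k k (D 0)" for k by (rule C_k_derivative_sequence)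
  moreover have "D 0 = cos" by (auto simp: D_def)
  ultimately show ?thesis by (simp add: smooth_def)
qed

subsection \<open>Cutoff functions\<close>

definition flat :: "real \<Rightarrow> real" where
  "flat t = (if t > 0 then exp (- (1 / t)) else 0)"

lemma poly_times_exp_tendsto_0:
  fixes p :: "real poly"
  shows "((\<lambda>y. poly p y * exp (- y)) \<longlongrightarrow> 0) at_top"
proof -
  have "((\<lambda>y. \<Sum>i\<le>degree p. coeff p i * (y ^ i / exp y)) \<longlongrightarrow> (\<Sum>i\<le>degree p. coeff p i * 0)) at_top"
    by (intro tendsto_sum tendsto_mult tendsto_const tendsto_power_div_exp_0)
  then show ?thesis
    by (simp add: poly_altdef sum_distrib_right exp_minus divide_inverse mult.assoc)
qed

text \<open>
  Every derivative of \<open>exp (-1/t)\<close> is a polynomial in \<open>1/t\<close> times \<open>exp (-1/t)\<close>, and hence tends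
  to \<open>0\<close> at the origin faster than any power.
\<close>
lemma smooth_flat: "smooth flat"
proof -
  \<comment> \<open>\<open>Q j\<close> is the polynomial for which the \<open>j\<close>-th derivative is \<open>Q j (1/t) exp (-1/t)\<close> for \<open>t > 0\<close>\<close>
  define Q :: "nat \<Rightarrow> real poly" where "Q = rec_nat 1 (\<lambda>_ q. [:0,0,1:] * (q - pderiv q))"
  have Q0: "Q 0 = 1" and QS: "Q (Suc j) = [:0,0,1:] * (Q j - pderiv (Q j))" for j
    by (auto simp: Q_def)
  define D where "D j t = (if t > 0 then poly (Q j) (1/t) * exp (- (1/t)) else 0)" for j and t :: real
  have "(D j has_field_derivative D (Suc j) t) (at t)" for j t
  proof -
    consider "t > 0" | "t < 0" | "t = 0" by linarith
    then show ?thesis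
    proof cases
      case 1
      have "((\<lambda>t. poly (Q j) (1/t) * exp (- (1/t))) has_field_derivative
          poly (Q j) (1/t) * (exp (- (1/t)) * (1/t^2)) + (poly (pderiv (Q j)) (1/t) * (- (1/t^2))) * exp (- (1/t))) (at t)"
      proof -
        have i: "((\<lambda>t. 1/t) has_field_derivative - (1/t^2)) (at t)"
          using 1 by (auto intro!: derivative_eq_intros simp: power2_eq_square)
        have "((\<lambda>t. poly (Q j) (1/t)) has_field_derivative (poly (pderiv (Q j)) (1/t) * (- (1/t^2)))) (at t)"
          by (rule DERIV_chain2[OF poly_DERIV i])
        moreover have "((\<lambda>t. exp (- (1/t))) has_field_derivative exp (- (1/t)) * (1/t^2)) (at t)"
          by (rule derivative_eq_intros i refl)+ simp
        ultimately show ?thesis by (rule DERIV_mult')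
      qed
      moreover have "poly (Q j) (1/t) * (exp (- (1/t)) * (1/t^2)) + (poly (pderiv (Q j)) (1/t) * (- (1/t^2))) * exp (- (1/t))
          = D (Suc j) t"
        using 1 by (simp add: D_def QS algebra_simps power2_eq_square)
      ultimately have "((\<lambda>t. poly (Q j) (1/t) * exp (- (1/t))) has_field_derivative D (Suc j) t) (at t)"
        by simp
      then show ?thesis
        by (rule has_field_derivative_transform_within_open[where S="{0<..}"]) (use 1 in \<open>auto simp: D_def\<close>)
    next
      case 2
      have "((\<lambda>t. 0) has_field_derivative D (Suc j) t) (at t)"
        using 2 by (simp add: D_def)
      then show ?thesis
        by (rule has_field_derivative_transform_within_open[where S="{..<0}"]) (use 2 in \<open>auto simp: D_def\<close>)
    next
      case 3
      have "((\<lambda>h. poly (pCons 0 (Q j)) (inverse h) * exp (- inverse h)) \<longlongrightarrow> 0) (at_right 0)"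
        using poly_times_exp_tendsto_0 filterlim_inverse_at_top_right by (rule filterlim_compose)
      then have r: "((\<lambda>h. (D j h - D j 0) / (h - 0)) \<longlongrightarrow> 0) (at_right 0)"
      proof (rule Lim_transform_eventually)
        show "\<forall>\<^sub>F h in at_right 0. poly (pCons 0 (Q j)) (inverse h) * exp (- inverse h) = (D j h - D j 0) / (h - 0)"
          by (auto simp: eventually_at_right_field D_def field_simps intro!: exI[of _ 1])
      qed
      have "((\<lambda>h::real. 0::real) \<longlongrightarrow> 0) (at_left 0)" by simp
      then have l: "((\<lambda>h. (D j h - D j 0) / (h - 0)) \<longlongrightarrow> 0) (at_left 0)"
      proof (rule Lim_transform_eventually)
        show "\<forall>\<^sub>F h in at_left 0. 0 = (D j h - D j 0) / (h - 0)"
          by (auto simp: eventually_at_left_field D_def intro!: exI[of _ "-1"])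
      qed
      have "((\<lambda>h. (D j h - D j 0) / (h - 0)) \<longlongrightarrow> 0) (at 0)"
        using filterlim_split_at[OF l r] .
      then show ?thesis using 3 by (simp add: has_field_derivative_iff D_def)
    qed
  qed
  then have "C_k k (D 0)" for k by (rule C_k_derivative_sequence)
  moreover have "D 0 = flat" by (auto simp: D_def flat_def Q0)
  ultimately show ?thesis by (simp add: smooth_def)
qed

definition step :: "real \<Rightarrow> real" where
  "step t = flat t * inverse (flat t + flat (1 - t))"

lemma flat_sum_pos: "flat t + flat (1 - t) > 0"
  by (auto simp: flat_def add_pos_pos)

lemma smooth_step: "smooth step"
proof -
  have "smooth (\<lambda>t. flat (1 + (- t)))"
    by (rule smooth_affine[OF _ smooth_flat]) (intro bounded_linear_minus bounded_linear_ident)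
  then have "smooth (\<lambda>t. flat t + flat (1 - t))" using smooth_flat by auto
  then show ?thesis
    unfolding step_def[abs_def] using flat_sum_pos
    by (intro smooth_mult smooth_flat smooth_inverse) (auto simp: less_le)
qed

lemma step_bounds: "0 \<le> step t" "step t \<le> 1"
  using flat_sum_pos[of t] by (auto simp: step_def flat_def field_simps)

lemma step_eq_0: "t \<le> 0 \<Longrightarrow> step t = 0"
  and step_eq_1: "1 \<le> t \<Longrightarrow> step t = 1"
  using flat_sum_pos[of t] by (auto simp: step_def flat_def)

lemma smooth_dist_sq: "smooth (\<lambda>x::'a::euclidean_space. (norm (x - p))\<^sup>2)"
proof -
  have "(norm (x - p))\<^sup>2 = (\<Sum>b\<in>Basis. (x \<bullet> b - p \<bullet> b) * (x \<bullet> b - p \<bullet> b))" for x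
    unfolding power2_norm_eq_inner by (subst euclidean_inner) (simp add: inner_diff_left)
  moreover have "smooth (\<lambda>x::'a. (\<Sum>b\<in>Basis. (x \<bullet> b - p \<bullet> b) * (x \<bullet> b - p \<bullet> b)))"
    by (intro smooth_intros)
  ultimately show ?thesis by simp
qed

lemma smooth_cutoff:
  fixes K U :: "'a::euclidean_space set"
  assumes "compact K" "open U" "K \<subseteq> U"
  obtains \<kappa> where "smooth \<kappa>" "\<And>x. 0 \<le> \<kappa> x" "\<And>x. \<kappa> x \<le> 1" "\<And>x. x \<in> K \<Longrightarrow> \<kappa> x = 1"
    "compact (closure {x. \<kappa> x \<noteq> 0})" "closure {x. \<kappa> x \<noteq> 0} \<subseteq> U"
proof -
  have "\<forall>p\<in>K. \<exists>r>0. cball p (2*r) \<subseteq> U"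
  proof
    fix p assume "p \<in> K"
    then obtain e where e: "e > 0" "cball p e \<subseteq> U"
      using assms open_contains_cball_eq by blast
    then show "\<exists>r>0. cball p (2*r) \<subseteq> U" by (intro exI[of _ "e/2"]) auto
  qed
  then obtain r where r: "\<And>p. p \<in> K \<Longrightarrow> r p > 0 \<and> cball p (2 * r p) \<subseteq> U"
    by metis
  \<comment> \<open>equal to \<open>1\<close> on the ball of radius \<open>r p\<close> and to \<open>0\<close> outside the one of radius \<open>2 r p\<close>\<close>
  define \<psi> where "\<psi> p x = step (2 - (1/(r p)\<^sup>2) * (norm (x - p))\<^sup>2)" for p x
  have sm: "smooth (\<psi> p)" for p
    unfolding \<psi>_def by (intro smooth_compose[OF smooth_step] smooth_diff smooth_mult smooth_const smooth_dist_sq)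
  have K: "K \<subseteq> (\<Union>p\<in>K. ball p (r p))" using r by auto
  then obtain A where A: "A \<subseteq> K" "finite A" "K \<subseteq> (\<Union>p\<in>A. ball p (r p))"
    using compactE_image[OF assms(1), of K "\<lambda>p. ball p (r p)"] by auto
  \<comment> \<open>smooth maximum of the bumps: \<open>1\<close> where one of them is \<open>1\<close>, \<open>0\<close> where all of them vanish\<close>
  define \<kappa> where "\<kappa> x = 1 - (\<Prod>p\<in>A. 1 - \<psi> p x)" for x
  have psi01: "0 \<le> \<psi> p x" "\<psi> p x \<le> 1" for p x
    unfolding \<psi>_def by (rule step_bounds)+
  have prod01: "0 \<le> (\<Prod>p\<in>A. 1 - \<psi> p x)" "(\<Prod>p\<in>A. 1 - \<psi> p x) \<le> 1" for x
    using psi01 by (auto intro!: prod_nonneg prod_le_1)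
  have supp: "{x. \<kappa> x \<noteq> 0} \<subseteq> (\<Union>p\<in>A. cball p (2 * r p))"
  proof
    fix x assume "x \<in> {x. \<kappa> x \<noteq> 0}"
    then have "(\<Prod>p\<in>A. 1 - \<psi> p x) \<noteq> 1" by (simp add: \<kappa>_def)
    then obtain p where p: "p \<in> A" "\<psi> p x \<noteq> 0"
      by (metis (mono_tags, lifting) diff_zero prod.neutral)
    then have rp: "r p > 0" using r A by auto
    have "2 - (1/(r p)\<^sup>2) * (norm (x - p))\<^sup>2 > 0"
      using p(2) step_eq_0 unfolding \<psi>_def by (meson not_le)
    then have "(norm (x - p))\<^sup>2 < 2 * (r p)\<^sup>2"
      using rp by (simp add: field_simps)
    then have "(norm (x - p))\<^sup>2 \<le> (2 * r p)\<^sup>2"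
    proof -
      have "(2 * r p)\<^sup>2 = 4 * (r p)\<^sup>2" "0 \<le> (r p)\<^sup>2" by (simp_all add: power_mult_distrib)
      then show ?thesis using \<open>(norm (x - p))\<^sup>2 < 2 * (r p)\<^sup>2\<close> by linarith
    qed
    then have "norm (x - p) \<le> 2 * r p"
      by (rule power2_le_imp_le) (use rp in auto)
    then show "x \<in> (\<Union>p\<in>A. cball p (2 * r p))"
      using p by (auto simp: dist_norm norm_minus_commute)
  qed
  have cpt: "compact (\<Union>p\<in>A. cball p (2 * r p))" using A by auto
  have clos: "closure {x. \<kappa> x \<noteq> 0} \<subseteq> (\<Union>p\<in>A. cball p (2 * r p))"
    using supp cpt by (simp add: closure_minimal compact_imp_closed)
  show thesis
  proof
    show "smooth \<kappa>" unfolding \<kappa>_def by (intro smooth_diff smooth_const smooth_prod sm)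
    show "0 \<le> \<kappa> x" "\<kappa> x \<le> 1" for x using prod01[of x] by (auto simp: \<kappa>_def)
    show "\<kappa> x = 1" if xK: "x \<in> K" for x
    proof -
      obtain p where p: "p \<in> A" "x \<in> ball p (r p)" using A(3) xK by blast
      then have rp: "r p > 0" using r A by auto
      have "norm (x - p) < r p" using p by (simp add: dist_norm norm_minus_commute)
      then have "(norm (x - p))\<^sup>2 \<le> (r p)\<^sup>2" by (intro power_mono) auto
      then have "\<psi> p x = 1" unfolding \<psi>_def using rp by (intro step_eq_1) (simp add: field_simps)
      then show ?thesis using p A(2) unfolding \<kappa>_def by (simp add: prod_zero_iff) blast
    qed
    show "compact (closure {x. \<kappa> x \<noteq> 0})"
      using compact_closure clos cpt by (meson bounded_subset closure_subset compact_imp_bounded order_trans)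
    show "closure {x. \<kappa> x \<noteq> 0} \<subseteq> U" using clos r A by blast
  qed
qed

section \<open>Averages and mollifiers in weighted spaces\<close>

text \<open>
  The \<open>A\<^sub>2\<close> condition for a Borel representative that is positive everywhere, with the measure of
  the ball multiplied out so that no quotients of extended reals occur.
\<close>
definition A2_weight :: "real \<Rightarrow> ('a::euclidean_space \<Rightarrow> real) \<Rightarrow> bool" where
  "A2_weight M w \<longleftrightarrow> 0 \<le> M \<and> w \<in> borel_measurable borel \<and> (\<forall>x. 0 < w x) \<and>
    (\<forall>c r. 0 < r \<longrightarrow>
      (\<integral>\<^sup>+x\<in>ball c r. ennreal (w x) \<partial>lborel) * (\<integral>\<^sup>+x\<in>ball c r. ennreal (1 / w x) \<partial>lborel)
        \<le> ennreal M * (emeasure lborel (ball c r))\<^sup>2)"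

definition wsq :: "('a::euclidean_space \<Rightarrow> real) \<Rightarrow> ('a \<Rightarrow> real) \<Rightarrow> ennreal" where
  "wsq w p = (\<integral>\<^sup>+x. ennreal ((p x)\<^sup>2 * w x) \<partial>lborel)"

definition ball_vol :: "'a::euclidean_space itself \<Rightarrow> real \<Rightarrow> real" where
  "ball_vol _ r = unit_ball_vol (DIM('a)) * r ^ DIM('a)"

lemma ball_vol_nonneg: "0 \<le> r \<Longrightarrow> 0 \<le> ball_vol TYPE('a::euclidean_space) r"
  by (simp add: ball_vol_def)

lemma ball_vol_mult:
  "ball_vol TYPE('a::euclidean_space) (a * r) = a ^ DIM('a) * ball_vol TYPE('a) r"
  by (simp add: ball_vol_def power_mult_distrib)

lemma emeasure_lborel_ball:
  "0 \<le> r \<Longrightarrow> emeasure lborel (ball (c::'a::euclidean_space) r) = ennreal (ball_vol TYPE('a) r)"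
  by (simp add: ball_vol_def emeasure_ball)

lemma indicator_ball_measurable [measurable (raw)]:
  fixes f g :: "'b \<Rightarrow> 'a::euclidean_space"
  assumes [measurable]: "f \<in> borel_measurable N" "g \<in> borel_measurable N"
  shows "(\<lambda>x. indicator (ball (f x) r) (g x) :: ennreal) \<in> borel_measurable N"
proof -
  have "(\<lambda>x. indicator (ball (f x) r) (g x) :: ennreal)
      = (\<lambda>x. if dist (f x) (g x) < r then 1 else 0)"
    by (auto simp: fun_eq_iff)
  then show ?thesis by simp
qed

lemma ball_measurable [measurable]: "ball (x::'a::euclidean_space) r \<in> sets borel"
  by (simp add: borel_open)

lemma indicator_ball_swap: "indicator (ball x r) y = indicator (ball y r) x"
  by (auto simp: indicator_def dist_commute)

text \<open>
  Averages over balls of a fixed radius are bounded on \<open>L\<^sup>2(w)\<close>: after Cauchy--Schwarz with the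
  splitting \<open>p = (p w\<^sup>1\<^sup>/\<^sup>2) w\<^sup>-\<^sup>1\<^sup>/\<^sup>2\<close> and an exchange of the integrals, only the product of the masses
  of \<open>w\<close> and \<open>1/w\<close> on one ball of twice the radius is left.
\<close>
lemma A2_averaging:
  fixes w :: "'a::euclidean_space \<Rightarrow> real"
  assumes A2: "A2_weight M w" and p [measurable]: "p \<in> borel_measurable borel" and r: "0 < r"
  shows "(\<integral>\<^sup>+x. (\<integral>\<^sup>+y. p y * indicator (ball x r) y \<partial>lborel)\<^sup>2 * ennreal (w x) \<partial>lborel)
     \<le> ennreal (M * (ball_vol TYPE('a) (2 * r))\<^sup>2) * (\<integral>\<^sup>+y. (p y)\<^sup>2 * ennreal (w y) \<partial>lborel)"
proof -
  have w [measurable]: "w \<in> borel_measurable borel" and wpos: "\<And>x. 0 < w x" and M: "0 \<le> M"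
    using A2 by (auto simp: A2_weight_def)
  \<comment> \<open>the mass of \<open>1/w\<close> on a ball\<close>
  define V where "V x \<rho> = (\<integral>\<^sup>+y. ennreal (1 / w y) * indicator (ball x \<rho>) y \<partial>lborel)" for x \<rho>
  have V [measurable]: "(\<lambda>x. V x \<rho>) \<in> borel_measurable borel" for \<rho>
    unfolding V_def by measurable
  have CS: "(\<integral>\<^sup>+y. p y * indicator (ball x r) y \<partial>lborel)\<^sup>2
     \<le> (\<integral>\<^sup>+y. (p y)\<^sup>2 * ennreal (w y) * indicator (ball x r) y \<partial>lborel) * V x r" for x
  proof -
    let ?f = "\<lambda>y. p y * ennreal (sqrt (w y)) * indicator (ball x r) y"
    let ?g = "\<lambda>y. ennreal (1 / sqrt (w y)) * indicator (ball x r) y"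
    have fg: "?f y * ?g y = p y * indicator (ball x r) y" for y
    proof -
      have "ennreal (sqrt (w y)) * ennreal (1 / sqrt (w y)) = 1"
        using wpos[of y] by (simp flip: ennreal_mult)
      then show ?thesis
        by (simp add: indicator_def) (metis (no_types, lifting) mult.assoc mult.right_neutral)
    qed
    have f2: "(?f y)\<^sup>2 = (p y)\<^sup>2 * ennreal (w y) * indicator (ball x r) y" for y
      using wpos[of y] by (auto simp: indicator_def power_mult_distrib ennreal_power less_imp_le)
    have g2: "(?g y)\<^sup>2 = ennreal (1 / w y) * indicator (ball x r) y" for y
      using wpos[of y]
      by (auto simp: indicator_def power_mult_distrib ennreal_power less_imp_le power_divide)
    have "(\<integral>\<^sup>+y. ?f y * ?g y \<partial>lborel)\<^sup>2 \<le> (\<integral>\<^sup>+y. (?f y)\<^sup>2 \<partial>lborel) * (\<integral>\<^sup>+y. (?g y)\<^sup>2 \<partial>lborel)"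
      by (rule Cauchy_Schwarz_nn_integral) measurable
    then show ?thesis unfolding fg f2 g2 V_def .
  qed
  have V_mono: "indicator (ball x r) y * V x r \<le> indicator (ball x r) y * V y (2 * r)" for x y
  proof (cases "y \<in> ball x r")
    case True
    have "ball x r \<subseteq> ball y (2 * r)"
    proof
      fix z assume "z \<in> ball x r"
      then show "z \<in> ball y (2*r)"
        using True dist_triangle[of y z x] by (simp add: dist_commute)
    qed
    then have "V x r \<le> V y (2 * r)"
      unfolding V_def by (intro nn_integral_mono) (auto simp: indicator_def)
    then show ?thesis by (intro mult_left_mono) auto
  qed auto
  have "(\<integral>\<^sup>+x. (\<integral>\<^sup>+y. p y * indicator (ball x r) y \<partial>lborel)\<^sup>2 * ennreal (w x) \<partial>lborel)
     \<le> (\<integral>\<^sup>+x. (\<integral>\<^sup>+y. (p y)\<^sup>2 * ennreal (w y) * indicator (ball x r) y \<partial>lborel) * (V x r * ennreal (w x)) \<partial>lborel)"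
    unfolding mult.assoc[symmetric] by (intro nn_integral_mono mult_right_mono CS) auto
  also have "\<dots> = (\<integral>\<^sup>+x. (\<integral>\<^sup>+y. (p y)\<^sup>2 * ennreal (w y) * indicator (ball x r) y * (V x r * ennreal (w x)) \<partial>lborel) \<partial>lborel)"
    by (intro nn_integral_cong nn_integral_multc[symmetric]) measurable
  also have "\<dots> \<le> (\<integral>\<^sup>+x. (\<integral>\<^sup>+y. ((p y)\<^sup>2 * ennreal (w y) * V y (2 * r)) * (ennreal (w x) * indicator (ball y r) x) \<partial>lborel) \<partial>lborel)"
  proof (intro nn_integral_mono)
    fix x y
    have "(p y)\<^sup>2 * ennreal (w y) * indicator (ball x r) y * (V x r * ennreal (w x))
        = ((p y)\<^sup>2 * ennreal (w y) * ennreal (w x)) * (indicator (ball x r) y * V x r)"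
      by (simp add: mult_ac)
    also have "\<dots> \<le> ((p y)\<^sup>2 * ennreal (w y) * ennreal (w x)) * (indicator (ball x r) y * V y (2 * r))"
      by (intro mult_left_mono V_mono) auto
    finally show "(p y)\<^sup>2 * ennreal (w y) * indicator (ball x r) y * (V x r * ennreal (w x))
        \<le> ((p y)\<^sup>2 * ennreal (w y) * V y (2 * r)) * (ennreal (w x) * indicator (ball y r) x)"
      by (simp add: mult_ac indicator_ball_swap[of x r y])
  qed
  also have "\<dots> = (\<integral>\<^sup>+y. (\<integral>\<^sup>+x. ((p y)\<^sup>2 * ennreal (w y) * V y (2 * r)) * (ennreal (w x) * indicator (ball y r) x) \<partial>lborel) \<partial>lborel)"
    by (rule lborel_pair.Fubini'[symmetric]) measurable
  also have "\<dots> = (\<integral>\<^sup>+y. ((p y)\<^sup>2 * ennreal (w y) * V y (2 * r)) * (\<integral>\<^sup>+x. ennreal (w x) * indicator (ball y r) x \<partial>lborel) \<partial>lborel)"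
    by (intro nn_integral_cong nn_integral_cmult) measurable
  also have "\<dots> \<le> (\<integral>\<^sup>+y. ennreal (M * (ball_vol TYPE('a) (2 * r))\<^sup>2) * ((p y)\<^sup>2 * ennreal (w y)) \<partial>lborel)"
  proof (intro nn_integral_mono)
    fix y
    have "(\<integral>\<^sup>+x. ennreal (w x) * indicator (ball y r) x \<partial>lborel) \<le> (\<integral>\<^sup>+x. ennreal (w x) * indicator (ball y (2*r)) x \<partial>lborel)"
      using r by (intro nn_integral_mono) (auto simp: indicator_def)
    then have "V y (2 * r) * (\<integral>\<^sup>+x. ennreal (w x) * indicator (ball y r) x \<partial>lborel)
       \<le> (\<integral>\<^sup>+x. ennreal (w x) * indicator (ball y (2*r)) x \<partial>lborel) * V y (2 * r)"
      by (metis mult.commute mult_left_mono zero_le)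
    also have "\<dots> \<le> ennreal M * (emeasure lborel (ball y (2*r)))\<^sup>2"
      using A2 r unfolding A2_weight_def V_def by auto
    also have "\<dots> = ennreal (M * (ball_vol TYPE('a) (2 * r))\<^sup>2)"
      using r M by (simp add: emeasure_lborel_ball ennreal_power ennreal_mult ball_vol_nonneg)
    finally have VM: "V y (2 * r) * (\<integral>\<^sup>+x. ennreal (w x) * indicator (ball y r) x \<partial>lborel)
       \<le> ennreal (M * (ball_vol TYPE('a) (2 * r))\<^sup>2)" .
    show "((p y)\<^sup>2 * ennreal (w y) * V y (2 * r)) * (\<integral>\<^sup>+x. ennreal (w x) * indicator (ball y r) x \<partial>lborel)
       \<le> ennreal (M * (ball_vol TYPE('a) (2 * r))\<^sup>2) * ((p y)\<^sup>2 * ennreal (w y))"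
      using mult_left_mono[OF VM, of "(p y)\<^sup>2 * ennreal (w y)"] by (simp add: mult_ac)
  qed
  also have "\<dots> = ennreal (M * (ball_vol TYPE('a) (2 * r))\<^sup>2) * (\<integral>\<^sup>+y. (p y)\<^sup>2 * ennreal (w y) \<partial>lborel)"
    by (rule nn_integral_cmult) measurable
  finally show ?thesis .
qed

text \<open>
  The radius \<open>4\<close> leaves room for a bump of radius \<open>1\<close> centred at distance \<open>3\<close> from the origin,
  which is the kernel that looks out of a slab.
\<close>
definition kernel :: "real \<Rightarrow> ('a::euclidean_space \<Rightarrow> real) \<Rightarrow> bool" where
  "kernel c \<rho> \<longleftrightarrow> smooth \<rho> \<and> (\<forall>z. 4 \<le> norm z \<longrightarrow> \<rho> z = 0) \<and> (\<forall>z. 0 \<le> \<rho> z \<and> \<rho> z \<le> c) \<and>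
     (\<integral>z. \<rho> z \<partial>lborel) = 1"

definition scaled :: "('a::euclidean_space \<Rightarrow> real) \<Rightarrow> real \<Rightarrow> 'a \<Rightarrow> real" where
  "scaled \<rho> s z = \<rho> ((1 / s) *\<^sub>R z) / s ^ DIM('a)"

definition mollify :: "('a::euclidean_space \<Rightarrow> real) \<Rightarrow> real \<Rightarrow> ('a \<Rightarrow> real) \<Rightarrow> 'a \<Rightarrow> real" where
  "mollify \<rho> s p x = (\<integral>y. scaled \<rho> s (x - y) * p y \<partial>lborel)"

lemma kernelD:
  assumes "kernel c \<rho>"
  shows "smooth \<rho>" "\<And>z. 4 \<le> norm z \<Longrightarrow> \<rho> z = 0" "\<And>z. 0 \<le> \<rho> z" "\<And>z. \<rho> z \<le> c"
    "(\<integral>z. \<rho> z \<partial>lborel) = 1" "\<rho> \<in> borel_measurable borel" "0 \<le> c"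
  using assms unfolding kernel_def
  by (auto intro: borel_measurable_continuous_onI smooth_continuous order_trans)

lemma scaled_measurable:
  assumes "kernel c \<rho>"
  shows "scaled \<rho> s \<in> borel_measurable borel"
  unfolding scaled_def[abs_def] using kernelD(6)[OF assms] by measurable

lemma scaled_le:
  assumes k: "kernel c \<rho>" and s: "0 < s"
  shows "scaled \<rho> s (x - y) \<le> c / s ^ DIM('a) * indicator (ball x (4 * s)) (y::'a::euclidean_space)"
    and "0 \<le> scaled \<rho> s z"
proof -
  show "0 \<le> scaled \<rho> s z" using kernelD(3)[OF k] s by (simp add: scaled_def)
  show "scaled \<rho> s (x - y) \<le> c / s ^ DIM('a) * indicator (ball x (4 * s)) y"
  proof (cases "dist x y < 4 * s")
    case True
    then show ?thesis using kernelD(4)[OF k] s by (simp add: scaled_def divide_right_mono)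
  next
    case False
    then have "4 * s \<le> norm (x - y)" by (simp add: dist_norm)
    then have "4 \<le> norm ((1/s) *\<^sub>R (x - y))"
      unfolding norm_scaleR using s by (simp add: field_simps)
    then show ?thesis using kernelD(2)[OF k] False by (simp add: scaled_def)
  qed
qed

lemma mollify_bound:
  fixes p :: "'a::euclidean_space \<Rightarrow> real"
  assumes k: "kernel c \<rho>" and s: "0 < s" and p [measurable]: "p \<in> borel_measurable borel"
  shows "ennreal \<bar>mollify \<rho> s p x\<bar>
    \<le> ennreal (c / s ^ DIM('a)) * (\<integral>\<^sup>+y. ennreal \<bar>p y\<bar> * indicator (ball x (4 * s)) y \<partial>lborel)"
proof -
  have "ennreal \<bar>mollify \<rho> s p x\<bar> \<le> (\<integral>\<^sup>+y. ennreal \<bar>scaled \<rho> s (x - y) * p y\<bar> \<partial>lborel)"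
  proof (cases "integrable lborel (\<lambda>y. scaled \<rho> s (x - y) * p y)")
    case True
    from integral_norm_bound_ennreal[OF True] show ?thesis by (simp add: mollify_def)
  next
    case False
    then show ?thesis by (simp add: mollify_def not_integrable_integral_eq)
  qed
  also have "\<dots> \<le> (\<integral>\<^sup>+y. ennreal (c / s ^ DIM('a)) * (ennreal \<bar>p y\<bar> * indicator (ball x (4 * s)) y) \<partial>lborel)"
  proof (rule nn_integral_mono)
    fix y
    have "\<bar>scaled \<rho> s (x - y) * p y\<bar> \<le> (c / s ^ DIM('a) * indicator (ball x (4 * s)) y) * \<bar>p y\<bar>"
      unfolding abs_mult using scaled_le[OF k s] by (intro mult_right_mono) auto
    then show "ennreal \<bar>scaled \<rho> s (x - y) * p y\<bar>
       \<le> ennreal (c / s ^ DIM('a)) * (ennreal \<bar>p y\<bar> * indicator (ball x (4 * s)) y)"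
      using kernelD(7)[OF k] s
      by (cases "y \<in> ball x (4 * s)") (auto simp flip: ennreal_mult intro!: ennreal_leI)
  qed
  also have "\<dots> = ennreal (c / s ^ DIM('a)) * (\<integral>\<^sup>+y. ennreal \<bar>p y\<bar> * indicator (ball x (4 * s)) y \<partial>lborel)"
    by (intro nn_integral_cmult) measurable
  finally show ?thesis .
qed

lemma mollify_measurable:
  assumes k: "kernel c \<rho>" and p [measurable]: "p \<in> borel_measurable borel"
  shows "mollify \<rho> s p \<in> borel_measurable borel"
proof -
  have [measurable]: "scaled \<rho> s \<in> borel_measurable borel" by (rule scaled_measurable[OF k])
  show ?thesis unfolding mollify_def[abs_def] by measurable
qed

text \<open>
  The bound that averaging over balls of radius \<open>4 s\<close> with the density \<open>c / s\<^sup>n\<close> gets from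
  \<open>A2_averaging\<close>.  The powers of \<open>s\<close> cancel, which is why no scale appears.
\<close>
definition avg_const :: "'a::euclidean_space itself \<Rightarrow> real \<Rightarrow> real \<Rightarrow> real" where
  "avg_const T c M = c\<^sup>2 * M * (ball_vol T 8)\<^sup>2"

lemma avg_const_nonneg: "0 \<le> M \<Longrightarrow> 0 \<le> avg_const T c M"
  by (simp add: avg_const_def)

lemma wsq_average_bound:
  fixes p q w :: "'a::euclidean_space \<Rightarrow> real"
  assumes A2: "A2_weight M w" and p: "p \<in> borel_measurable borel" and s: "0 < s" and c: "0 \<le> c"
    and bound: "\<And>x. ennreal \<bar>q x\<bar> \<le> ennreal (c / s ^ DIM('a)) * (\<integral>\<^sup>+y. ennreal \<bar>p y\<bar> * indicator (ball x (4 * s)) y \<partial>lborel)"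
  shows "wsq w q \<le> ennreal (avg_const TYPE('a) c M) * wsq w p"
proof -
  have wpos: "\<And>x. 0 < w x" and M: "0 \<le> M" and w [measurable]: "w \<in> borel_measurable borel"
    using A2 by (auto simp: A2_weight_def)
  note p [measurable]
  let ?T = "\<lambda>x. \<integral>\<^sup>+y. ennreal \<bar>p y\<bar> * indicator (ball x (4 * s)) y \<partial>lborel"
  have "wsq w q \<le> (\<integral>\<^sup>+x. ennreal ((c / s ^ DIM('a))\<^sup>2) * ((?T x)\<^sup>2 * ennreal (w x)) \<partial>lborel)"
    unfolding wsq_def
  proof (rule nn_integral_mono)
    fix x
    have "ennreal ((q x)\<^sup>2 * w x) = (ennreal \<bar>q x\<bar>)\<^sup>2 * ennreal (w x)"
      using wpos[of x] by (simp add: ennreal_mult ennreal_power less_imp_le)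
    also have "\<dots> \<le> (ennreal (c / s ^ DIM('a)) * ?T x)\<^sup>2 * ennreal (w x)"
      by (intro mult_right_mono power_mono bound) auto
    also have "\<dots> = ennreal ((c / s ^ DIM('a))\<^sup>2) * ((?T x)\<^sup>2 * ennreal (w x))"
      using c s by (simp add: power_mult_distrib ennreal_power mult.assoc)
    finally show "ennreal ((q x)\<^sup>2 * w x) \<le> ennreal ((c / s ^ DIM('a))\<^sup>2) * ((?T x)\<^sup>2 * ennreal (w x))" .
  qed
  also have "\<dots> = ennreal ((c / s ^ DIM('a))\<^sup>2) * (\<integral>\<^sup>+x. (?T x)\<^sup>2 * ennreal (w x) \<partial>lborel)"
    by (rule nn_integral_cmult) measurable
  also have "\<dots> \<le> ennreal ((c / s ^ DIM('a))\<^sup>2) *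
     (ennreal (M * (ball_vol TYPE('a) (2 * (4 * s)))\<^sup>2) * (\<integral>\<^sup>+y. (ennreal \<bar>p y\<bar>)\<^sup>2 * ennreal (w y) \<partial>lborel))"
    using s by (intro mult_left_mono A2_averaging[OF A2]) auto
  also have "(\<integral>\<^sup>+y. (ennreal \<bar>p y\<bar>)\<^sup>2 * ennreal (w y) \<partial>lborel) = wsq w p"
    unfolding wsq_def using wpos
    by (intro nn_integral_cong) (simp add: ennreal_mult ennreal_power less_imp_le)
  also have "ennreal ((c / s ^ DIM('a))\<^sup>2) * (ennreal (M * (ball_vol TYPE('a) (2 * (4 * s)))\<^sup>2) * wsq w p)
     = ennreal (avg_const TYPE('a) c M) * wsq w p"
  proof -
    have "(c / s ^ DIM('a))\<^sup>2 * (M * (ball_vol TYPE('a) (2 * (4 * s)))\<^sup>2) = avg_const TYPE('a) c M"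
      using s ball_vol_mult[where 'a='a, of s 8]
      by (simp add: avg_const_def power_mult_distrib power_divide mult.commute)
    then show ?thesis
      using M by (simp flip: mult.assoc ennreal_mult)
  qed
  finally show ?thesis .
qed

lemma wsq_mollify:
  assumes "A2_weight M w" "kernel c \<rho>" "0 < s" "p \<in> borel_measurable borel"
  shows "wsq w (mollify \<rho> s p) \<le> ennreal (avg_const TYPE('a) c M) * wsq w (p :: 'a::euclidean_space \<Rightarrow> real)"
  by (rule wsq_average_bound[OF assms(1,4,3) kernelD(7)[OF assms(2)] mollify_bound[OF assms(2,3,4)]])

section \<open>Weak derivatives and the weighted Poincare inequality\<close>

text \<open>
  The test functions \<open>h\<close> range over all smooth functions, without a condition on the support: the
  functions \<open>p\<close> that occur have compact support themselves.
\<close>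
definition weak_grad :: "('a::euclidean_space \<Rightarrow> real) \<Rightarrow> ('a \<Rightarrow> 'a) \<Rightarrow> bool" where
  "weak_grad p P \<longleftrightarrow> p \<in> borel_measurable borel \<and> P \<in> borel_measurable borel \<and>
     integrable lborel p \<and> integrable lborel P \<and>
     (\<forall>h. smooth h \<longrightarrow> (\<forall>b\<in>Basis. (\<integral>x. (grad h x \<bullet> b) * p x \<partial>lborel) = - (\<integral>x. h x * (P x \<bullet> b) \<partial>lborel)))"

lemma integrable_bounded_mult:
  fixes f g :: "'a \<Rightarrow> real"
  assumes "integrable M f" "g \<in> borel_measurable M" "\<And>x. \<bar>g x\<bar> \<le> B"
  shows "integrable M (\<lambda>x. g x * f x)"
proof (rule Bochner_Integration.integrable_bound)
  show "integrable M (\<lambda>x. B * f x)" using assms(1) by simp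
  have B: "0 \<le> B" using assms(3)[of undefined] abs_ge_zero order_trans by blast
  show "AE x in M. norm (g x * f x) \<le> norm (B * f x)"
    using assms(3) B by (auto simp: abs_mult intro!: mult_right_mono)
qed (use assms in measurable)

lemma integrable_times:
  fixes f :: "'a \<Rightarrow> real" and g :: "'b \<Rightarrow> real"
  assumes "sigma_finite_measure M" "sigma_finite_measure N" "integrable M f" "integrable N g"
  shows "integrable (M \<Otimes>\<^sub>M N) (\<lambda>z. f (fst z) * g (snd z))"
proof -
  interpret pair_sigma_finite M N using assms by (simp add: pair_sigma_finite_def)
  have [measurable]: "f \<in> borel_measurable M" "g \<in> borel_measurable N" using assms by auto
  show ?thesis
  proof (rule Fubini_integrable)
    show "integrable M (\<lambda>x. \<integral>y. norm (f (fst (x, y)) * g (snd (x, y))) \<partial>N)"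
      using assms by (simp add: abs_mult)
    show "AE x in M. integrable N (\<lambda>y. f (fst (x, y)) * g (snd (x, y)))"
      using assms by simp
  qed measurable
qed

lemma bounded_of_compact_support:
  fixes f :: "'a::euclidean_space \<Rightarrow> 'b::real_normed_vector"
  assumes "continuous_on UNIV f" "\<And>y. y \<notin> cball x R \<Longrightarrow> f y = 0"
  obtains B where "\<And>y. norm (f y) \<le> B" "0 \<le> B"
proof -
  have "compact (f ` cball x R)"
    using assms(1) by (intro compact_continuous_image) (auto intro: continuous_on_subset)
  then obtain B where "\<And>y. y \<in> cball x R \<Longrightarrow> norm (f y) \<le> B"
    using compact_imp_bounded bounded_iff by (metis imageI)
  then have "norm (f y) \<le> max B 0" for y
    using assms(2)[of y] by (cases "y \<in> cball x R") (auto intro: order_trans[OF _ max.cobounded1])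
  then show thesis using that[of "max B 0"] by simp
qed

lemma bump_integrable:
  fixes p :: "'a::euclidean_space \<Rightarrow> real"
  assumes h: "smooth h" "\<And>y. y \<notin> cball x R \<Longrightarrow> h y = 0" and p: "integrable lborel p"
  shows "integrable lborel (\<lambda>y. h y * p y)" "integrable lborel (\<lambda>y. (grad h y \<bullet> v) * p y)"
proof -
  obtain B where B: "\<And>y. norm (h y) \<le> B"
    using bounded_of_compact_support[OF smooth_continuous[OF h(1)] h(2)] by metis
  show "integrable lborel (\<lambda>y. h y * p y)"
    using B by (intro integrable_bounded_mult[OF p, where B=B])
      (auto intro!: borel_measurable_continuous_onI smooth_continuous h)
  have "grad h y \<bullet> v = 0" if "y \<notin> cball x R" for y
    using grad_zero_outside[OF open_Compl[OF closed_cball], of y x R h] h(2) that by auto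
  moreover have c: "continuous_on UNIV (\<lambda>y. grad h y \<bullet> v)"
    by (intro continuous_intros smooth_continuous_grad h)
  ultimately obtain B' where B': "\<And>y. norm (grad h y \<bullet> v) \<le> B'"
    using bounded_of_compact_support[OF c, of x R] by metis
  show "integrable lborel (\<lambda>y. (grad h y \<bullet> v) * p y)"
    using B' by (intro integrable_bounded_mult[OF p, where B=B'])
      (auto intro!: borel_measurable_continuous_onI c)
qed

lemma smooth_scaled:
  assumes "smooth \<rho>" shows "smooth (scaled \<rho> s)"
proof -
  have "smooth (\<lambda>z. (1 / s ^ DIM('a)) * \<rho> ((1 / s) *\<^sub>R (z::'a)))"
    by (intro smooth_intros smooth_linear[OF _ assms] bounded_linear_scaleR_right)
  then show ?thesis by (simp add: scaled_def[abs_def])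
qed

lemma grad_scaled:
  assumes "smooth \<rho>"
  shows "grad (scaled \<rho> s) z = (1 / (s * s ^ DIM('a))) *\<^sub>R grad \<rho> ((1 / s) *\<^sub>R (z::'a::euclidean_space))"
proof (rule grad_unique)
  have "((\<lambda>z. \<rho> ((1 / s) *\<^sub>R z)) has_derivative (\<lambda>v. grad \<rho> ((1 / s) *\<^sub>R z) \<bullet> ((1 / s) *\<^sub>R v))) (at z)"
    by (rule has_derivative_compose[OF _ smooth_has_derivative[OF assms]])
      (auto intro!: derivative_eq_intros)
  then have "((\<lambda>z. (1 / s ^ DIM('a)) * \<rho> ((1 / s) *\<^sub>R z)) has_derivative
     (\<lambda>v. (1 / s ^ DIM('a)) * (grad \<rho> ((1 / s) *\<^sub>R z) \<bullet> ((1 / s) *\<^sub>R v)))) (at z)"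
    by (rule has_derivative_mult_right)
  then show "(scaled \<rho> s has_derivative
     (\<lambda>v. ((1 / (s * s ^ DIM('a))) *\<^sub>R grad \<rho> ((1 / s) *\<^sub>R z)) \<bullet> v)) (at z)"
    by (simp add: scaled_def[abs_def] mult.commute)
qed

lemma smooth_reflect: "smooth \<phi> \<Longrightarrow> smooth (\<lambda>y. \<phi> (x - y))"
  using smooth_affine[OF bounded_linear_minus[OF bounded_linear_ident], where \<zeta>=\<phi> and c\<^sub>0=x] by simp

lemma grad_reflect:
  assumes "smooth \<phi>" shows "grad (\<lambda>y. \<phi> (x - y)) y = - grad \<phi> (x - y)"
proof (rule grad_unique)
  have "((\<lambda>y. \<phi> (x - y)) has_derivative (\<lambda>v. grad \<phi> (x - y) \<bullet> (- v))) (at y)"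
    by (rule has_derivative_compose[OF _ smooth_has_derivative[OF assms]])
      (auto intro!: derivative_eq_intros)
  then show "((\<lambda>y. \<phi> (x - y)) has_derivative (\<lambda>v. (- grad \<phi> (x - y)) \<bullet> v)) (at y)"
    by simp
qed

lemma scaled_outside:
  assumes k: "kernel c \<rho>" and s: "0 < s" and y: "y \<notin> cball x (4 * s)"
  shows "scaled \<rho> s (x - y) = 0"
  using scaled_le(1)[OF k s, of x y] scaled_le(2)[OF k s, of "x - y"] y by (simp add: indicator_def)

lemma mollify_weak_grad:
  fixes p :: "'a::euclidean_space \<Rightarrow> real"
  assumes g: "weak_grad p P" and k: "kernel c \<rho>" and b: "b \<in> Basis"
  shows "(\<integral>y. (grad (scaled \<rho> s) (x - y) \<bullet> b) * p y \<partial>lborel) = mollify \<rho> s (\<lambda>y. P y \<bullet> b) x"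
proof -
  note sm = smooth_scaled[OF kernelD(1)[OF k]]
  have "(\<integral>y. (grad (\<lambda>y. scaled \<rho> s (x - y)) y \<bullet> b) * p y \<partial>lborel)
     = - (\<integral>y. scaled \<rho> s (x - y) * (P y \<bullet> b) \<partial>lborel)"
    using g b smooth_reflect[OF sm] unfolding weak_grad_def by blast
  then show ?thesis by (simp add: grad_reflect[OF sm] mollify_def)
qed

text \<open>The derivative of the scaled kernel with respect to the scale.\<close>
definition dscaled :: "('a::euclidean_space \<Rightarrow> real) \<Rightarrow> real \<Rightarrow> 'a \<Rightarrow> real" where
  "dscaled \<rho> r z = - (real DIM('a) * \<rho> ((1 / r) *\<^sub>R z) + grad \<rho> ((1 / r) *\<^sub>R z) \<bullet> ((1 / r) *\<^sub>R z)) / r ^ Suc (DIM('a))"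

lemma scaled_has_derivative_scale:
  assumes \<rho>: "smooth \<rho>" and r: "0 < r"
  shows "((\<lambda>r. scaled \<rho> r (z::'a::euclidean_space)) has_real_derivative dscaled \<rho> r z) (at r)"
proof -
  let ?n = "DIM('a)"
  have i: "((\<lambda>r. 1 / r) has_real_derivative - (1 / r\<^sup>2)) (at r)"
    using r by (auto intro!: derivative_eq_intros simp: power2_eq_square)
  have "((\<lambda>r. (1 / r) *\<^sub>R z) has_derivative (\<lambda>t. (- (1 / r\<^sup>2) * t) *\<^sub>R z)) (at r)"
    using has_derivative_scaleR_left[OF i[unfolded has_field_derivative_def], of z] .
  from has_derivative_compose[OF this smooth_has_derivative[OF \<rho>]]
  have 1: "((\<lambda>r. \<rho> ((1 / r) *\<^sub>R z)) has_real_derivative - (1 / r\<^sup>2) * (grad \<rho> ((1 / r) *\<^sub>R z) \<bullet> z)) (at r)"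
    unfolding has_field_derivative_def
    by (rule has_derivative_eq_rhs) (simp add: fun_eq_iff)
  have "((\<lambda>r. (1 / r) ^ ?n) has_real_derivative of_nat ?n * (1 / r) ^ (?n - 1) * (- (1 / r\<^sup>2))) (at r)"
    using DERIV_power[OF i, of ?n] by (simp add: mult_ac)
  moreover have "of_nat ?n * (1 / r) ^ (?n - 1) * (- (1 / r\<^sup>2)) = - (of_nat ?n / r ^ Suc ?n)"
  proof -
    have "r ^ Suc ?n = r ^ (?n - 1) * r\<^sup>2"
      using DIM_positive[where 'a='a] by (simp add: power2_eq_square flip: power_Suc2)
    then show ?thesis by (simp add: power_divide)
  qed
  ultimately have 2: "((\<lambda>r. (1 / r) ^ ?n) has_real_derivative - (of_nat ?n / r ^ Suc ?n)) (at r)"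
    by simp
  have "((\<lambda>r. (1 / r) ^ ?n * \<rho> ((1 / r) *\<^sub>R z)) has_real_derivative
     (1 / r) ^ ?n * (- (1 / r\<^sup>2) * (grad \<rho> ((1 / r) *\<^sub>R z) \<bullet> z)) + (- (of_nat ?n / r ^ Suc ?n)) * \<rho> ((1 / r) *\<^sub>R z)) (at r)"
    by (rule DERIV_mult'[OF 2 1])
  moreover have "(1 / r) ^ ?n * (- (1 / r\<^sup>2) * (grad \<rho> ((1 / r) *\<^sub>R z) \<bullet> z)) + (- (of_nat ?n / r ^ Suc ?n)) * \<rho> ((1 / r) *\<^sub>R z)
     = dscaled \<rho> r z"
    using r by (simp add: dscaled_def field_simps power2_eq_square)
  ultimately show ?thesis
    by (simp add: scaled_def[abs_def] power_divide)
qed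

text \<open>
  The scale derivative of the kernel \<open>K\<^sub>r\<close> is minus the divergence of the field \<open>z K\<^sub>r(z) / r\<close>.
  Integration by parts thus turns the derivative of a mollification with respect to its scale
  into an average of the gradient, in which the factor \<open>(x - y) / r\<close> is bounded.
\<close>
lemma scale_derivative_weak:
  fixes p :: "'a::euclidean_space \<Rightarrow> real"
  assumes g: "weak_grad p P" and k: "kernel c \<rho>" and r: "0 < r"
  shows "(\<integral>y. dscaled \<rho> r (x - y) * p y \<partial>lborel)
     = - (\<integral>y. scaled \<rho> r (x - y) / r * ((x - y) \<bullet> P y) \<partial>lborel)"
proof -
  note sm = smooth_scaled[OF kernelD(1)[OF k], of r]
  have p: "integrable lborel p" and P: "integrable lborel P" using g by (auto simp: weak_grad_def)
  define h where "h b y = ((x - y) \<bullet> b) * scaled \<rho> r (x - y)" for b y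
  have smh: "smooth (h b)" for b
    unfolding h_def by (intro smooth_mult smooth_reflect[OF sm] smooth_reflect[of "\<lambda>y. y \<bullet> b"] smooth_inner)
  have h0: "h b y = 0" if "y \<notin> cball x (4 * r)" for b y
    unfolding h_def using scaled_outside[OF k r that] by simp
  have grad_h: "grad (h b) y \<bullet> b = - scaled \<rho> r (x - y) - ((x - y) \<bullet> b) * (grad (scaled \<rho> r) (x - y) \<bullet> b)"
    if b: "b \<in> Basis" for b y
  proof -
    have "grad (\<lambda>y. y \<bullet> b) z = b" for z
      by (rule grad_unique) (auto intro!: derivative_eq_intros simp: inner_commute)
    then have gb: "grad (\<lambda>y. (x - y) \<bullet> b) y = - b"
      using grad_reflect[OF smooth_inner[of b]] by simp
    have "grad (h b) y = ((x - y) \<bullet> b) *\<^sub>R - grad (scaled \<rho> r) (x - y) + scaled \<rho> r (x - y) *\<^sub>R - b"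
      unfolding h_def
      by (subst grad_mult[OF smooth_reflect[OF smooth_inner] smooth_reflect[OF sm]])
        (simp only: gb grad_reflect[OF sm])
    then show ?thesis using b by (simp add: inner_diff_left)
  qed
  have div: "(\<Sum>b\<in>Basis. grad (h b) y \<bullet> b) = r * dscaled \<rho> r (x - y)" for y
  proof -
    have "(\<Sum>b\<in>Basis. grad (h b) y \<bullet> b)
       = - (real DIM('a) * scaled \<rho> r (x - y)) - (x - y) \<bullet> grad (scaled \<rho> r) (x - y)"
    proof -
      have "(\<Sum>b\<in>Basis. grad (h b) y \<bullet> b)
         = (\<Sum>b\<in>Basis. - scaled \<rho> r (x - y) - ((x - y) \<bullet> b) * (grad (scaled \<rho> r) (x - y) \<bullet> b))"
        by (intro sum.cong refl grad_h)
      then show ?thesis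
        by (simp add: sum_subtractf sum_negf euclidean_inner[of "x - y" "grad (scaled \<rho> r) (x - y)"]
            del: inner_diff_left)
    qed
    also have "\<dots> = r * dscaled \<rho> r (x - y)"
    proof -
      have "- (real DIM('a) * scaled \<rho> r z) - z \<bullet> grad (scaled \<rho> r) z = r * dscaled \<rho> r z" for z :: 'a
        using r by (simp add: grad_scaled[OF kernelD(1)[OF k]] dscaled_def scaled_def field_simps inner_commute)
      then show ?thesis .
    qed
    finally show ?thesis .
  qed
  have "r * (\<integral>y. dscaled \<rho> r (x - y) * p y \<partial>lborel) = (\<integral>y. (\<Sum>b\<in>Basis. (grad (h b) y \<bullet> b) * p y) \<partial>lborel)"
    by (simp add: div flip: sum_distrib_right) (simp add: mult.assoc)
  also have "\<dots> = (\<Sum>b\<in>Basis. (\<integral>y. (grad (h b) y \<bullet> b) * p y \<partial>lborel))"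
    by (intro Bochner_Integration.integral_sum bump_integrable(2)[OF smh h0 p])
  also have "\<dots> = (\<Sum>b\<in>Basis. - (\<integral>y. h b y * (P y \<bullet> b) \<partial>lborel))"
    using g smh by (intro sum.cong refl) (auto simp: weak_grad_def)
  also have "\<dots> = - (\<integral>y. (\<Sum>b\<in>Basis. h b y * (P y \<bullet> b)) \<partial>lborel)"
    using P by (subst Bochner_Integration.integral_sum)
      (auto intro!: bump_integrable(1)[OF smh h0] simp: sum_negf)
  also have "(\<lambda>y. \<Sum>b\<in>Basis. h b y * (P y \<bullet> b)) = (\<lambda>y. scaled \<rho> r (x - y) * ((x - y) \<bullet> P y))"
    by (subst euclidean_inner[of "x - _"]) (simp add: h_def sum_distrib_left mult_ac)
  also have "(\<integral>y. scaled \<rho> r (x - y) * ((x - y) \<bullet> P y) \<partial>lborel)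
     = r * (\<integral>y. scaled \<rho> r (x - y) / r * ((x - y) \<bullet> P y) \<partial>lborel)"
    using r by (subst integral_mult_right_zero[symmetric]) simp
  finally show ?thesis using r by (simp add: field_simps)
qed

text \<open>
  The fundamental theorem of calculus in the scale writes the difference as an integral of scale
  derivatives over \<open>[s/2, s]\<close>, each of which is an average of the gradient over a ball of radius at
  most \<open>4 s\<close>.
\<close>
lemma mollify_halving_bound:
  fixes p :: "'a::euclidean_space \<Rightarrow> real"
  assumes g: "weak_grad p P" and k: "kernel c \<rho>" and s: "0 < s"
  shows "ennreal \<bar>mollify \<rho> s p x - mollify \<rho> (s / 2) p x\<bar>
    \<le> ennreal ((2 * 2 ^ DIM('a) * c * s) / s ^ DIM('a))
        * (\<integral>\<^sup>+y. ennreal \<bar>norm (P y)\<bar> * indicator (ball x (4 * s)) y \<partial>lborel)"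
proof -
  let ?n = "DIM('a)" and ?I = "indicator {s/2..s} :: real \<Rightarrow> real"
  have p: "integrable lborel p" and P: "integrable lborel P"
    and [measurable]: "p \<in> borel_measurable borel" "P \<in> borel_measurable borel"
    using g by (auto simp: weak_grad_def)
  have \<rho>: "smooth \<rho>" by (rule kernelD(1)[OF k])
  have [measurable]: "\<rho> \<in> borel_measurable borel" by (rule kernelD(6)[OF k])
  have [measurable]: "grad \<rho> \<in> borel_measurable borel"
    by (intro borel_measurable_continuous_onI smooth_continuous_grad \<rho>)
  have c: "0 \<le> c" by (rule kernelD(7)[OF k])
  have grad0: "grad \<rho> z = 0" if "4 < norm z" for z
    by (rule grad_zero_outside[of "- cball 0 4"]) (use kernelD(2)[OF k] that in auto)
  obtain G where G: "\<And>z. norm (grad \<rho> z) \<le> G" and "0 \<le> G"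
    using bounded_of_compact_support[OF smooth_continuous_grad[OF \<rho>], of 0 4] grad0
    by (metis mem_cball_0 not_le)
  have cont: "continuous_on {s/2..s} (\<lambda>r. dscaled \<rho> r z)" for z
    unfolding dscaled_def using s
    by (intro continuous_intros continuous_on_compose2[OF smooth_continuous[OF \<rho>, of UNIV]]
        continuous_on_compose2[OF smooth_continuous_grad[OF \<rho>, of UNIV]]) auto
  have FTC: "(\<integral>r. ?I r * dscaled \<rho> r z \<partial>lborel) = scaled \<rho> s z - scaled \<rho> (s/2) z" for z
  proof -
    have "((\<lambda>r. scaled \<rho> r z) has_vector_derivative dscaled \<rho> r z) (at r within {s/2..s})"
      if "s/2 \<le> r" "r \<le> s" for r
      using scaled_has_derivative_scale[OF \<rho>, of r z] that s
      by (simp add: has_field_derivative_at_within flip: has_real_derivative_iff_has_vector_derivative)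
    then have "(\<integral>r. ?I r *\<^sub>R dscaled \<rho> r z \<partial>lborel) = scaled \<rho> s z - scaled \<rho> (s/2) z"
      using s by (intro integral_FTC_atLeastAtMost cont) auto
    then show ?thesis by simp
  qed
  \<comment> \<open>a bound of the scale derivative on \<open>[s/2, s]\<close>, for the exchange of the two integrals\<close>
  define B where "B = (real ?n * c + G * 4) / (s/2) ^ Suc ?n"
  have bound: "\<bar>?I r * dscaled \<rho> r z\<bar> \<le> B * ?I r" for r z
  proof (cases "r \<in> {s/2..s}")
    case True
    then have r: "0 < r" "s/2 \<le> r" using s by auto
    let ?z = "(1 / r) *\<^sub>R z"
    have "\<bar>grad \<rho> ?z \<bullet> ?z\<bar> \<le> G * 4"
    proof (cases "norm ?z \<le> 4")
      case True
      have "\<bar>grad \<rho> ?z \<bullet> ?z\<bar> \<le> norm (grad \<rho> ?z) * norm ?z" by (rule Cauchy_Schwarz_ineq2)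
      also have "\<dots> \<le> G * 4" using True G \<open>0 \<le> G\<close> by (intro mult_mono) auto
      finally show ?thesis .
    next
      case False
      then show ?thesis using grad0[of ?z] \<open>0 \<le> G\<close> by simp
    qed
    moreover have "\<bar>real ?n * \<rho> ?z\<bar> \<le> real ?n * c"
      using kernelD(3,4)[OF k, of ?z] by (simp add: abs_mult mult_left_mono)
    ultimately have *: "\<bar>real ?n * \<rho> ?z + grad \<rho> ?z \<bullet> ?z\<bar> \<le> real ?n * c + G * 4" by linarith
    have "\<bar>dscaled \<rho> r z\<bar> = \<bar>real ?n * \<rho> ?z + grad \<rho> ?z \<bullet> ?z\<bar> / r ^ Suc ?n"
      unfolding dscaled_def using r by (simp add: abs_divide abs_minus_commute del: power_Suc)
    also have "\<dots> \<le> B" unfolding B_def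
      using * r s c \<open>0 \<le> G\<close> by (intro frac_le power_mono) (auto simp del: power_Suc)
    finally show ?thesis using True by simp
  qed auto
  have int: "integrable (lborel \<Otimes>\<^sub>M lborel) (\<lambda>(r, y). ?I r * dscaled \<rho> r (x - y) * p y)"
  proof (rule Bochner_Integration.integrable_bound)
    have "integrable lborel (\<lambda>r. B * ?I r)"
      using s by (intro integrable_mult_right integrable_real_indicator) (auto simp: emeasure_lborel_Icc_eq)
    then show "integrable (lborel \<Otimes>\<^sub>M lborel) (\<lambda>z. (B * ?I (fst z)) * p (snd z))"
      by (intro integrable_times p lborel.sigma_finite_measure_axioms)
    show "AE z in lborel \<Otimes>\<^sub>M lborel. norm (case z of (r, y) \<Rightarrow> ?I r * dscaled \<rho> r (x - y) * p y)
       \<le> norm ((B * ?I (fst z)) * p (snd z))"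
    proof (intro AE_I2, clarify)
      fix r y
      show "norm (?I r * dscaled \<rho> r (x - y) * p y) \<le> norm ((B * ?I (fst (r, y))) * p (snd (r, y)))"
        using mult_right_mono[OF bound[of r "x - y"], of "\<bar>p y\<bar>"]
        by (simp add: abs_mult) (smt (verit) abs_ge_zero mult_right_mono bound[of r "x - y"] indicator_pos_le abs_mult)
    qed
    show "(\<lambda>(r, y). ?I r * dscaled \<rho> r (x - y) * p y) \<in> borel_measurable (lborel \<Otimes>\<^sub>M lborel)"
      unfolding dscaled_def by measurable
  qed
  define T where "T = (\<integral>y. indicator (ball x (4 * s)) y * norm (P y) \<partial>lborel)"
  have intT: "integrable lborel (\<lambda>y. indicator (ball x (4 * s)) y * norm (P y))"
    using P by (intro integrable_bounded_mult[where B=1]) (auto simp: indicator_def)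
  have T: "ennreal T = (\<integral>\<^sup>+y. ennreal \<bar>norm (P y)\<bar> * indicator (ball x (4 * s)) y \<partial>lborel)"
  proof -
    have "ennreal T = (\<integral>\<^sup>+y. ennreal (indicator (ball x (4 * s)) y * norm (P y)) \<partial>lborel)"
      unfolding T_def using intT by (intro nn_integral_eq_integral[symmetric]) auto
    also have "\<dots> = (\<integral>\<^sup>+y. ennreal \<bar>norm (P y)\<bar> * indicator (ball x (4 * s)) y \<partial>lborel)"
      by (intro nn_integral_cong) (auto simp: indicator_def)
    finally show ?thesis .
  qed
  have T0: "0 \<le> T" unfolding T_def by (intro integral_nonneg_AE) auto
  have ms: "integrable lborel (\<lambda>y. scaled \<rho> r (x - y) * p y)" if "0 < r" for r
    by (rule bump_integrable(1)[OF smooth_reflect[OF smooth_scaled[OF \<rho>]] scaled_outside[OF k that] p])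
  have "mollify \<rho> s p x - mollify \<rho> (s / 2) p x = (\<integral>y. (scaled \<rho> s (x - y) - scaled \<rho> (s/2) (x - y)) * p y \<partial>lborel)"
    unfolding mollify_def using s by (simp add: left_diff_distrib ms)
  also have "\<dots> = (\<integral>y. (\<integral>r. ?I r * dscaled \<rho> r (x - y) * p y \<partial>lborel) \<partial>lborel)"
    by (simp add: FTC)
  also have "\<dots> = (\<integral>r. (\<integral>y. ?I r * dscaled \<rho> r (x - y) * p y \<partial>lborel) \<partial>lborel)"
    by (rule lborel_pair.Fubini_integral[OF int])
  also have "\<dots> = (\<integral>r. ?I r * (\<integral>y. dscaled \<rho> r (x - y) * p y \<partial>lborel) \<partial>lborel)"
    by (simp add: mult.assoc)
  finally have rep: "mollify \<rho> s p x - mollify \<rho> (s / 2) p x = (\<integral>r. ?I r * (\<integral>y. dscaled \<rho> r (x - y) * p y \<partial>lborel) \<partial>lborel)" .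
  define E where "E = 4 * c * (2 ^ ?n / s ^ ?n) * T"
  have E: "0 \<le> E" unfolding E_def using c T0 s by auto
  have inner_bound: "\<bar>\<integral>y. dscaled \<rho> r (x - y) * p y \<partial>lborel\<bar> \<le> E" if "r \<in> {s/2..s}" for r
  proof -
    have r: "0 < r" "r \<le> s" "s/2 \<le> r" using that s by auto
    have pt: "\<bar>scaled \<rho> r (x - y) / r * ((x - y) \<bullet> P y)\<bar>
        \<le> (4 * c * (2 ^ ?n / s ^ ?n)) * (indicator (ball x (4 * s)) y * norm (P y))" for y
    proof (cases "y \<in> ball x (4 * r)")
      case True
      then have y: "y \<in> ball x (4 * s)" "norm (x - y) \<le> 4 * r" using r by (auto simp: dist_norm)
      have "\<bar>(x - y) \<bullet> P y\<bar> \<le> norm (x - y) * norm (P y)" by (rule Cauchy_Schwarz_ineq2)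
      also have "\<dots> \<le> 4 * r * norm (P y)" using y by (intro mult_right_mono) auto
      finally have 1: "\<bar>(x - y) \<bullet> P y\<bar> / r \<le> 4 * norm (P y)" using r by (simp add: field_simps)
      have "scaled \<rho> r (x - y) \<le> c / r ^ ?n" using scaled_le(1)[OF k r(1), of x y] True by simp
      also have "\<dots> \<le> c / (s/2) ^ ?n" using r s c by (intro divide_left_mono power_mono) auto
      finally have 2: "scaled \<rho> r (x - y) \<le> c * (2 ^ ?n / s ^ ?n)" by (simp add: power_divide)
      have "\<bar>scaled \<rho> r (x - y) / r * ((x - y) \<bullet> P y)\<bar> = scaled \<rho> r (x - y) * (\<bar>(x - y) \<bullet> P y\<bar> / r)"
        using scaled_le(2)[OF k r(1)] r by (simp add: abs_mult)
      also have "\<dots> \<le> (c * (2 ^ ?n / s ^ ?n)) * (4 * norm (P y))"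
        using 1 2 c s r by (intro mult_mono) auto
      finally show ?thesis using y by (simp add: mult_ac)
    next
      case False
      then have "scaled \<rho> r (x - y) = 0"
        using scaled_le(1)[OF k r(1), of x y] scaled_le(2)[OF k r(1), of "x - y"] by simp
      then show ?thesis using c s by simp
    qed
    have "\<bar>\<integral>y. scaled \<rho> r (x - y) / r * ((x - y) \<bullet> P y) \<partial>lborel\<bar>
        \<le> (\<integral>y. \<bar>scaled \<rho> r (x - y) / r * ((x - y) \<bullet> P y)\<bar> \<partial>lborel)"
      by (rule integral_abs_bound)
    also have "\<dots> \<le> (\<integral>y. (4 * c * (2 ^ ?n / s ^ ?n)) * (indicator (ball x (4 * s)) y * norm (P y)) \<partial>lborel)"
      by (rule integral_mono'[OF integrable_mult_right[OF intT]])
        (use pt c s in \<open>auto intro: mult_nonneg_nonneg\<close>)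
    also have "\<dots> = E" unfolding E_def T_def by (rule integral_mult_right_zero)
    finally show ?thesis using scale_derivative_weak[OF g k r(1), of x] by simp
  qed
  have "\<bar>mollify \<rho> s p x - mollify \<rho> (s / 2) p x\<bar> \<le> (\<integral>r. \<bar>?I r * (\<integral>y. dscaled \<rho> r (x - y) * p y \<partial>lborel)\<bar> \<partial>lborel)"
    unfolding rep by (rule integral_abs_bound)
  also have "\<dots> \<le> (\<integral>r. E * ?I r \<partial>lborel)"
  proof (rule integral_mono')
    show "integrable lborel (\<lambda>r. E * ?I r)"
      using s by (intro integrable_mult_right integrable_real_indicator) (auto simp: emeasure_lborel_Icc_eq)
  qed (use inner_bound E in \<open>auto simp: indicator_def\<close>)
  also have "\<dots> = E * (s / 2)" using s by simp
  also have "\<dots> = (2 * 2 ^ ?n * c * s) / s ^ ?n * T" by (simp add: E_def)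
  finally have "ennreal \<bar>mollify \<rho> s p x - mollify \<rho> (s / 2) p x\<bar> \<le> ennreal ((2 * 2 ^ ?n * c * s) / s ^ ?n * T)"
    by (rule ennreal_leI)
  also have "\<dots> = ennreal ((2 * 2 ^ ?n * c * s) / s ^ ?n) * ennreal T"
    using s c T0 by (intro ennreal_mult) auto
  finally show ?thesis unfolding T .
qed

lemma integrable_indicator_cball:
  "integrable lborel (\<lambda>x. C * indicator (cball (a::'a::euclidean_space) R) x :: real)"
proof -
  have "emeasure lborel (cball a R) < \<infinity>" by (rule emeasure_bounded_finite) simp
  then show ?thesis by (intro integrable_mult_right integrable_real_indicator) auto
qed

lemma nn_integral_lborel_affine:
  fixes f :: "'a::euclidean_space \<Rightarrow> ennreal"
  assumes [measurable]: "f \<in> borel_measurable borel" and c: "c \<noteq> 0"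
  shows "(\<integral>\<^sup>+x. f x \<partial>lborel) = ennreal (\<bar>c\<bar> ^ DIM('a)) * (\<integral>\<^sup>+x. f (t + c *\<^sub>R x) \<partial>lborel)"
proof -
  have "(\<integral>\<^sup>+x. f x \<partial>lborel)
     = (\<integral>\<^sup>+x. f x \<partial>(density (distr lborel borel (\<lambda>x::'a. t + c *\<^sub>R x)) (\<lambda>_. \<bar>c\<bar> ^ DIM('a))))"
    using lborel_affine[OF c, of t] by simp
  also have "\<dots> = (\<integral>\<^sup>+x. ennreal (\<bar>c\<bar> ^ DIM('a)) * f (t + c *\<^sub>R x) \<partial>lborel)"
    by (subst nn_integral_density) (simp_all add: nn_integral_distr)
  also have "\<dots> = ennreal (\<bar>c\<bar> ^ DIM('a)) * (\<integral>\<^sup>+x. f (t + c *\<^sub>R x) \<partial>lborel)"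
    by (rule nn_integral_cmult) measurable
  finally show ?thesis .
qed

lemma nn_integral_kernel:
  assumes k: "kernel c \<rho>"
  shows "(\<integral>\<^sup>+z. ennreal (\<rho> z) \<partial>lborel) = 1"
proof -
  have "integrable lborel \<rho>"
    using kernelD(5)[OF k] not_integrable_integral_eq by fastforce
  then show ?thesis
    using kernelD(3,5)[OF k] by (simp add: nn_integral_eq_integral)
qed

lemma nn_integral_scaled:
  fixes x y :: "'a::euclidean_space"
  assumes k: "kernel c \<rho>" and s: "0 < s"
  shows "(\<integral>\<^sup>+x. ennreal (scaled \<rho> s (x - y)) \<partial>lborel) = 1"
    and "(\<integral>\<^sup>+y. ennreal (scaled \<rho> s (x - y)) \<partial>lborel) = 1"
proof -
  have [measurable]: "\<rho> \<in> borel_measurable borel" "scaled \<rho> s \<in> borel_measurable borel"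
    using kernelD(6)[OF k] scaled_measurable[OF k] by auto
  have *: "ennreal (s ^ DIM('a)) * (\<integral>\<^sup>+z. ennreal (scaled \<rho> s (s *\<^sub>R z)) \<partial>lborel) = 1"
  proof -
    have "ennreal (s ^ DIM('a)) * ennreal (scaled \<rho> s (s *\<^sub>R z)) = ennreal (\<rho> z)" for z
      using s kernelD(3)[OF k, of z] by (subst ennreal_mult[symmetric]) (auto simp: scaled_def)
    then show ?thesis
      using nn_integral_kernel[OF k] by (subst nn_integral_cmult[symmetric]) simp_all
  qed
  show "(\<integral>\<^sup>+x. ennreal (scaled \<rho> s (x - y)) \<partial>lborel) = 1"
    using s * by (subst nn_integral_lborel_affine[where c=s and t=y]) auto
  show "(\<integral>\<^sup>+y. ennreal (scaled \<rho> s (x - y)) \<partial>lborel) = 1"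
    using s * by (subst nn_integral_lborel_affine[where c="-s" and t=x]) auto
qed

lemma mollify_L1_le:
  fixes p :: "'a::euclidean_space \<Rightarrow> real"
  assumes k: "kernel c \<rho>" and s: "0 < s" and p [measurable]: "p \<in> borel_measurable borel"
  shows "(\<integral>\<^sup>+x. ennreal \<bar>mollify \<rho> s p x\<bar> \<partial>lborel) \<le> (\<integral>\<^sup>+x. ennreal \<bar>p x\<bar> \<partial>lborel)"
proof -
  have [measurable]: "scaled \<rho> s \<in> borel_measurable borel"
    using scaled_measurable[OF k] by auto
  have pt: "ennreal \<bar>mollify \<rho> s p x\<bar> \<le> (\<integral>\<^sup>+y. ennreal \<bar>p y\<bar> * ennreal (scaled \<rho> s (x - y)) \<partial>lborel)" for x
  proof (cases "integrable lborel (\<lambda>y. scaled \<rho> s (x - y) * p y)")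
    case True
    have "ennreal \<bar>mollify \<rho> s p x\<bar> \<le> (\<integral>\<^sup>+y. ennreal \<bar>scaled \<rho> s (x - y) * p y\<bar> \<partial>lborel)"
      using integral_norm_bound_ennreal[OF True] by (simp add: mollify_def)
    also have "\<dots> = (\<integral>\<^sup>+y. ennreal \<bar>p y\<bar> * ennreal (scaled \<rho> s (x - y)) \<partial>lborel)"
      using scaled_le(2)[OF k s]
      by (intro nn_integral_cong) (simp add: abs_mult mult.commute flip: ennreal_mult)
    finally show ?thesis .
  next
    case False
    then show ?thesis by (simp add: mollify_def not_integrable_integral_eq)
  qed
  have "(\<integral>\<^sup>+x. ennreal \<bar>mollify \<rho> s p x\<bar> \<partial>lborel)
      \<le> (\<integral>\<^sup>+x. (\<integral>\<^sup>+y. ennreal \<bar>p y\<bar> * ennreal (scaled \<rho> s (x - y)) \<partial>lborel) \<partial>lborel)"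
    by (intro nn_integral_mono pt)
  also have "\<dots> = (\<integral>\<^sup>+y. (\<integral>\<^sup>+x. ennreal \<bar>p y\<bar> * ennreal (scaled \<rho> s (x - y)) \<partial>lborel) \<partial>lborel)"
    by (rule lborel_pair.Fubini'[symmetric]) measurable
  also have "\<dots> = (\<integral>\<^sup>+y. ennreal \<bar>p y\<bar> \<partial>lborel)"
    by (subst nn_integral_cmult) (auto simp: nn_integral_scaled[OF k s])
  finally show ?thesis .
qed

lemma mollify_integrable:
  assumes k: "kernel c \<rho>" and s: "0 < s" and p: "integrable lborel p"
  shows "integrable lborel (mollify \<rho> s p)"
proof (rule integrableI_bounded)
  have pm: "p \<in> borel_measurable borel" using p by auto
  show "mollify \<rho> s p \<in> borel_measurable lborel" using mollify_measurable[OF k pm] by simp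
  have "(\<integral>\<^sup>+x. ennreal \<bar>p x\<bar> \<partial>lborel) < \<infinity>"
    using p by (simp add: integrable_iff_bounded)
  then show "(\<integral>\<^sup>+x. ennreal (norm (mollify \<rho> s p x)) \<partial>lborel) < \<infinity>"
    using mollify_L1_le[OF k s pm] by (simp add: order.strict_trans1)
qed

lemma mollify_diff:
  fixes p q :: "'a::euclidean_space \<Rightarrow> real"
  assumes k: "kernel c \<rho>" and s: "0 < s" and p: "integrable lborel p" "integrable lborel q"
  shows "mollify \<rho> s (\<lambda>x. p x - q x) x = mollify \<rho> s p x - mollify \<rho> s q x"
proof -
  note sm = smooth_reflect[OF smooth_scaled[OF kernelD(1)[OF k]]]
  show ?thesis
    unfolding mollify_def right_diff_distrib
    by (intro Bochner_Integration.integral_diff bump_integrable(1)[OF sm scaled_outside[OF k s]] p)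
qed

text \<open>
  Truncation in space and in height reduces the claim to bounded functions on a ball, and these
  are almost everywhere limits of continuous functions, which can be truncated in the same way.
\<close>
lemma continuous_approx_L1:
  fixes p :: "'a::euclidean_space \<Rightarrow> real"
  assumes p: "integrable lborel p" and e: "0 < e"
  obtains \<phi> R where "continuous_on UNIV \<phi>" "\<And>x. R \<le> norm x \<Longrightarrow> \<phi> x = 0" "0 < R" "integrable lborel \<phi>"
    "(\<integral>x. \<bar>p x - \<phi> x\<bar> \<partial>lborel) < e"
proof -
  have [measurable]: "p \<in> borel_measurable borel" using p by auto
  define q where "q k x = (if norm x \<le> real k \<and> \<bar>p x\<bar> \<le> real k then p x else 0)" for k :: nat and x
  have [measurable]: "q k \<in> borel_measurable borel" for k unfolding q_def by measurable
  have "(\<lambda>k. \<integral>x. \<bar>p x - q k x\<bar> \<partial>lborel) \<longlonglongrightarrow> (\<integral>x. 0 \<partial>(lborel::'a measure))"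
  proof (rule integral_dominated_convergence[where w="\<lambda>x. \<bar>p x\<bar>"])
    show "AE x in lborel. (\<lambda>k. \<bar>p x - q k x\<bar>) \<longlonglongrightarrow> 0"
    proof (intro AE_I2 tendsto_eventually)
      fix x
      obtain k0 :: nat where k0: "max (norm x) \<bar>p x\<bar> \<le> real k0" using real_arch_simple by blast
      show "\<forall>\<^sub>F k in sequentially. \<bar>p x - q k x\<bar> = 0"
        using eventually_ge_at_top[of k0]
      proof eventually_elim
        case (elim k)
        then have "max (norm x) \<bar>p x\<bar> \<le> real k" using k0 by linarith
        then show ?case by (simp add: q_def)
      qed
    qed
  qed (use p in \<open>auto simp: q_def\<close>)
  then have "\<forall>\<^sub>F k in sequentially. (\<integral>x. \<bar>p x - q k x\<bar> \<partial>lborel) < e / 2"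
    using e by (intro order_tendstoD(2)) auto
  then obtain k where k: "(\<integral>x. \<bar>p x - q k x\<bar> \<partial>lborel) < e / 2"
    using eventually_sequentially by auto
  have qb: "\<bar>q k x\<bar> \<le> real k * indicator (cball 0 (real k + 1)) x" for x
    by (auto simp: q_def indicator_def)
  have ind: "integrable lborel (\<lambda>x. C * indicator (cball 0 (real k + 1)) x :: real)" for C :: real
    by (rule integrable_indicator_cball)
  have qi: "integrable lborel (q k)"
    by (rule Bochner_Integration.integrable_bound[OF ind[of k]]) (use qb in auto)
  have "q k measurable_on UNIV"
    by (intro lebesgue_measurable_imp_measurable_on) (auto intro: measurable_completion)
  then obtain N g where N: "negligible N" and g: "\<And>n. continuous_on UNIV (g n)"
    "\<And>x. x \<notin> N \<Longrightarrow> (\<lambda>n. g n x) \<longlonglongrightarrow> q k x"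
    unfolding measurable_on_def by auto
  define \<phi> where "\<phi> n x = max (- real k) (min (real k) (g n x)) * max 0 (min 1 (real k + 1 - norm x))" for n x
  have c\<phi>: "continuous_on UNIV (\<phi> n)" for n
    unfolding \<phi>_def by (intro continuous_intros g)
  have [measurable]: "\<phi> n \<in> borel_measurable borel" for n
    by (rule borel_measurable_continuous_onI[OF c\<phi>])
  have \<phi>b: "\<bar>\<phi> n x\<bar> \<le> real k * indicator (cball 0 (real k + 1)) x" for n x
  proof (cases "norm x \<le> real k + 1")
    case True
    have "\<bar>\<phi> n x\<bar> \<le> real k * 1"
      unfolding \<phi>_def abs_mult by (intro mult_mono) auto
    then show ?thesis using True by (simp add: indicator_def)
  qed (auto simp: \<phi>_def)
  have \<phi>i: "integrable lborel (\<phi> n)" for n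
    by (rule Bochner_Integration.integrable_bound[OF ind[of k]]) (use \<phi>b[of n] in auto)
  have AEN: "AE x in lborel. x \<notin> N"
  proof -
    have "AE x in lebesgue. x \<notin> N" using N by (intro AE_not_in) (simp add: negligible_iff_null_sets)
    then show ?thesis by (simp add: AE_completion_iff)
  qed
  have "(\<lambda>n. \<integral>x. \<bar>q k x - \<phi> n x\<bar> \<partial>lborel) \<longlonglongrightarrow> (\<integral>x. 0 \<partial>(lborel::'a measure))"
  proof (rule integral_dominated_convergence[where w="\<lambda>x. real (2 * k) * indicator (cball 0 (real k + 1)) x"])
    show "AE x in lborel. (\<lambda>n. \<bar>q k x - \<phi> n x\<bar>) \<longlonglongrightarrow> 0"
      using AEN
    proof eventually_elim
      case (elim x)
      have "(\<lambda>n. \<bar>q k x - \<phi> n x\<bar>) \<longlonglongrightarrow>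
         \<bar>q k x - max (- real k) (min (real k) (q k x)) * max 0 (min 1 (real k + 1 - norm x))\<bar>"
        unfolding \<phi>_def by (intro tendsto_intros g(2)[OF elim])
      moreover have "max (- real k) (min (real k) (q k x)) * max 0 (min 1 (real k + 1 - norm x)) = q k x"
        by (auto simp: q_def)
      ultimately show ?case by simp
    qed
    show "AE x in lborel. norm \<bar>q k x - \<phi> n x\<bar> \<le> real (2 * k) * indicator (cball 0 (real k + 1)) x" for n
    proof (rule AE_I2)
      fix x
      show "norm \<bar>q k x - \<phi> n x\<bar> \<le> real (2 * k) * indicator (cball 0 (real k + 1)) x"
        using qb[of x] \<phi>b[of n x] by simp
    qed
    show "integrable lborel (\<lambda>x. real (2 * k) * indicator (cball 0 (real k + 1)) x)" by (rule ind)
  qed auto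
  then have "\<forall>\<^sub>F n in sequentially. (\<integral>x. \<bar>q k x - \<phi> n x\<bar> \<partial>lborel) < e / 2"
    using e by (intro order_tendstoD(2)) auto
  then obtain n where n: "(\<integral>x. \<bar>q k x - \<phi> n x\<bar> \<partial>lborel) < e / 2"
    using eventually_sequentially by auto
  have "(\<integral>x. \<bar>p x - \<phi> n x\<bar> \<partial>lborel) \<le> (\<integral>x. \<bar>p x - q k x\<bar> + \<bar>q k x - \<phi> n x\<bar> \<partial>lborel)"
    using p qi \<phi>i by (intro integral_mono) auto
  also have "\<dots> = (\<integral>x. \<bar>p x - q k x\<bar> \<partial>lborel) + (\<integral>x. \<bar>q k x - \<phi> n x\<bar> \<partial>lborel)"
    using p qi \<phi>i by (intro Bochner_Integration.integral_add) auto
  finally have "(\<integral>x. \<bar>p x - \<phi> n x\<bar> \<partial>lborel) < e" using k n by linarith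
  then show thesis
    using that[OF c\<phi>, of "real k + 1" n] \<phi>i by (auto simp: \<phi>_def)
qed

lemma mollify_continuous_L1:
  fixes \<phi> :: "'a::euclidean_space \<Rightarrow> real"
  assumes k: "kernel c \<rho>" and \<phi>: "continuous_on UNIV \<phi>" "\<And>x. R \<le> norm x \<Longrightarrow> \<phi> x = 0" "0 < R"
    and e: "0 < e"
  obtains \<delta> where "0 < \<delta>"
    "\<And>s. 0 < s \<Longrightarrow> s < \<delta> \<Longrightarrow> (\<integral>\<^sup>+x. ennreal \<bar>mollify \<rho> s \<phi> x - \<phi> x\<bar> \<partial>lborel) \<le> ennreal e"
proof -
  define V where "V = ball_vol TYPE('a) (R + 4)"
  have V: "0 < V" using \<phi>(3) by (simp add: V_def ball_vol_def)
  have "uniformly_continuous_on (cball 0 (R + 8)) \<phi>"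
    using \<phi>(1) by (intro compact_uniformly_continuous) (auto intro: continuous_on_subset)
  then obtain d where d: "0 < d"
    "\<And>x y. x \<in> cball 0 (R+8) \<Longrightarrow> y \<in> cball 0 (R+8) \<Longrightarrow> dist y x < d \<Longrightarrow> dist (\<phi> y) (\<phi> x) < e / V"
    using e V unfolding uniformly_continuous_on_def by (metis divide_pos_pos)
  have [measurable]: "\<phi> \<in> borel_measurable borel" by (rule borel_measurable_continuous_onI[OF \<phi>(1)])
  have \<phi>i: "integrable lborel \<phi>"
  proof -
    obtain B where B: "\<And>y. norm (\<phi> y) \<le> B" "0 \<le> B"
      using bounded_of_compact_support[OF \<phi>(1), of 0 R] \<phi>(2) by (metis linear mem_cball_0)
    have b: "norm (\<phi> y) \<le> norm (B * indicator (cball 0 R) y)" for y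
      using B(1)[of y] \<phi>(2)[of y] by (cases "norm y \<le> R") auto
    have "integrable lborel (\<lambda>x. B * indicator (cball (0::'a) R) x)"
      by (rule integrable_indicator_cball)
    then show ?thesis
      by (rule Bochner_Integration.integrable_bound) (simp, intro AE_I2 b)
  qed
  show thesis
  proof (rule that[of "min 1 (d / 4)"])
    show "0 < min 1 (d / 4)" using d by simp
    fix s :: real assume s: "0 < s" "s < min 1 (d / 4)"
    have [measurable]: "scaled \<rho> s \<in> borel_measurable borel" by (rule scaled_measurable[OF k])
    have si: "integrable lborel (\<lambda>y. scaled \<rho> s (x - y))" and s1: "(\<integral>y. scaled \<rho> s (x - y) \<partial>lborel) = 1" for x
      using nn_integral_scaled(2)[OF k s(1), of x] scaled_le(2)[OF k s(1)]
      by (auto intro!: integrableI_nonneg simp: integral_eq_nn_integral)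
    have pt: "\<bar>mollify \<rho> s \<phi> x - \<phi> x\<bar> \<le> (e / V) * indicator (ball 0 (R + 4)) x" for x
    proof (cases "norm x < R + 4")
      case True
      have "mollify \<rho> s \<phi> x - \<phi> x = (\<integral>y. scaled \<rho> s (x - y) * \<phi> y \<partial>lborel) - (\<integral>y. scaled \<rho> s (x - y) * \<phi> x \<partial>lborel)"
        by (simp add: mollify_def s1)
      also have "\<dots> = (\<integral>y. scaled \<rho> s (x - y) * (\<phi> y - \<phi> x) \<partial>lborel)"
        unfolding right_diff_distrib
        using bump_integrable(1)[OF smooth_reflect[OF smooth_scaled[OF kernelD(1)[OF k]]] scaled_outside[OF k s(1)] \<phi>i]
        by (intro Bochner_Integration.integral_diff[symmetric]) (auto intro: si)
      finally have "\<bar>mollify \<rho> s \<phi> x - \<phi> x\<bar> \<le> (\<integral>y. \<bar>scaled \<rho> s (x - y) * (\<phi> y - \<phi> x)\<bar> \<partial>lborel)"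
        by (metis integral_abs_bound)
      also have "\<dots> \<le> (\<integral>y. (e / V) * scaled \<rho> s (x - y) \<partial>lborel)"
      proof (rule integral_mono'[OF integrable_mult_right[OF si]])
        fix y
        show "\<bar>scaled \<rho> s (x - y) * (\<phi> y - \<phi> x)\<bar> \<le> (e / V) * scaled \<rho> s (x - y)"
        proof (cases "dist x y < 4 * s")
          case near: True
          then have "dist x y < d" "dist x y < 4" using s by auto
          then have "dist (\<phi> y) (\<phi> x) < e / V"
            using True norm_triangle_sub[of y x]
            by (intro d(2)) (auto simp: dist_norm norm_minus_commute)
          then have "\<bar>\<phi> y - \<phi> x\<bar> \<le> e / V" by (simp add: dist_real_def)
          then have "scaled \<rho> s (x - y) * \<bar>\<phi> y - \<phi> x\<bar> \<le> scaled \<rho> s (x - y) * (e / V)"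
            using scaled_le(2)[OF k s(1)] by (intro mult_left_mono) auto
          then show ?thesis using scaled_le(2)[OF k s(1), of "x - y"] by (simp add: abs_mult mult.commute)
        next
          case False
          then have "scaled \<rho> s (x - y) = 0"
            using scaled_le(1)[OF k s(1), of x y] scaled_le(2)[OF k s(1), of "x - y"] by simp
          then show ?thesis by simp
        qed
      qed (use e V scaled_le(2)[OF k s(1)] in auto)
      also have "\<dots> = e / V" using s1 by simp
      finally show ?thesis using True by simp
    next
      case False
      have "scaled \<rho> s (x - y) * \<phi> y = 0" for y
      proof (cases "dist x y < 4 * s")
        case True
        then have "R \<le> norm y" using False s norm_triangle_sub[of x y] by (auto simp: dist_norm)
        then show ?thesis using \<phi>(2) by simp
      next
        case False
        then have "scaled \<rho> s (x - y) = 0"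
          using scaled_le(1)[OF k s(1), of x y] scaled_le(2)[OF k s(1), of "x - y"] by simp
        then show ?thesis by simp
      qed
      then have "(\<lambda>y. scaled \<rho> s (x - y) * \<phi> y) = (\<lambda>y. 0)" by (rule ext)
      then have "mollify \<rho> s \<phi> x = 0" by (simp only: mollify_def integral_zero)
      then show ?thesis using False \<phi>(2)[of x] by simp
    qed
    have "(\<integral>\<^sup>+x. ennreal \<bar>mollify \<rho> s \<phi> x - \<phi> x\<bar> \<partial>lborel)
        \<le> (\<integral>\<^sup>+x. ennreal (e / V) * indicator (ball (0::'a) (R + 4)) x \<partial>lborel)"
    proof (rule nn_integral_mono)
      fix x
      show "ennreal \<bar>mollify \<rho> s \<phi> x - \<phi> x\<bar> \<le> ennreal (e / V) * indicator (ball 0 (R + 4)) x"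
        using ennreal_leI[OF pt[of x]] by (cases "norm x < R + 4") auto
    qed
    also have "\<dots> = ennreal (e / V) * ennreal V"
      using \<phi>(3) by (simp add: nn_integral_cmult_indicator emeasure_lborel_ball V_def)
    also have "\<dots> = ennreal e" using e V by (simp flip: ennreal_mult)
    finally show "(\<integral>\<^sup>+x. ennreal \<bar>mollify \<rho> s \<phi> x - \<phi> x\<bar> \<partial>lborel) \<le> ennreal e" .
  qed
qed

text \<open>
  Mollification contracts the \<open>L\<^sup>1\<close> norm and converges for continuous functions of compact
  support, which are dense.
\<close>
lemma mollify_tendsto_L1:
  fixes p :: "'a::euclidean_space \<Rightarrow> real"
  assumes k: "kernel c \<rho>" and p: "integrable lborel p" and s: "\<And>j. 0 < s j" "s \<longlonglongrightarrow> 0"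
  shows "(\<lambda>j. \<integral>x. norm (mollify \<rho> (s j) p x - p x) \<partial>lborel) \<longlonglongrightarrow> 0"
proof (rule tendstoI)
  fix e :: real assume e: "0 < e"
  obtain \<phi> R where \<phi>: "continuous_on UNIV \<phi>" "\<And>x. R \<le> norm x \<Longrightarrow> \<phi> x = 0" "0 < R" "integrable lborel \<phi>"
    and p\<phi>: "(\<integral>x. \<bar>p x - \<phi> x\<bar> \<partial>lborel) < e / 4"
    using continuous_approx_L1[OF p, of "e/4"] e by auto
  have [measurable]: "p \<in> borel_measurable borel" "\<phi> \<in> borel_measurable borel" using p \<phi> by auto
  obtain \<delta> where \<delta>: "0 < \<delta>"
    "\<And>s. 0 < s \<Longrightarrow> s < \<delta> \<Longrightarrow> (\<integral>\<^sup>+x. ennreal \<bar>mollify \<rho> s \<phi> x - \<phi> x\<bar> \<partial>lborel) \<le> ennreal (e/4)"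
    using mollify_continuous_L1[OF k \<phi>(1-3), of "e/4"] e by auto
  have "\<forall>\<^sub>F j in sequentially. s j < \<delta>" using s(2) \<delta>(1) by (rule order_tendstoD)
  then show "\<forall>\<^sub>F j in sequentially. dist (\<integral>x. norm (mollify \<rho> (s j) p x - p x) \<partial>lborel) 0 < e"
  proof eventually_elim
    case (elim j)
    note sj = s(1)[of j]
    have mp: "integrable lborel (mollify \<rho> (s j) p)" and m\<phi>: "integrable lborel (mollify \<rho> (s j) \<phi>)"
      using mollify_integrable[OF k sj] p \<phi> by auto
    have d: "integrable lborel (\<lambda>x. p x - \<phi> x)" using p \<phi> by auto
    have [measurable]: "mollify \<rho> (s j) p \<in> borel_measurable borel" "mollify \<rho> (s j) \<phi> \<in> borel_measurable borel"
      using mp m\<phi> by auto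
    have nd: "(\<integral>\<^sup>+x. ennreal \<bar>p x - \<phi> x\<bar> \<partial>lborel) = ennreal (\<integral>x. \<bar>p x - \<phi> x\<bar> \<partial>lborel)"
      using d by (intro nn_integral_eq_integral) auto
    have "(\<integral>\<^sup>+x. ennreal \<bar>mollify \<rho> (s j) p x - p x\<bar> \<partial>lborel)
       \<le> (\<integral>\<^sup>+x. (ennreal \<bar>mollify \<rho> (s j) (\<lambda>x. p x - \<phi> x) x\<bar> + ennreal \<bar>mollify \<rho> (s j) \<phi> x - \<phi> x\<bar>) + ennreal \<bar>p x - \<phi> x\<bar> \<partial>lborel)"
      unfolding mollify_diff[OF k sj p \<phi>(4)]
      by (intro nn_integral_mono) (simp flip: ennreal_plus add: ennreal_leI)
    also have "\<dots> = (\<integral>\<^sup>+x. ennreal \<bar>mollify \<rho> (s j) (\<lambda>x. p x - \<phi> x) x\<bar> \<partial>lborel)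
        + (\<integral>\<^sup>+x. ennreal \<bar>mollify \<rho> (s j) \<phi> x - \<phi> x\<bar> \<partial>lborel) + (\<integral>\<^sup>+x. ennreal \<bar>p x - \<phi> x\<bar> \<partial>lborel)"
      using mollify_measurable[OF k, of "\<lambda>x. p x - \<phi> x" "s j"]
      by (subst nn_integral_add; simp?)+
    also have "\<dots> \<le> (\<integral>\<^sup>+x. ennreal \<bar>p x - \<phi> x\<bar> \<partial>lborel) + ennreal (e/4) + (\<integral>\<^sup>+x. ennreal \<bar>p x - \<phi> x\<bar> \<partial>lborel)"
      using mollify_L1_le[OF k sj, of "\<lambda>x. p x - \<phi> x"] \<delta>(2)[OF sj elim]
      by (intro add_mono) auto
    also have "\<dots> = ennreal ((\<integral>x. \<bar>p x - \<phi> x\<bar> \<partial>lborel) + e / 4 + (\<integral>x. \<bar>p x - \<phi> x\<bar> \<partial>lborel))"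
    proof -
      have "0 \<le> (\<integral>x. \<bar>p x - \<phi> x\<bar> \<partial>lborel)" by (intro integral_nonneg_AE) auto
      then show ?thesis unfolding nd using e by (simp add: ennreal_plus[symmetric] del: ennreal_plus)
    qed
    finally have "(\<integral>\<^sup>+x. ennreal \<bar>mollify \<rho> (s j) p x - p x\<bar> \<partial>lborel)
       \<le> ennreal ((\<integral>x. \<bar>p x - \<phi> x\<bar> \<partial>lborel) + e / 4 + (\<integral>x. \<bar>p x - \<phi> x\<bar> \<partial>lborel))" .
    moreover have "(\<integral>\<^sup>+x. ennreal \<bar>mollify \<rho> (s j) p x - p x\<bar> \<partial>lborel)
       = ennreal (\<integral>x. \<bar>mollify \<rho> (s j) p x - p x\<bar> \<partial>lborel)"
      using mp p by (intro nn_integral_eq_integral) auto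
    moreover have "0 \<le> (\<integral>x. \<bar>p x - \<phi> x\<bar> \<partial>lborel)" by (intro integral_nonneg_AE) auto
    ultimately have "(\<integral>x. \<bar>mollify \<rho> (s j) p x - p x\<bar> \<partial>lborel)
        \<le> (\<integral>x. \<bar>p x - \<phi> x\<bar> \<partial>lborel) + e / 4 + (\<integral>x. \<bar>p x - \<phi> x\<bar> \<partial>lborel)"
      using e by (subst ennreal_le_iff[symmetric]) (simp_all del: ennreal_plus)
    then show ?case using p\<phi> e by (simp add: dist_real_def integral_nonneg_AE)
  qed
qed

text \<open>
  Cauchy--Schwarz with the weights \<open>2\<^sup>-\<^sup>j\<close>, whose sum is at most \<open>2\<close>.
\<close>
lemma sum_dyadic_square_le:
  fixes d :: "nat \<Rightarrow> real"
  shows "(\<Sum>j<J. d j)\<^sup>2 \<le> 2 * (\<Sum>j<J. 2 ^ j * (d j)\<^sup>2)"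
proof -
  have "(\<Sum>j<J. d j)\<^sup>2 = (\<Sum>j<J. sqrt ((1/2) ^ j) * (sqrt (2 ^ j) * d j))\<^sup>2"
    by (simp add: mult.assoc[symmetric] flip: real_sqrt_mult power_mult_distrib)
  also have "\<dots> \<le> (\<Sum>j<J. (sqrt ((1/2) ^ j))\<^sup>2) * (\<Sum>j<J. (sqrt (2 ^ j) * d j)\<^sup>2)"
    by (rule Cauchy_Schwarz_ineq_sum)
  also have "\<dots> = (\<Sum>j<J. (1/2) ^ j) * (\<Sum>j<J. 2 ^ j * (d j)\<^sup>2)"
    by (simp add: power_mult_distrib)
  also have "\<dots> \<le> 2 * (\<Sum>j<J. 2 ^ j * (d j)\<^sup>2)"
    by (intro mult_right_mono sum_nonneg) (auto simp: geometric_sum)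
  finally show ?thesis .
qed

lemma avg_const_mult: "avg_const T (c * t) M = avg_const T c M * t\<^sup>2"
  by (simp add: avg_const_def power_mult_distrib mult_ac)

definition poincare_const :: "'a::euclidean_space itself \<Rightarrow> real \<Rightarrow> real \<Rightarrow> real" where
  "poincare_const T c M = 4 * avg_const T (2 * 2 ^ DIM('a) * c) M"

text \<open>
  The weighted Poincare inequality in the form of an approximation rate.  Halving the scale
  repeatedly writes \<open>p - mollify \<rho> s p\<close> as a sum of differences of which the \<open>j\<close>-th is at most
  \<open>s 2\<^sup>-\<^sup>j\<close> times an average of the gradient, and averages are bounded on \<open>L\<^sup>2(w)\<close>.
\<close>
lemma wsq_mollify_diff:
  fixes p :: "'a::euclidean_space \<Rightarrow> real"
  assumes A2: "A2_weight M w" and g: "weak_grad p P" and k: "kernel c \<rho>" and s: "0 < s"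
  shows "wsq w (\<lambda>x. p x - mollify \<rho> s p x) \<le> ennreal (poincare_const TYPE('a) c M * s\<^sup>2) * wsq w (\<lambda>x. norm (P x))"
proof -
  have w [measurable]: "w \<in> borel_measurable borel" and wpos: "\<And>x. 0 < w x" and M: "0 \<le> M"
    using A2 by (auto simp: A2_weight_def)
  have p: "integrable lborel p" and [measurable]: "p \<in> borel_measurable borel" "P \<in> borel_measurable borel"
    using g by (auto simp: weak_grad_def)
  have c: "0 \<le> c" by (rule kernelD(7)[OF k])
  let ?Q = "wsq w (\<lambda>x. norm (P x))" and ?A = "avg_const TYPE('a) (2 * 2 ^ DIM('a) * c) M"
  have A: "0 \<le> ?A" using M by (rule avg_const_nonneg)
  define m where "m j = mollify \<rho> (s / 2 ^ j) p" for j :: nat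
  have [measurable]: "m j \<in> borel_measurable borel" for j
    unfolding m_def by (rule mollify_measurable[OF k]) simp
  define d where "d j x = m j x - m (Suc j) x" for j x
  have [measurable]: "d j \<in> borel_measurable borel" for j unfolding d_def by measurable
  have dj: "wsq w (d j) \<le> ennreal (?A * (s / 2 ^ j)\<^sup>2) * ?Q" for j
  proof -
    let ?s = "s / 2 ^ j"
    have "wsq w (d j) \<le> ennreal (avg_const TYPE('a) (2 * 2 ^ DIM('a) * c * ?s) M) * ?Q"
    proof (rule wsq_average_bound[OF A2])
      show "ennreal \<bar>d j x\<bar> \<le> ennreal (2 * 2 ^ DIM('a) * c * ?s / ?s ^ DIM('a)) *
          (\<integral>\<^sup>+y. ennreal \<bar>norm (P y)\<bar> * indicator (ball x (4 * ?s)) y \<partial>lborel)" for x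
        using mollify_halving_bound[OF g k, of ?s x] s by (simp add: d_def m_def mult.commute)
    qed (use s c in auto)
    also have "avg_const TYPE('a) (2 * 2 ^ DIM('a) * c * ?s) M = ?A * ?s\<^sup>2"
      by (rule avg_const_mult)
    finally show ?thesis .
  qed
  have tele: "(\<Sum>j<J. d j x) = m 0 x - m J x" for J x
    unfolding d_def by (rule sum_lessThan_telescope')
  have D: "wsq w (\<lambda>x. m J x - m 0 x) \<le> ennreal (4 * ?A * s\<^sup>2) * ?Q" for J
  proof -
    have "wsq w (\<lambda>x. m J x - m 0 x) \<le> (\<integral>\<^sup>+x. (\<Sum>j<J. ennreal (2 * 2 ^ j) * ennreal ((d j x)\<^sup>2 * w x)) \<partial>lborel)"
      unfolding wsq_def
    proof (rule nn_integral_mono)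
      fix x
      have "(m J x - m 0 x)\<^sup>2 = (\<Sum>j<J. d j x)\<^sup>2" by (simp add: tele power2_commute)
      also have "\<dots> \<le> 2 * (\<Sum>j<J. 2 ^ j * (d j x)\<^sup>2)" by (rule sum_dyadic_square_le)
      finally have "(m J x - m 0 x)\<^sup>2 * w x \<le> (2 * (\<Sum>j<J. 2 ^ j * (d j x)\<^sup>2)) * w x"
        using wpos[of x] by (intro mult_right_mono) auto
      also have "\<dots> = (\<Sum>j<J. (2 * 2 ^ j) * ((d j x)\<^sup>2 * w x))"
        by (simp add: sum_distrib_left sum_distrib_right mult_ac)
      finally have "ennreal ((m J x - m 0 x)\<^sup>2 * w x) \<le> ennreal (\<Sum>j<J. (2 * 2 ^ j) * ((d j x)\<^sup>2 * w x))"
        by (rule ennreal_leI)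
      also have "\<dots> = (\<Sum>j<J. ennreal (2 * 2 ^ j) * ennreal ((d j x)\<^sup>2 * w x))"
        using wpos[of x] by (subst sum_ennreal[symmetric]) (auto simp: less_imp_le ennreal_mult)
      finally show "ennreal ((m J x - m 0 x)\<^sup>2 * w x) \<le> (\<Sum>j<J. ennreal (2 * 2 ^ j) * ennreal ((d j x)\<^sup>2 * w x))" .
    qed
    also have "\<dots> = (\<Sum>j<J. ennreal (2 * 2 ^ j) * wsq w (d j))"
      unfolding wsq_def by (subst nn_integral_sum) (auto intro!: sum.cong nn_integral_cmult)
    also have "\<dots> \<le> (\<Sum>j<J. ennreal (2 * 2 ^ j) * (ennreal (?A * (s / 2 ^ j)\<^sup>2) * ?Q))"
      by (intro sum_mono mult_left_mono dj) auto
    also have "\<dots> = (\<Sum>j<J. ennreal (2 * ?A * s\<^sup>2 * (1/2) ^ j)) * ?Q"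
    proof -
      have "(2 * 2 ^ j) * (?A * (s / 2 ^ j)\<^sup>2) = 2 * ?A * s\<^sup>2 * (1/2) ^ j" for j
        by (simp add: power2_eq_square field_simps)
      then have "ennreal (2 * 2 ^ j) * ennreal (?A * (s / 2 ^ j)\<^sup>2) = ennreal (2 * ?A * s\<^sup>2 * (1/2) ^ j)" for j
        using A by (subst ennreal_mult[symmetric]) simp_all
      then show ?thesis by (simp add: sum_distrib_right flip: mult.assoc)
    qed
    also have "(\<Sum>j<J. ennreal (2 * ?A * s\<^sup>2 * (1/2) ^ j)) = ennreal (2 * ?A * s\<^sup>2 * (\<Sum>j<J. (1/2) ^ j))"
      using A by (subst sum_ennreal) (auto simp: sum_distrib_left)
    also have "\<dots> \<le> ennreal (2 * ?A * s\<^sup>2 * 2)"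
      using A by (intro ennreal_leI mult_left_mono) (auto simp: geometric_sum)
    finally show ?thesis by (simp add: mult_right_mono mult_ac)
  qed
  \<comment> \<open>Convergence in \<open>L\<^sup>1\<close> is unweighted.  It gives an almost everywhere convergent subsequence,
    along which the weighted bound passes to the limit by Fatou.\<close>
  have "(\<lambda>j. \<integral>x. norm (m j x - p x) \<partial>lborel) \<longlonglongrightarrow> 0"
    unfolding m_def
  proof (rule mollify_tendsto_L1[OF k p])
    have "(\<lambda>j. s * (1/2) ^ j) \<longlonglongrightarrow> s * 0" by (intro tendsto_intros LIMSEQ_power_zero) auto
    then show "(\<lambda>j. s / 2 ^ j) \<longlonglongrightarrow> 0" by (simp add: power_divide)
  qed (use s in auto)
  moreover have "integrable lborel (\<lambda>x. m j x - p x)" for j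
    unfolding m_def using mollify_integrable[OF k _ p] s p by auto
  ultimately obtain r where r: "strict_mono r" "AE x in lborel. (\<lambda>n. m (r n) x - p x) \<longlonglongrightarrow> 0"
    using tendsto_L1_AE_subseq[of lborel "\<lambda>j x. m j x - p x"] by auto
  have "wsq w (\<lambda>x. p x - m 0 x) = (\<integral>\<^sup>+x. liminf (\<lambda>n. ennreal ((m (r n) x - m 0 x)\<^sup>2 * w x)) \<partial>lborel)"
    unfolding wsq_def
  proof (rule nn_integral_cong_AE, use r(2) in eventually_elim)
    case (elim x)
    then have "(\<lambda>n. m (r n) x) \<longlonglongrightarrow> p x" by (simp add: LIM_zero_iff)
    then have "(\<lambda>n. ennreal ((m (r n) x - m 0 x)\<^sup>2 * w x)) \<longlonglongrightarrow> ennreal ((p x - m 0 x)\<^sup>2 * w x)"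
      by (intro tendsto_intros tendsto_ennrealI)
    then show ?case by (rule lim_imp_Liminf[symmetric, rotated]) simp
  qed
  also have "\<dots> \<le> liminf (\<lambda>n. wsq w (\<lambda>x. m (r n) x - m 0 x))"
    unfolding wsq_def by (rule nn_integral_liminf) measurable
  also have "\<dots> \<le> limsup (\<lambda>n. wsq w (\<lambda>x. m (r n) x - m 0 x))"
    by (rule Liminf_le_Limsup) simp
  also have "\<dots> \<le> ennreal (4 * ?A * s\<^sup>2) * ?Q"
    by (intro Limsup_bounded always_eventually allI D)
  finally show ?thesis by (simp add: m_def poincare_const_def)
qed

section \<open>Concentration on slabs\<close>

lemma bump_kernel_exists:
  obtains \<beta> :: "'a::euclidean_space \<Rightarrow> real" and c where
    "smooth \<beta>" "\<And>z. 0 \<le> \<beta> z" "\<And>z. \<beta> z \<le> c" "\<And>z. 1 \<le> norm z \<Longrightarrow> \<beta> z = 0" "(\<integral>z. \<beta> z \<partial>lborel) = 1"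
proof -
  obtain \<kappa> :: "'a \<Rightarrow> real" where \<kappa>: "smooth \<kappa>" "\<And>x. 0 \<le> \<kappa> x" "\<And>x. \<kappa> x \<le> 1" "\<And>x. x \<in> {0} \<Longrightarrow> \<kappa> x = 1"
    "closure {x. \<kappa> x \<noteq> 0} \<subseteq> ball 0 1"
    by (rule smooth_cutoff[of "{0}" "ball 0 1"]) auto
  have out: "\<kappa> z = 0" if "1 \<le> norm z" for z
    using \<kappa>(5) closure_subset[of "{x. \<kappa> x \<noteq> 0}"] that by fastforce
  have cont: "continuous_on UNIV \<kappa>" by (rule smooth_continuous[OF \<kappa>(1)])
  have [measurable]: "\<kappa> \<in> borel_measurable borel" by (rule borel_measurable_continuous_onI[OF cont])
  have int: "integrable lborel \<kappa>"
  proof (rule Bochner_Integration.integrable_bound)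
    show "integrable lborel (\<lambda>x. 1 * indicator (cball (0::'a) 1) x :: real)"
      by (rule integrable_indicator_cball)
    have "norm (\<kappa> x) \<le> norm (1 * indicator (cball 0 1) x :: real)" for x
      using \<kappa>(2,3)[of x] out[of x] by (cases "norm x \<le> 1") auto
    then show "AE x in lborel. norm (\<kappa> x) \<le> norm (1 * indicator (cball 0 1) x :: real)" by simp
  qed simp
  define I where "I = (\<integral>z. \<kappa> z \<partial>lborel)"
  have "I \<noteq> 0"
  proof
    assume "I = 0"
    then have "AE x in lborel. \<kappa> x = 0"
      using integral_nonneg_eq_0_iff_AE[OF int] \<kappa>(2) unfolding I_def by simp
    have "open {x. \<kappa> x \<noteq> 0}"
      using open_Collect_neq[OF cont continuous_on_const[of UNIV 0]] by simp
    moreover have "0 \<in> {x. \<kappa> x \<noteq> 0}" using \<kappa>(4) by simp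
    ultimately obtain d where d: "0 < d" "ball 0 d \<subseteq> {x. \<kappa> x \<noteq> 0}"
      using open_contains_ball by blast
    have "AE x in lborel. x \<notin> ball (0::'a) d"
      using \<open>AE x in lborel. \<kappa> x = 0\<close> by eventually_elim (use d in auto)
    then have "emeasure lborel (ball (0::'a) d) = 0"
      by (subst (asm) AE_iff_measurable[where N="ball 0 d"]) auto
    moreover have "emeasure lborel (ball (0::'a) d) \<noteq> 0"
    proof -
      have "0 < ball_vol TYPE('a) d" using d(1) by (simp add: ball_vol_def)
      then show ?thesis using d(1) by (simp add: emeasure_lborel_ball)
    qed
    ultimately show False by simp
  qed
  moreover have "0 \<le> I" unfolding I_def using \<kappa>(2) by (intro integral_nonneg_AE) auto
  ultimately have I: "0 < I" by simp
  show thesis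
  proof (rule that[of "\<lambda>z. (1 / I) * \<kappa> z" "1 / I"])
    show "smooth (\<lambda>z. (1 / I) * \<kappa> z)" by (intro smooth_intros \<kappa>(1))
    show "(\<integral>z. (1 / I) * \<kappa> z \<partial>lborel) = 1" using I by (simp flip: I_def)
  qed (use I \<kappa> out in \<open>auto simp: field_simps\<close>)
qed

text \<open>The centre of the kernel is free within distance \<open>3\<close> of the origin.\<close>
lemma kernel_shift:
  fixes \<beta> :: "'a::euclidean_space \<Rightarrow> real"
  assumes \<beta>: "smooth \<beta>" "\<And>z. 0 \<le> \<beta> z" "\<And>z. \<beta> z \<le> c" "\<And>z. 1 \<le> norm z \<Longrightarrow> \<beta> z = 0" "(\<integral>z. \<beta> z \<partial>lborel) = 1"
    and a: "norm a \<le> 3"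
  shows "kernel c (\<lambda>z. \<beta> (z - a))"
proof -
  have "smooth (\<lambda>z. \<beta> (- a + z))" by (rule smooth_affine[OF bounded_linear_ident \<beta>(1)])
  then have "smooth (\<lambda>z. \<beta> (z - a))" by simp
  moreover have "\<beta> (z - a) = 0" if "4 \<le> norm z" for z
    using norm_triangle_ineq2[of z a] a that by (intro \<beta>(4)) auto
  moreover have "(\<integral>z. \<beta> (z - a) \<partial>lborel) = 1"
  proof -
    have "\<beta> \<in> borel_measurable borel"
      by (rule borel_measurable_continuous_onI[OF smooth_continuous[OF \<beta>(1)]])
    then have "(\<integral>z. \<beta> z \<partial>distr lborel borel ((+) (- a))) = (\<integral>z. \<beta> (- a + z) \<partial>lborel)"
      by (intro integral_distr) auto
    then show ?thesis using \<beta>(5) by (simp add: lborel_distr_plus)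
  qed
  ultimately show ?thesis using \<beta>(2,3) by (simp add: kernel_def)
qed

definition slab :: "'a::euclidean_space \<Rightarrow> real \<Rightarrow> real \<Rightarrow> 'a set" where
  "slab e t \<epsilon> = {x. \<bar>x \<bullet> e + t\<bar> \<le> \<epsilon>}"

lemma slab_measurable [measurable]: "slab e t \<epsilon> \<in> sets borel"
  unfolding slab_def by measurable

definition restr :: "'a set \<Rightarrow> ('a \<Rightarrow> real) \<Rightarrow> 'a \<Rightarrow> real" where
  "restr S p x = indicator S x * p x"

lemma wsq_cut_add:
  fixes p w :: "'a::euclidean_space \<Rightarrow> real"
  assumes [measurable]: "p \<in> borel_measurable borel" "w \<in> borel_measurable borel" "S \<in> sets borel" "T \<in> sets borel"
    and "S \<inter> T = {}"
  shows "wsq w (restr (S \<union> T) p) = wsq w (restr S p) + wsq w (restr T p)"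
proof -
  have "wsq w (restr (S \<union> T) p) = (\<integral>\<^sup>+x. (ennreal ((restr S p x)\<^sup>2 * w x) + ennreal ((restr T p x)\<^sup>2 * w x)) \<partial>lborel)"
    unfolding wsq_def using assms(5) by (intro nn_integral_cong) (auto simp: restr_def indicator_def)
  also have "\<dots> = wsq w (restr S p) + wsq w (restr T p)"
    unfolding wsq_def restr_def by (rule nn_integral_add) measurable
  finally show ?thesis .
qed

lemma wsq_mono:
  assumes "\<And>x. \<bar>p x\<bar> \<le> \<bar>q x\<bar>" "\<And>x. 0 < w x"
  shows "wsq w p \<le> wsq w q"
  unfolding wsq_def using assms
  by (intro nn_integral_mono ennreal_leI mult_right_mono) (auto simp: less_imp_le abs_le_square_iff)

lemma wsq_sum_le:
  fixes p q w :: "'a::euclidean_space \<Rightarrow> real"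
  assumes [measurable]: "p \<in> borel_measurable borel" "q \<in> borel_measurable borel" "w \<in> borel_measurable borel"
    and w: "\<And>x. 0 < w x" and r: "\<And>x. \<bar>r x\<bar> \<le> \<bar>p x\<bar> + \<bar>q x\<bar>"
  shows "wsq w r \<le> 2 * wsq w p + 2 * wsq w q"
proof -
  have "wsq w r \<le> (\<integral>\<^sup>+x. (2 * ennreal ((p x)\<^sup>2 * w x) + 2 * ennreal ((q x)\<^sup>2 * w x)) \<partial>lborel)"
    unfolding wsq_def
  proof (rule nn_integral_mono)
    fix x
    have "(r x)\<^sup>2 \<le> (\<bar>p x\<bar> + \<bar>q x\<bar>)\<^sup>2" using r[of x] by (simp add: abs_le_square_iff[symmetric])
    also have "\<dots> \<le> 2 * (p x)\<^sup>2 + 2 * (q x)\<^sup>2"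
      using sum_squares_bound[of "\<bar>p x\<bar>" "\<bar>q x\<bar>"] by (simp add: power2_sum)
    finally have "(r x)\<^sup>2 * w x \<le> (2 * (p x)\<^sup>2 + 2 * (q x)\<^sup>2) * w x"
      using w[of x] by (intro mult_right_mono) auto
    also have "\<dots> = 2 * ((p x)\<^sup>2 * w x) + 2 * ((q x)\<^sup>2 * w x)" by (simp add: algebra_simps)
    finally have "ennreal ((r x)\<^sup>2 * w x) \<le> ennreal (2 * ((p x)\<^sup>2 * w x) + 2 * ((q x)\<^sup>2 * w x))"
      by (rule ennreal_leI)
    also have "\<dots> = 2 * ennreal ((p x)\<^sup>2 * w x) + 2 * ennreal ((q x)\<^sup>2 * w x)"
      using w[of x] by (subst ennreal_plus) (auto simp: ennreal_mult less_imp_le)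
    finally show "ennreal ((r x)\<^sup>2 * w x) \<le> 2 * ennreal ((p x)\<^sup>2 * w x) + 2 * ennreal ((q x)\<^sup>2 * w x)" .
  qed
  also have "\<dots> = 2 * wsq w p + 2 * wsq w q"
    unfolding wsq_def by (subst nn_integral_add) (auto simp: nn_integral_cmult)
  finally show ?thesis .
qed

text \<open>
  The hole-filling inequality: if the kernel is centred at \<open>3 e\<close>, then the mollification at
  scale \<open>\<epsilon>\<close> sees on the slab of half-width \<open>\<epsilon>\<close> only values of \<open>p\<close> in the slab of half-width
  \<open>5 \<epsilon>\<close> outside the original one.
\<close>
lemma slab_hole_filling:
  fixes p :: "'a::euclidean_space \<Rightarrow> real"
  assumes \<beta>: "smooth \<beta>" "\<And>z. 0 \<le> \<beta> z" "\<And>z. \<beta> z \<le> c" "\<And>z::'a. 1 \<le> norm z \<Longrightarrow> \<beta> z = 0" "(\<integral>z. \<beta> z \<partial>lborel) = 1"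
    and A2: "A2_weight M w" and g: "weak_grad p P" and e: "norm e = 1" and \<epsilon>: "0 < \<epsilon>"
  shows "wsq w (restr (slab e t \<epsilon>) p)
     \<le> ennreal (2 * poincare_const TYPE('a) c M * \<epsilon>\<^sup>2) * wsq w (\<lambda>x. norm (P x))
       + ennreal (2 * avg_const TYPE('a) c M) * wsq w (restr (slab e t (5 * \<epsilon>) - slab e t \<epsilon>) p)"
proof -
  have w [measurable]: "w \<in> borel_measurable borel" and wpos: "\<And>x. 0 < w x" and M: "0 \<le> M"
    using A2 by (auto simp: A2_weight_def)
  have [measurable]: "p \<in> borel_measurable borel" using g by (auto simp: weak_grad_def)
  define \<rho> where "\<rho> z = \<beta> (z - 3 *\<^sub>R e)" for z
  have k: "kernel c \<rho>" unfolding \<rho>_def by (rule kernel_shift[OF \<beta>]) (use e in auto)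
  note mm [measurable] = mollify_measurable[OF k]
  let ?S = "slab e t \<epsilon>" and ?H = "slab e t (5 * \<epsilon>) - slab e t \<epsilon>"
  let ?p = "mollify \<rho> \<epsilon> p"
  have local: "?p x = mollify \<rho> \<epsilon> (restr ?H p) x" if x: "x \<in> ?S" for x
    unfolding mollify_def
  proof (rule Bochner_Integration.integral_cong[OF refl])
    fix y
    show "scaled \<rho> \<epsilon> (x - y) * p y = scaled \<rho> \<epsilon> (x - y) * restr ?H p y"
    proof (cases "scaled \<rho> \<epsilon> (x - y) = 0")
      case False
      then have "norm ((1 / \<epsilon>) *\<^sub>R (x - y) - 3 *\<^sub>R e) < 1"
        using \<beta>(4) by (force simp: scaled_def \<rho>_def)
      then have "\<bar>((1 / \<epsilon>) *\<^sub>R (x - y) - 3 *\<^sub>R e) \<bullet> e\<bar> < 1"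
        using Cauchy_Schwarz_ineq2[of "(1 / \<epsilon>) *\<^sub>R (x - y) - 3 *\<^sub>R e" e] e by simp
      then have "\<bar>(1 / \<epsilon>) * ((x - y) \<bullet> e) - 3\<bar> < 1"
        using e by (simp only: inner_diff_left[of "(1 / \<epsilon>) *\<^sub>R (x - y)"] inner_scaleR_left)
          (simp add: dot_square_norm)
      then have "2 < (1 / \<epsilon>) * ((x - y) \<bullet> e)" "(1 / \<epsilon>) * ((x - y) \<bullet> e) < 4" by linarith+
      then have "2 * \<epsilon> < (x - y) \<bullet> e" "(x - y) \<bullet> e < 4 * \<epsilon>" using \<epsilon> by (simp_all add: field_simps)
      then have "y \<in> ?H" using x by (auto simp: slab_def inner_diff_left)
      then show ?thesis by (simp add: restr_def)
    qed simp
  qed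
  have "wsq w (restr ?S p) \<le> 2 * wsq w (\<lambda>x. p x - ?p x) + 2 * wsq w (mollify \<rho> \<epsilon> (restr ?H p))"
  proof (rule wsq_sum_le)
    show "mollify \<rho> \<epsilon> (restr ?H p) \<in> borel_measurable borel"
      by (rule mm) (simp add: restr_def[abs_def])
    fix x
    show "\<bar>restr ?S p x\<bar> \<le> \<bar>p x - ?p x\<bar> + \<bar>mollify \<rho> \<epsilon> (restr ?H p) x\<bar>"
      using local[of x] by (cases "x \<in> ?S") (auto simp: restr_def)
  qed (use wpos in auto)
  also have "\<dots> \<le> 2 * (ennreal (poincare_const TYPE('a) c M * \<epsilon>\<^sup>2) * wsq w (\<lambda>x. norm (P x)))
     + 2 * (ennreal (avg_const TYPE('a) c M) * wsq w (restr ?H p))"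
    by (intro add_mono mult_left_mono wsq_mollify_diff[OF A2 g k \<epsilon>] wsq_mollify[OF A2 k \<epsilon>])
      (auto simp: restr_def[abs_def])
  also have "\<dots> = ennreal (2 * poincare_const TYPE('a) c M * \<epsilon>\<^sup>2) * wsq w (\<lambda>x. norm (P x))
       + ennreal (2 * avg_const TYPE('a) c M) * wsq w (restr ?H p)"
    using M by (simp add: poincare_const_def avg_const_nonneg ennreal_mult mult.assoc)
  finally show ?thesis .
qed

text \<open>
  If \<open>g(\<epsilon>)\<close> is the weighted energy of \<open>p\<close> on the slab of half-width \<open>\<epsilon>\<close>, hole filling gives
  \<open>g(\<epsilon>) \<le> C (g(5 \<epsilon>) - g(\<epsilon>)) + B \<epsilon>\<^sup>2 D\<close>.  Adding \<open>C g(\<epsilon>)\<close> to both sides shows that \<open>g\<close> contracts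
  by \<open>\<gamma> = C / (1 + C) < 1\<close> from one slab to the next, up to an error that decays faster.  In the
  induction the quantity \<open>g(5\<^sup>-\<^sup>j) + B 25\<^sup>-\<^sup>j D\<close> is carried along, which absorbs the error.
\<close>
lemma slab_decay:
  "\<exists>\<gamma> B. 0 < \<gamma> \<and> \<gamma> < 1 \<and> 0 \<le> B \<and>
     (\<forall>w (p::'a::euclidean_space \<Rightarrow> real) P e t j. A2_weight M w \<longrightarrow> weak_grad p P \<longrightarrow> norm e = 1 \<longrightarrow>
        wsq w (restr (slab e t ((1/5) ^ j)) p)
          \<le> ennreal (\<gamma> ^ j) * (wsq w p + ennreal B * wsq w (\<lambda>x. norm (P x))))"
proof (cases "0 \<le> M")
  case False
  then show ?thesis by (intro exI[of _ "1/2"] exI[of _ 0]) (auto simp: A2_weight_def)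
next
  case True
  obtain \<beta> :: "'a \<Rightarrow> real" and c where \<beta>: "smooth \<beta>" "\<And>z. 0 \<le> \<beta> z" "\<And>z. \<beta> z \<le> c"
    "\<And>z. 1 \<le> norm z \<Longrightarrow> \<beta> z = 0" "(\<integral>z. \<beta> z \<partial>lborel) = 1"
    using bump_kernel_exists by metis
  define C where "C = 1 + 2 * avg_const TYPE('a) c M"
  define B where "B = 2 * poincare_const TYPE('a) c M"
  have C: "1 \<le> C" and B: "0 \<le> B"
    using True by (auto simp: C_def B_def poincare_const_def avg_const_nonneg)
  define \<gamma> where "\<gamma> = C / (1 + C)"
  \<comment> \<open>The lower bound keeps \<open>\<gamma>\<close> above the factor \<open>2/25\<close> that the error term needs.\<close>
  have \<gamma>: "1/2 \<le> \<gamma>" "\<gamma> < 1" using C by (auto simp: \<gamma>_def field_simps)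
  have "wsq w (restr (slab e t ((1/5) ^ j)) p) + ennreal (B * (1/25) ^ j) * wsq w (\<lambda>x. norm (P x))
          \<le> ennreal (\<gamma> ^ j) * (wsq w p + ennreal B * wsq w (\<lambda>x. norm (P x)))"
    if A2: "A2_weight M w" and g: "weak_grad p P" and e: "norm e = 1" for w p :: "'a \<Rightarrow> real" and P e t j
  proof (induction j)
    case 0
    have "wsq w (restr (slab e t ((1/5) ^ 0)) p) \<le> wsq w p"
      using A2 by (intro wsq_mono) (auto simp: restr_def indicator_def A2_weight_def)
    then show ?case by (simp add: add_right_mono)
  next
    case (Suc j)
    let ?\<epsilon> = "(1/5 :: real) ^ Suc j"
    let ?D = "wsq w (\<lambda>x. norm (P x))"
    define g1 where "g1 = wsq w (restr (slab e t ?\<epsilon>) p)"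
    define g2 where "g2 = wsq w (restr (slab e t (5 * ?\<epsilon>) - slab e t ?\<epsilon>) p)"
    have "p \<in> borel_measurable borel" "w \<in> borel_measurable borel"
      using g A2 by (auto simp: weak_grad_def A2_weight_def)
    then have "wsq w (restr (slab e t ?\<epsilon> \<union> (slab e t (5 * ?\<epsilon>) - slab e t ?\<epsilon>)) p) = g1 + g2"
      unfolding g1_def g2_def by (intro wsq_cut_add) auto
    moreover have "slab e t ?\<epsilon> \<union> (slab e t (5 * ?\<epsilon>) - slab e t ?\<epsilon>) = slab e t ((1/5) ^ j)"
    proof -
      have "slab e t \<epsilon> \<subseteq> slab e t (5 * \<epsilon>)" if "0 < \<epsilon>" for \<epsilon>
        using that by (auto simp: slab_def)
      from this[of ?\<epsilon>] show ?thesis by auto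
    qed
    ultimately have g12: "wsq w (restr (slab e t ((1/5) ^ j)) p) = g1 + g2" by simp
    have hole: "g1 \<le> ennreal (B * ?\<epsilon>\<^sup>2) * ?D + ennreal C * g2"
    proof -
      have "g1 \<le> ennreal (B * ?\<epsilon>\<^sup>2) * ?D + ennreal (2 * avg_const TYPE('a) c M) * g2"
        unfolding g1_def g2_def B_def by (intro slab_hole_filling[OF \<beta> A2 g e]) simp_all
      also have "\<dots> \<le> ennreal (B * ?\<epsilon>\<^sup>2) * ?D + ennreal C * g2"
        by (intro add_left_mono mult_right_mono ennreal_leI) (auto simp: C_def)
      finally show ?thesis .
    qed
    have "ennreal (1 + C) * g1 = g1 + ennreal C * g1"
      using C by (simp add: distrib_right)
    also have "\<dots> \<le> (ennreal (B * ?\<epsilon>\<^sup>2) * ?D + ennreal C * g2) + ennreal C * g1"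
      by (intro add_right_mono hole)
    also have "\<dots> = ennreal C * (g1 + g2) + ennreal (B * ?\<epsilon>\<^sup>2) * ?D"
      by (simp add: distrib_left add_ac)
    finally have "ennreal (1 / (1 + C)) * (ennreal (1 + C) * g1)
        \<le> ennreal (1 / (1 + C)) * (ennreal C * (g1 + g2) + ennreal (B * ?\<epsilon>\<^sup>2) * ?D)"
      by (rule mult_left_mono) simp
    moreover have "ennreal (1 / (1 + C)) * (ennreal (1 + C) * g1) = g1"
    proof -
      have "ennreal (1 / (1 + C)) * ennreal (1 + C) = 1"
        using C by (subst ennreal_mult[symmetric]) auto
      then show ?thesis by (metis mult.assoc mult_1)
    qed
    moreover have "ennreal (1 / (1 + C)) * (ennreal C * (g1 + g2) + ennreal (B * ?\<epsilon>\<^sup>2) * ?D)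
       = ennreal \<gamma> * (g1 + g2) + ennreal (1 / (1 + C) * (B * ?\<epsilon>\<^sup>2)) * ?D"
    proof -
      have "ennreal (1 / (1 + C)) * ennreal C = ennreal \<gamma>"
        using C unfolding \<gamma>_def by (subst ennreal_mult[symmetric]) auto
      moreover have "ennreal (1 / (1 + C)) * ennreal (B * ?\<epsilon>\<^sup>2) = ennreal (1 / (1 + C) * (B * ?\<epsilon>\<^sup>2))"
        using C B by (subst ennreal_mult) auto
      ultimately show ?thesis by (simp only: distrib_left mult.assoc[symmetric])
    qed
    ultimately have step: "g1 \<le> ennreal \<gamma> * (g1 + g2) + ennreal (1 / (1 + C) * (B * ?\<epsilon>\<^sup>2)) * ?D" by simp
    have coef: "1 / (1 + C) * (B * ?\<epsilon>\<^sup>2) + B * (1/25) ^ Suc j \<le> \<gamma> * (B * (1/25) ^ j)"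
    proof -
      have "?\<epsilon>\<^sup>2 = ((1/5)\<^sup>2) ^ Suc j" by (simp only: power_mult[symmetric] mult.commute)
      then have "?\<epsilon>\<^sup>2 = (1/25) ^ Suc j" by (simp only: power2_eq_square) simp
      moreover have "1 / (1 + C) * (B * ?\<epsilon>\<^sup>2) \<le> 1 * (B * ?\<epsilon>\<^sup>2)"
        using C B by (intro mult_right_mono) auto
      ultimately have "1 / (1 + C) * (B * ?\<epsilon>\<^sup>2) \<le> B * (1/25) ^ Suc j"
        by (simp only: mult_1)
      then have "1 / (1 + C) * (B * ?\<epsilon>\<^sup>2) + B * (1/25) ^ Suc j \<le> (2/25) * (B * (1/25) ^ j)" by simp
      also have "\<dots> \<le> \<gamma> * (B * (1/25) ^ j)" using \<gamma> B by (intro mult_right_mono) auto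
      finally show ?thesis .
    qed
    have "g1 + ennreal (B * (1/25) ^ Suc j) * ?D
       \<le> (ennreal \<gamma> * (g1 + g2) + ennreal (1 / (1 + C) * (B * ?\<epsilon>\<^sup>2)) * ?D) + ennreal (B * (1/25) ^ Suc j) * ?D"
      by (intro add_right_mono step)
    also have "\<dots> = ennreal \<gamma> * (g1 + g2) + ennreal (1 / (1 + C) * (B * ?\<epsilon>\<^sup>2) + B * (1/25) ^ Suc j) * ?D"
      using B C by (subst ennreal_plus) (auto simp: distrib_right add.assoc)
    also have "\<dots> \<le> ennreal \<gamma> * (g1 + g2) + ennreal (\<gamma> * (B * (1/25) ^ j)) * ?D"
      by (intro add_left_mono mult_right_mono ennreal_leI coef) auto
    also have "\<dots> = ennreal \<gamma> * ((g1 + g2) + ennreal (B * (1/25) ^ j) * ?D)"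
      using \<gamma> B by (simp add: distrib_left ennreal_mult mult.assoc)
    also have "\<dots> \<le> ennreal \<gamma> * (ennreal (\<gamma> ^ j) * (wsq w p + ennreal B * ?D))"
      using Suc.IH unfolding g12 by (intro mult_left_mono) auto
    also have "\<dots> = ennreal (\<gamma> ^ Suc j) * (wsq w p + ennreal B * ?D)"
      using \<gamma> by (simp add: ennreal_mult mult.assoc)
    finally show ?case unfolding g1_def .
  qed
  note main = this
  show ?thesis
  proof (rule exI[of _ \<gamma>], rule exI[of _ B], intro conjI allI impI)
    show "0 < \<gamma>" using \<gamma> by simp
    fix w p :: "'a \<Rightarrow> real" and P and e :: 'a and t j
    assume "A2_weight M w" "weak_grad p P" "norm e = 1"
    from main[OF this, of t j]
    show "wsq w (restr (slab e t ((1/5) ^ j)) p)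
          \<le> ennreal (\<gamma> ^ j) * (wsq w p + ennreal B * wsq w (\<lambda>x. norm (P x)))"
      by (rule order_trans[rotated]) simp
  qed (use \<gamma> B in auto)
qed

section \<open>The estimate at a fixed frequency\<close>

definition L2w :: "('a::euclidean_space \<Rightarrow> real) \<Rightarrow> ('a \<Rightarrow> real) \<Rightarrow> bool" where
  "L2w w p \<longleftrightarrow> p \<in> borel_measurable borel \<and> wsq w p < \<infinity>"

definition sqr :: "('a::euclidean_space \<Rightarrow> real) \<Rightarrow> ('a \<Rightarrow> real) \<Rightarrow> real" where
  "sqr w p = (\<integral>x. (p x)\<^sup>2 * w x \<partial>lborel)"

definition pos_weight :: "('a::euclidean_space \<Rightarrow> real) \<Rightarrow> bool" where
  "pos_weight w \<longleftrightarrow> w \<in> borel_measurable borel \<and> (\<forall>x. 0 < w x)"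

lemma A2_pos_weight: "A2_weight M w \<Longrightarrow> pos_weight w"
  by (auto simp: A2_weight_def pos_weight_def)

lemma pos_weightD:
  assumes "pos_weight w" shows "w \<in> borel_measurable borel" "0 < w x" "0 \<le> w x"
  using assms by (auto simp: pos_weight_def less_imp_le)

lemma L2w_sqr:
  assumes w: "pos_weight w" and p: "L2w w p"
  shows "integrable lborel (\<lambda>x. (p x)\<^sup>2 * w x)" "wsq w p = ennreal (sqr w p)"
proof -
  have [measurable]: "w \<in> borel_measurable borel" "p \<in> borel_measurable borel"
    using pos_weightD[OF w] p by (auto simp: L2w_def)
  show i: "integrable lborel (\<lambda>x. (p x)\<^sup>2 * w x)"
    using p pos_weightD[OF w] by (intro integrableI_nonneg) (auto simp: L2w_def wsq_def)
  show "wsq w p = ennreal (sqr w p)"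
    unfolding wsq_def sqr_def using i pos_weightD[OF w] by (intro nn_integral_eq_integral) auto
qed

lemma sqr_nonneg: "pos_weight w \<Longrightarrow> 0 \<le> sqr w p"
  unfolding sqr_def by (intro integral_nonneg_AE) (auto simp: pos_weightD)

lemma L2wI:
  assumes w: "pos_weight w" and p: "p \<in> borel_measurable borel" "wsq w p \<le> ennreal B" "0 \<le> B"
  shows "L2w w p" "sqr w p \<le> B"
proof -
  show L: "L2w w p" using p by (auto simp: L2w_def intro: order.strict_trans1)
  then show "sqr w p \<le> B" using L2w_sqr(2)[OF w L] p by simp
qed

lemma L2w_mono:
  assumes w: "pos_weight w" and q: "L2w w q" and p: "p \<in> borel_measurable borel" and le: "\<And>x. \<bar>p x\<bar> \<le> B * \<bar>q x\<bar>"
  shows "L2w w p" "sqr w p \<le> B\<^sup>2 * sqr w q"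
proof -
  have [measurable]: "q \<in> borel_measurable borel" "w \<in> borel_measurable borel"
    using q pos_weightD[OF w] by (auto simp: L2w_def)
  have "wsq w p \<le> (\<integral>\<^sup>+x. ennreal (B\<^sup>2) * ennreal ((q x)\<^sup>2 * w x) \<partial>lborel)"
    unfolding wsq_def
  proof (rule nn_integral_mono)
    fix x
    have "(p x)\<^sup>2 \<le> (B * \<bar>q x\<bar>)\<^sup>2"
      using le[of x] by (metis abs_ge_zero power2_abs power_mono)
    then have "(p x)\<^sup>2 * w x \<le> (B * \<bar>q x\<bar>)\<^sup>2 * w x"
      using pos_weightD[OF w] by (intro mult_right_mono) auto
    then show "ennreal ((p x)\<^sup>2 * w x) \<le> ennreal (B\<^sup>2) * ennreal ((q x)\<^sup>2 * w x)"
      using pos_weightD(2,3)[OF w, of x]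
      by (subst ennreal_mult[symmetric]) (auto intro!: ennreal_leI simp: power_mult_distrib mult.assoc)
  qed
  also have "\<dots> = ennreal (B\<^sup>2) * wsq w q"
    unfolding wsq_def by (rule nn_integral_cmult) measurable
  also have "\<dots> = ennreal (B\<^sup>2 * sqr w q)"
    using sqr_nonneg[OF w] by (simp add: L2w_sqr(2)[OF w q] ennreal_mult)
  finally have "wsq w p \<le> ennreal (B\<^sup>2 * sqr w q)" .
  from L2wI[OF w p this] show "L2w w p" "sqr w p \<le> B\<^sup>2 * sqr w q"
    using sqr_nonneg[OF w] by auto
qed

text \<open>
  Young's inequality; the parameter \<open>l\<close> is chosen later to balance the two terms.
\<close>
lemma L2w_mult:
  assumes w: "pos_weight w" and p: "L2w w p" and q: "L2w w q"
  shows "integrable lborel (\<lambda>x. p x * q x * w x)"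
    and "0 < l \<Longrightarrow> \<bar>\<integral>x. p x * q x * w x \<partial>lborel\<bar> \<le> (l * sqr w p + sqr w q / l) / 2"
proof -
  have [measurable]: "p \<in> borel_measurable borel" "q \<in> borel_measurable borel" "w \<in> borel_measurable borel"
    using p q pos_weightD[OF w] by (auto simp: L2w_def)
  note ip = L2w_sqr(1)[OF w p] and iq = L2w_sqr(1)[OF w q]
  have pt: "\<bar>p x * q x * w x\<bar> \<le> (l * ((p x)\<^sup>2 * w x) + ((q x)\<^sup>2 * w x) / l) / 2" if "0 < l" for l x
  proof -
    have "0 \<le> (l * \<bar>p x\<bar> - \<bar>q x\<bar>)\<^sup>2" by simp
    then have "2 * l * \<bar>p x * q x\<bar> \<le> l * l * (p x)\<^sup>2 + (q x)\<^sup>2"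
      by (simp add: power2_diff abs_mult power_mult_distrib power2_eq_square[of l] algebra_simps)
    then have "\<bar>p x * q x\<bar> \<le> (l * (p x)\<^sup>2 + (q x)\<^sup>2 / l) / 2"
      using that by (simp add: field_simps)
    then have "\<bar>p x * q x\<bar> * w x \<le> (l * (p x)\<^sup>2 + (q x)\<^sup>2 / l) / 2 * w x"
      using pos_weightD(2,3)[OF w, of x] by (intro mult_right_mono) auto
    then show ?thesis using pos_weightD(2,3)[OF w, of x] by (simp add: abs_mult algebra_simps)
  qed
  show "integrable lborel (\<lambda>x. p x * q x * w x)"
  proof (rule Bochner_Integration.integrable_bound)
    show "integrable lborel (\<lambda>x. (1 * ((p x)\<^sup>2 * w x) + ((q x)\<^sup>2 * w x) / 1) / 2)"
      using ip iq by simp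
    show "AE x in lborel. norm (p x * q x * w x) \<le> norm ((1 * ((p x)\<^sup>2 * w x) + ((q x)\<^sup>2 * w x) / 1) / 2)"
      using pt[of 1] by (auto intro: order_trans[OF _ abs_ge_self])
  qed measurable
  show "\<bar>\<integral>x. p x * q x * w x \<partial>lborel\<bar> \<le> (l * sqr w p + sqr w q / l) / 2" if l: "0 < l"
  proof -
    have "\<bar>\<integral>x. p x * q x * w x \<partial>lborel\<bar> \<le> (\<integral>x. \<bar>p x * q x * w x\<bar> \<partial>lborel)"
      by (rule integral_abs_bound)
    also have "\<dots> \<le> (\<integral>x. (l * ((p x)\<^sup>2 * w x) + ((q x)\<^sup>2 * w x) / l) / 2 \<partial>lborel)"
      by (rule integral_mono') (use ip iq pt[OF l] l pos_weightD[OF w] in \<open>auto intro!: add_nonneg_nonneg\<close>)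
    also have "\<dots> = (l * sqr w p + sqr w q / l) / 2"
      unfolding sqr_def using ip iq by simp
    finally show ?thesis .
  qed
qed

lemma L2w_mollify:
  fixes p :: "'a::euclidean_space \<Rightarrow> real"
  assumes A2: "A2_weight M w" and k: "kernel c \<rho>" and s: "0 < s" and p: "L2w w p"
  shows "L2w w (mollify \<rho> s p)" "sqr w (mollify \<rho> s p) \<le> avg_const TYPE('a) c M * sqr w p"
proof -
  have M: "0 \<le> M" using A2 by (auto simp: A2_weight_def)
  have pm: "p \<in> borel_measurable borel" using p by (auto simp: L2w_def)
  note w = A2_pos_weight[OF A2]
  have "wsq w (mollify \<rho> s p) \<le> ennreal (avg_const TYPE('a) c M * sqr w p)"
    using wsq_mollify[OF A2 k s pm]
    by (simp add: L2w_sqr(2)[OF w p] ennreal_mult sqr_nonneg[OF w] avg_const_nonneg[OF M])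
  from L2wI[OF w mollify_measurable[OF k pm] this]
  show "L2w w (mollify \<rho> s p)" "sqr w (mollify \<rho> s p) \<le> avg_const TYPE('a) c M * sqr w p"
    by (auto intro!: mult_nonneg_nonneg avg_const_nonneg sqr_nonneg w M)
qed

lemma L2w_mollify_diff:
  fixes p :: "'a::euclidean_space \<Rightarrow> real"
  assumes A2: "A2_weight M w" and k: "kernel c \<rho>" and s: "0 < s" and g: "weak_grad p P" and P: "L2w w (\<lambda>x. norm (P x))"
  shows "L2w w (\<lambda>x. p x - mollify \<rho> s p x)"
    "sqr w (\<lambda>x. p x - mollify \<rho> s p x) \<le> poincare_const TYPE('a) c M * s\<^sup>2 * sqr w (\<lambda>x. norm (P x))"
proof -
  have M: "0 \<le> M" using A2 by (auto simp: A2_weight_def)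
  have [measurable]: "p \<in> borel_measurable borel" using g by (auto simp: weak_grad_def)
  have [measurable]: "mollify \<rho> s p \<in> borel_measurable borel" by (rule mollify_measurable[OF k]) simp
  note w = A2_pos_weight[OF A2]
  have c0: "0 \<le> poincare_const TYPE('a) c M * s\<^sup>2"
    using M by (simp add: poincare_const_def avg_const_nonneg)
  have "wsq w (\<lambda>x. p x - mollify \<rho> s p x) \<le> ennreal (poincare_const TYPE('a) c M * s\<^sup>2 * sqr w (\<lambda>x. norm (P x)))"
    using wsq_mollify_diff[OF A2 g k s]
    by (simp add: L2w_sqr(2)[OF w P] ennreal_mult[OF c0 sqr_nonneg[OF w]])
  from L2wI[OF w _ this]
  show "L2w w (\<lambda>x. p x - mollify \<rho> s p x)"
    "sqr w (\<lambda>x. p x - mollify \<rho> s p x) \<le> poincare_const TYPE('a) c M * s\<^sup>2 * sqr w (\<lambda>x. norm (P x))"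
    using sqr_nonneg[OF w] c0 by auto
qed

text \<open>
  On a ball the product of the masses of \<open>w\<close> and \<open>1/w\<close> is finite by the \<open>A\<^sub>2\<close> condition and
  neither of them vanishes, so both are finite.
\<close>
lemma A2_weight_finite:
  assumes A2: "A2_weight M w" and r: "0 < r"
  shows "(\<integral>\<^sup>+x\<in>ball c r. ennreal (w x) \<partial>lborel) < \<infinity>" "(\<integral>\<^sup>+x\<in>ball c r. ennreal (1 / w x) \<partial>lborel) < \<infinity>"
proof -
  let ?a = "\<integral>\<^sup>+x\<in>ball c r. ennreal (w x) \<partial>lborel" and ?b = "\<integral>\<^sup>+x\<in>ball c r. ennreal (1 / w x) \<partial>lborel"
  note w = pos_weightD[OF A2_pos_weight[OF A2]]
  note w(1)[measurable]
  have V: "0 < ball_vol TYPE('a) r" using r by (simp add: ball_vol_def)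
  have le: "?a * ?b \<le> ennreal M * (emeasure lborel (ball c r))\<^sup>2" using A2 r by (auto simp: A2_weight_def)
  have "ennreal M * (emeasure lborel (ball c r))\<^sup>2 < \<infinity>"
    using r V by (simp add: emeasure_lborel_ball ennreal_power ennreal_mult_less_top)
  then have fin: "?a * ?b < \<infinity>" using le by (rule order.strict_trans1[rotated])
  have pos: "(\<integral>\<^sup>+x\<in>ball c r. ennreal (v x) \<partial>lborel) \<noteq> 0"
    if v: "v \<in> borel_measurable borel" "\<And>x. 0 < v x" for v
  proof
    note v(1)[measurable]
    assume "(\<integral>\<^sup>+x\<in>ball c r. ennreal (v x) \<partial>lborel) = 0"
    then have "AE x in lborel. ennreal (v x) * indicator (ball c r) x = 0"
      by (subst (asm) nn_integral_0_iff_AE) auto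
    moreover have "ennreal (v x) \<noteq> 0" for x using v(2)[of x] by (simp add: ennreal_eq_0_iff not_le)
    ultimately have "AE x in lborel. x \<notin> ball c r"
      by (auto elim!: eventually_mono simp: indicator_def split: if_splits)
    then have "emeasure lborel (ball c r) = 0"
      by (subst (asm) AE_iff_measurable[where N="ball c r"]) auto
    then show False using V r by (simp add: emeasure_lborel_ball)
  qed
  have "?a \<noteq> 0" "?b \<noteq> 0" by (rule pos; use w in simp)+
  then show "?a < \<infinity>" "?b < \<infinity>"
    using fin by (auto simp: ennreal_mult_less_top ennreal_mult_eq_top_iff less_top)
qed

text \<open>
  Unweighted integrability comes from \<open>|q| \<le> q\<^sup>2 w + 1/w\<close> and the local integrability of \<open>1/w\<close>.
\<close>
lemma L2w_compact_support_integrable: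
  assumes A2: "A2_weight M w" and q: "L2w w q" "\<And>x. x \<notin> cball 0 R \<Longrightarrow> q x = 0"
  shows "integrable lborel (\<lambda>x. q x * w x)" "integrable lborel q"
proof -
  define r where "r = max R 0 + 1"
  have r: "0 < r" "cball 0 R \<subseteq> ball (0::'a) r" by (auto simp: r_def)
  note w = pos_weightD[OF A2_pos_weight[OF A2]]
  have [measurable]: "w \<in> borel_measurable borel" "q \<in> borel_measurable borel" using w q by (auto simp: L2w_def)
  have "L2w w (indicator (ball 0 r))"
  proof -
    have "wsq w (indicator (ball 0 r)) = (\<integral>\<^sup>+x\<in>ball 0 r. ennreal (w x) \<partial>lborel)"
      unfolding wsq_def by (intro nn_integral_cong) (auto simp: indicator_def)
    then show ?thesis using A2_weight_finite(1)[OF A2 r(1)] by (simp add: L2w_def)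
  qed
  from L2w_mult(1)[OF A2_pos_weight[OF A2] q(1) this]
  have "integrable lborel (\<lambda>x. q x * indicator (ball 0 r) x * w x)" .
  moreover have "q x * indicator (ball 0 r) x * w x = q x * w x" for x
  proof (cases "x \<in> ball 0 r")
    case False
    then have "x \<notin> cball 0 R" using r(2) by blast
    then show ?thesis using q(2)[of x] by simp
  qed simp
  ultimately show "integrable lborel (\<lambda>x. q x * w x)" by simp
  have i1: "integrable lborel (\<lambda>x. (q x)\<^sup>2 * w x)" by (rule L2w_sqr(1)[OF A2_pos_weight[OF A2] q(1)])
  have i2: "integrable lborel (\<lambda>x. (1 / w x) * indicator (ball 0 r) x)"
  proof (rule integrableI_nonneg)
    have "(\<integral>\<^sup>+x. ennreal ((1 / w x) * indicator (ball 0 r) x) \<partial>lborel) = (\<integral>\<^sup>+x\<in>ball 0 r. ennreal (1 / w x) \<partial>lborel)"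
      by (intro nn_integral_cong) (auto simp: indicator_def)
    then show "(\<integral>\<^sup>+x. ennreal ((1 / w x) * indicator (ball 0 r) x) \<partial>lborel) < \<infinity>"
      using A2_weight_finite(2)[OF A2 r(1)] by simp
  qed (use w in \<open>auto simp: less_imp_le\<close>)
  show "integrable lborel q"
  proof (rule Bochner_Integration.integrable_bound)
    show "integrable lborel (\<lambda>x. (q x)\<^sup>2 * w x + (1 / w x) * indicator (ball 0 r) x)" using i1 i2 by simp
    show "AE x in lborel. norm (q x) \<le> norm ((q x)\<^sup>2 * w x + (1 / w x) * indicator (ball 0 r) x)"
    proof (rule AE_I2)
      fix x
      show "norm (q x) \<le> norm ((q x)\<^sup>2 * w x + (1 / w x) * indicator (ball 0 r) x)"
      proof (cases "x \<in> ball 0 r")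
        case True
        have "\<bar>q x\<bar> \<le> (q x)\<^sup>2 * w x + 1 / w x"
        proof -
          have "0 \<le> (\<bar>q x\<bar> * w x - 1)\<^sup>2 + \<bar>q x\<bar> * w x" using w(3)[of x] by simp
          then have "\<bar>q x\<bar> * w x \<le> (q x)\<^sup>2 * (w x * w x) + 1"
            by (simp add: power2_diff power_mult_distrib power2_eq_square[of "w x"]) (simp add: mult.commute)
          then show ?thesis using w(2)[of x] by (simp add: field_simps)
        qed
        then show ?thesis using True by (auto intro: order_trans[OF _ abs_ge_self])
      next
        case False
        then have "x \<notin> cball 0 R" using r(2) by blast
        then show ?thesis using q(2)[of x] by simp
      qed
    qed
  qed measurable
qed

text \<open>
  Moves a convolution from one factor to the other.  It turns the equation tested with a kernel
  centred at \<open>y\<close>, integrated against \<open>p(y)\<close>, into the equation tested with a mollification of \<open>p\<close>.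
\<close>
lemma weighted_convolution_swap:
  fixes F w p H :: "'a::euclidean_space \<Rightarrow> real"
  assumes F: "integrable lborel (\<lambda>x. F x * w x)" and p: "integrable lborel p"
    and H: "H \<in> borel_measurable borel" "\<And>z. \<bar>H z\<bar> \<le> B"
    and [measurable]: "F \<in> borel_measurable borel" "w \<in> borel_measurable borel"
  shows "integrable lborel (\<lambda>y. p y * (\<integral>x. F x * H (x - y) * w x \<partial>lborel))"
    and "(\<integral>y. p y * (\<integral>x. F x * H (x - y) * w x \<partial>lborel) \<partial>lborel)
       = (\<integral>x. F x * (\<integral>y. H (x - y) * p y \<partial>lborel) * w x \<partial>lborel)"
proof -
  have [measurable]: "p \<in> borel_measurable borel" using p by auto
  note H(1)[measurable]
  have int: "integrable (lborel \<Otimes>\<^sub>M lborel) (\<lambda>z. H (fst z - snd z) * ((F (fst z) * w (fst z)) * p (snd z)))"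
    by (rule integrable_bounded_mult[where B=B])
      (use H(2) in \<open>auto intro!: integrable_times[of lborel lborel "\<lambda>x. F x * w x" p] F p lborel.sigma_finite_measure_axioms\<close>)
  have int': "integrable (lborel \<Otimes>\<^sub>M lborel) (\<lambda>(x, y). p y * (F x * H (x - y) * w x))"
    by (rule Bochner_Integration.integrable_cong[THEN iffD1, OF refl _ int]) (auto simp: mult_ac)
  have eq: "(\<integral>x. p y * (F x * H (x - y) * w x) \<partial>lborel) = p y * (\<integral>x. F x * H (x - y) * w x \<partial>lborel)" for y
    by simp
  show "integrable lborel (\<lambda>y. p y * (\<integral>x. F x * H (x - y) * w x \<partial>lborel))"
    using lborel_pair.integrable_snd[OF int'] by simp
  have "(\<integral>y. p y * (\<integral>x. F x * H (x - y) * w x \<partial>lborel) \<partial>lborel)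
      = (\<integral>y. (\<integral>x. p y * (F x * H (x - y) * w x) \<partial>lborel) \<partial>lborel)" by simp
  also have "\<dots> = (\<integral>x. (\<integral>y. p y * (F x * H (x - y) * w x) \<partial>lborel) \<partial>lborel)"
    by (rule lborel_pair.Fubini_integral[OF int'])
  also have "\<dots> = (\<integral>x. F x * (\<integral>y. H (x - y) * p y \<partial>lborel) * w x \<partial>lborel)"
  proof (rule Bochner_Integration.integral_cong[OF refl])
    fix x
    have "(\<integral>y. p y * (F x * H (x - y) * w x) \<partial>lborel) = (\<integral>y. (F x * w x) * (H (x - y) * p y) \<partial>lborel)"
      by (simp add: mult_ac)
    also have "\<dots> = (F x * w x) * (\<integral>y. H (x - y) * p y \<partial>lborel)" by simp
    finally show "(\<integral>y. p y * (F x * H (x - y) * w x) \<partial>lborel) = F x * (\<integral>y. H (x - y) * p y \<partial>lborel) * w x"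
      by (simp add: mult_ac)
  qed
  finally show "(\<integral>y. p y * (\<integral>x. F x * H (x - y) * w x \<partial>lborel) \<partial>lborel)
       = (\<integral>x. F x * (\<integral>y. H (x - y) * p y \<partial>lborel) * w x \<partial>lborel)" .
qed

text \<open>
  The weak form of \<open>a w p = - div (w \<Phi>) + w G\<close>, where \<open>a = x \<bullet> u + \<tau>\<close>.
\<close>
definition transport_eq :: "('a::euclidean_space \<Rightarrow> real) \<Rightarrow> 'a \<Rightarrow> real \<Rightarrow> ('a \<Rightarrow> real) \<Rightarrow> ('a \<Rightarrow> 'a) \<Rightarrow> ('a \<Rightarrow> real) \<Rightarrow> bool"
  where "transport_eq w u \<tau> p \<Phi> G \<longleftrightarrow> (\<forall>h. smooth h \<longrightarrow>
     (\<integral>x. (x \<bullet> u + \<tau>) * p x * h x * w x \<partial>lborel)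
       = (\<integral>x. (\<Phi> x \<bullet> grad h x) * w x \<partial>lborel) + (\<integral>x. G x * h x * w x \<partial>lborel))"

definition total_sqr where
  "total_sqr w p P \<Phi> G = sqr w p + sqr w (\<lambda>x. norm (P x)) + sqr w (\<lambda>x. norm (\<Phi> x)) + sqr w G"

definition energy_const :: "'a::euclidean_space itself \<Rightarrow> real \<Rightarrow> real \<Rightarrow> real" where
  "energy_const T c M = 1 + avg_const T c M + poincare_const T c M"

lemma sqr_norm_components:
  fixes P :: "'a::euclidean_space \<Rightarrow> 'a"
  assumes w: "pos_weight w" and P: "P \<in> borel_measurable borel" "L2w w (\<lambda>x. norm (P x))"
  shows "\<And>b. b \<in> Basis \<Longrightarrow> L2w w (\<lambda>x. P x \<bullet> b)"
    and "(\<Sum>b\<in>Basis. sqr w (\<lambda>x. P x \<bullet> b)) = sqr w (\<lambda>x. norm (P x))"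
proof -
  note P(1)[measurable]
  show L: "L2w w (\<lambda>x. P x \<bullet> b)" if "b \<in> Basis" for b
    by (rule L2w_mono(1)[OF w P(2), where B=1]) (use that in \<open>auto simp: Basis_le_norm\<close>)
  have "(\<Sum>b\<in>Basis. sqr w (\<lambda>x. P x \<bullet> b)) = (\<integral>x. (\<Sum>b\<in>Basis. (P x \<bullet> b)\<^sup>2 * w x) \<partial>lborel)"
    unfolding sqr_def using L2w_sqr(1)[OF w L] by (subst Bochner_Integration.integral_sum) auto
  also have "\<dots> = sqr w (\<lambda>x. norm (P x))"
    unfolding sqr_def power2_norm_eq_inner
    by (subst (2) euclidean_inner) (simp add: sum_distrib_right power2_eq_square)
  finally show "(\<Sum>b\<in>Basis. sqr w (\<lambda>x. P x \<bullet> b)) = sqr w (\<lambda>x. norm (P x))" .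
qed

text \<open>
  Testing the equation with \<open>a\<close> times the mollification of \<open>p\<close> at scale \<open>\<epsilon>\<close>, where
  \<open>a = x \<bullet> u + \<tau>\<close> is the symbol of the transport operator, produces the integral of \<open>a\<^sup>2 p\<^sup>2 w\<close> up to
  the error \<open>a\<^sup>2 p (p - K\<^sub>\<epsilon> * p) w\<close>.  On the support both \<open>a\<close> and its gradient \<open>u\<close> are at most
  \<open>\<Lambda>\<close>, and the derivative that falls on the mollification is taken by the weak gradient of \<open>p\<close>,
  so every term on the right is of order \<open>\<Lambda>\<close>.  The error is of order \<open>\<Lambda>\<^sup>2 \<epsilon>\<close> by the Poincare
  inequality, which is again \<open>\<Lambda>\<close> for \<open>\<epsilon> = 1/\<Lambda>\<close>.
\<close>
lemma energy_estimate:
  fixes p G w \<rho> :: "'a::euclidean_space \<Rightarrow> real" and P \<Phi> :: "'a \<Rightarrow> 'a"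
  assumes A2: "A2_weight M w" and k: "kernel c \<rho>" and g: "weak_grad p P"
    and pL: "L2w w p" and PL: "L2w w (\<lambda>x. norm (P x))"
    and \<Phi>m: "\<Phi> \<in> borel_measurable borel" and \<Phi>L: "L2w w (\<lambda>x. norm (\<Phi> x))" and GL: "L2w w G"
    and supp: "\<And>x. x \<notin> cball 0 R \<Longrightarrow> p x = 0" "\<And>x. x \<notin> cball 0 R \<Longrightarrow> \<Phi> x = 0" "\<And>x. x \<notin> cball 0 R \<Longrightarrow> G x = 0"
    and \<Lambda>: "1 \<le> \<Lambda>" "norm u \<le> \<Lambda>" "\<And>x. x \<in> cball 0 R \<Longrightarrow> \<bar>x \<bullet> u + \<tau>\<bar> \<le> \<Lambda>"
    and eq: "transport_eq w u \<tau> p \<Phi> G"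
  shows "L2w w (\<lambda>x. (x \<bullet> u + \<tau>) * p x)"
    and "sqr w (\<lambda>x. (x \<bullet> u + \<tau>) * p x) \<le> energy_const TYPE('a) c M * \<Lambda> * total_sqr w p P \<Phi> G"
proof -
  note w = A2_pos_weight[OF A2]
  have [measurable]: "w \<in> borel_measurable borel" "p \<in> borel_measurable borel" "P \<in> borel_measurable borel"
    "G \<in> borel_measurable borel"
    using pos_weightD[OF w] g GL by (auto simp: weak_grad_def L2w_def)
  note \<Phi>m[measurable]
  have M: "0 \<le> M" using A2 by (auto simp: A2_weight_def)
  define a where "a x = x \<bullet> u + \<tau>" for x
  have [measurable]: "a \<in> borel_measurable borel" unfolding a_def by measurable
  have pint: "integrable lborel p" using g by (auto simp: weak_grad_def)
  define \<epsilon> where "\<epsilon> = 1 / \<Lambda>"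
  have \<epsilon>: "0 < \<epsilon>" using \<Lambda>(1) by (simp add: \<epsilon>_def)
  note sm = smooth_scaled[OF kernelD(1)[OF k], of \<epsilon>]
  let ?K = "scaled \<rho> \<epsilon>"
  have aL: "L2w w (\<lambda>x. a x * q x)" "sqr w (\<lambda>x. a x * q x) \<le> \<Lambda>\<^sup>2 * sqr w q"
    if "L2w w q" "\<And>x. x \<notin> cball 0 R \<Longrightarrow> q x = 0" for q
  proof -
    have m: "(\<lambda>x. a x * q x) \<in> borel_measurable borel" using that by (auto simp: L2w_def)
    have "\<bar>a x * q x\<bar> \<le> \<Lambda> * \<bar>q x\<bar>" for x
      using that(2)[of x] \<Lambda>(3)[of x] by (cases "x \<in> cball 0 R") (auto simp: abs_mult a_def mult_right_mono)
    from L2w_mono[OF w that(1) m this] show "L2w w (\<lambda>x. a x * q x)" "sqr w (\<lambda>x. a x * q x) \<le> \<Lambda>\<^sup>2 * sqr w q" by auto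
  qed
  have ap: "L2w w (\<lambda>x. a x * p x)" and aap: "L2w w (\<lambda>x. a x * (a x * p x))"
    and aaps: "sqr w (\<lambda>x. a x * (a x * p x)) \<le> \<Lambda>\<^sup>2 * (\<Lambda>\<^sup>2 * sqr w p)"
  proof -
    show 1: "L2w w (\<lambda>x. a x * p x)" by (rule aL[OF pL supp(1)])
    show "L2w w (\<lambda>x. a x * (a x * p x))" by (rule aL[OF 1]) (metis supp(1) mult_zero_right)+
    have "sqr w (\<lambda>x. a x * (a x * p x)) \<le> \<Lambda>\<^sup>2 * sqr w (\<lambda>x. a x * p x)" by (rule aL(2)[OF 1]) (metis supp(1) mult_zero_right)+
    also have "\<dots> \<le> \<Lambda>\<^sup>2 * (\<Lambda>\<^sup>2 * sqr w p)" by (intro mult_left_mono aL(2)[OF pL supp(1)]) auto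
    finally show "sqr w (\<lambda>x. a x * (a x * p x)) \<le> \<Lambda>\<^sup>2 * (\<Lambda>\<^sup>2 * sqr w p)" .
  qed
  show "L2w w (\<lambda>x. (x \<bullet> u + \<tau>) * p x)" using ap by (simp add: a_def)
  note \<Phi>c = sqr_norm_components[OF w \<Phi>m \<Phi>L]
  have \<Phi>0: "\<Phi> x \<bullet> b = 0" if "x \<notin> cball 0 R" for x b using supp(2)[OF that] by simp
  note a\<Phi> = aL[OF \<Phi>c(1) \<Phi>0]
  have uL: "L2w w (\<lambda>x. \<Phi> x \<bullet> u)" "sqr w (\<lambda>x. \<Phi> x \<bullet> u) \<le> \<Lambda>\<^sup>2 * sqr w (\<lambda>x. norm (\<Phi> x))"
  proof -
    have "\<bar>\<Phi> x \<bullet> u\<bar> \<le> \<Lambda> * \<bar>norm (\<Phi> x)\<bar>" for x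
      using Cauchy_Schwarz_ineq2[of "\<Phi> x" u] mult_left_mono[OF \<Lambda>(2), of "norm (\<Phi> x)"] by (simp add: mult.commute)
    from L2w_mono[OF w \<Phi>L _ this] show "L2w w (\<lambda>x. \<Phi> x \<bullet> u)" "sqr w (\<lambda>x. \<Phi> x \<bullet> u) \<le> \<Lambda>\<^sup>2 * sqr w (\<lambda>x. norm (\<Phi> x))"
      by auto
  qed
  note aG = aL[OF GL supp(3)]
  note int = L2w_compact_support_integrable(1)[OF A2, where R=R]
  have i1: "integrable lborel (\<lambda>x. (a x * (a x * p x)) * w x)" by (rule int[OF aap]) (metis supp(1) mult_zero_right)+
  have i2: "integrable lborel (\<lambda>x. (\<Phi> x \<bullet> u) * w x)" by (rule int[OF uL(1) \<Phi>0])
  have i3: "integrable lborel (\<lambda>x. (a x * (\<Phi> x \<bullet> b)) * w x)" if "b \<in> Basis" for b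
    by (rule int[OF a\<Phi>(1)[OF that]]) (metis \<Phi>0 mult_zero_right)+
  have i4: "integrable lborel (\<lambda>x. (a x * G x) * w x)" by (rule int[OF aG(1)]) (metis supp(3) mult_zero_right)+
  have Kb: "\<exists>B. \<forall>z. \<bar>?K z\<bar> \<le> B"
  proof -
    have "?K z = 0" if "z \<notin> cball 0 (4 * \<epsilon>)" for z
      using scaled_outside[OF k \<epsilon>, where x=0 and y="-z"] that by simp
    then show ?thesis
      using bounded_of_compact_support[OF smooth_continuous[OF sm], of 0 "4 * \<epsilon>"] by (metis real_norm_def)
  qed
  then obtain B1 where B1: "\<And>z. \<bar>?K z\<bar> \<le> B1" by auto
  have dKb: "\<exists>B. \<forall>z. \<bar>grad ?K z \<bullet> b\<bar> \<le> B" for b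
  proof -
    have "grad ?K z \<bullet> b = 0" if "z \<notin> cball 0 (4 * \<epsilon>)" for z
    proof -
      have "grad ?K z = 0"
      proof (rule grad_zero_outside[of "- cball 0 (4 * \<epsilon>)"])
        show "?K y = 0" if "y \<in> - cball 0 (4 * \<epsilon>)" for y
          using scaled_outside[OF k \<epsilon>, where x=0 and y="-y"] that by simp
      qed (use that in auto)
      then show ?thesis by simp
    qed
    moreover have "continuous_on UNIV (\<lambda>z. grad ?K z \<bullet> b)"
      by (intro continuous_intros smooth_continuous_grad sm)
    ultimately show ?thesis
      using bounded_of_compact_support[of "\<lambda>z. grad ?K z \<bullet> b" 0 "4 * \<epsilon>"] by (metis real_norm_def)
  qed
  then obtain B2 where B2: "\<And>b z. \<bar>grad ?K z \<bullet> b\<bar> \<le> B2 b" by metis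
  have Km: "?K \<in> borel_measurable borel" by (rule scaled_measurable[OF k])
  have dKm: "(\<lambda>z. grad ?K z \<bullet> b) \<in> borel_measurable borel" for b
    by (intro borel_measurable_continuous_onI continuous_intros smooth_continuous_grad sm)
  note Km[measurable] dKm[measurable]
  \<comment> \<open>the equation tested with \<open>a\<close> times the kernel centred at \<open>y\<close>\<close>
  have tested: "(\<integral>x. (a x * (a x * p x)) * ?K (x - y) * w x \<partial>lborel)
     = (\<integral>x. (\<Phi> x \<bullet> u) * ?K (x - y) * w x \<partial>lborel)
       + (\<Sum>b\<in>Basis. (\<integral>x. (a x * (\<Phi> x \<bullet> b)) * (grad ?K (x - y) \<bullet> b) * w x \<partial>lborel))
       + (\<integral>x. (a x * G x) * ?K (x - y) * w x \<partial>lborel)" for y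
  proof -
    let ?h = "\<lambda>x. a x * ?K (x - y)"
    have sK: "smooth (\<lambda>x. ?K (x - y))"
      using smooth_affine[OF bounded_linear_ident sm, of "-y"] by simp
    have sa: "smooth a" unfolding a_def by (intro smooth_intros)
    have ga: "grad a x = u" for x
      unfolding a_def by (rule grad_unique) (auto intro!: derivative_eq_intros simp: inner_commute)
    have gK: "grad (\<lambda>x. ?K (x - y)) x = grad ?K (x - y)" for x
    proof (rule grad_unique)
      show "((\<lambda>x. ?K (x - y)) has_derivative (\<lambda>v. grad ?K (x - y) \<bullet> v)) (at x)"
        by (rule has_derivative_compose[OF _ smooth_has_derivative[OF sm], where f'="\<lambda>v. v"])
          (auto intro!: derivative_eq_intros)
    qed
    have gh: "grad ?h x = a x *\<^sub>R grad ?K (x - y) + ?K (x - y) *\<^sub>R u" for x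
      by (subst grad_mult[OF sa sK]) (simp only: ga gK)
    have j2: "integrable lborel (\<lambda>x. ?K (x - y) * ((\<Phi> x \<bullet> u) * w x))"
      by (rule integrable_bounded_mult[OF i2, where B=B1]) (use B1 in auto)
    have j3: "integrable lborel (\<lambda>x. (grad ?K (x - y) \<bullet> b) * ((a x * (\<Phi> x \<bullet> b)) * w x))" if "b \<in> Basis" for b
      by (rule integrable_bounded_mult[OF i3[OF that], where B="B2 b"]) (use B2 in auto)
    have "(\<integral>x. a x * p x * ?h x * w x \<partial>lborel) = (\<integral>x. (\<Phi> x \<bullet> grad ?h x) * w x \<partial>lborel) + (\<integral>x. G x * ?h x * w x \<partial>lborel)"
      using eq smooth_mult[OF sa sK] unfolding transport_eq_def a_def by blast
    moreover have "(\<integral>x. (\<Phi> x \<bullet> grad ?h x) * w x \<partial>lborel)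
       = (\<integral>x. (\<Sum>b\<in>Basis. (grad ?K (x - y) \<bullet> b) * ((a x * (\<Phi> x \<bullet> b)) * w x)) + ?K (x - y) * ((\<Phi> x \<bullet> u) * w x) \<partial>lborel)"
    proof (rule Bochner_Integration.integral_cong[OF refl])
      fix x
      have "\<Phi> x \<bullet> grad ?h x = a x * (\<Phi> x \<bullet> grad ?K (x - y)) + ?K (x - y) * (\<Phi> x \<bullet> u)"
        by (simp add: gh inner_add_right)
      also have "\<Phi> x \<bullet> grad ?K (x - y) = (\<Sum>b\<in>Basis. (\<Phi> x \<bullet> b) * (grad ?K (x - y) \<bullet> b))"
        by (rule euclidean_inner)
      finally show "(\<Phi> x \<bullet> grad ?h x) * w x
         = (\<Sum>b\<in>Basis. (grad ?K (x - y) \<bullet> b) * ((a x * (\<Phi> x \<bullet> b)) * w x)) + ?K (x - y) * ((\<Phi> x \<bullet> u) * w x)"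
        by (simp add: distrib_left distrib_right sum_distrib_left sum_distrib_right mult_ac)
    qed
    moreover have "\<dots> = (\<Sum>b\<in>Basis. (\<integral>x. (grad ?K (x - y) \<bullet> b) * ((a x * (\<Phi> x \<bullet> b)) * w x) \<partial>lborel))
        + (\<integral>x. ?K (x - y) * ((\<Phi> x \<bullet> u) * w x) \<partial>lborel)"
      using j2 j3 by (subst Bochner_Integration.integral_add) (auto intro!: Bochner_Integration.integral_sum)
    ultimately show ?thesis by (simp add: mult_ac)
  qed
  note sw = weighted_convolution_swap[OF _ pint]
  note s1 = sw[OF i1 Km B1] and s2 = sw[OF i2 Km B1] and s4 = sw[OF i4 Km B1]
  note s3 = sw[OF i3 dKm B2]
  let ?m = "mollify \<rho> \<epsilon>"
  have weak: "(\<integral>y. (grad ?K (x - y) \<bullet> b) * p y \<partial>lborel) = ?m (\<lambda>y. P y \<bullet> b) x" if "b \<in> Basis" for b x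
    by (rule mollify_weak_grad[OF g k that])
  have main: "(\<integral>x. (a x * (a x * p x)) * ?m p x * w x \<partial>lborel)
     = (\<integral>x. (\<Phi> x \<bullet> u) * ?m p x * w x \<partial>lborel)
       + (\<Sum>b\<in>Basis. (\<integral>x. (a x * (\<Phi> x \<bullet> b)) * ?m (\<lambda>y. P y \<bullet> b) x * w x \<partial>lborel))
       + (\<integral>x. (a x * G x) * ?m p x * w x \<partial>lborel)"
  proof -
    have "(\<integral>x. (a x * (a x * p x)) * ?m p x * w x \<partial>lborel)
      = (\<integral>y. p y * (\<integral>x. (a x * (a x * p x)) * ?K (x - y) * w x \<partial>lborel) \<partial>lborel)"
      unfolding mollify_def by (rule s1(2)[symmetric]) measurable
    also have "\<dots> = (\<integral>y. p y * (\<integral>x. (\<Phi> x \<bullet> u) * ?K (x - y) * w x \<partial>lborel)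
       + (\<Sum>b\<in>Basis. p y * (\<integral>x. (a x * (\<Phi> x \<bullet> b)) * (grad ?K (x - y) \<bullet> b) * w x \<partial>lborel))
       + p y * (\<integral>x. (a x * G x) * ?K (x - y) * w x \<partial>lborel) \<partial>lborel)"
      by (subst tested) (simp only: distrib_left sum_distrib_left)
    also have "\<dots> = (\<integral>y. p y * (\<integral>x. (\<Phi> x \<bullet> u) * ?K (x - y) * w x \<partial>lborel) \<partial>lborel)
       + (\<Sum>b\<in>Basis. (\<integral>y. p y * (\<integral>x. (a x * (\<Phi> x \<bullet> b)) * (grad ?K (x - y) \<bullet> b) * w x \<partial>lborel) \<partial>lborel))
       + (\<integral>y. p y * (\<integral>x. (a x * G x) * ?K (x - y) * w x \<partial>lborel) \<partial>lborel)"
      by (subst Bochner_Integration.integral_add; (subst Bochner_Integration.integral_add)?;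
          (subst Bochner_Integration.integral_sum)?; (intro Bochner_Integration.integrable_add Bochner_Integration.integrable_sum)?;
          (rule s2(1) s3(1) s4(1) refl)?; measurable?)
    also have "\<dots> = (\<integral>x. (\<Phi> x \<bullet> u) * ?m p x * w x \<partial>lborel)
       + (\<Sum>b\<in>Basis. (\<integral>x. (a x * (\<Phi> x \<bullet> b)) * ?m (\<lambda>y. P y \<bullet> b) x * w x \<partial>lborel))
       + (\<integral>x. (a x * G x) * ?m p x * w x \<partial>lborel)"
    proof -
      have "(\<integral>y. p y * (\<integral>x. (a x * (\<Phi> x \<bullet> b)) * (grad ?K (x - y) \<bullet> b) * w x \<partial>lborel) \<partial>lborel)
          = (\<integral>x. (a x * (\<Phi> x \<bullet> b)) * ?m (\<lambda>y. P y \<bullet> b) x * w x \<partial>lborel)" if b: "b \<in> Basis" for b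
        unfolding weak[OF b, symmetric] by (rule s3(2)[OF b]) measurable
      moreover have "(\<integral>y. p y * (\<integral>x. (\<Phi> x \<bullet> u) * ?K (x - y) * w x \<partial>lborel) \<partial>lborel) = (\<integral>x. (\<Phi> x \<bullet> u) * ?m p x * w x \<partial>lborel)"
        unfolding mollify_def by (rule s2(2)) measurable
      moreover have "(\<integral>y. p y * (\<integral>x. (a x * G x) * ?K (x - y) * w x \<partial>lborel) \<partial>lborel) = (\<integral>x. (a x * G x) * ?m p x * w x \<partial>lborel)"
        unfolding mollify_def by (rule s4(2)) measurable
      ultimately show ?thesis by simp
    qed
    finally show ?thesis .
  qed
  let ?A = "avg_const TYPE('a) c M" and ?Q = "poincare_const TYPE('a) c M"
  have A0: "0 \<le> ?A" and Q0: "0 \<le> ?Q" using M by (auto simp: poincare_const_def avg_const_nonneg)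
  let ?sp = "sqr w p" and ?sP = "sqr w (\<lambda>x. norm (P x))" and ?s\<Phi> = "sqr w (\<lambda>x. norm (\<Phi> x))" and ?sG = "sqr w G"
  note nn = sqr_nonneg[OF w]
  note mp = L2w_mollify[OF A2 k \<epsilon> pL]
  have L0: "0 < 1 / \<Lambda>" using \<Lambda>(1) by simp
  have prod_bound: "\<bar>\<integral>x. f x * ?m q x * w x \<partial>lborel\<bar> \<le> \<Lambda> / 2 * (Sf + ?A * sqr w q)"
    if f: "L2w w f" "sqr w f \<le> \<Lambda>\<^sup>2 * Sf" and q: "L2w w q" for f q Sf
  proof -
    note mq = L2w_mollify[OF A2 k \<epsilon> q]
    have "\<bar>\<integral>x. f x * ?m q x * w x \<partial>lborel\<bar> \<le> ((1 / \<Lambda>) * sqr w f + sqr w (?m q) / (1 / \<Lambda>)) / 2"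
      by (rule L2w_mult(2)[OF w f(1) mq(1) L0])
    also have "\<dots> \<le> ((1 / \<Lambda>) * (\<Lambda>\<^sup>2 * Sf) + (?A * sqr w q) / (1 / \<Lambda>)) / 2"
      using \<Lambda>(1) f(2) mq(2) by (intro divide_right_mono add_mono mult_left_mono) auto
    also have "\<dots> = \<Lambda> / 2 * (Sf + ?A * sqr w q)"
      using \<Lambda>(1) by (simp add: field_simps power2_eq_square)
    finally show ?thesis .
  qed
  have b1: "\<bar>\<integral>x. (\<Phi> x \<bullet> u) * ?m p x * w x \<partial>lborel\<bar> \<le> \<Lambda> / 2 * (?s\<Phi> + ?A * ?sp)"
    by (rule prod_bound[OF uL pL])
  have b3: "\<bar>\<integral>x. (a x * G x) * ?m p x * w x \<partial>lborel\<bar> \<le> \<Lambda> / 2 * (?sG + ?A * ?sp)"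
    by (rule prod_bound[OF aG pL])
  have Pm: "P \<in> borel_measurable borel" by simp
  note Pc = sqr_norm_components[OF w Pm PL]
  have b2: "\<bar>\<Sum>b\<in>Basis. (\<integral>x. (a x * (\<Phi> x \<bullet> b)) * ?m (\<lambda>y. P y \<bullet> b) x * w x \<partial>lborel)\<bar> \<le> \<Lambda> / 2 * (?s\<Phi> + ?A * ?sP)"
  proof -
    have "\<bar>\<Sum>b\<in>Basis. (\<integral>x. (a x * (\<Phi> x \<bullet> b)) * ?m (\<lambda>y. P y \<bullet> b) x * w x \<partial>lborel)\<bar>
       \<le> (\<Sum>b\<in>Basis. \<bar>\<integral>x. (a x * (\<Phi> x \<bullet> b)) * ?m (\<lambda>y. P y \<bullet> b) x * w x \<partial>lborel\<bar>)"
      by (rule sum_abs)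
    also have "\<dots> \<le> (\<Sum>b\<in>Basis. \<Lambda> / 2 * (sqr w (\<lambda>x. \<Phi> x \<bullet> b) + ?A * sqr w (\<lambda>x. P x \<bullet> b)))"
      by (intro sum_mono prod_bound a\<Phi> Pc(1))
    also have "\<dots> = \<Lambda> / 2 * (?s\<Phi> + ?A * ?sP)"
      by (simp only: \<Phi>c(2)[symmetric] Pc(2)[symmetric] sum.distrib sum_distrib_left[symmetric])
    finally show ?thesis .
  qed
  note dL = L2w_mollify_diff[OF A2 k \<epsilon> g PL]
  have b4: "\<bar>\<integral>x. (a x * (a x * p x)) * (p x - ?m p x) * w x \<partial>lborel\<bar> \<le> \<Lambda> / 2 * (?sp + ?Q * ?sP)"
  proof -
    \<comment> \<open>The first factor has energy \<open>\<Lambda>\<^sup>4\<close> and the second one \<open>\<epsilon>\<^sup>2 = 1/\<Lambda>\<^sup>2\<close>; this parameter makes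
      both contributions of order \<open>\<Lambda>\<close>.\<close>
    have l: "0 < 1 / \<Lambda> ^ 3" using \<Lambda>(1) by simp
    have "\<bar>\<integral>x. (a x * (a x * p x)) * (p x - ?m p x) * w x \<partial>lborel\<bar>
       \<le> ((1 / \<Lambda> ^ 3) * sqr w (\<lambda>x. a x * (a x * p x)) + sqr w (\<lambda>x. p x - ?m p x) / (1 / \<Lambda> ^ 3)) / 2"
      by (rule L2w_mult(2)[OF w aap dL(1) l])
    also have "\<dots> \<le> ((1 / \<Lambda> ^ 3) * (\<Lambda>\<^sup>2 * (\<Lambda>\<^sup>2 * ?sp)) + (?Q * \<epsilon>\<^sup>2 * ?sP) / (1 / \<Lambda> ^ 3)) / 2"
      using \<Lambda>(1) aaps dL(2) by (intro divide_right_mono add_mono mult_left_mono) auto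
    also have "\<dots> = \<Lambda> / 2 * (?sp + ?Q * ?sP)"
      using \<Lambda>(1) by (simp add: \<epsilon>_def field_simps power2_eq_square power3_eq_cube)
    finally show ?thesis .
  qed
  have "sqr w (\<lambda>x. a x * p x) = (\<integral>x. (a x * (a x * p x)) * ?m p x * w x + (a x * (a x * p x)) * (p x - ?m p x) * w x \<partial>lborel)"
    unfolding sqr_def by (intro Bochner_Integration.integral_cong refl) (simp add: power2_eq_square algebra_simps)
  also have "\<dots> = (\<integral>x. (a x * (a x * p x)) * ?m p x * w x \<partial>lborel) + (\<integral>x. (a x * (a x * p x)) * (p x - ?m p x) * w x \<partial>lborel)"
    by (rule Bochner_Integration.integral_add[OF L2w_mult(1)[OF w aap mp(1)] L2w_mult(1)[OF w aap dL(1)]])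
  also have "\<dots> \<le> \<Lambda> / 2 * (?s\<Phi> + ?A * ?sp) + \<Lambda> / 2 * (?s\<Phi> + ?A * ?sP) + \<Lambda> / 2 * (?sG + ?A * ?sp) + \<Lambda> / 2 * (?sp + ?Q * ?sP)"
    unfolding main using b1 b2 b3 b4 by linarith
  also have "\<dots> = \<Lambda> / 2 * ((?s\<Phi> + ?A * ?sp) + (?s\<Phi> + ?A * ?sP) + (?sG + ?A * ?sp) + (?sp + ?Q * ?sP))"
    by (simp add: algebra_simps)
  also have "\<dots> \<le> \<Lambda> / 2 * (2 * ((1 + ?A + ?Q) * (?sp + ?sP + ?s\<Phi> + ?sG)))"
  proof (rule mult_left_mono)
    have "(1 + ?A + ?Q) * (?sp + ?sP + ?s\<Phi> + ?sG)
       = ?sp + ?sP + ?s\<Phi> + ?sG + ?A * ?sp + ?A * ?sP + ?A * ?s\<Phi> + ?A * ?sG + ?Q * ?sp + ?Q * ?sP + ?Q * ?s\<Phi> + ?Q * ?sG"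
      by (simp add: algebra_simps)
    moreover have "0 \<le> ?A * ?s\<Phi>" "0 \<le> ?A * ?sG" "0 \<le> ?Q * ?sp" "0 \<le> ?Q * ?s\<Phi>" "0 \<le> ?Q * ?sG" "0 \<le> ?A * ?sP" "0 \<le> ?A * ?sp" "0 \<le> ?Q * ?sP"
      using A0 Q0 nn by auto
    ultimately show "(?s\<Phi> + ?A * ?sp) + (?s\<Phi> + ?A * ?sP) + (?sG + ?A * ?sp) + (?sp + ?Q * ?sP)
      \<le> 2 * ((1 + ?A + ?Q) * (?sp + ?sP + ?s\<Phi> + ?sG))"
      using nn[of p] nn[of "\<lambda>x. norm (P x)"] nn[of G] nn[of "\<lambda>x. norm (\<Phi> x)"] by linarith
  qed (use \<Lambda>(1) in auto)
  finally show "sqr w (\<lambda>x. (x \<bullet> u + \<tau>) * p x) \<le> energy_const TYPE('a) c M * \<Lambda> * total_sqr w p P \<Phi> G"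
    by (simp add: a_def energy_const_def total_sqr_def mult_ac)
qed

definition transport_data ::
    "real \<Rightarrow> real \<Rightarrow> ('a::euclidean_space \<Rightarrow> real) \<Rightarrow> 'a \<Rightarrow> real \<Rightarrow> ('a \<Rightarrow> real) \<Rightarrow> ('a \<Rightarrow> 'a) \<Rightarrow> ('a \<Rightarrow> 'a) \<Rightarrow> ('a \<Rightarrow> real) \<Rightarrow> bool"
  where "transport_data M R w u \<tau> p P \<Phi> G \<longleftrightarrow> A2_weight M w \<and> weak_grad p P \<and> L2w w p \<and> L2w w (\<lambda>x. norm (P x)) \<and>
     \<Phi> \<in> borel_measurable borel \<and> L2w w (\<lambda>x. norm (\<Phi> x)) \<and> L2w w G \<and>
     (\<forall>x. x \<notin> cball 0 R \<longrightarrow> p x = 0 \<and> \<Phi> x = 0 \<and> G x = 0) \<and> transport_eq w u \<tau> p \<Phi> G"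

text \<open>
  The integer part \<open>j\<close> of \<open>log 5 N / 4\<close>, so that \<open>5\<^sup>j\<close> is \<open>N\<^sup>1\<^sup>/\<^sup>4\<close> up to a factor of \<open>5\<close>.
  The exponent \<open>\<sigma>\<close> is defined by \<open>\<gamma> = 5\<^sup>-\<^sup>\<sigma>\<close>.
\<close>
lemma powr_scale_index:
  fixes N \<gamma> :: real
  assumes N: "1 \<le> N" and \<gamma>: "0 < \<gamma>" "\<gamma> < 1"
  defines "\<sigma> \<equiv> - ln \<gamma> / ln 5"
  obtains j :: nat where "5 ^ j \<le> N powr (1/4)" "\<gamma> ^ j \<le> 5 powr \<sigma> * N powr (- (\<sigma> / 4))"
proof -
  have \<sigma>: "0 < \<sigma>" unfolding \<sigma>_def using \<gamma> by (simp add: divide_neg_pos)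
  define L where "L = log 5 N / 4"
  have L: "0 \<le> L" using N by (simp add: L_def)
  define j where "j = nat \<lfloor>L\<rfloor>"
  have j: "real j \<le> L" "L - 1 \<le> real j" using L unfolding j_def by linarith+
  have NL: "5 powr L = N powr (1/4)"
  proof -
    have "5 powr L = (5 powr log 5 N) powr (1/4)" by (simp add: L_def powr_powr)
    also have "\<dots> = N powr (1/4)" using N by simp
    finally show ?thesis .
  qed
  have "5 ^ j = 5 powr real j" by (simp add: powr_realpow)
  also have "\<dots> \<le> 5 powr L" using j by simp
  finally have 1: "5 ^ j \<le> N powr (1/4)" by (simp add: NL)
  have g5: "\<gamma> = 5 powr (- \<sigma>)" using \<gamma> by (simp add: \<sigma>_def powr_def)
  have "\<gamma> ^ j = (5 powr (- \<sigma>)) powr real j" using \<gamma> by (simp add: powr_realpow flip: g5)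
  also have "\<dots> = 5 powr (- \<sigma> * real j)" by (simp add: powr_powr)
  also have "\<dots> \<le> 5 powr (- \<sigma> * (L - 1))"
    using j \<sigma> by (intro powr_mono) auto
  also have "\<dots> = 5 powr \<sigma> * (5 powr L) powr (- \<sigma>)"
    by (simp add: powr_powr algebra_simps flip: powr_add)
  also have "(5 powr L) powr (- \<sigma>) = N powr (- (\<sigma> / 4))" unfolding NL by (simp add: powr_powr)
  finally show thesis using 1 that by blast
qed

text \<open>
  With \<open>N = 1 + |u| + |\<tau>|\<close>, the energy estimate says that the integral of \<open>a\<^sup>2 p\<^sup>2 w\<close> is of order
  \<open>N\<close>, so a power of \<open>N\<close> is gained wherever \<open>|a|\<close> is at least of order \<open>N\<^sup>3\<^sup>/\<^sup>4\<close>.  If \<open>\<tau>\<close>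
  dominates \<open>u\<close>, this holds on the whole support.  Otherwise \<open>u\<close> is of order \<open>N\<close>, and the set where
  it fails lies in a slab orthogonal to \<open>u\<close> whose width is of order \<open>N\<^sup>-\<^sup>1\<^sup>/\<^sup>4\<close>; there the gain comes
  from the impossibility of concentrating \<open>p\<close> on thin slabs.  The exponent depends on the
  dimension and the \<open>A\<^sub>2\<close> bound alone, since this is so for the rate of decay on slabs.
\<close>
lemma frequency_decay:
  fixes M :: real
  shows "\<exists>\<theta>. 0 < \<theta> \<and> \<theta> < 1 \<and> (\<forall>R\<ge>1. \<exists>C\<ge>0. \<forall>w (p :: 'a::euclidean_space \<Rightarrow> real) P \<Phi> G u \<tau>.
     transport_data M R w u \<tau> p P \<Phi> G \<longrightarrow>
       sqr w p \<le> C * (1 + norm u + \<bar>\<tau>\<bar>) powr (- \<theta>) * total_sqr w p P \<Phi> G)"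
proof -
  obtain \<gamma> B where \<gamma>: "0 < \<gamma>" "\<gamma> < 1" and B: "0 \<le> B"
    and decay: "\<And>w (p::'a \<Rightarrow> real) P e t j. A2_weight M w \<Longrightarrow> weak_grad p P \<Longrightarrow> norm e = 1 \<Longrightarrow>
        wsq w (restr (slab e t ((1/5) ^ j)) p)
          \<le> ennreal (\<gamma> ^ j) * (wsq w p + ennreal B * wsq w (\<lambda>x. norm (P x)))"
    using slab_decay[of M, where 'a='a] by blast
  obtain \<beta> :: "'a \<Rightarrow> real" and c where \<beta>: "smooth \<beta>" "\<And>z. 0 \<le> \<beta> z" "\<And>z. \<beta> z \<le> c"
    "\<And>z. 1 \<le> norm z \<Longrightarrow> \<beta> z = 0" "(\<integral>z. \<beta> z \<partial>lborel) = 1"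
    using bump_kernel_exists by metis
  have k: "kernel c \<beta>" using kernel_shift[OF \<beta>, of 0] by simp
  define E where "E = max 1 (energy_const TYPE('a) c M)"
  have E: "1 \<le> E" "energy_const TYPE('a) c M \<le> E" by (auto simp: E_def)
  define \<sigma> where "\<sigma> = - ln \<gamma> / ln 5"
  have \<sigma>: "0 < \<sigma>" unfolding \<sigma>_def using \<gamma> by (simp add: divide_neg_pos)
  define \<theta> where "\<theta> = min (1/2) (\<sigma> / 4)"
  have \<theta>: "0 < \<theta>" "\<theta> < 1" "\<theta> \<le> 1/2" "\<theta> \<le> \<sigma> / 4" using \<sigma> by (auto simp: \<theta>_def)
  show ?thesis
  proof (rule exI[of _ \<theta>], intro conjI allI impI \<theta>(1,2))
    fix R :: real assume R: "1 \<le> R"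
    define C1 where "C1 = 36 * E * (1 + R)"
    define C2 where "C2 = (1 + B) * 5 powr \<sigma> + (2 + 2 * R)\<^sup>2 * E * (1 + R)"
    define C3 where "C3 = 2 + 2 * R"
    have C: "0 \<le> C1" "0 \<le> C2" "0 \<le> C3" using E R B by (auto simp: C1_def C2_def C3_def)
    show "\<exists>C\<ge>0. \<forall>w (p :: 'a \<Rightarrow> real) P \<Phi> G u \<tau>. transport_data M R w u \<tau> p P \<Phi> G \<longrightarrow>
       sqr w p \<le> C * (1 + norm u + \<bar>\<tau>\<bar>) powr (- \<theta>) * total_sqr w p P \<Phi> G"
    proof (intro exI[of _ "C1 + C2 + C3"] conjI allI impI)
      show "0 \<le> C1 + C2 + C3" using C by simp
      fix w p :: "'a \<Rightarrow> real" and P \<Phi> :: "'a \<Rightarrow> 'a" and G :: "'a \<Rightarrow> real" and u :: 'a and \<tau> :: real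
      assume "transport_data M R w u \<tau> p P \<Phi> G"
      then have A2: "A2_weight M w" and g: "weak_grad p P" and pL: "L2w w p" and PL: "L2w w (\<lambda>x. norm (P x))"
        and \<Phi>m: "\<Phi> \<in> borel_measurable borel" and \<Phi>L: "L2w w (\<lambda>x. norm (\<Phi> x))" and GL: "L2w w G"
        and supp: "\<And>x. x \<notin> cball 0 R \<Longrightarrow> p x = 0" "\<And>x. x \<notin> cball 0 R \<Longrightarrow> \<Phi> x = 0" "\<And>x. x \<notin> cball 0 R \<Longrightarrow> G x = 0"
        and eq: "transport_eq w u \<tau> p \<Phi> G"
        unfolding transport_data_def by auto
      note w = A2_pos_weight[OF A2]
      define N where "N = 1 + norm u + \<bar>\<tau>\<bar>"
      have N: "1 \<le> N" by (simp add: N_def)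
      define T where "T = total_sqr w p P \<Phi> G"
      note nn = sqr_nonneg[OF w]
      have T: "0 \<le> T" "sqr w p \<le> T" "sqr w (\<lambda>x. norm (P x)) \<le> T"
        unfolding T_def total_sqr_def using nn[of p] nn[of "\<lambda>x. norm (P x)"] nn[of "\<lambda>x. norm (\<Phi> x)"] nn[of G]
        by linarith+
      define a where "a x = x \<bullet> u + \<tau>" for x
      have inner_le: "\<bar>x \<bullet> u\<bar> \<le> R * norm u" if "x \<in> cball 0 R" for x
        using Cauchy_Schwarz_ineq2[of x u] mult_right_mono[of "norm x" R "norm u"] that by simp
      have \<Lambda>: "1 \<le> (1 + R) * N" "norm u \<le> (1 + R) * N" "\<And>x. x \<in> cball 0 R \<Longrightarrow> \<bar>x \<bullet> u + \<tau>\<bar> \<le> (1 + R) * N"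
      proof -
        have RN: "N \<le> (1 + R) * N" using R N mult_right_mono[of 1 "1 + R" N] by simp
        have "norm u \<le> N" by (simp add: N_def)
        then show "1 \<le> (1 + R) * N" "norm u \<le> (1 + R) * N" using RN N by linarith+
        fix x :: 'a assume "x \<in> cball 0 R"
        then have "\<bar>x \<bullet> u + \<tau>\<bar> \<le> R * norm u + \<bar>\<tau>\<bar>" using inner_le[of x] by linarith
        also have "\<dots> \<le> (1 + R) * N"
        proof -
          have "R * norm u \<le> R * N" "\<bar>\<tau>\<bar> \<le> N" using R by (auto simp: N_def)
          then show ?thesis by (simp add: distrib_right)
        qed
        finally show "\<bar>x \<bullet> u + \<tau>\<bar> \<le> (1 + R) * N" .
      qed
      note energy = energy_estimate[where R=R, OF A2 k g pL PL \<Phi>m \<Phi>L GL supp \<Lambda> eq, folded a_def T_def]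
      have en: "sqr w (\<lambda>x. a x * p x) \<le> E * ((1 + R) * N) * T"
      proof -
        have "energy_const TYPE('a) c M * ((1 + R) * N) * T \<le> E * ((1 + R) * N) * T"
          using E(2) R N T(1) by (intro mult_right_mono) auto
        then show ?thesis using energy(2) by linarith
      qed
      have pm: "p \<in> borel_measurable borel" using pL by (auto simp: L2w_def)
      have powr_le: "x * N powr (- \<alpha>) \<le> x * N powr (- \<theta>)" if "\<theta> \<le> \<alpha>" "0 \<le> x" for x \<alpha>
        using that N by (intro mult_left_mono powr_mono) auto
      have N1: "1 / N = N powr (- 1)" using N by (simp add: powr_minus_divide)
      \<comment> \<open>the symbol is dominated by \<open>\<tau>\<close>, or \<open>u\<close> is of the order of \<open>N\<close>, or \<open>N\<close> is bounded\<close>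
      consider (time) "2 * R * norm u \<le> \<bar>\<tau>\<bar>" "1 \<le> \<bar>\<tau>\<bar>" | (space) "\<bar>\<tau>\<bar> < 2 * R * norm u" "1 \<le> norm u"
        | (low) "N \<le> 2 + 2 * R"
      proof -
        have "N \<le> 2 + 2 * R" if "2 * R * norm u \<le> \<bar>\<tau>\<bar>" "\<bar>\<tau>\<bar> < 1"
        proof -
          have "norm u \<le> R * norm u" using R mult_right_mono[of 1 R "norm u"] by simp
          then show ?thesis using that R by (simp add: N_def)
        qed
        moreover have "N \<le> 2 + 2 * R" if "\<bar>\<tau>\<bar> < 2 * R * norm u" "norm u < 1"
        proof -
          have "R * norm u \<le> R * 1" using R that by (intro mult_left_mono) auto
          then show ?thesis using that by (simp add: N_def)
        qed
        ultimately show thesis using time space low by linarith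
      qed
      then have "sqr w p \<le> (C1 + C2 + C3) * N powr (- \<theta>) * T"
      proof cases
        case time
        have uR: "R * norm u \<le> \<bar>\<tau>\<bar> / 2" using time by simp
        have u: "norm u \<le> R * norm u" using R mult_right_mono[of 1 R "norm u"] by simp
        have N6: "N \<le> 6 * \<bar>a x\<bar>" if "x \<in> cball 0 R" for x
        proof -
          have "\<bar>\<tau>\<bar> - \<bar>x \<bullet> u\<bar> \<le> \<bar>a x\<bar>" unfolding a_def by linarith
          then have "\<bar>\<tau>\<bar> / 2 \<le> \<bar>a x\<bar>" using inner_le[OF that] uR by linarith
          moreover have "norm u \<le> \<bar>\<tau>\<bar> / 2" using uR u by linarith
          ultimately show ?thesis unfolding N_def using time(2) by argo
        qed
        have "\<bar>p x\<bar> \<le> (6 / N) * \<bar>a x * p x\<bar>" for x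
        proof (cases "x \<in> cball 0 R")
          case True
          then have "N * \<bar>p x\<bar> \<le> 6 * \<bar>a x\<bar> * \<bar>p x\<bar>" using N6 by (intro mult_right_mono) auto
          then show ?thesis using N by (simp add: abs_mult field_simps)
        qed (use supp(1) in auto)
        from L2w_mono(2)[OF w energy(1) pm this]
        have "sqr w p \<le> (6 / N)\<^sup>2 * sqr w (\<lambda>x. a x * p x)" .
        also have "\<dots> \<le> (6 / N)\<^sup>2 * (E * ((1 + R) * N) * T)" by (intro mult_left_mono en) auto
        also have "\<dots> = C1 * T * (1 / N)" using N by (simp add: C1_def field_simps power2_eq_square)
        also have "\<dots> \<le> C1 * T * N powr (- \<theta>)"
          unfolding N1 using \<theta> C T by (intro powr_le) auto
        also have "\<dots> \<le> (C1 + C2 + C3) * T * N powr (- \<theta>)" using C T by (intro mult_right_mono) auto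
        finally show ?thesis by (simp add: mult_ac)
      next
        case space
        then have u0: "0 < norm u" by linarith
        have NU: "N \<le> (2 + 2 * R) * norm u" using space R by (simp add: N_def algebra_simps)
        obtain j where j: "5 ^ j \<le> N powr (1/4)" "\<gamma> ^ j \<le> 5 powr \<sigma> * N powr (- (\<sigma> / 4))"
          using powr_scale_index[OF N \<gamma>] unfolding \<sigma>_def by blast
        define e where "e = (1 / norm u) *\<^sub>R u"
        \<comment> \<open>the set \<open>|a| \<le> 5\<^sup>-\<^sup>j |u|\<close>\<close>
        define S where "S = slab e (\<tau> / norm u) ((1/5) ^ j)"
        have [measurable]: "S \<in> sets borel" unfolding S_def by measurable
        have e: "norm e = 1" using u0 by (simp add: e_def)
        have ax: "\<bar>x \<bullet> e + \<tau> / norm u\<bar> = \<bar>a x\<bar> / norm u" for x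
        proof -
          have "x \<bullet> e + \<tau> / norm u = a x / norm u" by (simp add: e_def a_def add_divide_distrib)
          then show ?thesis by (simp add: abs_divide)
        qed
        note pm[measurable]
        have rm: "restr S p \<in> borel_measurable borel" "restr (- S) p \<in> borel_measurable borel"
          unfolding restr_def[abs_def] by measurable
        have rS: "L2w w (restr S p)"
          by (rule L2w_mono(1)[OF w pL rm(1), where B=1]) (auto simp: restr_def indicator_def)
        have rS': "L2w w (restr (- S) p)"
          by (rule L2w_mono(1)[OF w pL rm(2), where B=1]) (auto simp: restr_def indicator_def)
        have split: "sqr w p = sqr w (restr S p) + sqr w (restr (- S) p)"
        proof -
          have "sqr w p = (\<integral>x. (restr S p x)\<^sup>2 * w x + (restr (- S) p x)\<^sup>2 * w x \<partial>lborel)"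
            unfolding sqr_def by (intro Bochner_Integration.integral_cong refl) (auto simp: restr_def indicator_def)
          then show ?thesis
            unfolding sqr_def using L2w_sqr(1)[OF w rS] L2w_sqr(1)[OF w rS'] by simp
        qed
        have "sqr w (restr S p) \<le> \<gamma> ^ j * (sqr w p + B * sqr w (\<lambda>x. norm (P x)))"
        proof -
          have "ennreal (sqr w (restr S p)) \<le> ennreal (\<gamma> ^ j) * (ennreal (sqr w p) + ennreal B * ennreal (sqr w (\<lambda>x. norm (P x))))"
            using decay[OF A2 g e, of "\<tau> / norm u" j]
            unfolding S_def[symmetric] L2w_sqr(2)[OF w rS] L2w_sqr(2)[OF w pL] L2w_sqr(2)[OF w PL] .
          also have "\<dots> = ennreal (\<gamma> ^ j * (sqr w p + B * sqr w (\<lambda>x. norm (P x))))"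
            using \<gamma> B nn by (simp add: ennreal_mult)
          finally show ?thesis using \<gamma> B nn by (subst (asm) ennreal_le_iff) auto
        qed
        also have "\<dots> \<le> \<gamma> ^ j * (T + B * T)"
          using \<gamma> B T by (intro mult_left_mono add_mono) auto
        also have "\<dots> \<le> (5 powr \<sigma> * N powr (- (\<sigma> / 4))) * (T + B * T)"
          using j(2) B T by (intro mult_right_mono) auto
        also have "\<dots> = ((1 + B) * 5 powr \<sigma> * T) * N powr (- (\<sigma> / 4))" by (simp add: algebra_simps)
        also have "\<dots> \<le> ((1 + B) * 5 powr \<sigma> * T) * N powr (- \<theta>)"
          using \<theta> B T by (intro powr_le) auto
        finally have in_slab: "sqr w (restr S p) \<le> ((1 + B) * 5 powr \<sigma> * T) * N powr (- \<theta>)" .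
        have "\<bar>restr (- S) p x\<bar> \<le> (5 ^ j / norm u) * \<bar>a x * p x\<bar>" for x
        proof (cases "x \<in> S")
          case False
          then have "(1/5) ^ j \<le> \<bar>a x\<bar> / norm u" unfolding S_def slab_def ax[symmetric] by simp
          then have "1 \<le> 5 ^ j / norm u * \<bar>a x\<bar>" using u0 by (simp add: power_divide field_simps)
          then have "1 * \<bar>p x\<bar> \<le> 5 ^ j / norm u * \<bar>a x\<bar> * \<bar>p x\<bar>" by (intro mult_right_mono) auto
          then show ?thesis using False by (simp add: restr_def abs_mult)
        qed (auto simp: restr_def)
        from L2w_mono(2)[OF w energy(1) rm(2) this]
        have "sqr w (restr (- S) p) \<le> (5 ^ j / norm u)\<^sup>2 * sqr w (\<lambda>x. a x * p x)" .
        also have "\<dots> \<le> (N powr (1/4) * (2 + 2 * R) / N)\<^sup>2 * (E * ((1 + R) * N) * T)"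
        proof (intro mult_mono power_mono en)
          have "1 / norm u \<le> (2 + 2 * R) / N" using NU u0 N by (simp add: field_simps)
          then have "5 ^ j * (1 / norm u) \<le> N powr (1/4) * ((2 + 2 * R) / N)"
            using j(1) u0 by (intro mult_mono) auto
          then show "5 ^ j / norm u \<le> N powr (1/4) * (2 + 2 * R) / N" by simp
        qed (use u0 nn in auto)
        also have "\<dots> = ((2 + 2 * R)\<^sup>2 * E * (1 + R) * T) * ((N powr (1/4))\<^sup>2 * (1 / N))"
          using N by (simp add: power_mult_distrib power_divide power2_eq_square[of N])
        also have "(N powr (1/4))\<^sup>2 * (1 / N) = N powr (- (1/2))"
          unfolding N1 power2_eq_square by (simp only: powr_add[symmetric]) simp
        also have "((2 + 2 * R)\<^sup>2 * E * (1 + R) * T) * N powr (- (1/2)) \<le> ((2 + 2 * R)\<^sup>2 * E * (1 + R) * T) * N powr (- \<theta>)"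
          using \<theta> E R T by (intro powr_le) auto
        finally have off_slab: "sqr w (restr (- S) p) \<le> ((2 + 2 * R)\<^sup>2 * E * (1 + R) * T) * N powr (- \<theta>)" .
        have "sqr w p \<le> C2 * T * N powr (- \<theta>)"
          using in_slab off_slab unfolding split C2_def by (simp add: distrib_right)
        also have "\<dots> \<le> (C1 + C2 + C3) * T * N powr (- \<theta>)" using C T by (intro mult_right_mono) auto
        finally show ?thesis by (simp add: mult_ac)
      next
        case low
        have "1 = N powr \<theta> * N powr (- \<theta>)" using N by (simp flip: powr_add)
        also have "\<dots> \<le> C3 * N powr (- \<theta>)"
        proof (rule mult_right_mono)
          have "N powr \<theta> \<le> N powr 1" using N \<theta> by (intro powr_mono) auto
          then show "N powr \<theta> \<le> C3" using low N by (simp add: C3_def)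
        qed simp
        finally have "1 * T \<le> C3 * N powr (- \<theta>) * T" using T by (intro mult_right_mono) auto
        also have "\<dots> \<le> (C1 + C2 + C3) * N powr (- \<theta>) * T" using C T by (intro mult_right_mono) auto
        finally show ?thesis using T by simp
      qed
      then show "sqr w p \<le> (C1 + C2 + C3) * (1 + norm u + \<bar>\<tau>\<bar>) powr (- \<theta>) * total_sqr w p P \<Phi> G"
        unfolding N_def T_def .
    qed
  qed
qed

section \<open>The Plancherel inequality\<close>

lemma integral_lborel_prod:
  fixes f :: "'a::euclidean_space \<Rightarrow> real \<Rightarrow> complex"
  assumes f: "\<And>b. b \<in> Basis \<Longrightarrow> integrable lborel (f b)"
  shows "(\<integral>x. (\<Prod>b\<in>Basis. f b (x \<bullet> b)) \<partial>lborel) = (\<Prod>b\<in>Basis. (\<integral>t. f b t \<partial>lborel))"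
proof -
  interpret product_sigma_finite "\<lambda>_::'a. lborel :: real measure" ..
  have [measurable]: "f b \<in> borel_measurable borel" if "b \<in> Basis" for b using f[OF that] by auto
  have "(\<integral>x. (\<Prod>b\<in>Basis. f b (x \<bullet> b)) \<partial>lborel)
     = (\<integral>x. (\<Prod>b\<in>Basis. f b (x \<bullet> b)) \<partial>(distr (\<Pi>\<^sub>M b\<in>Basis. lborel) borel (\<lambda>f. \<Sum>b\<in>Basis. f b *\<^sub>R b)))"
    by (subst lborel_eq) simp
  also have "\<dots> = (\<integral>x. (\<Prod>b\<in>Basis. f b ((\<Sum>b\<in>Basis. x b *\<^sub>R b) \<bullet> b)) \<partial>(\<Pi>\<^sub>M b\<in>Basis. lborel))"
    by (rule integral_distr) measurable
  also have "\<dots> = (\<integral>x. (\<Prod>b\<in>Basis. f b (x b)) \<partial>(\<Pi>\<^sub>M b\<in>Basis. lborel))"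
    by (intro Bochner_Integration.integral_cong prod.cong refl)
      (simp add: inner_sum_left inner_Basis if_distrib cong: if_cong)
  also have "\<dots> = (\<Prod>b\<in>Basis. (\<integral>t. f b t \<partial>lborel))"
    by (rule product_integral_prod) (use f in auto)
  finally show ?thesis .
qed

text \<open>
  The Gaussian \<open>exp (- \<delta>\<^sup>2 |x|\<^sup>2 / 2)\<close> (see \<open>gauss_eq\<close>) and, below, its Fourier transform.
  Both are written as products of normal densities, for which the one-dimensional transform is
  known from the characteristic function of the standard normal distribution.
\<close>
definition gauss :: "real \<Rightarrow> 'a::euclidean_space \<Rightarrow> real" where
  "gauss \<delta> x = (\<Prod>b\<in>Basis. (sqrt (2 * pi) / \<delta>) * normal_density 0 (1 / \<delta>) (x \<bullet> b))"

definition gauss_hat :: "real \<Rightarrow> 'a::euclidean_space \<Rightarrow> real" where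
  "gauss_hat \<delta> z = (\<Prod>b\<in>Basis. (2 * pi) * normal_density 0 \<delta> (z \<bullet> b))"

lemma gauss_measurable [measurable]: "gauss \<delta> \<in> borel_measurable borel"
  unfolding gauss_def by measurable

lemma gauss_eq:
  assumes "0 < \<delta>"
  shows "gauss \<delta> x = exp (- (\<delta> * norm x)\<^sup>2 / 2)"
proof -
  have "(sqrt (2 * pi) / \<delta>) * normal_density 0 (1 / \<delta>) t = exp (- (\<delta> * t)\<^sup>2 / 2)" for t
    using assms by (simp add: normal_density_def real_sqrt_divide power_mult_distrib field_simps real_sqrt_mult)
  then have "gauss \<delta> x = (\<Prod>b\<in>Basis. exp (- (\<delta> * (x \<bullet> b))\<^sup>2 / 2))" by (simp add: gauss_def)
  also have "\<dots> = exp (\<Sum>b\<in>Basis. - (\<delta> * (x \<bullet> b))\<^sup>2 / 2)" by (simp add: exp_sum)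
  also have "(\<Sum>b\<in>Basis. - (\<delta> * (x \<bullet> b))\<^sup>2 / 2) = - (\<delta> * norm x)\<^sup>2 / 2"
    unfolding power_mult_distrib power2_norm_eq_inner
    by (subst (2) euclidean_inner) (simp add: sum_negf sum_divide_distrib sum_distrib_left power2_eq_square)
  finally show ?thesis .
qed

lemma gauss_1d_fourier:
  assumes \<delta>: "0 < \<delta>"
  shows "integrable lborel (\<lambda>t. iexp (z * t) * complex_of_real ((sqrt (2 * pi) / \<delta>) * normal_density 0 (1 / \<delta>) t))"
    and "(\<integral>t. iexp (z * t) * complex_of_real ((sqrt (2 * pi) / \<delta>) * normal_density 0 (1 / \<delta>) t) \<partial>lborel)
       = complex_of_real ((2 * pi) * normal_density 0 \<delta> z)"
proof -
  have pos: "0 < 1 / \<delta>" using \<delta> by simp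
  have ni: "integrable lborel (\<lambda>t. complex_of_real ((sqrt (2 * pi) / \<delta>) * normal_density 0 (1 / \<delta>) t))"
    using integrable_normal_density[OF pos, of 0] by (intro integrable_of_real integrable_mult_right)
  show "integrable lborel (\<lambda>t. iexp (z * t) * complex_of_real ((sqrt (2 * pi) / \<delta>) * normal_density 0 (1 / \<delta>) t))"
    by (rule Bochner_Integration.integrable_bound[OF ni])
      (measurable, intro AE_I2, simp only: norm_mult norm_exp_i_times mult_1 order_refl)
  have char: "(\<integral>x. iexp (s * x) * complex_of_real (std_normal_density x) \<partial>lborel) = complex_of_real (exp (- (s\<^sup>2) / 2))" for s
  proof -
    have "(\<integral>x. iexp (s * x) * complex_of_real (std_normal_density x) \<partial>lborel)
        = (\<integral>x. std_normal_density x *\<^sub>R iexp (s * x) \<partial>lborel)"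
      by (intro Bochner_Integration.integral_cong) (auto simp: scaleR_conv_of_real mult.commute)
    also have "\<dots> = char std_normal_distribution s"
      unfolding char_def by (subst integral_density) auto
    finally show ?thesis by (simp add: char_std_normal_distribution)
  qed
  have dens: "(sqrt (2 * pi) / \<delta>) * normal_density 0 (1 / \<delta>) t = sqrt (2 * pi) * std_normal_density (\<delta> * t)" for t
    using \<delta> by (simp add: normal_density_def real_sqrt_divide power_mult_distrib field_simps real_sqrt_mult)
  have "(\<integral>x. iexp ((z / \<delta>) * x) * complex_of_real (std_normal_density x) \<partial>lborel)
      = \<bar>\<delta>\<bar> *\<^sub>R (\<integral>t. iexp ((z / \<delta>) * (0 + \<delta> * t)) * complex_of_real (std_normal_density (0 + \<delta> * t)) \<partial>lborel)"
    using \<delta> by (intro lborel_integral_real_affine) auto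
  also have "\<dots> = of_real \<delta> * (\<integral>t. iexp (z * t) * complex_of_real (std_normal_density (\<delta> * t)) \<partial>lborel)"
    using \<delta> by (simp add: scaleR_conv_of_real)
  finally have "of_real \<delta> * (\<integral>t. iexp (z * t) * complex_of_real (std_normal_density (\<delta> * t)) \<partial>lborel)
      = complex_of_real (exp (- ((z / \<delta>)\<^sup>2) / 2))" by (simp only: char)
  then have *: "(\<integral>t. iexp (z * t) * complex_of_real (std_normal_density (\<delta> * t)) \<partial>lborel)
      = complex_of_real (exp (- ((z / \<delta>)\<^sup>2) / 2) / \<delta>)"
    using \<delta> by (simp add: field_simps)
  have "(\<integral>t. iexp (z * t) * complex_of_real ((sqrt (2 * pi) / \<delta>) * normal_density 0 (1 / \<delta>) t) \<partial>lborel)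
      = (\<integral>t. complex_of_real (sqrt (2 * pi)) * (iexp (z * t) * complex_of_real (std_normal_density (\<delta> * t))) \<partial>lborel)"
    unfolding dens by (intro Bochner_Integration.integral_cong) auto
  also have "\<dots> = complex_of_real (sqrt (2 * pi)) * complex_of_real (exp (- ((z / \<delta>)\<^sup>2) / 2) / \<delta>)"
    by (simp only: integral_mult_right_zero *)
  also have "\<dots> = complex_of_real ((2 * pi) * normal_density 0 \<delta> z)"
  proof -
    have "sqrt (2 * pi) * (exp (- ((z / \<delta>)\<^sup>2) / 2) / \<delta>) = (2 * pi) * normal_density 0 \<delta> z"
    proof -
      have "2 * pi = sqrt (2 * pi) * sqrt (2 * pi)" by simp
      then show ?thesis
        using \<delta> by (simp add: normal_density_def real_sqrt_mult power_divide field_simps)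
    qed
    then show ?thesis by (simp only: of_real_mult[symmetric])
  qed
  finally show "(\<integral>t. iexp (z * t) * complex_of_real ((sqrt (2 * pi) / \<delta>) * normal_density 0 (1 / \<delta>) t) \<partial>lborel)
       = complex_of_real ((2 * pi) * normal_density 0 \<delta> z)" .
qed

lemma gauss_integrable:
  assumes \<delta>: "0 < \<delta>"
  shows "integrable lborel (gauss \<delta> :: 'a::euclidean_space \<Rightarrow> real)"
proof (rule integrableI_nonneg)
  have pos: "0 < 1 / \<delta>" using \<delta> by simp
  show "gauss \<delta> \<in> borel_measurable lborel" unfolding gauss_def by measurable
  show "AE x in lborel. 0 \<le> gauss \<delta> x"
    unfolding gauss_def using \<delta> by (auto intro!: prod_nonneg)
  have "(\<integral>\<^sup>+x. ennreal (gauss \<delta> (x::'a)) \<partial>lborel)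
      = (\<integral>\<^sup>+x. (\<Prod>b\<in>Basis. ennreal ((sqrt (2 * pi) / \<delta>) * normal_density 0 (1 / \<delta>) ((x::'a) \<bullet> b))) \<partial>lborel)"
    unfolding gauss_def using \<delta> by (subst prod_ennreal) auto
  also have "\<dots> = (\<Prod>b\<in>(Basis::'a set). (\<integral>\<^sup>+t. ennreal ((sqrt (2 * pi) / \<delta>) * normal_density 0 (1 / \<delta>) t) \<partial>lborel))"
    by (rule nn_integral_lborel_prod) auto
  also have "\<dots> < \<infinity>"
  proof -
    have "(\<integral>\<^sup>+t. ennreal ((sqrt (2 * pi) / \<delta>) * normal_density 0 (1 / \<delta>) t) \<partial>lborel) < \<infinity>"
      using integrable_mult_right[OF integrable_normal_density[OF pos, of 0], of "sqrt (2 * pi) / \<delta>"] \<delta>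
      by (simp add: integrable_iff_bounded abs_mult)
    then show ?thesis by (simp add: power_less_top_ennreal)
  qed
  finally show "(\<integral>\<^sup>+x. ennreal (gauss \<delta> (x::'a)) \<partial>lborel) < \<infinity>" .
qed

lemma gauss_fourier:
  assumes \<delta>: "0 < \<delta>"
  shows "(\<integral>\<xi>. cos (z \<bullet> \<xi>) * gauss \<delta> \<xi> \<partial>lborel) = gauss_hat \<delta> (z::'a::euclidean_space)"
proof -
  let ?g = "\<lambda>t. (sqrt (2 * pi) / \<delta>) * normal_density 0 (1 / \<delta>) t"
  have pt: "(\<Prod>b\<in>Basis. iexp ((z \<bullet> b) * (\<xi> \<bullet> b)) * complex_of_real (?g (\<xi> \<bullet> b)))
      = iexp (z \<bullet> \<xi>) * complex_of_real (gauss \<delta> \<xi>)" for \<xi> :: 'a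
  proof -
    have "(\<Prod>b\<in>Basis. iexp ((z \<bullet> b) * (\<xi> \<bullet> b))) = exp (\<Sum>b\<in>Basis. \<i> * complex_of_real ((z \<bullet> b) * (\<xi> \<bullet> b)))"
      by (simp add: exp_sum)
    also have "(\<Sum>b\<in>Basis. \<i> * complex_of_real ((z \<bullet> b) * (\<xi> \<bullet> b))) = \<i> * complex_of_real (z \<bullet> \<xi>)"
      by (subst (3) euclidean_inner) (simp add: sum_distrib_left)
    finally show ?thesis by (subst prod.distrib) (simp only: gauss_def of_real_prod)
  qed
  have "(\<integral>\<xi>. iexp (z \<bullet> \<xi>) * complex_of_real (gauss \<delta> \<xi>) \<partial>lborel) = (\<Prod>b\<in>Basis. complex_of_real ((2 * pi) * normal_density 0 \<delta> (z \<bullet> b)))"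
    unfolding pt[symmetric] gauss_1d_fourier(2)[OF \<delta>, symmetric]
    by (rule integral_lborel_prod[of "\<lambda>b t. iexp ((z \<bullet> b) * t) * complex_of_real (?g t)"]) (rule gauss_1d_fourier(1)[OF \<delta>])
  also have "\<dots> = complex_of_real (gauss_hat \<delta> z)" by (simp add: gauss_hat_def)
  finally have eq: "(\<integral>\<xi>. iexp (z \<bullet> \<xi>) * complex_of_real (gauss \<delta> \<xi>) \<partial>lborel) = complex_of_real (gauss_hat \<delta> z)" .
  have gi: "integrable lborel (\<lambda>\<xi>::'a. complex_of_real (gauss \<delta> \<xi>))"
    using gauss_integrable[OF \<delta>] by (rule integrable_of_real)
  then have "integrable lborel (\<lambda>\<xi>::'a. iexp (z \<bullet> \<xi>) * complex_of_real (gauss \<delta> \<xi>))"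
    by (rule Bochner_Integration.integrable_bound) (auto simp: norm_mult)
  then have "Re (\<integral>\<xi>. iexp (z \<bullet> \<xi>) * complex_of_real (gauss \<delta> \<xi>) \<partial>lborel) = (\<integral>\<xi>. Re (iexp (z \<bullet> \<xi>) * complex_of_real (gauss \<delta> \<xi>)) \<partial>lborel)"
    by (rule integral_Re[symmetric])
  also have "\<dots> = (\<integral>\<xi>. cos (z \<bullet> \<xi>) * gauss \<delta> \<xi> \<partial>lborel)"
    by (intro Bochner_Integration.integral_cong) (auto simp: Re_exp)
  finally show ?thesis unfolding eq by simp
qed

lemma gauss_hat_nonneg: "0 \<le> gauss_hat \<delta> z"
  unfolding gauss_hat_def by (intro prod_nonneg) auto

lemma gauss_hat_measurable [measurable]: "gauss_hat \<delta> \<in> borel_measurable borel"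
  unfolding gauss_hat_def by measurable

lemma nn_integral_gauss_hat:
  fixes a :: "'a::euclidean_space"
  assumes \<delta>: "0 < \<delta>"
  shows "(\<integral>\<^sup>+z. ennreal (gauss_hat \<delta> (a - z)) \<partial>lborel) = ennreal ((2 * pi) ^ DIM('a))" (is "?L a = _")
    and "(\<integral>\<^sup>+z. ennreal (gauss_hat \<delta> (z - a)) \<partial>lborel) = ennreal ((2 * pi) ^ DIM('a))"
proof -
  have n1: "(\<integral>\<^sup>+t. ennreal ((2 * pi) * normal_density 0 \<delta> (t - s)) \<partial>lborel) = ennreal (2 * pi)" for s
  proof -
    have "(\<lambda>t. normal_density 0 \<delta> (t - s)) = normal_density s \<delta>" by (simp add: normal_density_def fun_eq_iff)
    then have "(\<integral>\<^sup>+t. ennreal (normal_density 0 \<delta> (t - s)) \<partial>lborel) = 1"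
      using \<delta> by (subst nn_integral_eq_integral) (auto simp: fun_eq_iff)
    moreover have "(\<integral>\<^sup>+t. ennreal ((2 * pi) * normal_density 0 \<delta> (t - s)) \<partial>lborel)
       = ennreal (2 * pi) * (\<integral>\<^sup>+t. ennreal (normal_density 0 \<delta> (t - s)) \<partial>lborel)"
      by (subst nn_integral_cmult[symmetric]) (auto simp: ennreal_mult)
    ultimately show ?thesis by simp
  qed
  have "(\<integral>\<^sup>+z. ennreal (gauss_hat \<delta> (z - a)) \<partial>lborel)
      = (\<integral>\<^sup>+z. (\<Prod>b\<in>Basis. ennreal ((2 * pi) * normal_density 0 \<delta> (z \<bullet> b - a \<bullet> b))) \<partial>lborel)"
    unfolding gauss_hat_def by (subst prod_ennreal) (auto simp: inner_diff_left)
  also have "\<dots> = (\<Prod>b\<in>Basis. (\<integral>\<^sup>+t. ennreal ((2 * pi) * normal_density 0 \<delta> (t - a \<bullet> b)) \<partial>lborel))"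
    by (rule nn_integral_lborel_prod[of "\<lambda>b t. ennreal ((2 * pi) * normal_density 0 \<delta> (t - a \<bullet> b))"]) auto
  also have "\<dots> = ennreal ((2 * pi) ^ DIM('a))" by (simp only: n1) (simp add: ennreal_power)
  finally show 2: "(\<integral>\<^sup>+z. ennreal (gauss_hat \<delta> (z - a)) \<partial>lborel) = ennreal ((2 * pi) ^ DIM('a))" .
  have "gauss_hat \<delta> (a - z) = gauss_hat \<delta> (z - a)" for z
    unfolding gauss_hat_def normal_density_def by (simp add: inner_diff_left power2_commute)
  then show "?L a = ennreal ((2 * pi) ^ DIM('a))" using 2 by simp
qed

text \<open>
  The square of the integral is expanded into a double integral over \<open>p\<close> and \<open>q\<close>, and the
  \<open>\<xi>\<close>-integral is carried out first.  The Gaussian factor makes everything absolutely integrable.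
\<close>
lemma fourier_square_integral:
  fixes V :: "'a::euclidean_space \<Rightarrow> real" and e :: "'a \<Rightarrow> 'a \<Rightarrow> real"
  assumes V: "integrable lborel V" and \<delta>: "0 < \<delta>"
    and e: "(\<lambda>(q, \<xi>). e q \<xi>) \<in> borel_measurable (borel \<Otimes>\<^sub>M borel)" "\<And>q \<xi>. \<bar>e q \<xi>\<bar> \<le> 1"
  shows "integrable lborel (\<lambda>p. V p * (\<integral>q. V q * (\<integral>\<xi>. gauss \<delta> \<xi> * (e p \<xi> * e q \<xi>) \<partial>lborel) \<partial>lborel))"
    and "(\<integral>\<xi>. gauss \<delta> \<xi> * (\<integral>q. V q * e q \<xi> \<partial>lborel)\<^sup>2 \<partial>lborel)
       = (\<integral>p. V p * (\<integral>q. V q * (\<integral>\<xi>. gauss \<delta> \<xi> * (e p \<xi> * e q \<xi>) \<partial>lborel) \<partial>lborel) \<partial>lborel)"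
    and "\<And>p. integrable lborel (\<lambda>q. V q * (\<integral>\<xi>. gauss \<delta> \<xi> * (e p \<xi> * e q \<xi>) \<partial>lborel))"
    and "integrable lborel (\<lambda>\<xi>. gauss \<delta> \<xi> * (\<integral>q. V q * e q \<xi> \<partial>lborel)\<^sup>2)"
    and "\<And>p q. integrable lborel (\<lambda>\<xi>. gauss \<delta> \<xi> * (e p \<xi> * e q \<xi>))"
proof -
  have [measurable]: "V \<in> borel_measurable borel" using V by auto
  have em [measurable (raw)]: "(\<lambda>x. e (f x) (g x)) \<in> borel_measurable N"
    if "f \<in> borel_measurable N" "g \<in> borel_measurable N" for f g and N :: "'c measure"
    using measurable_compose[OF measurable_Pair[OF that] e(1)] by simp
  have em' [measurable (raw)]: "(\<lambda>x. e (f x) (g x)) \<in> borel_measurable N"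
    if "f \<in> borel_measurable N" "g \<in> borel_measurable N" for f g and N :: "'a measure"
    using measurable_compose[OF measurable_Pair[OF that] e(1)] by simp
  have em'' [measurable (raw)]: "(\<lambda>x. e (f x) (g x)) \<in> borel_measurable N"
    if "f \<in> borel_measurable N" "g \<in> borel_measurable N" for f g and N :: "('a \<times> 'a) measure"
    using measurable_compose[OF measurable_Pair[OF that] e(1)] by simp
  have [measurable]: "gauss \<delta> \<in> borel_measurable (borel :: 'a measure)" unfolding gauss_def by measurable
  note gi = gauss_integrable[OF \<delta>, where 'a='a]
  have g0: "0 \<le> gauss \<delta> \<xi>" for \<xi> :: 'a unfolding gauss_def using \<delta> by (auto intro!: prod_nonneg)
  define c where "c \<xi> = (\<integral>q. V q * e q \<xi> \<partial>lborel)" for \<xi>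
  define B where "B = (\<integral>q. \<bar>V q\<bar> \<partial>lborel)"
  have Ve: "integrable lborel (\<lambda>q. V q * e q \<xi>)" for \<xi>
  proof (rule Bochner_Integration.integrable_bound[OF V])
    show "AE q in lborel. norm (V q * e q \<xi>) \<le> norm (V q)"
      using e(2) by (auto simp: abs_mult intro!: mult_left_le)
  qed measurable
  have cB: "\<bar>c \<xi>\<bar> \<le> B" for \<xi>
  proof -
    have "\<bar>c \<xi>\<bar> \<le> (\<integral>q. \<bar>V q * e q \<xi>\<bar> \<partial>lborel)" unfolding c_def by (rule integral_abs_bound)
    also have "\<dots> \<le> B" unfolding B_def
      by (rule integral_mono[OF integrable_abs[OF Ve] integrable_abs[OF V]])
        (use e(2) in \<open>auto simp: abs_mult intro!: mult_left_le\<close>)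
    finally show ?thesis .
  qed
  have [measurable]: "c \<in> borel_measurable borel" unfolding c_def by measurable
  have B0: "0 \<le> B" using cB[of 0] by linarith
  note sf = lborel.sigma_finite_measure_axioms
  have prodi: "integrable (lborel \<Otimes>\<^sub>M lborel) (\<lambda>z. h z * (gauss \<delta> (fst z) * V (snd z)))"
    if "h \<in> borel_measurable (borel \<Otimes>\<^sub>M borel)" "\<And>z. \<bar>h z\<bar> \<le> D" for h :: "'a \<times> 'a \<Rightarrow> real" and D
  proof (rule Bochner_Integration.integrable_bound)
    show "integrable (lborel \<Otimes>\<^sub>M lborel) (\<lambda>z::'a \<times> 'a. D * (gauss \<delta> (fst z) * V (snd z)))"
      by (intro integrable_mult_right integrable_times sf gi V)
    have "0 \<le> D" using that(2)[of undefined] by linarith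
    then show "AE z in lborel \<Otimes>\<^sub>M lborel. norm (h z * (gauss \<delta> (fst z) * V (snd z))) \<le> norm (D * (gauss \<delta> (fst z) * V (snd z)))"
      using that(2) by (auto simp: abs_mult intro!: mult_right_mono)
    show "(\<lambda>z. h z * (gauss \<delta> (fst z) * V (snd z))) \<in> borel_measurable (lborel \<Otimes>\<^sub>M lborel)"
      using that(1) by measurable
  qed
  show gee: "integrable lborel (\<lambda>\<xi>. gauss \<delta> \<xi> * (e p \<xi> * e q \<xi>))" for p q
  proof (rule Bochner_Integration.integrable_bound[OF gi])
    have "\<bar>e p \<xi> * e q \<xi>\<bar> \<le> 1" for \<xi> unfolding abs_mult using e(2) by (intro mult_le_one) auto
    then show "AE \<xi> in lborel. norm (gauss \<delta> \<xi> * (e p \<xi> * e q \<xi>)) \<le> norm (gauss \<delta> \<xi>)"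
      by (auto simp: abs_mult intro!: mult_left_le)
  qed measurable
  have i1: "integrable (lborel \<Otimes>\<^sub>M lborel) (\<lambda>(\<xi>, p). gauss \<delta> \<xi> * (V p * e p \<xi> * c \<xi>))"
  proof (rule Bochner_Integration.integrable_cong[THEN iffD1, OF refl])
    show "integrable (lborel \<Otimes>\<^sub>M lborel) (\<lambda>z. (e (snd z) (fst z) * c (fst z)) * (gauss \<delta> (fst z) * V (snd z)))"
    proof -
      have b: "\<bar>e (snd z) (fst z) * c (fst z)\<bar> \<le> B" for z
        unfolding abs_mult using mult_mono[OF e(2)[of "snd z" "fst z"] cB[of "fst z"]] by simp
      show ?thesis by (rule prodi[OF _ b]) measurable
    qed
  qed (auto simp: mult_ac)
  have i2: "integrable (lborel \<Otimes>\<^sub>M lborel) (\<lambda>(\<xi>, q). gauss \<delta> \<xi> * (e p \<xi> * (V q * e q \<xi>)))" for p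
  proof (rule Bochner_Integration.integrable_cong[THEN iffD1, OF refl])
    show "integrable (lborel \<Otimes>\<^sub>M lborel) (\<lambda>z. (e p (fst z) * e (snd z) (fst z)) * (gauss \<delta> (fst z) * V (snd z)))"
    proof -
      have b: "\<bar>e p (fst z) * e (snd z) (fst z)\<bar> \<le> 1" for z
        unfolding abs_mult using e(2) by (intro mult_le_one) auto
      show ?thesis by (rule prodi[OF _ b]) measurable
    qed
  qed (auto simp: mult_ac)
  have inner: "(\<integral>\<xi>. gauss \<delta> \<xi> * (V p * e p \<xi> * c \<xi>) \<partial>lborel)
      = V p * (\<integral>q. V q * (\<integral>\<xi>. gauss \<delta> \<xi> * (e p \<xi> * e q \<xi>) \<partial>lborel) \<partial>lborel)" for p
  proof -
    have "(\<integral>\<xi>. gauss \<delta> \<xi> * (V p * e p \<xi> * c \<xi>) \<partial>lborel) = V p * (\<integral>\<xi>. (\<integral>q. gauss \<delta> \<xi> * (e p \<xi> * (V q * e q \<xi>)) \<partial>lborel) \<partial>lborel)"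
      by (simp add: c_def mult_ac flip: integral_mult_right_zero)
    also have "\<dots> = V p * (\<integral>q. (\<integral>\<xi>. gauss \<delta> \<xi> * (e p \<xi> * (V q * e q \<xi>)) \<partial>lborel) \<partial>lborel)"
      by (subst lborel_pair.Fubini_integral[OF i2]) simp
    also have "\<dots> = V p * (\<integral>q. V q * (\<integral>\<xi>. gauss \<delta> \<xi> * (e p \<xi> * e q \<xi>) \<partial>lborel) \<partial>lborel)"
      by (simp add: mult_ac flip: integral_mult_right_zero)
    finally show ?thesis .
  qed
  show "integrable lborel (\<lambda>p. V p * (\<integral>q. V q * (\<integral>\<xi>. gauss \<delta> \<xi> * (e p \<xi> * e q \<xi>) \<partial>lborel) \<partial>lborel))"
    using lborel_pair.integrable_snd[OF i1] by (simp only: inner)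
  have "(\<integral>\<xi>. gauss \<delta> \<xi> * (c \<xi>)\<^sup>2 \<partial>lborel) = (\<integral>\<xi>. (\<integral>p. gauss \<delta> \<xi> * (V p * e p \<xi> * c \<xi>) \<partial>lborel) \<partial>lborel)"
    by (simp only: integral_mult_right_zero integral_mult_left_zero c_def[symmetric] power2_eq_square)
  also have "\<dots> = (\<integral>p. (\<integral>\<xi>. gauss \<delta> \<xi> * (V p * e p \<xi> * c \<xi>) \<partial>lborel) \<partial>lborel)"
    by (rule lborel_pair.Fubini_integral[OF i1, symmetric])
  also have "\<dots> = (\<integral>p. V p * (\<integral>q. V q * (\<integral>\<xi>. gauss \<delta> \<xi> * (e p \<xi> * e q \<xi>) \<partial>lborel) \<partial>lborel) \<partial>lborel)"
    by (simp only: inner)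
  finally show "(\<integral>\<xi>. gauss \<delta> \<xi> * (\<integral>q. V q * e q \<xi> \<partial>lborel)\<^sup>2 \<partial>lborel)
       = (\<integral>p. V p * (\<integral>q. V q * (\<integral>\<xi>. gauss \<delta> \<xi> * (e p \<xi> * e q \<xi>) \<partial>lborel) \<partial>lborel) \<partial>lborel)"
    unfolding c_def .
  show "integrable lborel (\<lambda>q. V q * (\<integral>\<xi>. gauss \<delta> \<xi> * (e p \<xi> * e q \<xi>) \<partial>lborel))" for p
  proof -
    have "(\<integral>\<xi>. gauss \<delta> \<xi> * (e p \<xi> * (V q * e q \<xi>)) \<partial>lborel) = V q * (\<integral>\<xi>. gauss \<delta> \<xi> * (e p \<xi> * e q \<xi>) \<partial>lborel)" for q
      by (simp add: mult_ac flip: integral_mult_right_zero)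
    then show ?thesis using lborel_pair.integrable_snd[OF i2, of p] by simp
  qed
  show "integrable lborel (\<lambda>\<xi>. gauss \<delta> \<xi> * (\<integral>q. V q * e q \<xi> \<partial>lborel)\<^sup>2)"
    unfolding c_def[symmetric]
  proof (rule Bochner_Integration.integrable_bound)
    show "integrable lborel (\<lambda>\<xi>::'a. B\<^sup>2 * gauss \<delta> \<xi>)" using gi by simp
    have "(c \<xi>)\<^sup>2 \<le> B\<^sup>2" for \<xi> using cB[of \<xi>] B0 by (simp add: abs_le_square_iff[symmetric])
    then show "AE \<xi> in lborel. norm (gauss \<delta> \<xi> * (c \<xi>)\<^sup>2) \<le> norm (B\<^sup>2 * gauss \<delta> \<xi>)"
      using g0 by (auto simp: abs_mult mult.commute intro!: mult_left_mono)
  qed measurable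
qed

definition fourier_cos :: "('a::euclidean_space \<Rightarrow> real) \<Rightarrow> 'a \<Rightarrow> real" where
  "fourier_cos V \<xi> = (\<integral>q. V q * cos (q \<bullet> \<xi>) \<partial>lborel)"

definition fourier_sin :: "('a::euclidean_space \<Rightarrow> real) \<Rightarrow> 'a \<Rightarrow> real" where
  "fourier_sin V \<xi> = (\<integral>q. V q * sin (q \<bullet> \<xi>) \<partial>lborel)"

lemma fourier_measurable:
  assumes [measurable]: "V \<in> borel_measurable borel"
  shows "fourier_cos V \<in> borel_measurable borel" "fourier_sin V \<in> borel_measurable borel"
  unfolding fourier_cos_def[abs_def] fourier_sin_def[abs_def] by measurable

text \<open>
  Against a Gaussian weight the energy of the transform becomes a double integral of
  \<open>V(p) V(q)\<close> with a positive kernel of mass \<open>(2 \<pi>)\<^sup>d\<close>, whatever the width of the Gaussian is.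
\<close>
lemma plancherel_gauss:
  fixes V :: "'a::euclidean_space \<Rightarrow> real"
  assumes V: "integrable lborel V" and \<delta>: "0 < \<delta>"
  shows "(\<integral>\<^sup>+\<xi>. ennreal (gauss \<delta> \<xi> * ((fourier_cos V \<xi>)\<^sup>2 + (fourier_sin V \<xi>)\<^sup>2)) \<partial>lborel)
     \<le> ennreal ((2 * pi) ^ DIM('a)) * (\<integral>\<^sup>+q. ennreal ((V q)\<^sup>2) \<partial>lborel)"
proof -
  have [measurable]: "V \<in> borel_measurable borel" using V by auto
  let ?ec = "\<lambda>q \<xi>::'a. cos (q \<bullet> \<xi>)" and ?es = "\<lambda>q \<xi>::'a. sin (q \<bullet> \<xi>)"
  have "(\<lambda>(q, \<xi>). ?ec q \<xi>) \<in> borel_measurable (borel \<Otimes>\<^sub>M borel)" by measurable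
  note fc = fourier_square_integral[OF V \<delta> this abs_cos_le_one]
  have "(\<lambda>(q, \<xi>). ?es q \<xi>) \<in> borel_measurable (borel \<Otimes>\<^sub>M borel)" by measurable
  note fs = fourier_square_integral[OF V \<delta> this abs_sin_le_one]
  have hat: "(\<integral>\<xi>. gauss \<delta> \<xi> * (?ec p \<xi> * ?ec q \<xi>) \<partial>lborel) + (\<integral>\<xi>. gauss \<delta> \<xi> * (?es p \<xi> * ?es q \<xi>) \<partial>lborel) = gauss_hat \<delta> (p - q)" for p q
  proof -
    have "(\<integral>\<xi>. gauss \<delta> \<xi> * (?ec p \<xi> * ?ec q \<xi>) \<partial>lborel) + (\<integral>\<xi>. gauss \<delta> \<xi> * (?es p \<xi> * ?es q \<xi>) \<partial>lborel)
       = (\<integral>\<xi>. gauss \<delta> \<xi> * (?ec p \<xi> * ?ec q \<xi>) + gauss \<delta> \<xi> * (?es p \<xi> * ?es q \<xi>) \<partial>lborel)"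
      by (rule Bochner_Integration.integral_add[OF fc(5) fs(5), symmetric])
    also have "\<dots> = (\<integral>\<xi>. cos ((p - q) \<bullet> \<xi>) * gauss \<delta> \<xi> \<partial>lborel)"
      by (intro Bochner_Integration.integral_cong refl) (simp add: inner_diff_left cos_diff algebra_simps)
    finally show ?thesis by (simp add: gauss_fourier[OF \<delta>])
  qed
  have g0: "0 \<le> gauss \<delta> \<xi>" for \<xi> :: 'a unfolding gauss_def using \<delta> by (auto intro!: prod_nonneg)
  define J where "J = (\<integral>p. V p * (\<integral>q. V q * gauss_hat \<delta> (p - q) \<partial>lborel) \<partial>lborel)"
  have "(\<integral>\<xi>. gauss \<delta> \<xi> * ((fourier_cos V \<xi>)\<^sup>2 + (fourier_sin V \<xi>)\<^sup>2) \<partial>lborel)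
     = (\<integral>\<xi>. gauss \<delta> \<xi> * (fourier_cos V \<xi>)\<^sup>2 \<partial>lborel) + (\<integral>\<xi>. gauss \<delta> \<xi> * (fourier_sin V \<xi>)\<^sup>2 \<partial>lborel)"
    unfolding distrib_left fourier_cos_def fourier_sin_def
    by (rule Bochner_Integration.integral_add[OF fc(4) fs(4)])
  also have "\<dots> = J"
    unfolding fourier_cos_def fourier_sin_def fc(2) fs(2) J_def hat[symmetric]
    by (subst Bochner_Integration.integral_add[OF fc(1) fs(1), symmetric])
      (simp add: distrib_left Bochner_Integration.integral_add[OF fc(3) fs(3)])
  finally have IJ: "(\<integral>\<xi>. gauss \<delta> \<xi> * ((fourier_cos V \<xi>)\<^sup>2 + (fourier_sin V \<xi>)\<^sup>2) \<partial>lborel) = J" .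
  have "integrable lborel (\<lambda>\<xi>. gauss \<delta> \<xi> * ((fourier_cos V \<xi>)\<^sup>2 + (fourier_sin V \<xi>)\<^sup>2))"
    unfolding distrib_left fourier_cos_def fourier_sin_def
    by (rule Bochner_Integration.integrable_add[OF fc(4) fs(4)])
  then have "(\<integral>\<^sup>+\<xi>. ennreal (gauss \<delta> \<xi> * ((fourier_cos V \<xi>)\<^sup>2 + (fourier_sin V \<xi>)\<^sup>2)) \<partial>lborel) = ennreal J"
    unfolding IJ[symmetric] using g0 by (intro nn_integral_eq_integral) (auto intro!: mult_nonneg_nonneg)
  also have "ennreal J \<le> (\<integral>\<^sup>+p. (\<integral>\<^sup>+q. ennreal (\<bar>V p\<bar> * (\<bar>V q\<bar> * gauss_hat \<delta> (p - q))) \<partial>lborel) \<partial>lborel)"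
  proof -
    have iq: "integrable lborel (\<lambda>q. V q * gauss_hat \<delta> (p - q))" for p
      unfolding hat[symmetric] distrib_left by (rule Bochner_Integration.integrable_add[OF fc(3) fs(3)])
    have ip: "integrable lborel (\<lambda>p. V p * (\<integral>q. V q * gauss_hat \<delta> (p - q) \<partial>lborel))"
      unfolding hat[symmetric] distrib_left Bochner_Integration.integral_add[OF fc(3) fs(3)]
      by (rule Bochner_Integration.integrable_add[OF fc(1) fs(1)])
    have "ennreal J \<le> ennreal \<bar>J\<bar>" by (intro ennreal_leI) simp
    also have "\<dots> \<le> (\<integral>\<^sup>+p. ennreal \<bar>V p * (\<integral>q. V q * gauss_hat \<delta> (p - q) \<partial>lborel)\<bar> \<partial>lborel)"
      using integral_norm_bound_ennreal[OF ip] by (simp add: J_def)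
    also have "\<dots> \<le> (\<integral>\<^sup>+p. (\<integral>\<^sup>+q. ennreal (\<bar>V p\<bar> * (\<bar>V q\<bar> * gauss_hat \<delta> (p - q))) \<partial>lborel) \<partial>lborel)"
    proof (rule nn_integral_mono)
      fix p
      have "ennreal \<bar>V p * (\<integral>q. V q * gauss_hat \<delta> (p - q) \<partial>lborel)\<bar> = ennreal \<bar>V p\<bar> * ennreal \<bar>\<integral>q. V q * gauss_hat \<delta> (p - q) \<partial>lborel\<bar>"
        by (simp add: abs_mult ennreal_mult)
      also have "\<dots> \<le> ennreal \<bar>V p\<bar> * (\<integral>\<^sup>+q. ennreal (\<bar>V q\<bar> * gauss_hat \<delta> (p - q)) \<partial>lborel)"
        using integral_norm_bound_ennreal[OF iq, of p]
        by (intro mult_left_mono) (auto simp: abs_mult gauss_hat_nonneg)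
      also have "\<dots> = (\<integral>\<^sup>+q. ennreal (\<bar>V p\<bar> * (\<bar>V q\<bar> * gauss_hat \<delta> (p - q))) \<partial>lborel)"
        by (subst nn_integral_cmult[symmetric]) (auto simp: ennreal_mult gauss_hat_nonneg)
      finally show "ennreal \<bar>V p * (\<integral>q. V q * gauss_hat \<delta> (p - q) \<partial>lborel)\<bar> \<le> (\<integral>\<^sup>+q. ennreal (\<bar>V p\<bar> * (\<bar>V q\<bar> * gauss_hat \<delta> (p - q))) \<partial>lborel)" .
    qed
    finally show ?thesis .
  qed
  also have "\<dots> \<le> (\<integral>\<^sup>+p. (\<integral>\<^sup>+q. ennreal ((V p)\<^sup>2 / 2) * ennreal (gauss_hat \<delta> (p - q)) + ennreal ((V q)\<^sup>2 / 2) * ennreal (gauss_hat \<delta> (p - q)) \<partial>lborel) \<partial>lborel)"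
  proof (intro nn_integral_mono)
    fix p q
    have "\<bar>V p\<bar> * \<bar>V q\<bar> \<le> (V p)\<^sup>2 / 2 + (V q)\<^sup>2 / 2"
      using sum_squares_bound[of "\<bar>V p\<bar>" "\<bar>V q\<bar>"] by simp
    then have "\<bar>V p\<bar> * \<bar>V q\<bar> * gauss_hat \<delta> (p - q) \<le> ((V p)\<^sup>2 / 2 + (V q)\<^sup>2 / 2) * gauss_hat \<delta> (p - q)"
      by (intro mult_right_mono gauss_hat_nonneg)
    then have "ennreal (\<bar>V p\<bar> * (\<bar>V q\<bar> * gauss_hat \<delta> (p - q))) \<le> ennreal ((V p)\<^sup>2 / 2 * gauss_hat \<delta> (p - q) + (V q)\<^sup>2 / 2 * gauss_hat \<delta> (p - q))"
      by (intro ennreal_leI) (simp add: distrib_right mult.assoc)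
    also have "\<dots> = ennreal ((V p)\<^sup>2 / 2) * ennreal (gauss_hat \<delta> (p - q)) + ennreal ((V q)\<^sup>2 / 2) * ennreal (gauss_hat \<delta> (p - q))"
      by (simp only: ennreal_plus[OF mult_nonneg_nonneg mult_nonneg_nonneg] ennreal_mult[OF _ gauss_hat_nonneg]
          gauss_hat_nonneg zero_le_power2 divide_nonneg_pos zero_less_numeral)
    finally show "ennreal (\<bar>V p\<bar> * (\<bar>V q\<bar> * gauss_hat \<delta> (p - q))) \<le> ennreal ((V p)\<^sup>2 / 2) * ennreal (gauss_hat \<delta> (p - q)) + ennreal ((V q)\<^sup>2 / 2) * ennreal (gauss_hat \<delta> (p - q))" .
  qed
  also have "\<dots> = (\<integral>\<^sup>+p. (\<integral>\<^sup>+q. ennreal ((V p)\<^sup>2 / 2) * ennreal (gauss_hat \<delta> (p - q)) \<partial>lborel) \<partial>lborel)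
      + (\<integral>\<^sup>+p. (\<integral>\<^sup>+q. ennreal ((V q)\<^sup>2 / 2) * ennreal (gauss_hat \<delta> (p - q)) \<partial>lborel) \<partial>lborel)"
    by (simp add: nn_integral_add)
  also have "(\<integral>\<^sup>+p. (\<integral>\<^sup>+q. ennreal ((V q)\<^sup>2 / 2) * ennreal (gauss_hat \<delta> (p - q)) \<partial>lborel) \<partial>lborel)
      = (\<integral>\<^sup>+q. (\<integral>\<^sup>+p. ennreal ((V q)\<^sup>2 / 2) * ennreal (gauss_hat \<delta> (p - q)) \<partial>lborel) \<partial>lborel)"
    by (rule lborel_pair.Fubini'[symmetric]) measurable
  also have "\<dots> = (\<integral>\<^sup>+q. ennreal ((V q)\<^sup>2 / 2) \<partial>lborel) * ennreal ((2 * pi) ^ DIM('a))"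
    by (simp add: nn_integral_cmult nn_integral_multc nn_integral_gauss_hat(2)[OF \<delta>])
  also have "(\<integral>\<^sup>+p. (\<integral>\<^sup>+q. ennreal ((V p)\<^sup>2 / 2) * ennreal (gauss_hat \<delta> (p - q)) \<partial>lborel) \<partial>lborel)
      = (\<integral>\<^sup>+q. ennreal ((V q)\<^sup>2 / 2) \<partial>lborel) * ennreal ((2 * pi) ^ DIM('a))"
    by (simp add: nn_integral_cmult nn_integral_multc nn_integral_gauss_hat(1)[OF \<delta>])
  also have "(\<integral>\<^sup>+q. ennreal ((V q)\<^sup>2 / 2) \<partial>lborel) * ennreal ((2 * pi) ^ DIM('a)) + (\<integral>\<^sup>+q. ennreal ((V q)\<^sup>2 / 2) \<partial>lborel) * ennreal ((2 * pi) ^ DIM('a))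
     = ennreal ((2 * pi) ^ DIM('a)) * ((\<integral>\<^sup>+q. ennreal ((V q)\<^sup>2 / 2) \<partial>lborel) + (\<integral>\<^sup>+q. ennreal ((V q)\<^sup>2 / 2) \<partial>lborel))"
    by (simp only: distrib_left mult.commute)
  also have "(\<integral>\<^sup>+q. ennreal ((V q)\<^sup>2 / 2) \<partial>lborel) + (\<integral>\<^sup>+q. ennreal ((V q)\<^sup>2 / 2) \<partial>lborel) = (\<integral>\<^sup>+q. ennreal ((V q)\<^sup>2) \<partial>lborel)"
    by (subst nn_integral_add[symmetric]) (auto intro!: nn_integral_cong simp flip: ennreal_plus)
  finally show ?thesis .
qed

text \<open>
  The limit of \<open>plancherel_gauss\<close> as the Gaussian flattens out to \<open>1\<close>; Fatou gives the inequality.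
\<close>
lemma plancherel_le:
  fixes V :: "'a::euclidean_space \<Rightarrow> real"
  assumes V: "integrable lborel V"
  shows "(\<integral>\<^sup>+\<xi>. ennreal ((fourier_cos V \<xi>)\<^sup>2 + (fourier_sin V \<xi>)\<^sup>2) \<partial>lborel)
     \<le> ennreal ((2 * pi) ^ DIM('a)) * (\<integral>\<^sup>+q. ennreal ((V q)\<^sup>2) \<partial>lborel)"
proof -
  have [measurable]: "V \<in> borel_measurable borel" using V by auto
  note fourier_measurable[OF this, measurable]
  let ?E = "\<lambda>\<xi>. (fourier_cos V \<xi>)\<^sup>2 + (fourier_sin V \<xi>)\<^sup>2"
  define d where "d n = 1 / real (Suc n)" for n
  have d: "0 < d n" for n by (simp add: d_def)
  have [measurable]: "gauss \<delta> \<in> borel_measurable (borel :: 'a measure)" for \<delta> unfolding gauss_def by measurable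
  have lim: "(\<lambda>n. ennreal (gauss (d n) \<xi> * ?E \<xi>)) \<longlonglongrightarrow> ennreal (?E \<xi>)" for \<xi>
  proof -
    have "d \<longlonglongrightarrow> 0" unfolding d_def by (rule LIMSEQ_inverse_real_of_nat[unfolded inverse_eq_divide])
    then have "(\<lambda>n. exp (- (d n * norm \<xi>)\<^sup>2 / 2) * ?E \<xi>) \<longlonglongrightarrow> exp (- (0 * norm \<xi>)\<^sup>2 / 2) * ?E \<xi>"
      by (intro tendsto_intros) auto
    then show ?thesis by (intro tendsto_ennrealI) (simp add: gauss_eq[OF d])
  qed
  have "(\<integral>\<^sup>+\<xi>. ennreal (?E \<xi>) \<partial>lborel) = (\<integral>\<^sup>+\<xi>. liminf (\<lambda>n. ennreal (gauss (d n) \<xi> * ?E \<xi>)) \<partial>lborel)"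
    by (intro nn_integral_cong lim_imp_Liminf[symmetric] lim) simp
  also have "\<dots> \<le> liminf (\<lambda>n. \<integral>\<^sup>+\<xi>. ennreal (gauss (d n) \<xi> * ?E \<xi>) \<partial>lborel)"
    by (rule nn_integral_liminf) measurable
  also have "\<dots> \<le> limsup (\<lambda>n. \<integral>\<^sup>+\<xi>. ennreal (gauss (d n) \<xi> * ?E \<xi>) \<partial>lborel)"
    by (rule Liminf_le_Limsup) simp
  also have "\<dots> \<le> ennreal ((2 * pi) ^ DIM('a)) * (\<integral>\<^sup>+q. ennreal ((V q)\<^sup>2) \<partial>lborel)"
    by (intro Limsup_bounded always_eventually allI plancherel_gauss[OF V d])
  finally show ?thesis .
qed

section \<open>Bessel-potential norms of compactly supported functions\<close>

lemma esqrt_power2: "(esqrt a)\<^sup>2 = a"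
proof (cases "a = top")
  case False
  then obtain x where "a = ennreal x" "0 \<le> x" by (cases a) auto
  then show ?thesis by (simp add: esqrt_def ennreal_power)
qed (simp add: esqrt_def power2_eq_square)

lemma esqrt_0_iff: "esqrt a = 0 \<longleftrightarrow> a = 0"
  by (metis esqrt_power2 power2_eq_square mult_zero_left esqrt_def enn2real_0 real_sqrt_zero ennreal_0 ennreal_zero_neq_top)

lemma esqrt_less_top_iff: "esqrt a < top \<longleftrightarrow> a < top"
  by (auto simp: esqrt_def less_top)

lemma esqrt_mono: "a \<le> b \<Longrightarrow> esqrt a \<le> esqrt b"
  by (auto simp: esqrt_def top_unique less_top intro!: ennreal_leI real_sqrt_le_mono enn2real_mono)

text \<open>
  For \<open>nn_integral\<close> the completion makes no difference, even on functions that are not measurable.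
\<close>
lemma L2_norm_lborel: "L2_norm lebesgue u = esqrt (\<integral>\<^sup>+p. ennreal ((norm (u p))\<^sup>2) \<partial>lborel)"
  unfolding L2_norm_def by (simp add: nn_integral_completion)

lemma L2_compact_support_integrable:
  fixes V :: "'a::euclidean_space \<Rightarrow> real"
  assumes V [measurable]: "V \<in> borel_measurable borel" and supp: "\<And>q. q \<notin> cball 0 r \<Longrightarrow> V q = 0"
    and fin: "(\<integral>\<^sup>+q. ennreal ((V q)\<^sup>2) \<partial>lborel) < \<infinity>"
  shows "integrable lborel V"
proof (rule Bochner_Integration.integrable_bound)
  have "integrable lborel (\<lambda>q. (V q)\<^sup>2)" using fin by (intro integrableI_nonneg) auto
  then show "integrable lborel (\<lambda>q. (V q)\<^sup>2 + 1 * indicator (cball 0 r) q)"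
    by (intro Bochner_Integration.integrable_add integrable_indicator_cball)
  show "AE q in lborel. norm (V q) \<le> norm ((V q)\<^sup>2 + 1 * indicator (cball 0 r) q)"
  proof (rule AE_I2)
    fix q
    have "\<bar>V q\<bar> \<le> (V q)\<^sup>2 + 1"
    proof -
      have "0 \<le> (\<bar>V q\<bar> - 1)\<^sup>2 + \<bar>V q\<bar>" by simp
      then show ?thesis by (simp add: power2_diff)
    qed
    then show "norm (V q) \<le> norm ((V q)\<^sup>2 + 1 * indicator (cball 0 r) q)"
      using supp[of q] by (cases "q \<in> cball 0 r") auto
  qed
qed measurable

text \<open>
  For a function supported in a ball of radius \<open>r\<close> the truncated Fourier integrals are constant
  once the radius of truncation exceeds \<open>r\<close>.  Their limit is therefore the classical transform,
  and any other \<open>L\<^sup>2\<close> limit, in particular the one that is chosen, agrees with it almost everywhere.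
\<close>
lemma Hs_norm_compact_support:
  fixes V :: "'a::euclidean_space \<Rightarrow> real"
  assumes V [measurable]: "V \<in> borel_measurable borel" and supp: "\<And>q. q \<notin> cball 0 r \<Longrightarrow> V q = 0"
    and fin: "(\<integral>\<^sup>+q. ennreal ((V q)\<^sup>2) \<partial>lborel) < \<infinity>"
  shows "Hs_norm s (\<lambda>q. complex_of_real (V q)) = esqrt (\<integral>\<^sup>+\<xi>. ennreal ((1 + (norm \<xi>)\<^sup>2) powr s *
      ((fourier_cos V \<xi>)\<^sup>2 + (fourier_sin V \<xi>)\<^sup>2)) \<partial>lborel)"
proof -
  have int: "integrable lborel V" by (rule L2_compact_support_integrable[OF V supp fin])
  let ?V = "\<lambda>q. complex_of_real (V q)"
  define W where "W \<xi> = complex_of_real (fourier_cos V \<xi>) - \<i> * complex_of_real (fourier_sin V \<xi>)" for \<xi>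
  note fourier_measurable[OF V, measurable]
  have Wm [measurable]: "W \<in> borel_measurable borel" unfolding W_def[abs_def] by measurable
  have W2: "(cmod (W \<xi>))\<^sup>2 = (fourier_cos V \<xi>)\<^sup>2 + (fourier_sin V \<xi>)\<^sup>2" for \<xi>
    by (simp add: W_def cmod_power2)
  have trig: "integrable lborel (\<lambda>q. V q * cos (q \<bullet> \<xi>))" "integrable lborel (\<lambda>q. V q * sin (q \<bullet> \<xi>))" for \<xi>
    by (rule Bochner_Integration.integrable_bound[OF int]; (measurable; fail | (auto simp: abs_mult intro!: mult_left_le)))+
  have F: "(\<integral>q. exp (- \<i> * of_real (q \<bullet> \<xi>)) * ?V q \<partial>lebesgue_on (ball 0 R)) = W \<xi>" if R: "r < R" for R \<xi>
  proof -
    have "(\<integral>q. exp (- \<i> * of_real (q \<bullet> \<xi>)) * ?V q \<partial>lebesgue_on (ball 0 R))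
       = (\<integral>q. indicator (ball 0 R) q *\<^sub>R (exp (- \<i> * of_real (q \<bullet> \<xi>)) * ?V q) \<partial>lebesgue)"
      by (rule integral_restrict_space) auto
    also have "\<dots> = (\<integral>q. complex_of_real (V q * cos (q \<bullet> \<xi>)) - \<i> * complex_of_real (V q * sin (q \<bullet> \<xi>)) \<partial>lebesgue)"
    proof (intro Bochner_Integration.integral_cong refl)
      fix q
      have "exp (- \<i> * of_real (q \<bullet> \<xi>)) = cis (- (q \<bullet> \<xi>))" by (simp add: cis_conv_exp)
      then have e: "exp (- \<i> * of_real (q \<bullet> \<xi>)) * ?V q
          = complex_of_real (V q * cos (q \<bullet> \<xi>)) - \<i> * complex_of_real (V q * sin (q \<bullet> \<xi>))"
        by (simp add: complex_eq_iff)
      have "q \<notin> ball 0 R \<Longrightarrow> V q = 0" using supp[of q] R by auto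
      then show "indicator (ball 0 R) q *\<^sub>R (exp (- \<i> * of_real (q \<bullet> \<xi>)) * ?V q)
          = complex_of_real (V q * cos (q \<bullet> \<xi>)) - \<i> * complex_of_real (V q * sin (q \<bullet> \<xi>))"
        unfolding e by (cases "q \<in> ball 0 R") auto
    qed
    also have "\<dots> = (\<integral>q. complex_of_real (V q * cos (q \<bullet> \<xi>)) - \<i> * complex_of_real (V q * sin (q \<bullet> \<xi>)) \<partial>lborel)"
      by (rule integral_completion) measurable
    also have "\<dots> = (\<integral>q. complex_of_real (V q * cos (q \<bullet> \<xi>)) \<partial>lborel) - (\<integral>q. \<i> * complex_of_real (V q * sin (q \<bullet> \<xi>)) \<partial>lborel)"
      by (intro Bochner_Integration.integral_diff integrable_mult_right integrable_of_real trig)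
    also have "\<dots> = W \<xi>"
      unfolding W_def fourier_cos_def fourier_sin_def
      by (simp only: integral_mult_right_zero integral_complex_of_real)
    finally show ?thesis .
  qed
  have WL2: "W \<in> L2 lebesgue"
  proof -
    have "(\<integral>\<^sup>+\<xi>. ennreal ((cmod (W \<xi>))\<^sup>2) \<partial>lborel) < top"
      unfolding W2 using plancherel_le[OF int] fin
      by (auto simp: ennreal_mult_less_top intro: order.strict_trans1)
    then have "L2_norm lebesgue W < top"
      unfolding L2_norm_lborel esqrt_less_top_iff .
    then show ?thesis by (simp add: L2_def measurable_completion)
  qed
  let ?F = "\<lambda>R \<xi>. \<integral>q. exp (- \<i> * of_real (q \<bullet> \<xi>)) * ?V q \<partial>lebesgue_on (ball 0 R)"
  have ev: "\<forall>\<^sub>F R in at_top. L2_norm lebesgue (\<lambda>\<xi>. ?F R \<xi> - U \<xi>) = L2_norm lebesgue (\<lambda>\<xi>. W \<xi> - U \<xi>)" for U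
    using eventually_gt_at_top[of r] by eventually_elim (simp only: F)
  have "is_L2_fourier ?V W"
    unfolding is_L2_fourier_def
  proof (intro conjI WL2 tendsto_eventually)
    have z: "L2_norm lebesgue (\<lambda>\<xi>. W \<xi> - W \<xi>) = 0" by (simp add: L2_norm_def esqrt_0_iff)
    show "\<forall>\<^sub>F R in at_top. L2_norm lebesgue (\<lambda>\<xi>. ?F R \<xi> - W \<xi>) = 0"
      using ev[of W] unfolding z .
  qed
  then have U: "is_L2_fourier ?V (L2_fourier ?V)"
    unfolding L2_fourier_def by (rule someI[where P="is_L2_fourier ?V"])
  let ?U = "L2_fourier ?V"
  have Um: "?U \<in> borel_measurable lebesgue" using U by (auto simp: is_L2_fourier_def L2_def)
  have "((\<lambda>R. L2_norm lebesgue (\<lambda>\<xi>. ?F R \<xi> - ?U \<xi>)) \<longlongrightarrow> L2_norm lebesgue (\<lambda>\<xi>. W \<xi> - ?U \<xi>)) at_top"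
    by (rule tendsto_eventually[OF ev])
  moreover have "((\<lambda>R. L2_norm lebesgue (\<lambda>\<xi>. ?F R \<xi> - ?U \<xi>)) \<longlongrightarrow> 0) at_top"
    using U by (simp add: is_L2_fourier_def)
  ultimately have "L2_norm lebesgue (\<lambda>\<xi>. W \<xi> - ?U \<xi>) = 0"
    by (rule tendsto_unique[rotated]) simp
  then have "(\<integral>\<^sup>+\<xi>. ennreal ((cmod (W \<xi> - ?U \<xi>))\<^sup>2) \<partial>lebesgue) = 0"
    by (simp add: L2_norm_def esqrt_0_iff)
  moreover have "W \<in> borel_measurable lebesgue" using Wm by (simp add: measurable_completion)
  ultimately have "AE \<xi> in lebesgue. W \<xi> = ?U \<xi>"
    using Um by (subst (asm) nn_integral_0_iff_AE) auto
  then have "(\<integral>\<^sup>+\<xi>. ennreal ((1 + (norm \<xi>)\<^sup>2) powr s * (cmod (?U \<xi>))\<^sup>2) \<partial>lebesgue)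
     = (\<integral>\<^sup>+\<xi>. ennreal ((1 + (norm \<xi>)\<^sup>2) powr s * (cmod (W \<xi>))\<^sup>2) \<partial>lebesgue)"
    by (intro nn_integral_cong_AE) auto
  then show ?thesis unfolding Hs_norm_def W2 by (simp add: nn_integral_completion)
qed

text \<open>A cutoff of \<open>u\<close> is an extension of \<open>u\<close>, and thus bounds the quotient norm.\<close>
lemma Hs_norm_on_le:
  fixes V u :: "'a::euclidean_space \<Rightarrow> real"
  assumes V: "V \<in> borel_measurable borel" and supp: "\<And>q. q \<notin> cball 0 r \<Longrightarrow> V q = 0"
    and fin: "(\<integral>\<^sup>+q. ennreal ((V q)\<^sup>2) \<partial>lborel) < \<infinity>"
    and ext: "AE q in lborel. q \<in> D \<longrightarrow> V q = u q"
  shows "(Hs_norm_on s D (\<lambda>q. complex_of_real (u q)))\<^sup>2 \<le> (\<integral>\<^sup>+\<xi>. ennreal ((1 + (norm \<xi>)\<^sup>2) powr s *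
      ((fourier_cos V \<xi>)\<^sup>2 + (fourier_sin V \<xi>)\<^sup>2)) \<partial>lborel)" (is "_ \<le> ?I")
proof (cases "?I = top")
  case False
  let ?V = "\<lambda>q. complex_of_real (V q)"
  have eq: "Hs_norm s ?V = esqrt ?I"
    by (rule Hs_norm_compact_support[where r=r, OF V supp fin])
  have "?V \<in> L2 lebesgue"
  proof -
    have "(\<lambda>q. complex_of_real (V q)) \<in> borel_measurable borel" using V by measurable
    moreover have "L2_norm lebesgue ?V < top"
      unfolding L2_norm_lborel esqrt_less_top_iff using fin by simp
    ultimately show ?thesis by (simp add: L2_def measurable_completion)
  qed
  then have "?V \<in> Hs s"
    using False unfolding Hs_def mem_Collect_eq eq esqrt_less_top_iff by (simp add: less_top)
  moreover have "AE q in lebesgue. q \<in> D \<longrightarrow> ?V q = complex_of_real (u q)"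
    unfolding AE_completion_iff using ext by simp
  ultimately have "Hs_norm_on s D (\<lambda>q. complex_of_real (u q)) \<le> Hs_norm s ?V"
    unfolding Hs_norm_on_def by (intro INF_lower) auto
  then have "(Hs_norm_on s D (\<lambda>q. complex_of_real (u q)))\<^sup>2 \<le> (Hs_norm s ?V)\<^sup>2"
    by (intro power_mono) auto
  then show ?thesis by (simp add: eq esqrt_power2)
qed simp

section \<open>From the kinetic equation to its Fourier transform\<close>

definition W2 :: "('x::euclidean_space \<Rightarrow> real) \<Rightarrow> ('x \<times> 'q::euclidean_space \<Rightarrow> real) \<Rightarrow> ennreal" where
  "W2 w u = (\<integral>\<^sup>+p. ennreal ((u p)\<^sup>2 * w (fst p)) \<partial>lborel)"

definition field :: "real \<Rightarrow> ('x::euclidean_space \<Rightarrow> real) \<Rightarrow> ('x \<times> 'q::euclidean_space \<Rightarrow> real) \<Rightarrow> bool" where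
  "field R w u \<longleftrightarrow> u \<in> borel_measurable borel \<and> (\<forall>p. p \<notin> cball 0 R \<times> cball 0 R \<longrightarrow> u p = 0) \<and> W2 w u < \<infinity>"

text \<open>
  The Fourier transform in \<open>q\<close>, with \<open>e\<close> one of the functions \<open>sin\<close>, \<open>cos\<close> and \<open>- sin\<close>.
\<close>
definition osc :: "(real \<Rightarrow> real) \<Rightarrow> 'q::euclidean_space \<Rightarrow> ('x::euclidean_space \<times> 'q \<Rightarrow> real) \<Rightarrow> 'x \<Rightarrow> real" where
  "osc e \<xi> u x = (\<integral>q. u (x, q) * e (q \<bullet> \<xi>) \<partial>lborel)"

lemma osc_cos: "osc cos \<xi> u x = fourier_cos (\<lambda>q. u (x, q)) \<xi>"
  and osc_sin: "osc sin \<xi> u x = fourier_sin (\<lambda>q. u (x, q)) \<xi>"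
  by (simp_all add: osc_def fourier_cos_def fourier_sin_def)

lemma fieldD:
  assumes "field R w u"
  shows "u \<in> borel_measurable borel" "u \<in> borel_measurable (borel \<Otimes>\<^sub>M borel)"
    "\<And>p. p \<notin> cball 0 R \<times> cball 0 R \<Longrightarrow> u p = 0" "\<And>x q. x \<notin> cball 0 R \<Longrightarrow> u (x, q) = 0" "W2 w u < \<infinity>"
proof -
  show "u \<in> borel_measurable borel" and z: "\<And>p. p \<notin> cball 0 R \<times> cball 0 R \<Longrightarrow> u p = 0" and "W2 w u < \<infinity>"
    using assms unfolding field_def by blast+
  then show "u \<in> borel_measurable (borel \<Otimes>\<^sub>M borel)" by (simp add: borel_prod)
  show "u (x, q) = 0" if "x \<notin> cball 0 R" for x q by (rule z) (use that in blast)
qed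

lemma osc_outside:
  assumes "field R w u" "x \<notin> cball 0 R" shows "osc e \<xi> u x = 0"
  unfolding osc_def using fieldD(4)[OF assms] by simp

lemma osc_measurable:
  assumes u: "field R w u" and [measurable]: "e \<in> borel_measurable borel"
  shows "osc e \<xi> u \<in> borel_measurable borel"
    "(\<lambda>(\<xi>, x). osc e \<xi> u x) \<in> borel_measurable (borel \<Otimes>\<^sub>M borel)"
proof -
  note fieldD(2)[OF u, measurable]
  show "osc e \<xi> u \<in> borel_measurable borel" unfolding osc_def by measurable
  show "(\<lambda>(\<xi>, x). osc e \<xi> u x) \<in> borel_measurable (borel \<Otimes>\<^sub>M borel)" unfolding osc_def by measurable
qed

text \<open>
  From \<open>|u| w \<le> u\<^sup>2 w + w\<close> and \<open>|u| \<le> u\<^sup>2 w + 1/w\<close> on the compact support.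
\<close>
lemma field_integrable:
  fixes u :: "'x::euclidean_space \<times> 'q::euclidean_space \<Rightarrow> real"
  assumes A2: "A2_weight M w" and u: "field R w u"
  shows "integrable lborel (\<lambda>p. u p * w (fst p))" "integrable lborel (\<lambda>p. u p * 1)"
proof -
  note w = pos_weightD[OF A2_pos_weight[OF A2]]
  note w(1)[measurable] and fieldD(1)[OF u, measurable]
  define r where "r = max R 0 + 1"
  have r: "0 < r" "R < r" by (auto simp: r_def)
  have [measurable]: "(\<lambda>p::'x \<times> 'q. w (fst p)) \<in> borel_measurable borel"
    unfolding borel_prod[symmetric] by measurable
  have i0: "integrable lborel (\<lambda>p. (u p)\<^sup>2 * w (fst p))"
    using fieldD(5)[OF u] w by (intro integrableI_nonneg) (auto simp: W2_def)
  have iw: "integrable lborel (\<lambda>x. w x * indicator (ball 0 r) x)"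
  proof (rule integrableI_nonneg)
    have "(\<integral>\<^sup>+x. ennreal (w x * indicator (ball 0 r) x) \<partial>lborel) = (\<integral>\<^sup>+x\<in>ball 0 r. ennreal (w x) \<partial>lborel)"
      by (intro nn_integral_cong) (auto simp: indicator_def)
    then show "(\<integral>\<^sup>+x. ennreal (w x * indicator (ball 0 r) x) \<partial>lborel) < \<infinity>"
      using A2_weight_finite(1)[OF A2 r(1)] by simp
  qed (use w in \<open>auto simp: less_imp_le\<close>)
  have iw': "integrable lborel (\<lambda>x. 1 / w x * indicator (ball 0 r) x)"
  proof (rule integrableI_nonneg)
    have "(\<integral>\<^sup>+x. ennreal (1 / w x * indicator (ball 0 r) x) \<partial>lborel) = (\<integral>\<^sup>+x\<in>ball 0 r. ennreal (1 / w x) \<partial>lborel)"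
      by (intro nn_integral_cong) (auto simp: indicator_def)
    then show "(\<integral>\<^sup>+x. ennreal (1 / w x * indicator (ball 0 r) x) \<partial>lborel) < \<infinity>"
      using A2_weight_finite(2)[OF A2 r(1)] by simp
  qed (use w in \<open>auto simp: less_imp_le\<close>)
  have i1: "integrable lborel (\<lambda>q::'q. 1 * indicator (cball 0 R) q :: real)" by (rule integrable_indicator_cball)
  have prod: "integrable lborel (\<lambda>p::'x \<times> 'q. (v (fst p) * indicator (ball 0 r) (fst p)) * (1 * indicator (cball 0 R) (snd p)))"
    if "integrable lborel (\<lambda>x. v x * indicator (ball 0 r) x)" for v :: "'x \<Rightarrow> real"
    using integrable_times[OF lborel.sigma_finite_measure_axioms lborel.sigma_finite_measure_axioms that i1]
    unfolding lborel_prod .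
  have pos: "0 \<le> w x" "0 < w x" for x using w by auto
  have bound: "\<bar>u p\<bar> \<le> (u p)\<^sup>2 * t + 1 / t" if "0 < t" for t p
  proof -
    have "0 \<le> (\<bar>u p\<bar> * t - 1)\<^sup>2 + \<bar>u p\<bar> * t" using that by simp
    then have "\<bar>u p\<bar> * t \<le> (u p)\<^sup>2 * (t * t) + 1"
      by (simp add: power2_diff power_mult_distrib power2_eq_square[of t]) (simp add: mult.commute)
    then show ?thesis using that by (simp add: field_simps)
  qed
  have supp: "u p = 0 \<or> (fst p \<in> ball 0 r \<and> snd p \<in> cball 0 R)" for p
  proof (cases "u p = 0")
    case False
    then have "p \<in> cball 0 R \<times> cball 0 R" using fieldD(3)[OF u] by blast
    then show ?thesis using r(2) by (auto simp: mem_Times_iff)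
  qed simp
  show "integrable lborel (\<lambda>p. u p * w (fst p))"
  proof (rule Bochner_Integration.integrable_bound)
    show "integrable lborel (\<lambda>p. (u p)\<^sup>2 * w (fst p) + (w (fst p) * indicator (ball 0 r) (fst p)) * (1 * indicator (cball 0 R) (snd p)))"
      by (intro Bochner_Integration.integrable_add i0 prod iw)
    show "AE p in lborel. norm (u p * w (fst p)) \<le> norm ((u p)\<^sup>2 * w (fst p) + (w (fst p) * indicator (ball 0 r) (fst p)) * (1 * indicator (cball 0 R) (snd p)))"
    proof (rule AE_I2)
      fix p
      show "norm (u p * w (fst p)) \<le> norm ((u p)\<^sup>2 * w (fst p) + (w (fst p) * indicator (ball 0 r) (fst p)) * (1 * indicator (cball 0 R) (snd p)))"
        using supp[of p]
      proof
        assume "fst p \<in> ball 0 r \<and> snd p \<in> cball 0 R"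
        moreover have "\<bar>u p\<bar> * w (fst p) \<le> ((u p)\<^sup>2 * 1 + 1 / 1) * w (fst p)"
          by (intro mult_right_mono bound pos) simp
        ultimately show ?thesis using pos by (simp add: abs_mult distrib_right abs_of_nonneg)
      qed (simp)
    qed
  qed measurable
  show "integrable lborel (\<lambda>p. u p * 1)"
  proof (rule Bochner_Integration.integrable_bound)
    show "integrable lborel (\<lambda>p. (u p)\<^sup>2 * w (fst p) + (1 / w (fst p) * indicator (ball 0 r) (fst p)) * (1 * indicator (cball 0 R) (snd p)))"
      by (intro Bochner_Integration.integrable_add i0 prod iw')
    show "AE p in lborel. norm (u p * 1) \<le> norm ((u p)\<^sup>2 * w (fst p) + (1 / w (fst p) * indicator (ball 0 r) (fst p)) * (1 * indicator (cball 0 R) (snd p)))"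
    proof (rule AE_I2)
      fix p
      show "norm (u p * 1) \<le> norm ((u p)\<^sup>2 * w (fst p) + (1 / w (fst p) * indicator (ball 0 r) (fst p)) * (1 * indicator (cball 0 R) (snd p)))"
        using supp[of p]
      proof
        assume "fst p \<in> ball 0 r \<and> snd p \<in> cball 0 R"
        then show ?thesis using bound[OF pos(2), of p "fst p"] by (auto intro: order_trans[OF _ abs_ge_self])
      qed simp
    qed
  qed measurable
qed

lemma osc_integral_bounded:
  fixes u :: "'x::euclidean_space \<times> 'q::euclidean_space \<Rightarrow> real"
  assumes u: "field R w u" and int: "integrable lborel (\<lambda>p. u p * \<omega> (fst p))"
    and h: "h \<in> borel_measurable borel" "\<And>x. x \<in> cball 0 R \<Longrightarrow> \<bar>h x\<bar> \<le> H"
    and e: "e \<in> borel_measurable borel" "\<And>t. \<bar>e t\<bar> \<le> (1::real)"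
  shows "integrable lborel (\<lambda>p. u p * (h (fst p) * e (snd p \<bullet> \<xi>)) * \<omega> (fst p))"
    and "(\<integral>p. u p * (h (fst p) * e (snd p \<bullet> \<xi>)) * \<omega> (fst p) \<partial>lborel) = (\<integral>x. osc e \<xi> u x * h x * \<omega> x \<partial>lborel)"
    and "integrable lborel (\<lambda>x. osc e \<xi> u x * h x * \<omega> x)"
proof -
  note h(1)[measurable] and e(1)[measurable]
  define g where "g p = indicator (cball 0 R) (fst p) * h (fst p) * e (snd p \<bullet> \<xi>)" for p :: "'x \<times> 'q"
  have [measurable]: "(\<lambda>p::'x \<times> 'q. fst p) \<in> borel_measurable borel" "(\<lambda>p::'x \<times> 'q. snd p \<bullet> \<xi>) \<in> borel_measurable borel"
    by (auto intro!: borel_measurable_continuous_onI continuous_intros)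
  have [measurable]: "g \<in> borel_measurable borel"
    unfolding g_def
    by (intro borel_measurable_times measurable_compose[OF _ h(1)] measurable_compose[OF _ e(1)]
        measurable_compose[OF _ borel_measurable_indicator[of "cball 0 R" borel]]) measurable
  have "\<bar>g p\<bar> \<le> max H 0" for p
  proof (cases "fst p \<in> cball 0 R")
    case True
    then have "\<bar>h (fst p)\<bar> * \<bar>e (snd p \<bullet> \<xi>)\<bar> \<le> max H 0 * 1" using h(2) e(2) by (intro mult_mono) (auto simp: le_max_iff_disj)
    then show ?thesis using True by (simp add: g_def abs_mult)
  qed (simp add: g_def)
  then have "integrable lborel (\<lambda>p. g p * (u p * \<omega> (fst p)))"
    by (intro integrable_bounded_mult[OF int]) auto
  moreover have "g p * (u p * \<omega> (fst p)) = u p * (h (fst p) * e (snd p \<bullet> \<xi>)) * \<omega> (fst p)" for p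
    using fieldD(4)[OF u, of "fst p" "snd p"] by (cases "fst p \<in> cball 0 R") (auto simp: g_def)
  ultimately show i: "integrable lborel (\<lambda>p. u p * (h (fst p) * e (snd p \<bullet> \<xi>)) * \<omega> (fst p))" by simp
  then have "(\<integral>p. u p * (h (fst p) * e (snd p \<bullet> \<xi>)) * \<omega> (fst p) \<partial>lborel)
     = (\<integral>x. (\<integral>q. u (x, q) * (h x * e (q \<bullet> \<xi>)) * \<omega> x \<partial>lborel) \<partial>lborel)"
    using lborel_pair.integral_fst'[of "\<lambda>p. u p * (h (fst p) * e (snd p \<bullet> \<xi>)) * \<omega> (fst p)"]
    unfolding lborel_prod by simp
  moreover have inner: "(\<integral>q. u (x, q) * (h x * e (q \<bullet> \<xi>)) * \<omega> x \<partial>lborel) = osc e \<xi> u x * h x * \<omega> x" for x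
  proof -
    have "(\<integral>q. u (x, q) * (h x * e (q \<bullet> \<xi>)) * \<omega> x \<partial>lborel) = (\<integral>q. (u (x, q) * e (q \<bullet> \<xi>)) * (h x * \<omega> x) \<partial>lborel)"
      by (intro Bochner_Integration.integral_cong refl) (simp add: mult_ac)
    also have "\<dots> = osc e \<xi> u x * (h x * \<omega> x)" unfolding osc_def by (rule integral_mult_left_zero)
    finally show ?thesis by simp
  qed
  ultimately show "(\<integral>p. u p * (h (fst p) * e (snd p \<bullet> \<xi>)) * \<omega> (fst p) \<partial>lborel) = (\<integral>x. osc e \<xi> u x * h x * \<omega> x \<partial>lborel)"
    by (simp only: inner)
  have "integrable (lborel \<Otimes>\<^sub>M lborel) (\<lambda>p. u p * (h (fst p) * e (snd p \<bullet> \<xi>)) * \<omega> (fst p))"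
    unfolding lborel_prod by (rule i)
  from lborel_pair.integrable_fst'[OF this]
  show "integrable lborel (\<lambda>x. osc e \<xi> u x * h x * \<omega> x)" by (simp only: fst_conv snd_conv inner)
qed

text \<open>
  Fubini: testing with \<open>h(x) e(q \<bullet> \<xi>)\<close> in phase space is testing the transform with \<open>h\<close>.  The factor
  \<open>\<omega>\<close> is \<open>w\<close> in the equation and \<open>1\<close> in the definition of the weak gradient.
\<close>
lemma osc_integral:
  fixes u :: "'x::euclidean_space \<times> 'q::euclidean_space \<Rightarrow> real"
  assumes u: "field R w u" and int: "integrable lborel (\<lambda>p. u p * \<omega> (fst p))"
    and h: "continuous_on UNIV h" and e: "continuous_on UNIV e" "\<And>t. \<bar>e t\<bar> \<le> (1::real)"
  shows "integrable lborel (\<lambda>p. u p * (h (fst p) * e (snd p \<bullet> \<xi>)) * \<omega> (fst p))"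
    and "(\<integral>p. u p * (h (fst p) * e (snd p \<bullet> \<xi>)) * \<omega> (fst p) \<partial>lborel) = (\<integral>x. osc e \<xi> u x * h x * \<omega> x \<partial>lborel)"
    and "integrable lborel (\<lambda>x. osc e \<xi> u x * h x * \<omega> x)"
proof -
  have "compact (h ` cball 0 R)"
    using h by (intro compact_continuous_image) (auto intro: continuous_on_subset)
  then obtain H where H: "\<And>x. x \<in> cball 0 R \<Longrightarrow> \<bar>h x\<bar> \<le> H"
    using compact_imp_bounded bounded_iff by (metis imageI real_norm_def)
  note b = osc_integral_bounded[OF u int borel_measurable_continuous_onI[OF h] H borel_measurable_continuous_onI[OF e(1)] e(2)]
  show "integrable lborel (\<lambda>p. u p * (h (fst p) * e (snd p \<bullet> \<xi>)) * \<omega> (fst p))"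
    "(\<integral>p. u p * (h (fst p) * e (snd p \<bullet> \<xi>)) * \<omega> (fst p) \<partial>lborel) = (\<integral>x. osc e \<xi> u x * h x * \<omega> x \<partial>lborel)"
    "integrable lborel (\<lambda>x. osc e \<xi> u x * h x * \<omega> x)"
    by (rule b; assumption)+
qed

definition osc_sq :: "('x::euclidean_space \<Rightarrow> real) \<Rightarrow> 'q::euclidean_space \<Rightarrow> ('x \<times> 'q \<Rightarrow> real) \<Rightarrow> ennreal" where
  "osc_sq w \<xi> u = wsq w (osc cos \<xi> u) + wsq w (osc sin \<xi> u)"

lemma osc_sq_eq:
  fixes u :: "'x::euclidean_space \<times> 'q::euclidean_space \<Rightarrow> real"
  assumes w: "pos_weight w" and u: "field R w u"
  shows "osc_sq w \<xi> u = (\<integral>\<^sup>+x. ennreal (((osc cos \<xi> u x)\<^sup>2 + (osc sin \<xi> u x)\<^sup>2) * w x) \<partial>lborel)"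
proof -
  have [measurable]: "osc cos \<xi> u \<in> borel_measurable borel" "osc sin \<xi> u \<in> borel_measurable borel" "w \<in> borel_measurable borel"
    using osc_measurable(1)[OF u] pos_weightD[OF w] by auto
  show ?thesis
    unfolding osc_sq_def wsq_def using pos_weightD[OF w]
    by (subst nn_integral_add[symmetric]) (auto intro!: nn_integral_cong simp: distrib_right ennreal_plus)
qed

lemma osc_sq_measurable:
  fixes u :: "'x::euclidean_space \<times> 'q::euclidean_space \<Rightarrow> real"
  assumes w: "pos_weight w" and u: "field R w u"
  shows "(\<lambda>\<xi>. osc_sq w \<xi> u) \<in> borel_measurable borel"
proof -
  note osc_measurable(2)[OF u, of cos, measurable] osc_measurable(2)[OF u, of sin, measurable] pos_weightD(1)[OF w, measurable]
  show ?thesis unfolding osc_sq_eq[OF assms] by measurable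
qed

text \<open>
  Plancherel on almost every section, integrated in \<open>x\<close> against the weight.
\<close>
lemma osc_energy:
  fixes u :: "'x::euclidean_space \<times> 'q::euclidean_space \<Rightarrow> real"
  assumes A2: "A2_weight M w" and u: "field R w u"
  shows "(\<integral>\<^sup>+\<xi>. osc_sq w \<xi> u \<partial>lborel) \<le> ennreal ((2 * pi) ^ DIM('q)) * W2 w u"
proof -
  note w = A2_pos_weight[OF A2]
  note osc_measurable(2)[OF u, of cos, measurable] osc_measurable(2)[OF u, of sin, measurable] pos_weightD(1)[OF w, measurable]
  note fieldD(2)[OF u, measurable]
  have "integrable (lborel \<Otimes>\<^sub>M lborel) u" using field_integrable(2)[OF A2 u] by (simp add: lborel_prod)
  then have AEi: "AE x in lborel. integrable lborel (\<lambda>q. u (x, q))" by (rule lborel_pair.AE_integrable_fst')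
  have "(\<integral>\<^sup>+\<xi>. osc_sq w \<xi> u \<partial>lborel)
      = (\<integral>\<^sup>+\<xi>. (\<integral>\<^sup>+x. ennreal (((osc cos \<xi> u x)\<^sup>2 + (osc sin \<xi> u x)\<^sup>2) * w x) \<partial>lborel) \<partial>lborel)"
    by (simp only: osc_sq_eq[OF w u])
  also have "\<dots> = (\<integral>\<^sup>+x. (\<integral>\<^sup>+\<xi>. ennreal (((osc cos \<xi> u x)\<^sup>2 + (osc sin \<xi> u x)\<^sup>2) * w x) \<partial>lborel) \<partial>lborel)"
    by (rule lborel_pair.Fubini'[symmetric]) measurable
  also have "\<dots> \<le> (\<integral>\<^sup>+x. ennreal ((2 * pi) ^ DIM('q)) * (\<integral>\<^sup>+q. ennreal ((u (x, q))\<^sup>2 * w x) \<partial>lborel) \<partial>lborel)"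
  proof (rule nn_integral_mono_AE, use AEi in eventually_elim)
    case (elim x)
    have um: "(\<lambda>q. u (x, q)) \<in> borel_measurable borel" by measurable
    note fourier_measurable[OF um, measurable]
    have wx: "0 \<le> w x" using pos_weightD[OF w] by simp
    have "(\<integral>\<^sup>+\<xi>. ennreal (((osc cos \<xi> u x)\<^sup>2 + (osc sin \<xi> u x)\<^sup>2) * w x) \<partial>lborel)
        = (\<integral>\<^sup>+\<xi>. ennreal ((fourier_cos (\<lambda>q. u (x, q)) \<xi>)\<^sup>2 + (fourier_sin (\<lambda>q. u (x, q)) \<xi>)\<^sup>2) * ennreal (w x) \<partial>lborel)"
      unfolding osc_cos osc_sin using wx by (intro nn_integral_cong) (simp add: ennreal_mult)
    also have "\<dots> = (\<integral>\<^sup>+\<xi>. ennreal ((fourier_cos (\<lambda>q. u (x, q)) \<xi>)\<^sup>2 + (fourier_sin (\<lambda>q. u (x, q)) \<xi>)\<^sup>2) \<partial>lborel) * ennreal (w x)"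
      by (rule nn_integral_multc) measurable
    also have "\<dots> \<le> (ennreal ((2 * pi) ^ DIM('q)) * (\<integral>\<^sup>+q. ennreal ((u (x, q))\<^sup>2) \<partial>lborel)) * ennreal (w x)"
      by (intro mult_right_mono plancherel_le elim) simp
    also have "\<dots> = ennreal ((2 * pi) ^ DIM('q)) * (\<integral>\<^sup>+q. ennreal ((u (x, q))\<^sup>2) * ennreal (w x) \<partial>lborel)"
      by (subst nn_integral_multc) (auto simp: mult.assoc)
    also have "(\<integral>\<^sup>+q. ennreal ((u (x, q))\<^sup>2) * ennreal (w x) \<partial>lborel) = (\<integral>\<^sup>+q. ennreal ((u (x, q))\<^sup>2 * w x) \<partial>lborel)"
      using wx by (intro nn_integral_cong) (simp add: ennreal_mult)
    finally show ?case .
  qed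
  also have "\<dots> = ennreal ((2 * pi) ^ DIM('q)) * (\<integral>\<^sup>+x. (\<integral>\<^sup>+q. ennreal ((u (x, q))\<^sup>2 * w x) \<partial>lborel) \<partial>lborel)"
    by (rule nn_integral_cmult) measurable
  also have "(\<integral>\<^sup>+x. (\<integral>\<^sup>+q. ennreal ((u (x, q))\<^sup>2 * w x) \<partial>lborel) \<partial>lborel) = W2 w u"
    unfolding W2_def lborel_prod[symmetric]
    by (subst lborel.nn_integral_fst[symmetric]) (auto intro!: nn_integral_cong)
  finally show ?thesis .
qed

lemma grad_tensor:
  fixes H :: "'x::euclidean_space \<Rightarrow> real" and \<Theta> :: "'q::euclidean_space \<Rightarrow> real"
  assumes "smooth H" "smooth \<Theta>"
  shows "grad (\<lambda>p. H (fst p) * \<Theta> (snd p)) p = (\<Theta> (snd p) *\<^sub>R grad H (fst p), H (fst p) *\<^sub>R grad \<Theta> (snd p))"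
proof (rule grad_unique)
  have 1: "((\<lambda>p. H (fst p)) has_derivative (\<lambda>v. grad H (fst p) \<bullet> fst v)) (at p)"
    by (rule has_derivative_compose[OF _ smooth_has_derivative[OF assms(1)]]) (auto intro!: derivative_eq_intros)
  have 2: "((\<lambda>p. \<Theta> (snd p)) has_derivative (\<lambda>v. grad \<Theta> (snd p) \<bullet> snd v)) (at p)"
    by (rule has_derivative_compose[OF _ smooth_has_derivative[OF assms(2)]]) (auto intro!: derivative_eq_intros)
  show "((\<lambda>p. H (fst p) * \<Theta> (snd p)) has_derivative
     (\<lambda>v. (\<Theta> (snd p) *\<^sub>R grad H (fst p), H (fst p) *\<^sub>R grad \<Theta> (snd p)) \<bullet> v)) (at p)"
    by (rule has_derivative_eq_rhs[OF has_derivative_mult[OF 1 2]]) (auto simp: inner_prod_def fun_eq_iff)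
qed

lemma smooth_tensor:
  fixes H :: "'x::euclidean_space \<Rightarrow> real" and \<Theta> :: "'q::euclidean_space \<Rightarrow> real"
  assumes "smooth H" "smooth \<Theta>"
  shows "smooth (\<lambda>p. H (fst p) * \<Theta> (snd p))"
  by (intro smooth_mult smooth_linear[OF bounded_linear_fst assms(1)] smooth_linear[OF bounded_linear_snd assms(2)])

lemma grad_wave:
  assumes e: "\<And>t. (e has_real_derivative e' t) (at t)" and \<theta>: "smooth \<theta>"
  shows "grad (\<lambda>q. \<theta> q * e (q \<bullet> \<xi>)) q = e (q \<bullet> \<xi>) *\<^sub>R grad \<theta> q + (\<theta> q * e' (q \<bullet> \<xi>)) *\<^sub>R \<xi>"
proof (rule grad_unique)
  have "((\<lambda>q. e (q \<bullet> \<xi>)) has_derivative (\<lambda>v. e' (q \<bullet> \<xi>) * (v \<bullet> \<xi>))) (at q)"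
    by (rule has_derivative_compose[OF _ e[unfolded has_field_derivative_def]]) (auto intro!: derivative_eq_intros)
  from has_derivative_mult[OF smooth_has_derivative[OF \<theta>] this]
  show "((\<lambda>q. \<theta> q * e (q \<bullet> \<xi>)) has_derivative
     (\<lambda>v. (e (q \<bullet> \<xi>) *\<^sub>R grad \<theta> q + (\<theta> q * e' (q \<bullet> \<xi>)) *\<^sub>R \<xi>) \<bullet> v)) (at q)"
    by (rule has_derivative_eq_rhs) (auto simp: inner_add_left inner_commute algebra_simps fun_eq_iff)
qed

text \<open>
  A solution on a phase space \<open>(x, q)\<close> with the transport field \<open>B(x)\<close> in the \<open>q\<close> directions,
  together with the two cutoffs.  The equation and the definition of the weak gradient are stated
  for the test functions \<open>(h(x) \<kappa>(x)) (\<theta>(q) e(q \<bullet> \<xi>))\<close>; the cutoffs make them admissible for every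
  smooth \<open>h\<close> and \<open>e\<close>.
\<close>
locale kinetic =
  fixes M R K :: real and w :: "'x::euclidean_space \<Rightarrow> real" and B :: "'x \<Rightarrow> 'q::euclidean_space"
    and \<kappa> :: "'x \<Rightarrow> real" and \<theta> :: "'q \<Rightarrow> real"
    and f g :: "'x \<times> 'q \<Rightarrow> real" and Df F :: "'x \<times> 'q \<Rightarrow> 'x"
  assumes A2: "A2_weight M w" and K: "1 \<le> K"
    and B: "continuous_on UNIV B"
    and \<kappa>: "smooth \<kappa>" "\<And>x. \<bar>\<kappa> x\<bar> \<le> 1" "\<And>x. norm (grad \<kappa> x) \<le> K"
    and \<theta>: "smooth \<theta>" "\<And>q. \<bar>\<theta> q\<bar> \<le> 1" "\<And>x q. x \<in> cball 0 R \<Longrightarrow> \<bar>grad \<theta> q \<bullet> B x\<bar> \<le> K"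
    and meas: "f \<in> borel_measurable borel" "g \<in> borel_measurable borel" "Df \<in> borel_measurable borel" "F \<in> borel_measurable borel"
    and supp: "\<And>p. p \<notin> cball 0 R \<times> cball 0 R \<Longrightarrow> f p = 0 \<and> g p = 0 \<and> Df p = 0 \<and> F p = 0"
    and fin: "(\<integral>\<^sup>+p. ennreal (((f p)\<^sup>2 + (norm (Df p))\<^sup>2 + (norm (F p))\<^sup>2 + (g p)\<^sup>2) * w (fst p)) \<partial>lborel) < \<infinity>"
    and weak: "\<And>h e \<xi> b. smooth h \<Longrightarrow> smooth e \<Longrightarrow> b \<in> Basis \<Longrightarrow>
      (\<integral>p. f p * (fst (grad (\<lambda>p. (h (fst p) * \<kappa> (fst p)) * (\<theta> (snd p) * e (snd p \<bullet> \<xi>))) p) \<bullet> b) \<partial>lborel)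
       = - (\<integral>p. (Df p \<bullet> b) * ((h (fst p) * \<kappa> (fst p)) * (\<theta> (snd p) * e (snd p \<bullet> \<xi>))) \<partial>lborel)"
    and eq: "\<And>h e \<xi>. smooth h \<Longrightarrow> smooth e \<Longrightarrow>
      (\<integral>p. f p * (snd (grad (\<lambda>p. (h (fst p) * \<kappa> (fst p)) * (\<theta> (snd p) * e (snd p \<bullet> \<xi>))) p) \<bullet> B (fst p)) * w (fst p) \<partial>lborel)
       = (\<integral>p. (F p \<bullet> fst (grad (\<lambda>p. (h (fst p) * \<kappa> (fst p)) * (\<theta> (snd p) * e (snd p \<bullet> \<xi>))) p)) * w (fst p) \<partial>lborel)
         - (\<integral>p. g p * ((h (fst p) * \<kappa> (fst p)) * (\<theta> (snd p) * e (snd p \<bullet> \<xi>))) * w (fst p) \<partial>lborel)"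
begin

definition energy_density :: "'x \<times> 'q \<Rightarrow> real" where
  "energy_density p = (f p)\<^sup>2 + (norm (Df p))\<^sup>2 + (norm (F p))\<^sup>2 + (g p)\<^sup>2"

definition total :: ennreal where
  "total = (\<integral>\<^sup>+p. ennreal (energy_density p * w (fst p)) \<partial>lborel)"

text \<open>
  The localised fields.  The derivatives that fall on the cutoffs produce \<open>f_dcut\<close> in the gradient
  of \<open>f_cut\<close>, and \<open>F_dcut\<close> and \<open>f_ycut\<close> in the right-hand side of its equation.
\<close>
definition f_cut where "f_cut p = \<kappa> (fst p) * \<theta> (snd p) * f p"
definition Df_cut where "Df_cut b p = \<kappa> (fst p) * \<theta> (snd p) * (Df p \<bullet> b)"
definition f_dcut where "f_dcut b p = \<theta> (snd p) * f p * (grad \<kappa> (fst p) \<bullet> b)"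
definition grad_cut where "grad_cut b p = Df_cut b p + f_dcut b p"
definition F_cut where "F_cut b p = \<kappa> (fst p) * \<theta> (snd p) * (F p \<bullet> b)"
definition F_dcut where "F_dcut p = \<theta> (snd p) * (F p \<bullet> grad \<kappa> (fst p))"
definition g_cut where "g_cut p = \<kappa> (fst p) * \<theta> (snd p) * g p"
definition f_ycut where "f_ycut p = \<kappa> (fst p) * f p * (grad \<theta> (snd p) \<bullet> B (fst p))"
definition source where "source p = F_dcut p - g_cut p - f_ycut p"

lemma energy_nonneg: "0 \<le> energy_density p"
  by (simp add: energy_density_def)

lemma cont_comp:
  fixes h :: "'x \<Rightarrow> 'c::topological_space" and k :: "'q \<Rightarrow> 'd::topological_space"
  shows "continuous_on UNIV h \<Longrightarrow> continuous_on UNIV (\<lambda>p::'x \<times> 'q. h (fst p))"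
    "continuous_on UNIV k \<Longrightarrow> continuous_on UNIV (\<lambda>p::'x \<times> 'q. k (snd p))"
  by (rule continuous_on_compose2[of UNIV h UNIV fst], auto intro!: continuous_intros)
    (rule continuous_on_compose2[of UNIV k UNIV snd], auto intro!: continuous_intros)

lemma measurable_data [measurable]:
  "f \<in> borel_measurable borel" "g \<in> borel_measurable borel" "Df \<in> borel_measurable borel" "F \<in> borel_measurable borel"
  "w \<in> borel_measurable borel"
  "(\<lambda>p::'x \<times> 'q. \<kappa> (fst p)) \<in> borel_measurable borel" "(\<lambda>p::'x \<times> 'q. \<theta> (snd p)) \<in> borel_measurable borel"
  "(\<lambda>p::'x \<times> 'q. grad \<kappa> (fst p)) \<in> borel_measurable borel" "(\<lambda>p::'x \<times> 'q. grad \<theta> (snd p)) \<in> borel_measurable borel"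
  "(\<lambda>p::'x \<times> 'q. B (fst p)) \<in> borel_measurable borel" "(\<lambda>p::'x \<times> 'q. w (fst p)) \<in> borel_measurable borel"
proof -
  show w: "w \<in> borel_measurable borel" using A2 by (auto simp: A2_weight_def)
  have "(\<lambda>p::'x \<times> 'q. fst p) \<in> borel_measurable borel"
    by (intro borel_measurable_continuous_onI continuous_intros)
  then show "(\<lambda>p::'x \<times> 'q. w (fst p)) \<in> borel_measurable borel" using w by (rule measurable_compose)
qed (use meas in \<open>auto intro!: borel_measurable_continuous_onI cont_comp smooth_continuous_grad \<kappa> \<theta> B
    smooth_continuous[OF smooth_linear[OF bounded_linear_fst]] smooth_continuous[OF smooth_linear[OF bounded_linear_snd]]\<close>)

text \<open>
  All localised fields are linear in the data with coefficients bounded on the support, so their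
  energies are bounded by that of the data.
\<close>
lemma field_of_bound:
  assumes m: "u \<in> borel_measurable borel" and b: "\<And>p. p \<in> cball 0 R \<times> cball 0 R \<Longrightarrow> \<bar>u p\<bar> \<le> C * sqrt (energy_density p)"
    and z: "\<And>p. f p = 0 \<Longrightarrow> g p = 0 \<Longrightarrow> Df p = 0 \<Longrightarrow> F p = 0 \<Longrightarrow> u p = 0" and C: "0 \<le> C"
  shows "field R w u"
proof -
  note m[measurable]
  have z': "u p = 0" if "p \<notin> cball 0 R \<times> cball 0 R" for p
    using supp[OF that] z by blast
  have [measurable]: "energy_density \<in> borel_measurable borel" unfolding energy_density_def by measurable
  have "(u p)\<^sup>2 \<le> C\<^sup>2 * energy_density p" for p
  proof (cases "p \<in> cball 0 R \<times> cball 0 R")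
    case True
    then have "\<bar>u p\<bar>\<^sup>2 \<le> (C * sqrt (energy_density p))\<^sup>2" by (intro power_mono b) auto
    then show ?thesis using energy_nonneg[of p] by (simp add: power_mult_distrib)
  next
    case False
    then show ?thesis using z'[OF False] energy_nonneg[of p] by simp
  qed
  then have "W2 w u \<le> (\<integral>\<^sup>+p. ennreal (C\<^sup>2) * ennreal (energy_density p * w (fst p)) \<partial>lborel)"
    unfolding W2_def using pos_weightD[OF A2_pos_weight[OF A2]] energy_nonneg
    by (intro nn_integral_mono) (auto simp: mult.assoc[symmetric] simp flip: ennreal_mult intro!: ennreal_leI mult_right_mono)
  also have "\<dots> = ennreal (C\<^sup>2) * total" unfolding total_def by (rule nn_integral_cmult) measurable
  also have "\<dots> < \<infinity>" using fin by (simp add: total_def energy_density_def ennreal_mult_less_top)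
  finally show ?thesis using m z' by (auto simp: field_def)
qed

lemma energy_bounds:
  "\<bar>f p\<bar> \<le> sqrt (energy_density p)" "norm (Df p) \<le> sqrt (energy_density p)"
  "norm (F p) \<le> sqrt (energy_density p)" "\<bar>g p\<bar> \<le> sqrt (energy_density p)"
  unfolding energy_density_def by (rule real_le_rsqrt; simp)+

lemma cut_le: "\<bar>\<kappa> (fst p) * \<theta> (snd p)\<bar> \<le> 1"
  unfolding abs_mult using \<kappa>(2) \<theta>(2) by (intro mult_le_one) auto

lemma cut_mult_le: "\<bar>a\<bar> \<le> t \<Longrightarrow> \<bar>\<kappa> (fst p) * \<theta> (snd p) * a\<bar> \<le> t"
  unfolding abs_mult[of _ a] using cut_le[of p] mult_mono[of "\<bar>\<kappa> (fst p) * \<theta> (snd p)\<bar>" 1 "\<bar>a\<bar>" t] by auto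

lemma f_cut_le: "\<bar>f_cut p\<bar> \<le> \<bar>f p\<bar>"
  unfolding f_cut_def by (rule cut_mult_le) simp
lemma g_cut_le: "\<bar>g_cut p\<bar> \<le> \<bar>g p\<bar>"
  unfolding g_cut_def by (rule cut_mult_le) simp
lemma Df_cut_le: "b \<in> Basis \<Longrightarrow> \<bar>Df_cut b p\<bar> \<le> \<bar>Df p \<bullet> b\<bar>"
  unfolding Df_cut_def by (rule cut_mult_le) simp
lemma F_cut_le: "b \<in> Basis \<Longrightarrow> \<bar>F_cut b p\<bar> \<le> \<bar>F p \<bullet> b\<bar>"
  unfolding F_cut_def by (rule cut_mult_le) simp

lemma f_dcut_le: "b \<in> Basis \<Longrightarrow> \<bar>f_dcut b p\<bar> \<le> K * \<bar>f p\<bar>"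
proof -
  assume b: "b \<in> Basis"
  have "\<bar>grad \<kappa> (fst p) \<bullet> b\<bar> \<le> K" using Basis_le_norm[OF b, of "grad \<kappa> (fst p)"] \<kappa>(3)[of "fst p"] by linarith
  moreover have "\<bar>\<theta> (snd p) * f p\<bar> \<le> 1 * \<bar>f p\<bar>" unfolding abs_mult using \<theta>(2) by (intro mult_right_mono) auto
  ultimately have "\<bar>\<theta> (snd p) * f p\<bar> * \<bar>grad \<kappa> (fst p) \<bullet> b\<bar> \<le> (1 * \<bar>f p\<bar>) * K" by (intro mult_mono) auto
  then show ?thesis by (simp add: f_dcut_def abs_mult mult_ac)
qed

lemma F_dcut_le: "\<bar>F_dcut p\<bar> \<le> K * norm (F p)"
proof -
  have "\<bar>F p \<bullet> grad \<kappa> (fst p)\<bar> \<le> norm (F p) * norm (grad \<kappa> (fst p))" by (rule Cauchy_Schwarz_ineq2)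
  also have "\<dots> \<le> norm (F p) * K" using \<kappa>(3) by (intro mult_left_mono) auto
  finally have "\<bar>\<theta> (snd p)\<bar> * \<bar>F p \<bullet> grad \<kappa> (fst p)\<bar> \<le> 1 * (norm (F p) * K)" using \<theta>(2) by (intro mult_mono) auto
  then show ?thesis by (simp add: F_dcut_def abs_mult mult_ac)
qed

lemma f_ycut_le: "\<bar>f_ycut p\<bar> \<le> K * \<bar>f p\<bar>"
proof (cases "fst p \<in> cball 0 R")
  case True
  have "\<bar>\<kappa> (fst p) * f p\<bar> \<le> 1 * \<bar>f p\<bar>" unfolding abs_mult using \<kappa>(2) by (intro mult_right_mono) auto
  then have "\<bar>\<kappa> (fst p) * f p\<bar> * \<bar>grad \<theta> (snd p) \<bullet> B (fst p)\<bar> \<le> (1 * \<bar>f p\<bar>) * K"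
    using \<theta>(3)[OF True] by (intro mult_mono) auto
  then show ?thesis by (simp add: f_ycut_def abs_mult mult_ac)
next
  case False
  then have "f p = 0" using supp[of p] by (metis mem_Times_iff)
  then show ?thesis by (simp add: f_ycut_def)
qed

lemma fields:
  "field R w f_cut" "b \<in> Basis \<Longrightarrow> field R w (Df_cut b)" "b \<in> Basis \<Longrightarrow> field R w (f_dcut b)"
  "b \<in> Basis \<Longrightarrow> field R w (grad_cut b)"
  "b \<in> Basis \<Longrightarrow> field R w (F_cut b)" "field R w F_dcut" "field R w g_cut" "field R w f_ycut" "field R w source"
proof -
  let ?E = "\<lambda>p. sqrt (energy_density p)"
  have E0: "0 \<le> ?E p" for p using energy_nonneg by simp
  have KE: "K * t \<le> K * ?E p" "t \<le> K * ?E p" if "t \<le> ?E p" for t p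
    using that K E0[of p] mult_right_mono[of 1 K "?E p"] by (auto intro!: mult_left_mono)
  note en = energy_bounds
  have bf: "\<bar>f_cut p\<bar> \<le> K * ?E p" "\<bar>g_cut p\<bar> \<le> K * ?E p" "\<bar>F_dcut p\<bar> \<le> K * ?E p" "\<bar>f_ycut p\<bar> \<le> K * ?E p" for p
    using f_cut_le[of p] g_cut_le[of p] F_dcut_le[of p] f_ycut_le[of p] KE[OF en(1)[of p]] KE[OF en(3)[of p]] KE[OF en(4)[of p]]
    by linarith+
  have bb: "\<bar>Df_cut b p\<bar> \<le> K * ?E p" "\<bar>f_dcut b p\<bar> \<le> K * ?E p" "\<bar>F_cut b p\<bar> \<le> K * ?E p" if b: "b \<in> Basis" for b p
    using Df_cut_le[OF b, of p] f_dcut_le[OF b, of p] F_cut_le[OF b, of p] Basis_le_norm[OF b, of "Df p"] Basis_le_norm[OF b, of "F p"]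
      KE[OF en(1)[of p]] KE[OF en(2)[of p]] KE[OF en(3)[of p]] by linarith+
  have K0: "0 \<le> K" "0 \<le> 3 * K" "0 \<le> 2 * K" using K by auto
  have ms [measurable]: "f_cut \<in> borel_measurable borel" "Df_cut b \<in> borel_measurable borel" "f_dcut b \<in> borel_measurable borel"
    "F_cut b \<in> borel_measurable borel" "F_dcut \<in> borel_measurable borel" "g_cut \<in> borel_measurable borel" "f_ycut \<in> borel_measurable borel" for b
    unfolding f_cut_def[abs_def] Df_cut_def[abs_def] f_dcut_def[abs_def] F_cut_def[abs_def] F_dcut_def[abs_def] g_cut_def[abs_def] f_ycut_def[abs_def]
    by measurable
  have ms2: "source \<in> borel_measurable borel" "grad_cut b \<in> borel_measurable borel" for b
    unfolding source_def[abs_def] grad_cut_def[abs_def] by measurable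
  show "field R w f_cut" by (rule field_of_bound[OF ms(1) bf(1) _ K0(1)]) (simp add: f_cut_def)
  show "field R w g_cut" by (rule field_of_bound[OF ms(6) bf(2) _ K0(1)]) (simp add: g_cut_def)
  show "field R w F_dcut" by (rule field_of_bound[OF ms(5) bf(3) _ K0(1)]) (simp add: F_dcut_def)
  show "field R w f_ycut" by (rule field_of_bound[OF ms(7) bf(4) _ K0(1)]) (simp add: f_ycut_def)
  show "field R w (Df_cut b)" if "b \<in> Basis" by (rule field_of_bound[OF ms(2) bb(1)[OF that] _ K0(1)]) (simp add: Df_cut_def)
  show "field R w (f_dcut b)" if "b \<in> Basis" by (rule field_of_bound[OF ms(3) bb(2)[OF that] _ K0(1)]) (simp add: f_dcut_def)
  show "field R w (F_cut b)" if "b \<in> Basis" by (rule field_of_bound[OF ms(4) bb(3)[OF that] _ K0(1)]) (simp add: F_cut_def)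
  have "\<bar>source p\<bar> \<le> 3 * K * ?E p" for p using bf[of p] unfolding source_def by linarith
  then show "field R w source"
    by (rule field_of_bound[OF ms2(1) _ _ K0(2)]) (simp add: source_def F_dcut_def g_cut_def f_ycut_def)
  have "\<bar>grad_cut b p\<bar> \<le> 2 * K * ?E p" if "b \<in> Basis" for p using bb[OF that, of p] unfolding grad_cut_def by linarith
  then show "field R w (grad_cut b)" if "b \<in> Basis"
    by (rule field_of_bound[OF ms2(2) _ _ K0(3)]) (use that in \<open>simp_all add: grad_cut_def f_dcut_def Df_cut_def\<close>)
qed

lemma field_norm_bound:
  "(f_cut p)\<^sup>2 + (\<Sum>b\<in>Basis. (grad_cut b p)\<^sup>2) + (\<Sum>b\<in>Basis. (F_cut b p)\<^sup>2) + (source p)\<^sup>2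
     \<le> (2 * real DIM('x) + 9) * K\<^sup>2 * energy_density p"
proof -
  have K1: "1 \<le> K\<^sup>2" using K by simp
  have sq: "(a::real)\<^sup>2 \<le> c\<^sup>2" if "\<bar>a\<bar> \<le> c" for a c using that by (metis abs_ge_zero power2_abs power_mono)
  have 1: "(f_cut p)\<^sup>2 \<le> K\<^sup>2 * (f p)\<^sup>2"
    using sq[OF f_cut_le[of p]] mult_right_mono[OF K1, of "(f p)\<^sup>2"] by simp
  have 2: "(\<Sum>b\<in>Basis. (grad_cut b p)\<^sup>2) \<le> 2 * K\<^sup>2 * (norm (Df p))\<^sup>2 + 2 * real DIM('x) * (K\<^sup>2 * (f p)\<^sup>2)"
  proof -
    have "(grad_cut b p)\<^sup>2 \<le> 2 * K\<^sup>2 * (Df p \<bullet> b)\<^sup>2 + 2 * (K\<^sup>2 * (f p)\<^sup>2)" if b: "b \<in> Basis" for b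
    proof -
      have "(grad_cut b p)\<^sup>2 \<le> 2 * (Df_cut b p)\<^sup>2 + 2 * (f_dcut b p)\<^sup>2"
        using sum_squares_bound[of "Df_cut b p" "f_dcut b p"] by (simp add: grad_cut_def power2_sum)
      moreover have "(Df_cut b p)\<^sup>2 \<le> K\<^sup>2 * (Df p \<bullet> b)\<^sup>2"
        using sq[OF Df_cut_le[OF b, of p]] mult_right_mono[OF K1, of "(Df p \<bullet> b)\<^sup>2"] by simp
      moreover have "(f_dcut b p)\<^sup>2 \<le> K\<^sup>2 * (f p)\<^sup>2" using sq[OF f_dcut_le[OF b, of p]] by (simp add: power_mult_distrib)
      ultimately show ?thesis by linarith
    qed
    then have "(\<Sum>b\<in>Basis. (grad_cut b p)\<^sup>2) \<le> (\<Sum>b\<in>Basis. 2 * K\<^sup>2 * (Df p \<bullet> b)\<^sup>2 + 2 * (K\<^sup>2 * (f p)\<^sup>2))"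
      by (rule sum_mono)
    also have "\<dots> = 2 * K\<^sup>2 * (\<Sum>b\<in>Basis. (Df p \<bullet> b)\<^sup>2) + 2 * real DIM('x) * (K\<^sup>2 * (f p)\<^sup>2)"
      by (simp add: sum.distrib sum_distrib_left)
    also have "(\<Sum>b\<in>Basis. (Df p \<bullet> b)\<^sup>2) = (norm (Df p))\<^sup>2"
      unfolding power2_norm_eq_inner euclidean_inner[of "Df p" "Df p"] by (simp add: power2_eq_square)
    finally show ?thesis .
  qed
  have 3: "(\<Sum>b\<in>Basis. (F_cut b p)\<^sup>2) \<le> K\<^sup>2 * (norm (F p))\<^sup>2"
  proof -
    have "(\<Sum>b\<in>Basis. (F_cut b p)\<^sup>2) \<le> (\<Sum>b\<in>Basis. (F p \<bullet> b)\<^sup>2)"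
      by (intro sum_mono) (metis F_cut_le abs_ge_zero power2_abs power_mono)
    also have "\<dots> = (norm (F p))\<^sup>2"
      unfolding power2_norm_eq_inner euclidean_inner[of "F p" "F p"] by (simp add: power2_eq_square)
    also have "\<dots> \<le> K\<^sup>2 * (norm (F p))\<^sup>2" using mult_right_mono[OF K1, of "(norm (F p))\<^sup>2"] by simp
    finally show ?thesis .
  qed
  have 4: "(source p)\<^sup>2 \<le> 3 * (K\<^sup>2 * (norm (F p))\<^sup>2) + 3 * (K\<^sup>2 * (g p)\<^sup>2) + 3 * (K\<^sup>2 * (f p)\<^sup>2)"
  proof -
    have tri: "(a - b - c)\<^sup>2 \<le> 3 * a\<^sup>2 + 3 * b\<^sup>2 + 3 * c\<^sup>2" for a b c :: real
    proof -
      have "0 \<le> (a + b)\<^sup>2 + (a + c)\<^sup>2 + (b - c)\<^sup>2" by simp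
      then show ?thesis by (simp add: power2_eq_square algebra_simps)
    qed
    have "(F_dcut p)\<^sup>2 \<le> K\<^sup>2 * (norm (F p))\<^sup>2" using sq[OF F_dcut_le[of p]] by (simp add: power_mult_distrib)
    moreover have "(g_cut p)\<^sup>2 \<le> K\<^sup>2 * (g p)\<^sup>2" using sq[OF g_cut_le[of p]] mult_right_mono[OF K1, of "(g p)\<^sup>2"] by simp
    moreover have "(f_ycut p)\<^sup>2 \<le> K\<^sup>2 * (f p)\<^sup>2" using sq[OF f_ycut_le[of p]] by (simp add: power_mult_distrib)
    ultimately show ?thesis using tri[of "F_dcut p" "g_cut p" "f_ycut p"] unfolding source_def by linarith
  qed
  define A where "A = K\<^sup>2 * (f p)\<^sup>2"
  define D where "D = K\<^sup>2 * (norm (Df p))\<^sup>2"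
  define H where "H = K\<^sup>2 * (norm (F p))\<^sup>2"
  define G where "G = K\<^sup>2 * (g p)\<^sup>2"
  define n where "n = real DIM('x)"
  have nn: "0 \<le> A" "0 \<le> D" "0 \<le> H" "0 \<le> G" "0 \<le> n" by (auto simp: A_def D_def H_def G_def n_def)
  have "(2 * n + 9) * K\<^sup>2 * energy_density p = (2 * n + 9) * A + (2 * n + 9) * D + (2 * n + 9) * H + (2 * n + 9) * G"
    by (simp add: energy_density_def A_def D_def H_def G_def algebra_simps)
  moreover have "(2 * n + 9) * A = 2 * n * A + 9 * A" "9 * D \<le> (2 * n + 9) * D" "9 * H \<le> (2 * n + 9) * H" "9 * G \<le> (2 * n + 9) * G"
    using nn by (auto simp: distrib_right intro!: mult_nonneg_nonneg)
  ultimately show ?thesis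
    using 1 2 3 4 nn unfolding A_def[symmetric] D_def[symmetric] H_def[symmetric] G_def[symmetric] n_def[symmetric] mult.assoc[of 2 "K\<^sup>2"]
    by linarith
qed

lemma W2_sources:
  "W2 w f_cut + (\<Sum>b\<in>Basis. W2 w (grad_cut b)) + (\<Sum>b\<in>Basis. W2 w (F_cut b)) + W2 w source
     \<le> ennreal ((2 * real DIM('x) + 9) * K\<^sup>2) * total"
proof -
  have [measurable]: "f_cut \<in> borel_measurable borel" "source \<in> borel_measurable borel"
    using fieldD(1)[OF fields(1)] fieldD(1)[OF fields(9)] by auto
  have [measurable]: "grad_cut b \<in> borel_measurable borel" "F_cut b \<in> borel_measurable borel" if "b \<in> Basis" for b
    using fieldD(1)[OF fields(4)[OF that]] fieldD(1)[OF fields(5)[OF that]] by auto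
  have [measurable]: "energy_density \<in> borel_measurable borel" unfolding energy_density_def by measurable
  have w0: "0 \<le> w x" for x using pos_weightD[OF A2_pos_weight[OF A2]] by simp
  have "W2 w f_cut + (\<Sum>b\<in>Basis. W2 w (grad_cut b)) + (\<Sum>b\<in>Basis. W2 w (F_cut b)) + W2 w source
     = (\<integral>\<^sup>+p. ennreal ((f_cut p)\<^sup>2 * w (fst p)) + (\<Sum>b\<in>Basis. ennreal ((grad_cut b p)\<^sup>2 * w (fst p)))
         + (\<Sum>b\<in>Basis. ennreal ((F_cut b p)\<^sup>2 * w (fst p))) + ennreal ((source p)\<^sup>2 * w (fst p)) \<partial>lborel)"
    unfolding W2_def by (simp add: nn_integral_add nn_integral_sum)
  also have "\<dots> = (\<integral>\<^sup>+p. ennreal (((f_cut p)\<^sup>2 + (\<Sum>b\<in>Basis. (grad_cut b p)\<^sup>2) + (\<Sum>b\<in>Basis. (F_cut b p)\<^sup>2) + (source p)\<^sup>2) * w (fst p)) \<partial>lborel)"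
    using w0 by (intro nn_integral_cong) (simp add: distrib_right sum_distrib_right sum_nonneg)
  also have "\<dots> \<le> (\<integral>\<^sup>+p. ennreal ((2 * real DIM('x) + 9) * K\<^sup>2) * ennreal (energy_density p * w (fst p)) \<partial>lborel)"
  proof (rule nn_integral_mono)
    fix p
    show "ennreal (((f_cut p)\<^sup>2 + (\<Sum>b\<in>Basis. (grad_cut b p)\<^sup>2) + (\<Sum>b\<in>Basis. (F_cut b p)\<^sup>2) + (source p)\<^sup>2) * w (fst p))
       \<le> ennreal ((2 * real DIM('x) + 9) * K\<^sup>2) * ennreal (energy_density p * w (fst p))"
      using mult_right_mono[OF field_norm_bound w0, of p "fst p"] energy_nonneg[of p] w0
      by (subst ennreal_mult[symmetric]) (auto intro!: ennreal_leI simp: mult.assoc)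
  qed
  also have "\<dots> = ennreal ((2 * real DIM('x) + 9) * K\<^sup>2) * total"
    unfolding total_def by (rule nn_integral_cmult) measurable
  finally show ?thesis .
qed

end

context kinetic
begin

text \<open>
  In the equation for the test function \<open>(h \<kappa>) (\<theta> e(q \<bullet> \<xi>))\<close> the derivative along \<open>B\<close> of the
  oscillation is \<open>(B(x) \<bullet> \<xi>) e'(q \<bullet> \<xi>)\<close>, whose factor is the symbol \<open>x \<bullet> u + \<tau>\<close>.  Hence the transform
  with \<open>e'\<close> appears on the left and the transforms with \<open>e\<close> on the right.
\<close>
lemma transport_cut:
  assumes e: "smooth e" "\<And>t. \<bar>e t\<bar> \<le> 1" "\<And>t. (e has_real_derivative e' t) (at t)"
    and e': "smooth e'" "\<And>t. \<bar>e' t\<bar> \<le> 1"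
    and sym: "\<And>x. B x \<bullet> \<xi> = x \<bullet> u + \<tau>"
  shows "transport_eq w u \<tau> (osc e' \<xi> f_cut) (\<lambda>x. \<Sum>b\<in>Basis. osc e \<xi> (F_cut b) x *\<^sub>R b) (osc e \<xi> source)"
  unfolding transport_eq_def
proof (intro allI impI)
  fix h :: "'x \<Rightarrow> real" assume h: "smooth h"
  let ?H = "\<lambda>x. h x * \<kappa> x" and ?\<Theta> = "\<lambda>q. \<theta> q * e (q \<bullet> \<xi>)"
  let ?\<phi> = "\<lambda>p::'x \<times> 'q. (h (fst p) * \<kappa> (fst p)) * (\<theta> (snd p) * e (snd p \<bullet> \<xi>))"
  have sH: "smooth ?H" by (rule smooth_mult[OF h \<kappa>(1)])
  have s\<Theta>: "smooth ?\<Theta>" by (intro smooth_mult \<theta>(1) smooth_compose[OF e(1)] smooth_inner)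
  note grad\<phi> = grad_tensor[OF sH s\<Theta>]
  have gH: "grad ?H x = h x *\<^sub>R grad \<kappa> x + \<kappa> x *\<^sub>R grad h x" for x by (rule grad_mult[OF h \<kappa>(1)])
  note g\<Theta> = grad_wave[OF e(3) \<theta>(1)]
  have ch: "continuous_on UNIV h" by (rule smooth_continuous[OF h])
  have ce: "continuous_on UNIV e" and ce': "continuous_on UNIV e'" using e(1) e'(1) by (auto intro: smooth_continuous)
  have cha: "continuous_on UNIV (\<lambda>x. h x * (x \<bullet> u + \<tau>))" by (intro continuous_intros ch)
  have cdh: "continuous_on UNIV (\<lambda>x. grad h x \<bullet> b)" for b by (intro continuous_intros smooth_continuous_grad h)
  note int = field_integrable(1)[OF A2]
  note o1 = osc_integral[where \<xi>=\<xi>, OF fields(1) int[OF fields(1)] cha ce' e'(2)]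
  note oF = osc_integral[where \<xi>=\<xi>, OF fields(5) int[OF fields(5)] cdh ce e(2)]
  note oD = osc_integral[where \<xi>=\<xi>, OF fields(6) int[OF fields(6)] ch ce e(2)]
  note og = osc_integral[where \<xi>=\<xi>, OF fields(7) int[OF fields(7)] ch ce e(2)]
  note oy = osc_integral[where \<xi>=\<xi>, OF fields(8) int[OF fields(8)] ch ce e(2)]
  note oS = osc_integral[where \<xi>=\<xi>, OF fields(9) int[OF fields(9)] ch ce e(2)]
  have "f p * (snd (grad ?\<phi> p) \<bullet> B (fst p)) * w (fst p)
      = f_ycut p * (h (fst p) * e (snd p \<bullet> \<xi>)) * w (fst p)
        + f_cut p * ((h (fst p) * (fst p \<bullet> u + \<tau>)) * e' (snd p \<bullet> \<xi>)) * w (fst p)" for p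
  proof -
    have "\<xi> \<bullet> B (fst p) = fst p \<bullet> u + \<tau>" using sym[of "fst p"] by (simp add: inner_commute)
    then show ?thesis
      unfolding grad\<phi> snd_conv g\<Theta> f_ycut_def f_cut_def by (simp add: inner_add_left algebra_simps)
  qed
  then have L: "(\<integral>p. f p * (snd (grad ?\<phi> p) \<bullet> B (fst p)) * w (fst p) \<partial>lborel)
      = (\<integral>p. f_ycut p * (h (fst p) * e (snd p \<bullet> \<xi>)) * w (fst p) \<partial>lborel)
        + (\<integral>p. f_cut p * ((h (fst p) * (fst p \<bullet> u + \<tau>)) * e' (snd p \<bullet> \<xi>)) * w (fst p) \<partial>lborel)"
    by (simp only: Bochner_Integration.integral_add[OF oy(1) o1(1)])
  have "(F p \<bullet> fst (grad ?\<phi> p)) * w (fst p)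
      = (\<Sum>b\<in>Basis. F_cut b p * ((grad h (fst p) \<bullet> b) * e (snd p \<bullet> \<xi>)) * w (fst p))
        + F_dcut p * (h (fst p) * e (snd p \<bullet> \<xi>)) * w (fst p)" for p
  proof -
    have "(\<Sum>b\<in>Basis. F_cut b p * ((grad h (fst p) \<bullet> b) * e (snd p \<bullet> \<xi>)) * w (fst p))
       = \<kappa> (fst p) * \<theta> (snd p) * e (snd p \<bullet> \<xi>) * w (fst p) * (\<Sum>b\<in>Basis. (F p \<bullet> b) * (grad h (fst p) \<bullet> b))"
      by (simp add: F_cut_def sum_distrib_left mult_ac)
    also have "(\<Sum>b\<in>Basis. (F p \<bullet> b) * (grad h (fst p) \<bullet> b)) = F p \<bullet> grad h (fst p)"
      by (rule euclidean_inner[symmetric])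
    finally show ?thesis
      unfolding grad\<phi> fst_conv gH F_dcut_def by (simp add: inner_add_right algebra_simps)
  qed
  then have "(\<integral>p. (F p \<bullet> fst (grad ?\<phi> p)) * w (fst p) \<partial>lborel)
      = (\<integral>p. (\<Sum>b\<in>Basis. F_cut b p * ((grad h (fst p) \<bullet> b) * e (snd p \<bullet> \<xi>)) * w (fst p))
        + F_dcut p * (h (fst p) * e (snd p \<bullet> \<xi>)) * w (fst p) \<partial>lborel)"
    by (simp only:)
  also have "\<dots> = (\<integral>p. (\<Sum>b\<in>Basis. F_cut b p * ((grad h (fst p) \<bullet> b) * e (snd p \<bullet> \<xi>)) * w (fst p)) \<partial>lborel)
        + (\<integral>p. F_dcut p * (h (fst p) * e (snd p \<bullet> \<xi>)) * w (fst p) \<partial>lborel)"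
    by (rule Bochner_Integration.integral_add[OF Bochner_Integration.integrable_sum oD(1)]) (rule oF(1))
  also have "(\<integral>p. (\<Sum>b\<in>Basis. F_cut b p * ((grad h (fst p) \<bullet> b) * e (snd p \<bullet> \<xi>)) * w (fst p)) \<partial>lborel)
      = (\<Sum>b\<in>Basis. (\<integral>p. F_cut b p * ((grad h (fst p) \<bullet> b) * e (snd p \<bullet> \<xi>)) * w (fst p) \<partial>lborel))"
    by (rule Bochner_Integration.integral_sum) (rule oF(1))
  finally have R: "(\<integral>p. (F p \<bullet> fst (grad ?\<phi> p)) * w (fst p) \<partial>lborel)
      = (\<Sum>b\<in>Basis. (\<integral>p. F_cut b p * ((grad h (fst p) \<bullet> b) * e (snd p \<bullet> \<xi>)) * w (fst p) \<partial>lborel))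
        + (\<integral>p. F_dcut p * (h (fst p) * e (snd p \<bullet> \<xi>)) * w (fst p) \<partial>lborel)" .
  have G: "(\<integral>p. g p * ?\<phi> p * w (fst p) \<partial>lborel) = (\<integral>p. g_cut p * (h (fst p) * e (snd p \<bullet> \<xi>)) * w (fst p) \<partial>lborel)"
    by (intro Bochner_Integration.integral_cong refl) (simp add: g_cut_def mult_ac)
  have S: "(\<integral>p. source p * (h (fst p) * e (snd p \<bullet> \<xi>)) * w (fst p) \<partial>lborel)
      = (\<integral>p. F_dcut p * (h (fst p) * e (snd p \<bullet> \<xi>)) * w (fst p) \<partial>lborel)
        - (\<integral>p. g_cut p * (h (fst p) * e (snd p \<bullet> \<xi>)) * w (fst p) \<partial>lborel)
        - (\<integral>p. f_ycut p * (h (fst p) * e (snd p \<bullet> \<xi>)) * w (fst p) \<partial>lborel)"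
    unfolding source_def left_diff_distrib
    by (simp only: Bochner_Integration.integral_diff[OF Bochner_Integration.integrable_diff[OF oD(1) og(1)] oy(1)]
        Bochner_Integration.integral_diff[OF oD(1) og(1)])
  have fluxes: "(\<Sum>b\<in>Basis. (\<integral>x. osc e \<xi> (F_cut b) x * (grad h x \<bullet> b) * w x \<partial>lborel))
      = (\<integral>x. ((\<Sum>b\<in>Basis. osc e \<xi> (F_cut b) x *\<^sub>R b) \<bullet> grad h x) * w x \<partial>lborel)"
  proof -
    have "(\<Sum>b\<in>Basis. (\<integral>x. osc e \<xi> (F_cut b) x * (grad h x \<bullet> b) * w x \<partial>lborel))
       = (\<integral>x. (\<Sum>b\<in>Basis. osc e \<xi> (F_cut b) x * (grad h x \<bullet> b) * w x) \<partial>lborel)"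
      by (rule Bochner_Integration.integral_sum[symmetric]) (rule oF(3))
    also have "\<dots> = (\<integral>x. ((\<Sum>b\<in>Basis. osc e \<xi> (F_cut b) x *\<^sub>R b) \<bullet> grad h x) * w x \<partial>lborel)"
      by (intro Bochner_Integration.integral_cong refl) (simp add: inner_sum_left sum_distrib_right inner_commute[of "grad h _"])
    finally show ?thesis .
  qed
  have "(\<integral>x. (x \<bullet> u + \<tau>) * osc e' \<xi> f_cut x * h x * w x \<partial>lborel)
      = (\<integral>x. osc e' \<xi> f_cut x * (h x * (x \<bullet> u + \<tau>)) * w x \<partial>lborel)"
    by (intro Bochner_Integration.integral_cong refl) (simp add: mult_ac)
  also have "\<dots> = (\<integral>p. f_cut p * ((h (fst p) * (fst p \<bullet> u + \<tau>)) * e' (snd p \<bullet> \<xi>)) * w (fst p) \<partial>lborel)"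
    by (rule o1(2)[symmetric])
  also have "\<dots> = (\<Sum>b\<in>Basis. (\<integral>p. F_cut b p * ((grad h (fst p) \<bullet> b) * e (snd p \<bullet> \<xi>)) * w (fst p) \<partial>lborel))
      + (\<integral>p. source p * (h (fst p) * e (snd p \<bullet> \<xi>)) * w (fst p) \<partial>lborel)"
    using eq[OF h e(1), of \<xi>] unfolding L R G S by linarith
  also have "\<dots> = (\<Sum>b\<in>Basis. (\<integral>x. osc e \<xi> (F_cut b) x * (grad h x \<bullet> b) * w x \<partial>lborel))
      + (\<integral>x. osc e \<xi> source x * h x * w x \<partial>lborel)"
    by (simp only: oF(2) oS(2) cong: sum.cong)
  finally show "(\<integral>x. (x \<bullet> u + \<tau>) * osc e' \<xi> f_cut x * h x * w x \<partial>lborel)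
      = (\<integral>x. ((\<Sum>b\<in>Basis. osc e \<xi> (F_cut b) x *\<^sub>R b) \<bullet> grad h x) * w x \<partial>lborel)
        + (\<integral>x. osc e \<xi> source x * h x * w x \<partial>lborel)"
    unfolding fluxes .
qed

lemma weak_grad_cut:
  assumes e: "smooth e" "\<And>t. \<bar>e t\<bar> \<le> 1"
  shows "weak_grad (osc e \<xi> f_cut) (\<lambda>x. \<Sum>b\<in>Basis. osc e \<xi> (grad_cut b) x *\<^sub>R b)"
proof -
  have ce: "continuous_on UNIV e" using e(1) by (rule smooth_continuous)
  have em: "e \<in> borel_measurable borel" by (rule borel_measurable_continuous_onI[OF ce])
  note int = field_integrable(2)[OF A2]
  have [measurable]: "osc e \<xi> f_cut \<in> borel_measurable borel" by (rule osc_measurable(1)[OF fields(1) em])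
  have gm: "osc e \<xi> (grad_cut b) \<in> borel_measurable borel" if "b \<in> Basis" for b
    by (rule osc_measurable(1)[OF fields(4)[OF that] em])
  have i: "integrable lborel (osc e \<xi> v)" if v: "field R w v" for v
    using osc_integral(3)[where \<omega>="\<lambda>_. 1" and \<xi>=\<xi> and h="\<lambda>_. 1", OF v int[OF v] continuous_on_const ce e(2)] by simp
  let ?P = "\<lambda>x. \<Sum>b\<in>Basis. osc e \<xi> (grad_cut b) x *\<^sub>R b"
  have Pb: "?P x \<bullet> b = osc e \<xi> (grad_cut b) x" if "b \<in> Basis" for x b
    using that by (simp add: inner_sum_left inner_Basis if_distrib cong: if_cong)
  show ?thesis
    unfolding weak_grad_def
  proof (intro conjI allI impI ballI)
    show "?P \<in> borel_measurable borel" using gm by measurable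
    show "integrable lborel ?P" by (intro Bochner_Integration.integrable_sum integrable_scaleR_left i fields(4))
    show "integrable lborel (osc e \<xi> f_cut)" by (rule i[OF fields(1)])
    fix h :: "'x \<Rightarrow> real" and b :: 'x
    assume h: "smooth h" and b: "b \<in> Basis"
    let ?H = "\<lambda>x. h x * \<kappa> x" and ?\<Theta> = "\<lambda>q. \<theta> q * e (q \<bullet> \<xi>)"
    let ?\<phi> = "\<lambda>p::'x \<times> 'q. (h (fst p) * \<kappa> (fst p)) * (\<theta> (snd p) * e (snd p \<bullet> \<xi>))"
    have sH: "smooth ?H" by (rule smooth_mult[OF h \<kappa>(1)])
    have s\<Theta>: "smooth ?\<Theta>" by (intro smooth_mult \<theta>(1) smooth_compose[OF e(1)] smooth_inner)
    note grad\<phi> = grad_tensor[OF sH s\<Theta>]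
    have gH: "grad ?H x = h x *\<^sub>R grad \<kappa> x + \<kappa> x *\<^sub>R grad h x" for x by (rule grad_mult[OF h \<kappa>(1)])
    have ch: "continuous_on UNIV h" by (rule smooth_continuous[OF h])
    have cdh: "continuous_on UNIV (\<lambda>x. grad h x \<bullet> b)" by (intro continuous_intros smooth_continuous_grad h)
    have one: "\<omega> * (1::real) = \<omega>" for \<omega> by simp
    note o1 = osc_integral[where \<omega>="\<lambda>_. 1" and \<xi>=\<xi>, OF fields(1) int[OF fields(1)] cdh ce e(2), unfolded one]
    note oD = osc_integral[where \<omega>="\<lambda>_. 1" and \<xi>=\<xi>, OF fields(2)[OF b] int[OF fields(2)[OF b]] ch ce e(2), unfolded one]
    note od = osc_integral[where \<omega>="\<lambda>_. 1" and \<xi>=\<xi>, OF fields(3)[OF b] int[OF fields(3)[OF b]] ch ce e(2), unfolded one]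
    note og = osc_integral[where \<omega>="\<lambda>_. 1" and \<xi>=\<xi>, OF fields(4)[OF b] int[OF fields(4)[OF b]] ch ce e(2), unfolded one]
    have "f p * (fst (grad ?\<phi> p) \<bullet> b) = f_dcut b p * (h (fst p) * e (snd p \<bullet> \<xi>)) + f_cut p * ((grad h (fst p) \<bullet> b) * e (snd p \<bullet> \<xi>))" for p
      unfolding grad\<phi> fst_conv gH f_dcut_def f_cut_def by (simp add: inner_add_left algebra_simps)
    then have L: "(\<integral>p. f p * (fst (grad ?\<phi> p) \<bullet> b) \<partial>lborel)
        = (\<integral>p. f_dcut b p * (h (fst p) * e (snd p \<bullet> \<xi>)) \<partial>lborel) + (\<integral>p. f_cut p * ((grad h (fst p) \<bullet> b) * e (snd p \<bullet> \<xi>)) \<partial>lborel)"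
      by (simp only: Bochner_Integration.integral_add[OF od(1) o1(1)])
    have D: "(\<integral>p. (Df p \<bullet> b) * ?\<phi> p \<partial>lborel) = (\<integral>p. Df_cut b p * (h (fst p) * e (snd p \<bullet> \<xi>)) \<partial>lborel)"
      by (intro Bochner_Integration.integral_cong refl) (simp add: Df_cut_def mult_ac)
    have G: "(\<integral>p. grad_cut b p * (h (fst p) * e (snd p \<bullet> \<xi>)) \<partial>lborel)
        = (\<integral>p. Df_cut b p * (h (fst p) * e (snd p \<bullet> \<xi>)) \<partial>lborel) + (\<integral>p. f_dcut b p * (h (fst p) * e (snd p \<bullet> \<xi>)) \<partial>lborel)"
      unfolding grad_cut_def distrib_right by (rule Bochner_Integration.integral_add[OF oD(1) od(1)])
    have "(\<integral>x. (grad h x \<bullet> b) * osc e \<xi> f_cut x \<partial>lborel) = (\<integral>p. f_cut p * ((grad h (fst p) \<bullet> b) * e (snd p \<bullet> \<xi>)) \<partial>lborel)"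
      unfolding o1(2) by (simp only: mult.commute)
    also have "\<dots> = - (\<integral>p. grad_cut b p * (h (fst p) * e (snd p \<bullet> \<xi>)) \<partial>lborel)"
      using weak[OF h e(1) b, of \<xi>] unfolding L D G by linarith
    also have "\<dots> = - (\<integral>x. h x * (?P x \<bullet> b) \<partial>lborel)"
      unfolding og(2) Pb[OF b] by (simp only: mult.commute)
    finally show "(\<integral>x. (grad h x \<bullet> b) * osc e \<xi> f_cut x \<partial>lborel) = - (\<integral>x. h x * (?P x \<bullet> b) \<partial>lborel)" .
  qed measurable
qed

end

lemma wsq_components:
  fixes c :: "'x::euclidean_space \<Rightarrow> 'x \<Rightarrow> real"
  assumes w: "pos_weight w" and c: "\<And>b. b \<in> Basis \<Longrightarrow> c b \<in> borel_measurable borel"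
  shows "wsq w (\<lambda>x. norm (\<Sum>b\<in>Basis. c b x *\<^sub>R b)) = (\<Sum>b\<in>Basis. wsq w (c b))"
proof -
  note c[measurable] pos_weightD(1)[OF w, measurable]
  have n: "(norm (\<Sum>b\<in>Basis. c b x *\<^sub>R b))\<^sup>2 = (\<Sum>b\<in>Basis. (c b x)\<^sup>2)" for x
    unfolding power2_norm_eq_inner euclidean_inner[of "\<Sum>b\<in>Basis. c b x *\<^sub>R b" "\<Sum>b\<in>Basis. c b x *\<^sub>R b"]
    by (intro sum.cong refl) (simp add: inner_sum_left inner_Basis if_distrib power2_eq_square cong: if_cong)
  have "wsq w (\<lambda>x. norm (\<Sum>b\<in>Basis. c b x *\<^sub>R b)) = (\<integral>\<^sup>+x. (\<Sum>b\<in>Basis. ennreal ((c b x)\<^sup>2 * w x)) \<partial>lborel)"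
    unfolding wsq_def n using pos_weightD[OF w]
    by (intro nn_integral_cong) (simp add: sum_distrib_right)
  also have "\<dots> = (\<Sum>b\<in>Basis. wsq w (c b))" unfolding wsq_def by (rule nn_integral_sum) measurable
  finally show ?thesis .
qed

lemma smooth_sin: "smooth (sin :: real \<Rightarrow> real)" and smooth_neg_sin: "smooth (\<lambda>t::real. - sin t)"
proof -
  have "smooth (\<lambda>t::real. cos (pi/2 + (- t)))"
    by (rule smooth_affine[OF _ smooth_cos]) (intro bounded_linear_minus bounded_linear_ident)
  moreover have "(\<lambda>t::real. cos (pi/2 + (- t))) = sin" by (auto simp: sin_cos_eq)
  ultimately show s: "smooth (sin :: real \<Rightarrow> real)" by simp
  show "smooth (\<lambda>t::real. - sin t)" using smooth_diff[OF smooth_const[of 0] s] by simp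
qed

lemma osc_neg_sin: "osc (\<lambda>t. - sin t) \<xi> u x = - osc sin \<xi> u x"
  by (simp add: osc_def)

context kinetic
begin

text \<open>
  Both pairs \<open>(e, e')\<close> are taken in turn to bound the cosine and the sine part of the transform of
  \<open>f_cut\<close>.
\<close>
lemma frequency_bound:
  fixes e e' :: "real \<Rightarrow> real"
  assumes dec: "\<And>(p::'x \<Rightarrow> real) P \<Phi> G u \<tau>. transport_data M R w u \<tau> p P \<Phi> G \<Longrightarrow>
       sqr w p \<le> C * (1 + norm u + \<bar>\<tau>\<bar>) powr (- \<alpha>) * total_sqr w p P \<Phi> G"
    and C: "0 \<le> C"
    and sym: "\<And>x. B x \<bullet> \<xi> = x \<bullet> u + \<tau>"
    and e: "(e, e') \<in> {(sin, cos), (cos, \<lambda>t. - sin t)}"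
    and finite: "osc_sq w \<xi> f_cut < \<infinity>" "\<And>b. b \<in> Basis \<Longrightarrow> osc_sq w \<xi> (grad_cut b) < \<infinity>"
      "\<And>b. b \<in> Basis \<Longrightarrow> osc_sq w \<xi> (F_cut b) < \<infinity>" "osc_sq w \<xi> source < \<infinity>"
  shows "wsq w (osc e' \<xi> f_cut) \<le> ennreal (C * (1 + norm u + \<bar>\<tau>\<bar>) powr (- \<alpha>)) *
     (osc_sq w \<xi> f_cut + (\<Sum>b\<in>Basis. osc_sq w \<xi> (grad_cut b)) + (\<Sum>b\<in>Basis. osc_sq w \<xi> (F_cut b)) + osc_sq w \<xi> source)"
proof -
  have ee: "smooth e" "\<And>t. \<bar>e t\<bar> \<le> 1" "\<And>t. (e has_real_derivative e' t) (at t)" "smooth e'" "\<And>t. \<bar>e' t\<bar> \<le> 1"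
    using e smooth_sin smooth_cos smooth_neg_sin by (auto intro!: derivative_eq_intros)
  have em: "e \<in> borel_measurable borel" "e' \<in> borel_measurable borel"
    by (auto intro!: borel_measurable_continuous_onI smooth_continuous ee)
  note w = A2_pos_weight[OF A2]
  have wle: "wsq w (osc e \<xi> v) \<le> osc_sq w \<xi> v" "wsq w (osc e' \<xi> v) \<le> osc_sq w \<xi> v" for v :: "'x \<times> 'q \<Rightarrow> real"
  proof -
    have "wsq w (osc (\<lambda>t. - sin t) \<xi> v) = wsq w (osc sin \<xi> v)" by (simp add: wsq_def osc_neg_sin)
    then show "wsq w (osc e \<xi> v) \<le> osc_sq w \<xi> v" "wsq w (osc e' \<xi> v) \<le> osc_sq w \<xi> v"
      using e by (auto simp: osc_sq_def add_increasing add_increasing2)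
  qed
  let ?p = "osc e' \<xi> f_cut" and ?P = "\<lambda>x. \<Sum>b\<in>Basis. osc e' \<xi> (grad_cut b) x *\<^sub>R b"
    and ?\<Phi> = "\<lambda>x. \<Sum>b\<in>Basis. osc e \<xi> (F_cut b) x *\<^sub>R b" and ?G = "osc e \<xi> source"
  have m: "?p \<in> borel_measurable borel" "?G \<in> borel_measurable borel"
    by (rule osc_measurable(1)[OF fields(1) em(2)], rule osc_measurable(1)[OF fields(9) em(1)])
  have mP: "b \<in> Basis \<Longrightarrow> osc e' \<xi> (grad_cut b) \<in> borel_measurable borel" for b
    by (rule osc_measurable(1)[OF fields(4) em(2)])
  have mF: "b \<in> Basis \<Longrightarrow> osc e \<xi> (F_cut b) \<in> borel_measurable borel" for b
    by (rule osc_measurable(1)[OF fields(5) em(1)])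
  have MP: "?P \<in> borel_measurable borel" and MF: "?\<Phi> \<in> borel_measurable borel" using mP mF by measurable
  have WP: "wsq w (\<lambda>x. norm (?P x)) \<le> (\<Sum>b\<in>Basis. osc_sq w \<xi> (grad_cut b))"
    by (subst wsq_components[OF w mP]) (auto intro!: sum_mono wle)
  have WF: "wsq w (\<lambda>x. norm (?\<Phi> x)) \<le> (\<Sum>b\<in>Basis. osc_sq w \<xi> (F_cut b))"
    by (subst wsq_components[OF w mF]) (auto intro!: sum_mono wle)
  have sP: "(\<Sum>b\<in>Basis. osc_sq w \<xi> (grad_cut b)) < \<infinity>" "(\<Sum>b\<in>Basis. osc_sq w \<xi> (F_cut b)) < \<infinity>"
    using finite by (auto simp: less_top[symmetric] ennreal_sum_eq_top)
  have Lp: "L2w w ?p" using m wle(2)[of f_cut] finite(1) by (auto simp: L2w_def intro: order.strict_trans1)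
  have LG: "L2w w ?G" using m wle(1)[of source] finite(4) by (auto simp: L2w_def intro: order.strict_trans1)
  have LP: "L2w w (\<lambda>x. norm (?P x))" using MP WP sP(1) by (auto simp: L2w_def intro: order.strict_trans1)
  have LF: "L2w w (\<lambda>x. norm (?\<Phi> x))" using MF WF sP(2) by (auto simp: L2w_def intro: order.strict_trans1)
  have data: "transport_data M R w u \<tau> ?p ?P ?\<Phi> ?G"
    unfolding transport_data_def
    using A2 Lp LG LP LF MF weak_grad_cut[OF ee(4,5)] transport_cut[OF ee(1-3) ee(4,5) sym]
      osc_outside[OF fields(1)] osc_outside[OF fields(9)] osc_outside[OF fields(5)]
    by simp
  have c0: "0 \<le> C * (1 + norm u + \<bar>\<tau>\<bar>) powr (- \<alpha>)" using C by simp
  have "wsq w ?p = ennreal (sqr w ?p)" by (rule L2w_sqr(2)[OF w Lp])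
  also have "\<dots> \<le> ennreal (C * (1 + norm u + \<bar>\<tau>\<bar>) powr (- \<alpha>) * total_sqr w ?p ?P ?\<Phi> ?G)"
    by (rule ennreal_leI[OF dec[OF data]])
  also have "\<dots> = ennreal (C * (1 + norm u + \<bar>\<tau>\<bar>) powr (- \<alpha>)) * (wsq w ?p + wsq w (\<lambda>x. norm (?P x)) + wsq w (\<lambda>x. norm (?\<Phi> x)) + wsq w ?G)"
    unfolding L2w_sqr(2)[OF w Lp] L2w_sqr(2)[OF w LP] L2w_sqr(2)[OF w LF] L2w_sqr(2)[OF w LG] total_sqr_def
    using sqr_nonneg[OF w] by (subst ennreal_mult[OF c0]) (simp_all add: add_nonneg_nonneg)
  also have "\<dots> \<le> ennreal (C * (1 + norm u + \<bar>\<tau>\<bar>) powr (- \<alpha>)) *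
     (osc_sq w \<xi> f_cut + (\<Sum>b\<in>Basis. osc_sq w \<xi> (grad_cut b)) + (\<Sum>b\<in>Basis. osc_sq w \<xi> (F_cut b)) + osc_sq w \<xi> source)"
    by (intro mult_left_mono add_mono wle WP WF) auto
  finally show ?thesis .
qed

text \<open>
  For almost every \<open>\<xi>\<close> all transforms have finite weighted norms, and the decay at the frequency \<open>\<xi>\<close>
  applies.  By \<open>sym\<close> and \<open>2 s \<le> \<alpha>\<close> the factor \<open>(1 + |\<xi>|\<^sup>2)\<^sup>s\<close> is absorbed by the gain, and Plancherel
  bounds the integral of what is left.
\<close>
lemma kinetic_fourier_estimate:
  assumes dec: "\<And>(p::'x \<Rightarrow> real) P \<Phi> G u \<tau>. transport_data M R w u \<tau> p P \<Phi> G \<Longrightarrow>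
       sqr w p \<le> C * (1 + norm u + \<bar>\<tau>\<bar>) powr (- \<alpha>) * total_sqr w p P \<Phi> G"
    and C: "0 \<le> C"
    and sym: "\<And>\<xi>. \<exists>u \<tau>. (\<forall>x. B x \<bullet> \<xi> = x \<bullet> u + \<tau>) \<and> 1 + (norm \<xi>)\<^sup>2 \<le> (1 + norm u + \<bar>\<tau>\<bar>)\<^sup>2"
    and s: "0 < s" "2 * s \<le> \<alpha>"
  shows "(\<integral>\<^sup>+\<xi>. ennreal ((1 + (norm \<xi>)\<^sup>2) powr s) * osc_sq w \<xi> f_cut \<partial>lborel)
     \<le> ennreal (2 * C * (2 * pi) ^ DIM('q) * ((2 * real DIM('x) + 9) * K\<^sup>2)) * total"
proof -
  note w = A2_pos_weight[OF A2]
  have osm: "(\<lambda>\<xi>::'q. osc_sq w \<xi> v) \<in> borel_measurable borel" if "field R w v" for v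
    by (rule osc_sq_measurable[OF w that])
  have AEfin: "AE \<xi>::'q in lborel. osc_sq w \<xi> v < \<infinity>" if v: "field R w v" for v
  proof -
    have "(\<integral>\<^sup>+\<xi>. osc_sq w \<xi> v \<partial>lborel) \<le> ennreal ((2 * pi) ^ DIM('q)) * W2 w v" by (rule osc_energy[OF A2 v])
    also have "\<dots> < \<infinity>" using fieldD(5)[OF v] by (simp add: ennreal_mult_less_top)
    finally have "AE \<xi>::'q in lborel. osc_sq w \<xi> v \<noteq> \<infinity>"
      using osm[OF v] by (intro nn_integral_noteq_infinite) auto
    then show ?thesis by (simp add: less_top)
  qed
  have AEfin_b: "AE \<xi>::'q in lborel. \<forall>b\<in>Basis. osc_sq w \<xi> (v b) < \<infinity>" if "\<And>b. b \<in> Basis \<Longrightarrow> field R w (v b)" for v :: "'x \<Rightarrow> 'x \<times> 'q \<Rightarrow> real"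
    using that AEfin by (subst AE_ball_countable) (auto intro: countable_finite)
  have Gfin: "AE \<xi>::'q in lborel. \<forall>b\<in>Basis. osc_sq w \<xi> (grad_cut b) < \<infinity>" by (rule AEfin_b) (rule fields(4))
  have Ffin: "AE \<xi>::'q in lborel. \<forall>b\<in>Basis. osc_sq w \<xi> (F_cut b) < \<infinity>" by (rule AEfin_b) (rule fields(5))
  let ?T = "\<lambda>\<xi>. osc_sq w \<xi> f_cut + (\<Sum>b\<in>Basis. osc_sq w \<xi> (grad_cut b)) + (\<Sum>b\<in>Basis. osc_sq w \<xi> (F_cut b)) + osc_sq w \<xi> source"
  have [measurable]: "(\<lambda>\<xi>::'q. osc_sq w \<xi> f_cut) \<in> borel_measurable borel" "(\<lambda>\<xi>::'q. osc_sq w \<xi> source) \<in> borel_measurable borel"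
    by (rule osm[OF fields(1)], rule osm[OF fields(9)])
  have [measurable]: "(\<lambda>\<xi>::'q. osc_sq w \<xi> (grad_cut b)) \<in> borel_measurable borel" "(\<lambda>\<xi>::'q. osc_sq w \<xi> (F_cut b)) \<in> borel_measurable borel" if "b \<in> Basis" for b
    by (rule osm[OF fields(4)[OF that]], rule osm[OF fields(5)[OF that]])
  have "(\<integral>\<^sup>+\<xi>. ennreal ((1 + (norm \<xi>)\<^sup>2) powr s) * osc_sq w \<xi> f_cut \<partial>lborel) \<le> (\<integral>\<^sup>+\<xi>. ennreal (2 * C) * ?T \<xi> \<partial>lborel)"
  proof (rule nn_integral_mono_AE)
    show "AE \<xi> in lborel. ennreal ((1 + (norm \<xi>)\<^sup>2) powr s) * osc_sq w \<xi> f_cut \<le> ennreal (2 * C) * ?T \<xi>"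
      using AEfin[OF fields(1)] AEfin[OF fields(9)] Gfin Ffin
    proof eventually_elim
      case (elim \<xi>)
      obtain u \<tau> where u: "\<And>x. B x \<bullet> \<xi> = x \<bullet> u + \<tau>" and N: "1 + (norm \<xi>)\<^sup>2 \<le> (1 + norm u + \<bar>\<tau>\<bar>)\<^sup>2"
        using sym by blast
      let ?N = "1 + norm u + \<bar>\<tau>\<bar>"
      note fb = frequency_bound[OF dec C u]
      have 1: "wsq w (osc cos \<xi> f_cut) \<le> ennreal (C * ?N powr (- \<alpha>)) * ?T \<xi>"
        by (rule fb[where e=sin]) (use elim in auto)
      have "wsq w (osc (\<lambda>t. - sin t) \<xi> f_cut) \<le> ennreal (C * ?N powr (- \<alpha>)) * ?T \<xi>"
        by (rule fb[where e=cos]) (use elim in auto)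
      moreover have "wsq w (osc (\<lambda>t. - sin t) \<xi> f_cut) = wsq w (osc sin \<xi> f_cut)" by (simp add: wsq_def osc_neg_sin)
      ultimately have 2: "wsq w (osc sin \<xi> f_cut) \<le> ennreal (C * ?N powr (- \<alpha>)) * ?T \<xi>" by simp
      have "osc_sq w \<xi> f_cut \<le> ennreal (C * ?N powr (- \<alpha>)) * ?T \<xi> + ennreal (C * ?N powr (- \<alpha>)) * ?T \<xi>"
        unfolding osc_sq_def[of w \<xi> f_cut] using 1 2 unfolding osc_sq_def[of w \<xi> f_cut] by (rule add_mono)
      also have "\<dots> = ennreal (2 * (C * ?N powr (- \<alpha>))) * ?T \<xi>"
      proof -
        have "ennreal (2 * (C * ?N powr (- \<alpha>))) = ennreal (C * ?N powr (- \<alpha>)) + ennreal (C * ?N powr (- \<alpha>))"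
          using C by (subst ennreal_plus[symmetric]) auto
        then show ?thesis by (simp only: distrib_right)
      qed
      finally have "ennreal ((1 + (norm \<xi>)\<^sup>2) powr s) * osc_sq w \<xi> f_cut
         \<le> ennreal ((1 + (norm \<xi>)\<^sup>2) powr s) * (ennreal (2 * (C * ?N powr (- \<alpha>))) * ?T \<xi>)"
        by (rule mult_left_mono) simp
      also have "\<dots> = ennreal ((1 + (norm \<xi>)\<^sup>2) powr s * (2 * (C * ?N powr (- \<alpha>)))) * ?T \<xi>"
        using C by (subst ennreal_mult) (auto simp: mult.assoc)
      also have "\<dots> \<le> ennreal (2 * C) * ?T \<xi>"
      proof (intro mult_right_mono ennreal_leI)
        have N1: "1 \<le> ?N" by simp
        have "(1 + (norm \<xi>)\<^sup>2) powr s \<le> (?N\<^sup>2) powr s" using N s by (intro powr_mono2) auto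
        also have "\<dots> = ?N powr (2 * s)" using N1 by (simp add: powr_powr flip: powr_numeral)
        also have "\<dots> \<le> ?N powr \<alpha>" using N1 s by (intro powr_mono) auto
        finally have "(1 + (norm \<xi>)\<^sup>2) powr s * ?N powr (- \<alpha>) \<le> ?N powr \<alpha> * ?N powr (- \<alpha>)"
          by (rule mult_right_mono) simp
        also have "\<dots> = 1"
        proof -
          have "?N \<noteq> 0" using N1 by linarith
          then show ?thesis by (simp flip: powr_add)
        qed
        finally have "(1 + (norm \<xi>)\<^sup>2) powr s * ?N powr (- \<alpha>) \<le> 1" .
        from mult_left_mono[OF this, of "2 * C"]
        show "(1 + (norm \<xi>)\<^sup>2) powr s * (2 * (C * ?N powr (- \<alpha>))) \<le> 2 * C" using C by (simp add: mult_ac)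
      qed simp
      finally show ?case .
    qed
  qed
  also have "\<dots> = ennreal (2 * C) * (\<integral>\<^sup>+\<xi>. ?T \<xi> \<partial>lborel)"
    by (intro nn_integral_cmult) measurable
  also have "(\<integral>\<^sup>+\<xi>. ?T \<xi> \<partial>lborel) = (\<integral>\<^sup>+\<xi>. osc_sq w \<xi> f_cut \<partial>lborel) + (\<Sum>b\<in>Basis. (\<integral>\<^sup>+\<xi>. osc_sq w \<xi> (grad_cut b) \<partial>lborel))
      + (\<Sum>b\<in>Basis. (\<integral>\<^sup>+\<xi>. osc_sq w \<xi> (F_cut b) \<partial>lborel)) + (\<integral>\<^sup>+\<xi>. osc_sq w \<xi> source \<partial>lborel)"
  proof -
    show ?thesis by (simp add: nn_integral_add nn_integral_sum)
  qed
  also have "\<dots> \<le> ennreal ((2 * pi) ^ DIM('q)) * W2 w f_cut + (\<Sum>b\<in>Basis. ennreal ((2 * pi) ^ DIM('q)) * W2 w (grad_cut b))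
      + (\<Sum>b\<in>Basis. ennreal ((2 * pi) ^ DIM('q)) * W2 w (F_cut b)) + ennreal ((2 * pi) ^ DIM('q)) * W2 w source"
    by (intro add_mono sum_mono osc_energy[where R=R, OF A2] fields)
  also have "\<dots> = ennreal ((2 * pi) ^ DIM('q)) * (W2 w f_cut + (\<Sum>b\<in>Basis. W2 w (grad_cut b)) + (\<Sum>b\<in>Basis. W2 w (F_cut b)) + W2 w source)"
    by (simp only: distrib_left sum_distrib_left)
  also have "\<dots> \<le> ennreal ((2 * pi) ^ DIM('q)) * (ennreal ((2 * real DIM('x) + 9) * K\<^sup>2) * total)"
    by (intro mult_left_mono W2_sources) simp
  also have "ennreal (2 * C) * (ennreal ((2 * pi) ^ DIM('q)) * (ennreal ((2 * real DIM('x) + 9) * K\<^sup>2) * total))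
     = ennreal (2 * C * (2 * pi) ^ DIM('q) * ((2 * real DIM('x) + 9) * K\<^sup>2)) * total"
    using C by (simp add: ennreal_mult mult.assoc)
  finally show ?thesis by (simp add: mult_left_mono)
qed

end

section \<open>Borel representatives\<close>

text \<open>
  A Borel representative is set to \<open>1\<close> on the null set where it fails to be positive.  Replacing \<open>M\<close>
  by \<open>max M 0\<close> covers negative \<open>M\<close>, for which \<open>ennreal M\<close> is \<open>0\<close>.
\<close>
lemma borel_weight:
  fixes w :: "'a::euclidean_space \<Rightarrow> real"
  assumes w: "weight w" and A2: "A2_const w \<le> ennreal M"
  obtains \<omega> where "A2_weight (max M 0) \<omega>" "AE x in lborel. w x = \<omega> x"
proof -
  obtain w0 where w0 [measurable]: "w0 \<in> borel_measurable borel" and ae0: "AE x in lborel. w x = w0 x"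
    using w completion_ex_borel_measurable_real[of w lborel] by (auto simp: weight_def)
  define \<omega> where "\<omega> x = (if 0 < w0 x then w0 x else 1)" for x
  have [measurable]: "\<omega> \<in> borel_measurable borel" unfolding \<omega>_def by measurable
  have pos: "0 < \<omega> x" for x by (simp add: \<omega>_def)
  have "AE x in lborel. 0 < w x" using w by (simp add: weight_def AE_completion_iff)
  then have ae: "AE x in lborel. w x = \<omega> x" using ae0 by eventually_elim (simp add: \<omega>_def)
  have "(\<integral>\<^sup>+x\<in>ball c r. ennreal (\<omega> x) \<partial>lborel) * (\<integral>\<^sup>+x\<in>ball c r. ennreal (1 / \<omega> x) \<partial>lborel)
      \<le> ennreal (max M 0) * (emeasure lborel (ball c r))\<^sup>2" if r: "0 < r" for c r
  proof -
    let ?m = "emeasure lborel (ball c r)"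
    have m: "?m \<noteq> 0" "?m \<noteq> \<infinity>"
      using r emeasure_lborel_ball_finite[of c r] content_ball_pos[of r c]
      by (auto simp: less_top measure_def)
    have "ball c r \<in> balls" using r by (auto simp: balls_def)
    then have "((\<integral>\<^sup>+x\<in>ball c r. ennreal (w x) \<partial>lebesgue) / emeasure lebesgue (ball c r)) *
        ((\<integral>\<^sup>+x\<in>ball c r. ennreal (inverse (w x)) \<partial>lebesgue) / emeasure lebesgue (ball c r)) \<le> A2_const w"
      unfolding A2_const_def by (rule SUP_upper)
    also have "(\<integral>\<^sup>+x\<in>ball c r. ennreal (w x) \<partial>lebesgue) = (\<integral>\<^sup>+x\<in>ball c r. ennreal (\<omega> x) \<partial>lborel)"
      unfolding nn_integral_completion using ae by (intro nn_integral_cong_AE) auto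
    also have "(\<integral>\<^sup>+x\<in>ball c r. ennreal (inverse (w x)) \<partial>lebesgue) = (\<integral>\<^sup>+x\<in>ball c r. ennreal (1 / \<omega> x) \<partial>lborel)"
      unfolding nn_integral_completion using ae by (intro nn_integral_cong_AE) (auto simp: inverse_eq_divide)
    also have "emeasure lebesgue (ball c r) = ?m" by simp
    finally have "(\<integral>\<^sup>+x\<in>ball c r. ennreal (\<omega> x) \<partial>lborel) / ?m * ((\<integral>\<^sup>+x\<in>ball c r. ennreal (1 / \<omega> x) \<partial>lborel) / ?m) \<le> ennreal (max M 0)"
      using A2 by (meson ennreal_leI max.cobounded1 order_trans)
    then have "?m\<^sup>2 * ((\<integral>\<^sup>+x\<in>ball c r. ennreal (\<omega> x) \<partial>lborel) / ?m * ((\<integral>\<^sup>+x\<in>ball c r. ennreal (1 / \<omega> x) \<partial>lborel) / ?m)) \<le> ?m\<^sup>2 * ennreal (max M 0)"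
      by (rule mult_left_mono) simp
    also have "?m\<^sup>2 * ((\<integral>\<^sup>+x\<in>ball c r. ennreal (\<omega> x) \<partial>lborel) / ?m * ((\<integral>\<^sup>+x\<in>ball c r. ennreal (1 / \<omega> x) \<partial>lborel) / ?m))
       = (?m * ((\<integral>\<^sup>+x\<in>ball c r. ennreal (\<omega> x) \<partial>lborel) / ?m)) * (?m * ((\<integral>\<^sup>+x\<in>ball c r. ennreal (1 / \<omega> x) \<partial>lborel) / ?m))"
      by (simp add: power2_eq_square mult_ac)
    also have "\<dots> = (\<integral>\<^sup>+x\<in>ball c r. ennreal (\<omega> x) \<partial>lborel) * (\<integral>\<^sup>+x\<in>ball c r. ennreal (1 / \<omega> x) \<partial>lborel)"
    proof -
      have c: "?m * (a / ?m) = a" for a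
      proof -
        have "?m * (a / ?m) = a * ?m / ?m" by (simp only: ennreal_times_divide mult.commute[of ?m])
        also have "\<dots> = a" using m by (intro ennreal_mult_divide_eq) auto
        finally show ?thesis .
      qed
      show ?thesis unfolding c ..
    qed
    finally show ?thesis by (simp add: mult.commute)
  qed
  then have "A2_weight (max M 0) \<omega>" using pos by (simp add: A2_weight_def)
  with ae show ?thesis using that by blast
qed

lemma borel_representative:
  fixes u :: "'a::euclidean_space \<Rightarrow> 'b::euclidean_space"
  assumes \<Omega>: "\<Omega> \<in> sets borel" and u: "u \<in> borel_measurable (lebesgue_on \<Omega>)"
  obtains v where "v \<in> borel_measurable borel" "AE p in lborel. p \<in> \<Omega> \<longrightarrow> u p = v p" "\<And>p. p \<notin> \<Omega> \<Longrightarrow> v p = 0"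
proof -
  have \<Omega>l: "\<Omega> \<in> sets lebesgue" using \<Omega> by simp
  have m: "(\<lambda>p. if p \<in> \<Omega> then u p else 0) \<in> borel_measurable lebesgue"
    by (rule borel_measurable_if_I[OF u \<Omega>l])
  have "\<exists>v. v \<in> borel_measurable borel \<and> (AE p in lborel. (if p \<in> \<Omega> then u p else 0) \<bullet> b = v p)" for b :: 'b
    using completion_ex_borel_measurable_real[OF borel_measurable_inner[OF m borel_measurable_const], of b] by auto
  then obtain v where v: "\<And>b. v b \<in> borel_measurable borel" "\<And>b. AE p in lborel. (if p \<in> \<Omega> then u p else 0) \<bullet> b = v b p"
    by metis
  note v(1)[measurable] \<Omega>[measurable]
  let ?v = "\<lambda>p. if p \<in> \<Omega> then \<Sum>b\<in>Basis. v b p *\<^sub>R b else 0"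
  have "AE p in lborel. \<forall>b\<in>Basis. (if p \<in> \<Omega> then u p else 0) \<bullet> b = v b p"
    using v(2) by (subst AE_ball_countable) (auto intro: countable_finite)
  then have "AE p in lborel. p \<in> \<Omega> \<longrightarrow> u p = ?v p"
  proof eventually_elim
    case (elim p)
    show ?case
    proof
      assume p: "p \<in> \<Omega>"
      then have "(\<Sum>b\<in>Basis. v b p *\<^sub>R b) = (\<Sum>b\<in>Basis. (u p \<bullet> b) *\<^sub>R b)" using elim by (intro sum.cong) auto
      then show "u p = ?v p" using p by (simp add: euclidean_representation)
    qed
  qed
  moreover have "?v \<in> borel_measurable borel" by (rule measurable_If_set) (use \<Omega> v(1) in \<open>auto intro!: borel_measurable_sum\<close>)
  ultimately show ?thesis by (intro that[of ?v]) auto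
qed

lemma measurable_AE_borel:
  fixes h k :: "'a::euclidean_space \<Rightarrow> 'b::euclidean_space"
  assumes \<Omega> [measurable]: "\<Omega> \<in> sets borel" and k [measurable]: "k \<in> borel_measurable borel" and ae: "AE p in lborel. p \<in> \<Omega> \<longrightarrow> h p = k p"
  shows "h \<in> borel_measurable (lebesgue_on \<Omega>)"
proof -
  have \<Omega>l: "\<Omega> \<in> sets lebesgue" using \<Omega> by simp
  have "(\<lambda>x. if x \<in> \<Omega> then k x else 0) \<in> borel_measurable lborel" by measurable
  then have "(\<lambda>x. if x \<in> \<Omega> then k x else 0) \<in> borel_measurable lebesgue" by (rule measurable_completion)
  moreover have "AE x in lebesgue. (if x \<in> \<Omega> then k x else 0) = (if x \<in> \<Omega> then h x else 0)"
    unfolding AE_completion_iff using ae by eventually_elim simp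
  ultimately have "(\<lambda>x. if x \<in> \<Omega> then h x else 0) \<in> borel_measurable lebesgue" by (rule borel_measurable_AE)
  then show ?thesis using borel_measurable_if[OF \<Omega>l, of h] by simp
qed

lemma integral_borel_representative:
  fixes h k :: "'a::euclidean_space \<Rightarrow> real"
  assumes \<Omega>: "\<Omega> \<in> sets borel" and k: "k \<in> borel_measurable borel"
    and ae: "AE p in lborel. p \<in> \<Omega> \<longrightarrow> h p = k p" and z: "\<And>p. p \<notin> \<Omega> \<Longrightarrow> k p = 0"
  shows "(\<integral>p. h p \<partial>lebesgue_on \<Omega>) = (\<integral>p. k p \<partial>lborel)"
proof -
  have "h \<in> borel_measurable (lebesgue_on \<Omega>)" by (rule measurable_AE_borel[OF \<Omega> k ae])
  then have hm: "(\<lambda>p. indicator \<Omega> p *\<^sub>R h p) \<in> borel_measurable lebesgue"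
    using \<Omega> by (subst borel_measurable_restrict_space_iff[symmetric]) auto
  have km: "k \<in> borel_measurable lebesgue" using k by (intro measurable_completion) simp
  have "(\<integral>p. h p \<partial>lebesgue_on \<Omega>) = (\<integral>p. indicator \<Omega> p *\<^sub>R h p \<partial>lebesgue)"
    using \<Omega> by (intro integral_restrict_space) auto
  also have "\<dots> = (\<integral>p. k p \<partial>lebesgue)"
    by (rule integral_cong_AE[OF hm km]) (use ae z in \<open>auto simp: AE_completion_iff indicator_def elim!: eventually_mono\<close>)
  also have "\<dots> = (\<integral>p. k p \<partial>lborel)" using k by (intro integral_completion) simp
  finally show ?thesis .
qed

text \<open>A null set in \<open>x\<close> times the whole space is a null set of the product.\<close>
lemma AE_fst:
  assumes "AE x in (lborel :: 'a::euclidean_space measure). P x"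
  shows "AE p in (lborel :: ('a \<times> 'b::euclidean_space) measure). P (fst p)"
proof -
  obtain N where N: "{x. \<not> P x} \<subseteq> N" "emeasure lborel N = 0" "N \<in> sets (lborel :: 'a measure)"
    using AE_E[OF assms] by auto
  have "emeasure (lborel \<Otimes>\<^sub>M lborel) (N \<times> (UNIV :: 'b set)) = emeasure lborel N * emeasure lborel (UNIV :: 'b set)"
    using N(3) by (intro lborel.emeasure_pair_measure_Times) auto
  then have "N \<times> (UNIV :: 'b set) \<in> null_sets lborel"
    using N borel_Times[of N "UNIV :: 'b set"] by (auto simp: null_sets_def lborel_prod)
  then show ?thesis by (rule AE_I') (use N in auto)
qed

lemma weighted_measurable:
  fixes w :: "real ^ 'n \<Rightarrow> real" and \<Omega> :: "('n::finite, 'm::finite) phase set"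
  assumes \<Omega>: "\<Omega> \<in> sets borel" and \<omega>: "A2_weight M \<omega>" "AE x in lborel. w x = \<omega> x"
  shows "(\<lambda>p. w (fst p)) \<in> borel_measurable (lebesgue_on \<Omega>)" "AE p in lborel. w (fst (p :: ('n, 'm) phase)) = \<omega> (fst p)"
    "(\<lambda>p::('n, 'm) phase. \<omega> (fst p)) \<in> borel_measurable borel"
proof -
  show ae: "AE p in lborel. w (fst (p :: ('n, 'm) phase)) = \<omega> (fst p)" by (rule AE_fst[OF \<omega>(2)])
  have "(\<lambda>p::('n, 'm) phase. fst p) \<in> borel_measurable borel"
    by (intro borel_measurable_continuous_onI continuous_intros)
  then show m: "(\<lambda>p::('n, 'm) phase. \<omega> (fst p)) \<in> borel_measurable borel"
    using \<omega>(1) by (auto simp: A2_weight_def intro: measurable_compose)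
  show "(\<lambda>p. w (fst p)) \<in> borel_measurable (lebesgue_on \<Omega>)"
    by (rule measurable_AE_borel[OF \<Omega> m]) (use ae in auto)
qed

lemma weighted_integral:
  fixes w :: "real ^ 'n \<Rightarrow> real" and \<Omega> :: "('n::finite, 'm::finite) phase set" and h k :: "('n, 'm) phase \<Rightarrow> real"
  assumes \<Omega>: "\<Omega> \<in> sets borel" and \<omega>: "A2_weight M \<omega>" "AE x in lborel. w x = \<omega> x"
    and k: "k \<in> borel_measurable borel" and ae: "AE p in lborel. p \<in> \<Omega> \<longrightarrow> h p = k p" and z: "\<And>p. p \<notin> \<Omega> \<Longrightarrow> k p = 0"
  shows "(\<integral>p. h p \<partial>weighted_measure w \<Omega>) = (\<integral>p. k p * \<omega> (fst p) \<partial>lborel)"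
proof -
  note wm = weighted_measurable[OF \<Omega> \<omega>]
  have pos: "AE p in lebesgue_on \<Omega>. 0 \<le> w (fst p)"
    using wm(2) pos_weightD(3)[OF A2_pos_weight[OF \<omega>(1)]] \<Omega>
    by (subst AE_restrict_space_iff) (auto simp: AE_completion_iff elim!: eventually_mono)
  have hm: "h \<in> borel_measurable (lebesgue_on \<Omega>)" by (rule measurable_AE_borel[OF \<Omega> k ae])
  have "(\<integral>p. h p \<partial>weighted_measure w \<Omega>) = (\<integral>p. w (fst p) * h p \<partial>lebesgue_on \<Omega>)"
    unfolding weighted_measure_def using integral_density[OF hm wm(1) pos] by simp
  also have "\<dots> = (\<integral>p. k p * \<omega> (fst p) \<partial>lborel)"
  proof (rule integral_borel_representative[OF \<Omega>])
    show "(\<lambda>p. k p * \<omega> (fst p)) \<in> borel_measurable borel" using k wm(3) by simp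
    show "AE p in lborel. p \<in> \<Omega> \<longrightarrow> w (fst p) * h p = k p * \<omega> (fst p)"
      using ae wm(2) by eventually_elim simp
  qed (simp add: z)
  finally show ?thesis .
qed

lemma weighted_nn_integral:
  fixes w :: "real ^ 'n \<Rightarrow> real" and \<Omega> :: "('n::finite, 'm::finite) phase set" and h k :: "('n, 'm) phase \<Rightarrow> real"
  assumes \<Omega>: "\<Omega> \<in> sets borel" and \<omega>: "A2_weight M \<omega>" "AE x in lborel. w x = \<omega> x"
    and k: "k \<in> borel_measurable borel" and ae: "AE p in lborel. p \<in> \<Omega> \<longrightarrow> h p = k p" and z: "\<And>p. p \<notin> \<Omega> \<Longrightarrow> k p = 0"
    and nonneg: "\<And>p. 0 \<le> k p"
  shows "(\<integral>\<^sup>+p. ennreal (h p) \<partial>weighted_measure w \<Omega>) = (\<integral>\<^sup>+p. ennreal (k p * \<omega> (fst p)) \<partial>lborel)"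
proof -
  note wm = weighted_measurable[OF \<Omega> \<omega>]
  have hm: "h \<in> borel_measurable (lebesgue_on \<Omega>)" by (rule measurable_AE_borel[OF \<Omega> k ae])
  have "(\<integral>\<^sup>+p. ennreal (h p) \<partial>weighted_measure w \<Omega>) = (\<integral>\<^sup>+p. ennreal (w (fst p)) * ennreal (h p) \<partial>lebesgue_on \<Omega>)"
    unfolding weighted_measure_def using hm wm(1) by (intro nn_integral_density) auto
  also have "\<dots> = (\<integral>\<^sup>+p. ennreal (w (fst p)) * ennreal (h p) * indicator \<Omega> p \<partial>lborel)"
    using \<Omega> by (subst nn_integral_restrict_space) (auto simp: nn_integral_completion)
  also have "\<dots> = (\<integral>\<^sup>+p. ennreal (k p * \<omega> (fst p)) \<partial>lborel)"
  proof (rule nn_integral_cong_AE)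
    show "AE p in lborel. ennreal (w (fst p)) * ennreal (h p) * indicator \<Omega> p = ennreal (k p * \<omega> (fst p))"
      using ae wm(2)
    proof eventually_elim
      case (elim p)
      then show ?case
        using nonneg[of p] pos_weightD(3)[OF A2_pos_weight[OF \<omega>(1)], of "fst p"] z[of p]
        by (cases "p \<in> \<Omega>") (auto simp: mult.commute simp flip: ennreal_mult)
    qed
  qed
  finally show ?thesis .
qed

section \<open>The fractional norm of the localised solution\<close>

context kinetic
begin

lemma f_cut_sections:
  "AE x in lborel. (\<integral>\<^sup>+q. ennreal ((f_cut (x, q))\<^sup>2) \<partial>lborel) < \<infinity>"
proof -
  note fieldD(2)[OF fields(1), measurable] pos_weightD(1)[OF A2_pos_weight[OF A2], measurable]
  note w = pos_weightD(2,3)[OF A2_pos_weight[OF A2]]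
  have "(\<integral>\<^sup>+x. (\<integral>\<^sup>+q. ennreal ((f_cut (x, q))\<^sup>2 * w x) \<partial>lborel) \<partial>lborel) = W2 w f_cut"
    unfolding W2_def lborel_prod[symmetric] by (subst lborel.nn_integral_fst[symmetric]) auto
  then have "(\<integral>\<^sup>+x. (\<integral>\<^sup>+q. ennreal ((f_cut (x, q))\<^sup>2 * w x) \<partial>lborel) \<partial>lborel) \<noteq> \<infinity>"
    using fieldD(5)[OF fields(1)] by simp
  then have "AE x in lborel. (\<integral>\<^sup>+q. ennreal ((f_cut (x, q))\<^sup>2 * w x) \<partial>lborel) \<noteq> \<infinity>"
    by (intro nn_integral_noteq_infinite) measurable
  then show ?thesis
  proof eventually_elim
    case (elim x)
    have "(\<integral>\<^sup>+q. ennreal ((f_cut (x, q))\<^sup>2 * w x) \<partial>lborel) = ennreal (w x) * (\<integral>\<^sup>+q. ennreal ((f_cut (x, q))\<^sup>2) \<partial>lborel)"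
      using w by (subst nn_integral_cmult[symmetric]) (auto simp: ennreal_mult mult.commute intro!: nn_integral_cong)
    then show ?case using elim w[of x] by (auto simp: ennreal_mult_eq_top_iff less_top)
  qed
qed

text \<open>
  On \<open>D\<close> the function \<open>f_cut(x, \<cdot>)\<close> extends \<open>u(x, \<cdot>)\<close>, and it has compact support, so its explicit
  Bessel-potential norm bounds the quotient norm for almost every \<open>x\<close>.  Integration in \<open>x\<close> and Tonelli
  give the claim.  The comparison in \<open>x\<close> uses the monotonicity of the integral alone, which holds for
  arbitrary functions; no measurability of the quotient norm in \<open>x\<close> is at hand.
\<close>
lemma fractional_norm_le:
  fixes D :: "'q set"
  assumes ext: "AE p in lborel. fst p \<in> E \<and> snd p \<in> D \<longrightarrow> f_cut p = u p"
  shows "(\<integral>\<^sup>+x\<in>E. (Hs_norm_on s D (\<lambda>q. complex_of_real (u (x, q))))\<^sup>2 * ennreal (w x) \<partial>lborel)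
     \<le> (\<integral>\<^sup>+\<xi>. ennreal ((1 + (norm \<xi>)\<^sup>2) powr s) * osc_sq w \<xi> f_cut \<partial>lborel)"
proof -
  note w = pos_weightD[OF A2_pos_weight[OF A2]]
  note osc_measurable(2)[OF fields(1), of cos, measurable] osc_measurable(2)[OF fields(1), of sin, measurable] w(1)[measurable]
  have [measurable]: "f_cut \<in> borel_measurable (borel \<Otimes>\<^sub>M borel)" by (rule fieldD(2)[OF fields(1)])
  have "AE p in lborel \<Otimes>\<^sub>M lborel. fst p \<in> E \<and> snd p \<in> D \<longrightarrow> f_cut p = u p" using ext unfolding lborel_prod .
  from lborel_pair.AE_pair[OF this]
  have sec: "AE x in lborel. AE q in lborel. x \<in> E \<and> q \<in> D \<longrightarrow> f_cut (x, q) = u (x, q)" by simp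
  let ?S = "\<lambda>x \<xi>. (osc cos \<xi> f_cut x)\<^sup>2 + (osc sin \<xi> f_cut x)\<^sup>2"
  let ?N = "\<lambda>\<xi>::'q. (1 + (norm \<xi>)\<^sup>2) powr s"
  have "(\<integral>\<^sup>+x\<in>E. (Hs_norm_on s D (\<lambda>q. complex_of_real (u (x, q))))\<^sup>2 * ennreal (w x) \<partial>lborel)
     \<le> (\<integral>\<^sup>+x. (\<integral>\<^sup>+\<xi>. ennreal (?N \<xi>) * ennreal (?S x \<xi> * w x) \<partial>lborel) \<partial>lborel)"
  proof (rule nn_integral_mono_AE)
    show "AE x in lborel. (Hs_norm_on s D (\<lambda>q. complex_of_real (u (x, q))))\<^sup>2 * ennreal (w x) * indicator E x
       \<le> (\<integral>\<^sup>+\<xi>. ennreal (?N \<xi>) * ennreal (?S x \<xi> * w x) \<partial>lborel)"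
      using sec f_cut_sections
    proof eventually_elim
      case (elim x)
      show ?case
      proof (cases "x \<in> E")
        case True
        have "(Hs_norm_on s D (\<lambda>q. complex_of_real (u (x, q))))\<^sup>2 \<le> (\<integral>\<^sup>+\<xi>. ennreal (?N \<xi> *
            ((fourier_cos (\<lambda>q. f_cut (x, q)) \<xi>)\<^sup>2 + (fourier_sin (\<lambda>q. f_cut (x, q)) \<xi>)\<^sup>2)) \<partial>lborel)"
        proof (rule Hs_norm_on_le[where r=R])
          show "f_cut (x, q) = 0" if "q \<notin> cball 0 R" for q
            by (rule fieldD(3)[OF fields(1)]) (use that in blast)
          show "AE q in lborel. q \<in> D \<longrightarrow> f_cut (x, q) = u (x, q)" using elim(1) True by simp
        qed (use elim(2) in measurable)
        then have "(Hs_norm_on s D (\<lambda>q. complex_of_real (u (x, q))))\<^sup>2 * ennreal (w x)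
           \<le> (\<integral>\<^sup>+\<xi>. ennreal (?N \<xi> * ?S x \<xi>) \<partial>lborel) * ennreal (w x)"
          unfolding osc_cos[symmetric] osc_sin[symmetric] by (rule mult_right_mono) simp
        also have "\<dots> = (\<integral>\<^sup>+\<xi>. ennreal (?N \<xi> * ?S x \<xi>) * ennreal (w x) \<partial>lborel)"
          by (rule nn_integral_multc[symmetric]) measurable
        also have "\<dots> = (\<integral>\<^sup>+\<xi>. ennreal (?N \<xi>) * ennreal (?S x \<xi> * w x) \<partial>lborel)"
          using w(3) by (intro nn_integral_cong) (simp add: ennreal_mult mult.assoc)
        finally show ?thesis using True by simp
      qed simp
    qed
  qed
  also have "\<dots> = (\<integral>\<^sup>+\<xi>. (\<integral>\<^sup>+x. ennreal (?N \<xi>) * ennreal (?S x \<xi> * w x) \<partial>lborel) \<partial>lborel)"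
    by (rule lborel_pair.Fubini'[symmetric]) measurable
  also have "\<dots> = (\<integral>\<^sup>+\<xi>. ennreal (?N \<xi>) * osc_sq w \<xi> f_cut \<partial>lborel)"
  proof (intro nn_integral_cong)
    fix \<xi> :: 'q
    have [measurable]: "osc cos \<xi> f_cut \<in> borel_measurable borel" "osc sin \<xi> f_cut \<in> borel_measurable borel"
      by (intro osc_measurable(1)[OF fields(1)], simp)+
    show "(\<integral>\<^sup>+x. ennreal (?N \<xi>) * ennreal (?S x \<xi> * w x) \<partial>lborel) = ennreal (?N \<xi>) * osc_sq w \<xi> f_cut"
      unfolding osc_sq_eq[OF A2_pos_weight[OF A2] fields(1)] by (rule nn_integral_cmult) measurable
  qed
  finally show ?thesis .
qed

end

section \<open>The kinetic operator on phase space\<close>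

definition drift :: "('m::finite \<Rightarrow> 'n::finite) \<Rightarrow> real ^ 'n \<Rightarrow> (real ^ 'm) \<times> real" where
  "drift \<iota> x = (vel \<iota> x, 1)"

lemma continuous_drift: "continuous_on S (drift \<iota>)"
  unfolding drift_def[abs_def] vel_def by (intro continuous_intros)

text \<open>
  The slope \<open>u\<close> of the symbol is \<open>\<eta>\<close> extended by zero along the injection \<open>\<iota>\<close>, so \<open>|u| = |\<eta>|\<close>.
\<close>
lemma drift_symbol:
  fixes \<iota> :: "'m::finite \<Rightarrow> 'n::finite" and \<xi> :: "(real ^ 'm) \<times> real"
  assumes "inj \<iota>"
  shows "\<exists>u \<tau>. (\<forall>x. drift \<iota> x \<bullet> \<xi> = x \<bullet> u + \<tau>) \<and> 1 + (norm \<xi>)\<^sup>2 \<le> (1 + norm u + \<bar>\<tau>\<bar>)\<^sup>2"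
proof -
  define u :: "real ^ 'n" where "u = (\<Sum>i\<in>UNIV. fst \<xi> $ i *\<^sub>R axis (\<iota> i) 1)"
  have xu: "x \<bullet> u = vel \<iota> x \<bullet> fst \<xi>" for x
    unfolding u_def inner_sum_right inner_scaleR_right inner_axis by (simp add: vel_def inner_vec_def mult.commute)
  have "vel \<iota> u = fst \<xi>"
    using assms by (simp add: vec_eq_iff vel_def u_def axis_def inj_eq if_distrib cong: if_cong)
  then have "(norm u)\<^sup>2 = (norm (fst \<xi>))\<^sup>2"
    using xu[of u] by (simp add: power2_norm_eq_inner)
  then have nu: "norm u = norm (fst \<xi>)" by simp
  have "(norm \<xi>)\<^sup>2 = (norm (fst \<xi>))\<^sup>2 + (snd \<xi>)\<^sup>2"
    by (cases \<xi>) (simp add: norm_Pair)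
  then have "1 + (norm \<xi>)\<^sup>2 \<le> (1 + norm u + \<bar>snd \<xi>\<bar>)\<^sup>2"
    unfolding nu by (simp add: power2_eq_square algebra_simps)
  moreover have "drift \<iota> x \<bullet> \<xi> = x \<bullet> u + snd \<xi>" for x
    by (cases \<xi>) (simp add: drift_def xu)
  ultimately show ?thesis by blast
qed

lemma phase_derivatives:
  fixes \<phi> :: "('n::finite, 'm::finite) phase \<Rightarrow> real"
  assumes "smooth \<phi>"
  shows "grad_x \<phi> p = fst (grad \<phi> p)" "Y_op \<iota> \<phi> p = snd (grad \<phi> p) \<bullet> drift \<iota> (fst p)"
proof -
  show "grad_x \<phi> p = fst (grad \<phi> p)"
    by (simp add: grad_x_def vec_eq_iff frechet_derivative_grad[OF assms] inner_prod_def inner_axis)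
  have "grad_y \<phi> p = fst (snd (grad \<phi> p))"
    by (simp add: grad_y_def vec_eq_iff frechet_derivative_grad[OF assms] inner_prod_def inner_axis)
  moreover have "d_t \<phi> p = snd (snd (grad \<phi> p))"
    by (simp add: d_t_def frechet_derivative_grad[OF assms] inner_prod_def)
  ultimately show "Y_op \<iota> \<phi> p = snd (grad \<phi> p) \<bullet> drift \<iota> (fst p)"
    by (simp add: Y_op_def drift_def inner_prod_def inner_commute)
qed

lemma cutoff_wave_test_function:
  fixes \<kappa> h :: "'a::euclidean_space \<Rightarrow> real" and \<theta> :: "'b::euclidean_space \<Rightarrow> real"
  assumes \<kappa>: "smooth \<kappa>" "compact (closure {x. \<kappa> x \<noteq> 0})" "closure {x. \<kappa> x \<noteq> 0} \<subseteq> U"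
    and \<theta>: "smooth \<theta>" "compact (closure {q. \<theta> q \<noteq> 0})" "closure {q. \<theta> q \<noteq> 0} \<subseteq> V"
    and h: "smooth h" and e: "smooth e"
  shows "(\<lambda>p. (h (fst p) * \<kappa> (fst p)) * (\<theta> (snd p) * e (snd p \<bullet> \<xi>))) \<in> test_functions (U \<times> V)" (is "?\<phi> \<in> _")
    and "smooth (\<lambda>p. (h (fst p) * \<kappa> (fst p)) * (\<theta> (snd p) * e (snd p \<bullet> \<xi>)))"
proof -
  show s: "smooth ?\<phi>"
    by (rule smooth_tensor[of "\<lambda>x. h x * \<kappa> x" "\<lambda>q. \<theta> q * e (q \<bullet> \<xi>)"])
      (intro smooth_mult h \<kappa> \<theta> smooth_compose[OF e] smooth_inner)+
  have "closure {p. ?\<phi> p \<noteq> 0} \<subseteq> closure ({x. \<kappa> x \<noteq> 0} \<times> {q. \<theta> q \<noteq> 0})" by (intro closure_mono) auto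
  then have "closure {p. ?\<phi> p \<noteq> 0} \<subseteq> closure {x. \<kappa> x \<noteq> 0} \<times> closure {q. \<theta> q \<noteq> 0}" by (simp add: closure_Times)
  moreover have "compact (closure {x. \<kappa> x \<noteq> 0} \<times> closure {q. \<theta> q \<noteq> 0})" using \<kappa> \<theta> by (intro compact_Times)
  ultimately have "compact (closure {p. ?\<phi> p \<noteq> 0})" "closure {p. ?\<phi> p \<noteq> 0} \<subseteq> U \<times> V"
    using \<kappa>(3) \<theta>(3) compact_Int_closed[of "closure {x. \<kappa> x \<noteq> 0} \<times> closure {q. \<theta> q \<noteq> 0}" "closure {p. ?\<phi> p \<noteq> 0}"]
    by (auto simp: Int_absorb1 subset_iff)
  then show "?\<phi> \<in> test_functions (U \<times> V)" using s by (simp add: test_functions_def compactly_inside_def smooth_def)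
qed

lemma esqrt_of_square: "esqrt (a\<^sup>2) = a"
proof (cases a)
  case (real r)
  then show ?thesis by (simp add: esqrt_def ennreal_power)
qed (simp add: esqrt_def)

definition representative :: "'a::euclidean_space set \<Rightarrow> ('a \<Rightarrow> 'b::euclidean_space) \<Rightarrow> ('a \<Rightarrow> 'b) \<Rightarrow> bool" where
  "representative \<Omega> u v \<longleftrightarrow> v \<in> borel_measurable borel \<and> (AE p in lborel. p \<in> \<Omega> \<longrightarrow> u p = v p) \<and> (\<forall>p. p \<notin> \<Omega> \<longrightarrow> v p = 0)"

lemma representativeD:
  assumes "representative \<Omega> u v"
  shows "v \<in> borel_measurable borel" "AE p in lborel. p \<in> \<Omega> \<longrightarrow> u p = v p" "\<And>p. p \<notin> \<Omega> \<Longrightarrow> v p = 0"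
  using assms by (auto simp: representative_def)

lemma L2_norm_weighted:
  fixes w :: "real ^ 'n \<Rightarrow> real" and \<Omega> :: "('n::finite, 'm::finite) phase set"
    and u v :: "('n, 'm) phase \<Rightarrow> 'b::euclidean_space"
  assumes \<Omega>: "\<Omega> \<in> sets borel" and \<omega>: "A2_weight M \<omega>" "AE x in lborel. w x = \<omega> x" and r: "representative \<Omega> u v"
  shows "L2_norm (weighted_measure w \<Omega>) u = esqrt (\<integral>\<^sup>+p. ennreal ((norm (v p))\<^sup>2 * \<omega> (fst p)) \<partial>lborel)"
proof -
  note [measurable] = representativeD(1)[OF r]
  have "(\<integral>\<^sup>+p. ennreal ((norm (u p))\<^sup>2) \<partial>weighted_measure w \<Omega>) = (\<integral>\<^sup>+p. ennreal ((norm (v p))\<^sup>2 * \<omega> (fst p)) \<partial>lborel)"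
  proof (rule weighted_nn_integral[OF \<Omega> \<omega>])
    show "AE p in lborel. p \<in> \<Omega> \<longrightarrow> (norm (u p))\<^sup>2 = (norm (v p))\<^sup>2"
      using representativeD(2)[OF r] by eventually_elim auto
  qed (use representativeD(3)[OF r] in auto)
  then show ?thesis by (simp add: L2_norm_def)
qed

lemma energy_of_representatives:
  fixes w :: "real ^ 'n \<Rightarrow> real" and \<Omega> :: "('n::finite, 'm::finite) phase set"
  assumes \<Omega>: "\<Omega> \<in> sets borel" and \<omega>: "A2_weight M \<omega>" "AE x in lborel. w x = \<omega> x"
    and r: "representative \<Omega> f f0" "representative \<Omega> Df Df0" "representative \<Omega> F F0" "representative \<Omega> g g0"
  defines "\<mu> \<equiv> weighted_measure w \<Omega>"
  shows "(\<integral>\<^sup>+p. ennreal (((f0 p :: real)\<^sup>2 + (norm (Df0 p :: real ^ 'n))\<^sup>2 + (norm (F0 p :: real ^ 'n))\<^sup>2 + (g0 p :: real)\<^sup>2) * \<omega> (fst p)) \<partial>lborel)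
     = (L2_norm \<mu> f)\<^sup>2 + (L2_norm \<mu> Df)\<^sup>2 + (L2_norm \<mu> F)\<^sup>2 + (L2_norm \<mu> g)\<^sup>2"
proof -
  note [measurable] = r[THEN representativeD(1)] weighted_measurable(3)[OF \<Omega> \<omega>]
  note w0 = pos_weightD(3)[OF A2_pos_weight[OF \<omega>(1)]]
  show ?thesis
    unfolding \<mu>_def r[THEN L2_norm_weighted[OF \<Omega> \<omega>]] esqrt_power2
    using w0 by (simp add: distrib_right nn_integral_add)
qed

text \<open>
  The definitions of a weak solution and of a weak gradient, specialised to the test functions
  \<open>(h \<kappa>) (\<theta> e(q \<bullet> \<xi>))\<close> and transferred to Borel representatives.
\<close>
lemma kinetic_of_solution:
  fixes \<iota> :: "'m::finite \<Rightarrow> 'n::finite" and w \<omega> :: "real ^ 'n \<Rightarrow> real"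
    and f g :: "('n, 'm) phase \<Rightarrow> real" and Df F :: "('n, 'm) phase \<Rightarrow> real ^ 'n"
    and U :: "(real ^ 'n) set" and V :: "((real ^ 'm) \<times> real) set"
  assumes \<omega>: "A2_weight M \<omega>" "AE x in lborel. w x = \<omega> x" and K: "1 \<le> K"
    and U: "open U" "U \<subseteq> cball 0 R" and V: "open V" "V \<subseteq> cball 0 R"
    and \<kappa>: "smooth \<kappa>" "\<And>x. \<bar>\<kappa> x\<bar> \<le> 1" "\<And>x. norm (grad \<kappa> x) \<le> K"
      "compact (closure {x. \<kappa> x \<noteq> 0})" "closure {x. \<kappa> x \<noteq> 0} \<subseteq> U"
    and \<theta>: "smooth \<theta>" "\<And>q. \<bar>\<theta> q\<bar> \<le> 1" "\<And>x q. x \<in> cball 0 R \<Longrightarrow> \<bar>grad \<theta> q \<bullet> drift \<iota> x\<bar> \<le> K"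
      "compact (closure {q. \<theta> q \<noteq> 0})" "closure {q. \<theta> q \<noteq> 0} \<subseteq> V"
    and weak: "is_weak_grad_x (U \<times> V) f Df" and eq: "weighted_kinetic_eq \<iota> w (U \<times> V) f F g"
    and r: "representative (U \<times> V) f f0" "representative (U \<times> V) Df Df0" "representative (U \<times> V) F F0" "representative (U \<times> V) g g0"
    and fin: "L2_norm (weighted_measure w (U \<times> V)) f < top" "L2_norm (weighted_measure w (U \<times> V)) Df < top"
      "L2_norm (weighted_measure w (U \<times> V)) F < top" "L2_norm (weighted_measure w (U \<times> V)) g < top"
  shows "kinetic M R K \<omega> (drift \<iota>) \<kappa> \<theta> f0 g0 Df0 F0"
proof
  let ?\<Omega> = "U \<times> V"
  have \<Omega>: "?\<Omega> \<in> sets borel" using U(1) V(1) by (intro borel_open open_Times)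
  note rm = r[THEN representativeD(1)] and ra = r[THEN representativeD(2)] and rz = r[THEN representativeD(3)]
  note [measurable] = rm
  show "A2_weight M \<omega>" "1 \<le> K" "smooth \<kappa>" "smooth \<theta>" by fact+
  show "\<bar>\<kappa> x\<bar> \<le> 1" "norm (grad \<kappa> x) \<le> K" for x by fact+
  show "\<bar>\<theta> q\<bar> \<le> 1" for q by fact
  show "\<bar>grad \<theta> q \<bullet> drift \<iota> x\<bar> \<le> K" if "x \<in> cball 0 R" for x q using that by (rule \<theta>(3))
  show "continuous_on UNIV (drift \<iota>)" by (rule continuous_drift)
  show "f0 \<in> borel_measurable borel" "g0 \<in> borel_measurable borel" "Df0 \<in> borel_measurable borel" "F0 \<in> borel_measurable borel"
    by (fact rm)+
  show "f0 p = 0 \<and> g0 p = 0 \<and> Df0 p = 0 \<and> F0 p = 0" if "p \<notin> cball 0 R \<times> cball 0 R" for p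
  proof -
    have "p \<notin> ?\<Omega>" using that U(2) V(2) by blast
    then show ?thesis using rz by simp
  qed
  show "(\<integral>\<^sup>+p. ennreal (((f0 p)\<^sup>2 + (norm (Df0 p))\<^sup>2 + (norm (F0 p))\<^sup>2 + (g0 p)\<^sup>2) * \<omega> (fst p)) \<partial>lborel) < \<infinity>"
    unfolding energy_of_representatives[OF \<Omega> \<omega> r] using fin by (simp add: power2_eq_square ennreal_mult_less_top)
  fix h :: "real ^ 'n \<Rightarrow> real" and e :: "real \<Rightarrow> real" and \<xi> :: "(real ^ 'm) \<times> real"
  assume h: "smooth h" and e: "smooth e"
  let ?\<phi> = "\<lambda>p::('n, 'm) phase. (h (fst p) * \<kappa> (fst p)) * (\<theta> (snd p) * e (snd p \<bullet> \<xi>))"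
  note test = cutoff_wave_test_function[OF \<kappa>(1,4,5) \<theta>(1,4,5) h e, of \<xi>]
  note d = phase_derivatives[OF test(2)]
  have [measurable]: "?\<phi> \<in> borel_measurable borel" "grad ?\<phi> \<in> borel_measurable borel"
    by (intro borel_measurable_continuous_onI smooth_continuous smooth_continuous_grad test(2))+
  have [measurable]: "(\<lambda>p::('n, 'm) phase. drift \<iota> (fst p)) \<in> borel_measurable borel"
    by (intro borel_measurable_continuous_onI continuous_on_compose2[OF continuous_drift[of UNIV]] continuous_intros) auto
  have [measurable]: "(\<lambda>p. fst (grad ?\<phi> p)) \<in> borel_measurable borel" "(\<lambda>p. snd (grad ?\<phi> p)) \<in> borel_measurable borel"
    by (intro borel_measurable_continuous_onI continuous_intros smooth_continuous_grad test(2))+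
  {
    fix b :: "real ^ 'n" assume "b \<in> Basis"
    then obtain i where b: "b = axis i 1" by (auto simp: Basis_vec_def)
    have "(\<integral>p. f p * grad_x ?\<phi> p $ i \<partial>lebesgue_on ?\<Omega>) = - (\<integral>p. Df p $ i * ?\<phi> p \<partial>lebesgue_on ?\<Omega>)"
      using weak test(1) unfolding is_weak_grad_x_def by blast
    also have "(\<integral>p. f p * grad_x ?\<phi> p $ i \<partial>lebesgue_on ?\<Omega>) = (\<integral>p. f0 p * (fst (grad ?\<phi> p) \<bullet> b) \<partial>lborel)"
    proof (rule integral_borel_representative[OF \<Omega>])
      show "AE p in lborel. p \<in> ?\<Omega> \<longrightarrow> f p * grad_x ?\<phi> p $ i = f0 p * (fst (grad ?\<phi> p) \<bullet> b)"
        using ra(1) by eventually_elim (simp add: d(1) b inner_axis)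
    qed (measurable, simp add: rz)
    also have "(\<integral>p. Df p $ i * ?\<phi> p \<partial>lebesgue_on ?\<Omega>) = (\<integral>p. (Df0 p \<bullet> b) * ?\<phi> p \<partial>lborel)"
    proof (rule integral_borel_representative[OF \<Omega>])
      show "AE p in lborel. p \<in> ?\<Omega> \<longrightarrow> Df p $ i * ?\<phi> p = (Df0 p \<bullet> b) * ?\<phi> p"
        using ra(2) by eventually_elim (simp add: b inner_axis)
    qed (measurable, simp add: rz)
    finally show "(\<integral>p. f0 p * (fst (grad ?\<phi> p) \<bullet> b) \<partial>lborel) = - (\<integral>p. (Df0 p \<bullet> b) * ?\<phi> p \<partial>lborel)" .
  }
  have "- (\<integral>p. f p * Y_op \<iota> ?\<phi> p \<partial>weighted_measure w ?\<Omega>)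
     = - (\<integral>p. F p \<bullet> grad_x ?\<phi> p \<partial>weighted_measure w ?\<Omega>) + (\<integral>p. g p * ?\<phi> p \<partial>weighted_measure w ?\<Omega>)"
    using eq test(1) unfolding weighted_kinetic_eq_def by blast
  also have "(\<integral>p. f p * Y_op \<iota> ?\<phi> p \<partial>weighted_measure w ?\<Omega>)
     = (\<integral>p. f0 p * (snd (grad ?\<phi> p) \<bullet> drift \<iota> (fst p)) * \<omega> (fst p) \<partial>lborel)"
  proof (rule weighted_integral[OF \<Omega> \<omega>])
    show "AE p in lborel. p \<in> ?\<Omega> \<longrightarrow> f p * Y_op \<iota> ?\<phi> p = f0 p * (snd (grad ?\<phi> p) \<bullet> drift \<iota> (fst p))"
      using ra(1) by eventually_elim (simp add: d(2))
  qed (measurable, simp add: rz)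
  also have "(\<integral>p. F p \<bullet> grad_x ?\<phi> p \<partial>weighted_measure w ?\<Omega>) = (\<integral>p. (F0 p \<bullet> fst (grad ?\<phi> p)) * \<omega> (fst p) \<partial>lborel)"
  proof (rule weighted_integral[OF \<Omega> \<omega>])
    show "AE p in lborel. p \<in> ?\<Omega> \<longrightarrow> F p \<bullet> grad_x ?\<phi> p = F0 p \<bullet> fst (grad ?\<phi> p)"
      using ra(3) by eventually_elim (simp add: d(1))
  qed (measurable, simp add: rz)
  also have "(\<integral>p. g p * ?\<phi> p \<partial>weighted_measure w ?\<Omega>) = (\<integral>p. g0 p * ?\<phi> p * \<omega> (fst p) \<partial>lborel)"
  proof (rule weighted_integral[OF \<Omega> \<omega>])
    show "AE p in lborel. p \<in> ?\<Omega> \<longrightarrow> g p * ?\<phi> p = g0 p * ?\<phi> p"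
      using ra(4) by eventually_elim simp
  qed (measurable, simp add: rz)
  finally show "(\<integral>p. f0 p * (snd (grad ?\<phi> p) \<bullet> drift \<iota> (fst p)) * \<omega> (fst p) \<partial>lborel)
     = (\<integral>p. (F0 p \<bullet> fst (grad ?\<phi> p)) * \<omega> (fst p) \<partial>lborel) - (\<integral>p. g0 p * ?\<phi> p * \<omega> (fst p) \<partial>lborel)"
    by linarith
qed

text \<open>
  The gradient of a cutoff is continuous and vanishes off the compact support, hence is bounded.
\<close>
lemma cutoff_with_gradient_bound:
  fixes A U :: "'a::euclidean_space set"
  assumes A: "compact A" "A \<subseteq> U" and U: "open U" "U \<subseteq> cball 0 R"
  obtains \<kappa> B where "smooth \<kappa>" "\<And>x. \<bar>\<kappa> x\<bar> \<le> 1" "\<And>x. x \<in> A \<Longrightarrow> \<kappa> x = 1" "\<And>x. norm (grad \<kappa> x) \<le> B" "0 \<le> B"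
    "compact (closure {x. \<kappa> x \<noteq> 0})" "closure {x. \<kappa> x \<noteq> 0} \<subseteq> U"
proof -
  obtain \<kappa> where \<kappa>: "smooth \<kappa>" "\<And>x. 0 \<le> \<kappa> x" "\<And>x. \<kappa> x \<le> 1" "\<And>x. x \<in> A \<Longrightarrow> \<kappa> x = 1"
    "compact (closure {x. \<kappa> x \<noteq> 0})" "closure {x. \<kappa> x \<noteq> 0} \<subseteq> U"
    using smooth_cutoff[OF A(1) U(1) A(2)] by metis
  have "grad \<kappa> y = 0" if "y \<notin> cball 0 R" for y
  proof (rule grad_zero_outside)
    show "open (- closure {x. \<kappa> x \<noteq> 0})" by auto
    show "y \<in> - closure {x. \<kappa> x \<noteq> 0}" using that \<kappa>(6) U(2) by blast
    show "\<kappa> z = 0" if "z \<in> - closure {x. \<kappa> x \<noteq> 0}" for z using that closure_subset[of "{x. \<kappa> x \<noteq> 0}"] by blast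
  qed
  then obtain B where "\<And>y. norm (grad \<kappa> y) \<le> B" "0 \<le> B"
    using bounded_of_compact_support[OF smooth_continuous_grad[OF \<kappa>(1)]] by metis
  with \<kappa> show ?thesis by (intro that[of \<kappa> B]) auto
qed

text \<open>
  The cutoffs, the radius \<open>R\<close> and thus all constants are chosen before the weight and the solution.
\<close>
lemma local_estimate:
  fixes \<iota> :: "'m::finite \<Rightarrow> 'n::finite" and U E :: "(real ^ 'n) set" and V D :: "((real ^ 'm) \<times> real) set"
  assumes \<iota>: "inj \<iota>" and U: "open U" "bounded U" "E \<Subset> U" and V: "open V" "bounded V" "D \<Subset> V"
    and decay: "\<forall>R\<ge>1. \<exists>C\<ge>0. \<forall>w (p :: real ^ 'n \<Rightarrow> real) P \<Phi> G u \<tau>.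
      transport_data (max M 0) R w u \<tau> p P \<Phi> G \<longrightarrow>
        sqr w p \<le> C * (1 + norm u + \<bar>\<tau>\<bar>) powr (- \<alpha>) * total_sqr w p P \<Phi> G"
  shows "\<exists>C\<ge>0. \<forall>(w :: real ^ 'n \<Rightarrow> real) (f :: ('n, 'm) phase \<Rightarrow> real) Df F g s.
    weight w \<and> A2_const w \<le> ennreal M \<and> is_weak_grad_x (U \<times> V) f Df \<and>
    f \<in> L2 (weighted_measure w (U \<times> V)) \<and> Df \<in> L2 (weighted_measure w (U \<times> V)) \<and>
    F \<in> L2 (weighted_measure w (U \<times> V)) \<and> g \<in> L2 (weighted_measure w (U \<times> V)) \<and>
    weighted_kinetic_eq \<iota> w (U \<times> V) f F g \<and> 0 < s \<and> 2 * s \<le> \<alpha> \<longrightarrow>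
    L2_Hs_norm w E s D f \<le> ennreal C * (L2_norm (weighted_measure w (U \<times> V)) f + L2_norm (weighted_measure w (U \<times> V)) Df
      + L2_norm (weighted_measure w (U \<times> V)) F + L2_norm (weighted_measure w (U \<times> V)) g)"
proof -
  obtain R1 R2 where "U \<subseteq> cball 0 R1" "V \<subseteq> cball 0 R2"
    using U(2) V(2) unfolding bounded_iff subset_iff mem_cball_0 by blast
  moreover define R where "R = max 1 (max R1 R2)"
  ultimately have R: "1 \<le> R" "U \<subseteq> cball 0 R" "V \<subseteq> cball 0 R" by auto
  obtain C where C: "0 \<le> C" and dec: "\<And>w (p :: real ^ 'n \<Rightarrow> real) P \<Phi> G u \<tau>.
      transport_data (max M 0) R w u \<tau> p P \<Phi> G \<Longrightarrow> sqr w p \<le> C * (1 + norm u + \<bar>\<tau>\<bar>) powr (- \<alpha>) * total_sqr w p P \<Phi> G"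
    using decay R(1) by blast
  obtain \<kappa> B\<kappa> where \<kappa>: "smooth \<kappa>" "\<And>x. \<bar>\<kappa> x\<bar> \<le> 1" "\<And>x. x \<in> closure E \<Longrightarrow> \<kappa> x = 1" "\<And>x. norm (grad \<kappa> x) \<le> B\<kappa>" "0 \<le> B\<kappa>"
    "compact (closure {x. \<kappa> x \<noteq> 0})" "closure {x. \<kappa> x \<noteq> 0} \<subseteq> U"
    using cutoff_with_gradient_bound[of "closure E" U R] U(1,3) R(2) unfolding compactly_inside_def by metis
  obtain \<theta> B\<theta> where \<theta>: "smooth \<theta>" "\<And>x. \<bar>\<theta> x\<bar> \<le> 1" "\<And>x. x \<in> closure D \<Longrightarrow> \<theta> x = 1" "\<And>x. norm (grad \<theta> x) \<le> B\<theta>" "0 \<le> B\<theta>"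
    "compact (closure {x. \<theta> x \<noteq> 0})" "closure {x. \<theta> x \<noteq> 0} \<subseteq> V"
    using cutoff_with_gradient_bound[of "closure D" V R] V(1,3) R(3) unfolding compactly_inside_def by metis
  have "compact (drift \<iota> ` cball 0 R)" by (intro compact_continuous_image continuous_drift) auto
  then obtain Bd where Bd: "\<And>x. x \<in> cball 0 R \<Longrightarrow> norm (drift \<iota> x) \<le> Bd"
    using compact_imp_bounded bounded_iff by (metis imageI)
  define K where "K = max 1 (max B\<kappa> (B\<theta> * Bd))"
  have K: "1 \<le> K" and K\<kappa>: "norm (grad \<kappa> x) \<le> K" for x using \<kappa>(4)[of x] by (auto simp: K_def)
  have K\<theta>: "\<bar>grad \<theta> q \<bullet> drift \<iota> x\<bar> \<le> K" if "x \<in> cball 0 R" for q x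
  proof -
    have "\<bar>grad \<theta> q \<bullet> drift \<iota> x\<bar> \<le> norm (grad \<theta> q) * norm (drift \<iota> x)" by (rule Cauchy_Schwarz_ineq2)
    also have "\<dots> \<le> B\<theta> * Bd" using \<theta>(4,5) Bd[OF that] by (intro mult_mono) auto
    finally show ?thesis by (simp add: K_def)
  qed
  define Q where "Q = 2 * C * (2 * pi) ^ DIM((real ^ 'm) \<times> real) * ((2 * real DIM(real ^ 'n) + 9) * K\<^sup>2)"
  have Q: "0 \<le> Q" using C by (simp add: Q_def)
  have \<Omega>: "U \<times> V \<in> sets borel" using U(1) V(1) by (intro borel_open open_Times)
  show ?thesis
  proof (rule exI[of _ "sqrt Q"], intro conjI allI impI; (elim conjE)?)
    show "0 \<le> sqrt Q" using Q by simp
    fix w :: "real ^ 'n \<Rightarrow> real" and f g :: "('n, 'm) phase \<Rightarrow> real" and Df F :: "('n, 'm) phase \<Rightarrow> real ^ 'n" and s :: real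
    let ?\<mu> = "weighted_measure w (U \<times> V)"
    assume w: "weight w" "A2_const w \<le> ennreal M" and weak: "is_weak_grad_x (U \<times> V) f Df" and eq: "weighted_kinetic_eq \<iota> w (U \<times> V) f F g"
      and L2: "f \<in> L2 ?\<mu>" "Df \<in> L2 ?\<mu>" "F \<in> L2 ?\<mu>" "g \<in> L2 ?\<mu>" and s: "0 < s" "2 * s \<le> \<alpha>"
    obtain \<omega> where \<omega>: "A2_weight (max M 0) \<omega>" "AE x in lborel. w x = \<omega> x" using borel_weight[OF w] by blast
    have meas: "f \<in> borel_measurable (lebesgue_on (U \<times> V))" "Df \<in> borel_measurable (lebesgue_on (U \<times> V))"
      "F \<in> borel_measurable (lebesgue_on (U \<times> V))" "g \<in> borel_measurable (lebesgue_on (U \<times> V))"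
      and fin: "L2_norm ?\<mu> f < top" "L2_norm ?\<mu> Df < top" "L2_norm ?\<mu> F < top" "L2_norm ?\<mu> g < top"
      using L2 by (auto simp: L2_def weighted_measure_def)
    have rep: "\<exists>v. representative (U \<times> V) u v" if "u \<in> borel_measurable (lebesgue_on (U \<times> V))"
      for u :: "('n, 'm) phase \<Rightarrow> 'b::euclidean_space"
      by (rule borel_representative[OF \<Omega> that]) (auto simp: representative_def)
    obtain f0 where r1: "representative (U \<times> V) f f0" using rep[OF meas(1)] by blast
    obtain Df0 where r2: "representative (U \<times> V) Df Df0" using rep[OF meas(2)] by blast
    obtain F0 where r3: "representative (U \<times> V) F F0" using rep[OF meas(3)] by blast
    obtain g0 where r4: "representative (U \<times> V) g g0" using rep[OF meas(4)] by blast
    note r = r1 r2 r3 r4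
    interpret k: kinetic "max M 0" R K \<omega> "drift \<iota>" \<kappa> \<theta> f0 g0 Df0 F0
      by (rule kinetic_of_solution[OF \<omega> K U(1) R(2) V(1) R(3) \<kappa>(1,2) K\<kappa> \<kappa>(6,7) \<theta>(1,2) K\<theta> \<theta>(6,7) weak eq r fin])
    have "AE p in lborel. fst p \<in> E \<and> snd p \<in> D \<longrightarrow> k.f_cut p = f p"
      using representativeD(2)[OF r(1)]
    proof eventually_elim
      case (elim p)
      show ?case
      proof
        assume p: "fst p \<in> E \<and> snd p \<in> D"
        then have c: "fst p \<in> closure E" "snd p \<in> closure D" using closure_subset by auto
        then have "p \<in> U \<times> V" using U(3) V(3) by (auto simp: compactly_inside_def mem_Times_iff)
        then show "k.f_cut p = f p" using elim c \<kappa>(3) \<theta>(3) by (simp add: k.f_cut_def)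
      qed
    qed
    from k.fractional_norm_le[OF this, of s]
    have "(\<integral>\<^sup>+x\<in>E. (Hs_norm_on s D (\<lambda>q. complex_of_real (f (x, q))))\<^sup>2 * ennreal (\<omega> x) \<partial>lborel)
       \<le> (\<integral>\<^sup>+\<xi>. ennreal ((1 + (norm \<xi>)\<^sup>2) powr s) * osc_sq \<omega> \<xi> k.f_cut \<partial>lborel)" .
    also have "\<dots> \<le> ennreal Q * k.total"
      unfolding Q_def by (rule k.kinetic_fourier_estimate[OF dec C drift_symbol[OF \<iota>] s])
    also have "\<dots> = (ennreal (sqrt Q))\<^sup>2 * ((L2_norm ?\<mu> f)\<^sup>2 + (L2_norm ?\<mu> Df)\<^sup>2 + (L2_norm ?\<mu> F)\<^sup>2 + (L2_norm ?\<mu> g)\<^sup>2)"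
      unfolding k.total_def k.energy_density_def energy_of_representatives[OF \<Omega> \<omega> r] using Q by (simp add: ennreal_power)
    also have "\<dots> \<le> (ennreal (sqrt Q))\<^sup>2 * (L2_norm ?\<mu> f + L2_norm ?\<mu> Df + L2_norm ?\<mu> F + L2_norm ?\<mu> g)\<^sup>2"
    proof (rule mult_left_mono)
      have sq: "a\<^sup>2 + b\<^sup>2 \<le> (a + b)\<^sup>2" for a b :: ennreal
        by (simp add: power2_eq_square distrib_left distrib_right add_mono add_increasing add_increasing2)
      show "(L2_norm ?\<mu> f)\<^sup>2 + (L2_norm ?\<mu> Df)\<^sup>2 + (L2_norm ?\<mu> F)\<^sup>2 + (L2_norm ?\<mu> g)\<^sup>2
         \<le> (L2_norm ?\<mu> f + L2_norm ?\<mu> Df + L2_norm ?\<mu> F + L2_norm ?\<mu> g)\<^sup>2"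
        by (rule order_trans[OF add_right_mono[OF order_trans[OF add_right_mono[OF sq] sq]] sq])
    qed simp
    finally have le: "(\<integral>\<^sup>+x\<in>E. (Hs_norm_on s D (\<lambda>q. complex_of_real (f (x, q))))\<^sup>2 * ennreal (\<omega> x) \<partial>lborel)
       \<le> (ennreal (sqrt Q) * (L2_norm ?\<mu> f + L2_norm ?\<mu> Df + L2_norm ?\<mu> F + L2_norm ?\<mu> g))\<^sup>2"
      by (simp add: power_mult_distrib)
    have "(\<integral>\<^sup>+x\<in>E. (Hs_norm_on s D (\<lambda>q. complex_of_real (f (x, q))))\<^sup>2 * ennreal (w x) \<partial>lebesgue)
       = (\<integral>\<^sup>+x\<in>E. (Hs_norm_on s D (\<lambda>q. complex_of_real (f (x, q))))\<^sup>2 * ennreal (\<omega> x) \<partial>lborel)"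
      unfolding nn_integral_completion using \<omega>(2) by (intro nn_integral_cong_AE) auto
    then show "L2_Hs_norm w E s D f \<le> ennreal (sqrt Q) * (L2_norm ?\<mu> f + L2_norm ?\<mu> Df + L2_norm ?\<mu> F + L2_norm ?\<mu> g)"
      using esqrt_mono[OF le] by (simp add: L2_Hs_norm_def esqrt_of_square)
  qed
qed

theorem proposition3p1:
  fixes M :: real
  shows "\<exists>s_star::real. 0 < s_star \<and> s_star < 1 \<and>
    (\<forall>(\<iota> :: 'm::finite \<Rightarrow> 'n::finite) (I :: real set) (I' :: real set)
       (Dx :: (real ^ 'n) set) (Dx' :: (real ^ 'n) set)
       (Dy :: (real ^ 'm) set) (Dy' :: (real ^ 'm) set).
      inj \<iota> \<and>
      I \<in> bounded_open_intervals \<and> I' \<in> bounded_open_intervals \<and> I \<Subset> I' \<and>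
      Dx \<in> balls \<and> Dx' \<in> balls \<and> Dx \<Subset> Dx' \<and>
      bounded_Lipschitz_set Dy \<and> bounded_Lipschitz_set Dy' \<and> Dy \<Subset> Dy' \<longrightarrow>
      (\<exists>C::real. 0 \<le> C \<and>
        (\<forall>(w :: real ^ 'n \<Rightarrow> real) (f :: ('n, 'm) phase \<Rightarrow> real)
           (Df :: ('n, 'm) phase \<Rightarrow> real ^ 'n) (F :: ('n, 'm) phase \<Rightarrow> real ^ 'n)
           (g :: ('n, 'm) phase \<Rightarrow> real).
          (let \<Omega> = Dx' \<times> Dy' \<times> I'; \<mu> = weighted_measure w \<Omega> in
            weight w \<and> A2_const w \<le> ennreal M \<and>
            is_weak_grad_x \<Omega> f Df \<and>
            f \<in> L2 \<mu> \<and> Df \<in> L2 \<mu> \<and> F \<in> L2 \<mu> \<and> g \<in> L2 \<mu> \<and>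
            weighted_kinetic_eq \<iota> w \<Omega> f F g \<longrightarrow>
            (\<forall>s. 0 < s \<and> s \<le> s_star \<longrightarrow>
              L2_Hs_norm w Dx s (Dy \<times> I) f
                \<le> ennreal C * (L2_norm \<mu> f + L2_norm \<mu> Df + L2_norm \<mu> F + L2_norm \<mu> g))))))"
proof -
  obtain \<alpha> where \<alpha>: "0 < \<alpha>" "\<alpha> < 1"
    and decay: "\<forall>R\<ge>1. \<exists>C\<ge>0. \<forall>w (p :: real ^ 'n \<Rightarrow> real) P \<Phi> G u \<tau>.
      transport_data (max M 0) R w u \<tau> p P \<Phi> G \<longrightarrow>
        sqr w p \<le> C * (1 + norm u + \<bar>\<tau>\<bar>) powr (- \<alpha>) * total_sqr w p P \<Phi> G"
    using frequency_decay[of "max M 0", where 'a="real ^ 'n"] by blast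
  show ?thesis
  proof (rule exI[of _ "\<alpha> / 2"], intro conjI allI impI; (elim conjE)?)
    show "0 < \<alpha> / 2" "\<alpha> / 2 < 1" using \<alpha> by auto
    fix \<iota> :: "'m \<Rightarrow> 'n" and I I' :: "real set" and Dx Dx' :: "(real ^ 'n) set" and Dy Dy' :: "(real ^ 'm) set"
    assume \<iota>: "inj \<iota>" and I': "I' \<in> bounded_open_intervals" and I: "I \<Subset> I'" and Dx': "Dx' \<in> balls" and Dx: "Dx \<Subset> Dx'"
      and Dy': "bounded_Lipschitz_set Dy'" and Dy: "Dy \<Subset> Dy'"
    have U: "open Dx'" "bounded Dx'" using Dx' by (auto simp: balls_def)
    have V: "open (Dy' \<times> I')" "bounded (Dy' \<times> I')"
      using Dy' I' by (auto simp: bounded_Lipschitz_set_def bounded_open_intervals_def intro: open_Times bounded_Times)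
    have D: "Dy \<times> I \<Subset> Dy' \<times> I'"
      using Dy I unfolding compactly_inside_def closure_Times by (auto intro: compact_Times)
    have half: "s \<le> \<alpha> / 2 \<Longrightarrow> 2 * s \<le> \<alpha>" for s by simp
    show "\<exists>C::real. 0 \<le> C \<and>
        (\<forall>(w :: real ^ 'n \<Rightarrow> real) (f :: ('n, 'm) phase \<Rightarrow> real)
           (Df :: ('n, 'm) phase \<Rightarrow> real ^ 'n) (F :: ('n, 'm) phase \<Rightarrow> real ^ 'n)
           (g :: ('n, 'm) phase \<Rightarrow> real).
          (let \<Omega> = Dx' \<times> Dy' \<times> I'; \<mu> = weighted_measure w \<Omega> in
            weight w \<and> A2_const w \<le> ennreal M \<and>
            is_weak_grad_x \<Omega> f Df \<and>
            f \<in> L2 \<mu> \<and> Df \<in> L2 \<mu> \<and> F \<in> L2 \<mu> \<and> g \<in> L2 \<mu> \<and>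
            weighted_kinetic_eq \<iota> w \<Omega> f F g \<longrightarrow>
            (\<forall>s. 0 < s \<and> s \<le> \<alpha> / 2 \<longrightarrow>
              L2_Hs_norm w Dx s (Dy \<times> I) f
                \<le> ennreal C * (L2_norm \<mu> f + L2_norm \<mu> Df + L2_norm \<mu> F + L2_norm \<mu> g))))"
      using local_estimate[OF \<iota> U Dx V D decay] unfolding Let_def by (meson half)
  qed
qed

end
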